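(* Assume that: (i) the constitutive coefficients satisfy $$\mu_{\rm e}>0,\quad 2\mu_{\rm e}+3\lambda_{\rm e}>0,\quad \mu_{\rm c}\ge 0,\quad \mu_{\rm micro}>0,\quad 2\mu_{\rm micro}+3\lambda_{\rm micro}>0,\quad \mu_{\rm macro}>0,\quad L_{\rm c}>0;$$ (ii) $F\in L^2(\Omega)$ and $M\in L^2(\Omega)$; (iii) $g\in H^{3/2}(\partial\Omega)$ and $G_i\in\widetilde{\chi}_{\partial\Omega}$ for $i=1,2,3$. Then there exists one and only one weak solution $(u,P)$ of the problem $$0=\mathrm{Div}\big(2\mu_{\rm e}\,\mathrm{sym}(\nabla u-P)+2\mu_{\rm c}\,\mathrm{skew}(\nabla u-P)+\lambda_{\rm e}\,\mathrm{tr}(\nabla u-P)\,I\big)+F,$$ $$0=2\mu_{\rm e}\,\mathrm{sym}(\nabla u-P)+2\mu_{\rm c}\,\mathrm{skew}(\nabla u-P)+\lambda_{\rm e}\,\mathrm{tr}(\nabla u-P)\,I-\big(2\mu_{\rm micro}\,\mathrm{sym}\,P+\lambda_{\rm micro}(\mathrm{tr}\,P)\,I\big)-\mu_{\rm macro}L_{\rm c}^2\,\mathrm{Curl}\,\mathrm{Curl}\,P+M$$ in $\Omega$, with $u=g$ and $P_i\times n=G_i$ ($i=1,2,3$) on $\partial\Omega$, such that $u=\widetilde u+\widetilde g$ and $P=\widetilde P+\widetilde G$, where $\widetilde g,\widetilde G$ are the extensions of the boundary data fixed in the context and $(\widetilde u,\widetilde P)\in H^1_0(\Omega)\times H_0(\mathrm{Curl};\Omega)$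 is the weak solution of the following problem: $$\int_\Omega\Big(2\mu_{\rm e}\langle\mathrm{sym}(\nabla\widetilde u-\widetilde P),\mathrm{sym}(\nabla\overline u-\overline P)\rangle+2\mu_{\rm c}\langle\mathrm{skew}(\nabla\widetilde u-\widetilde P),\mathrm{skew}(\nabla\overline u-\overline P)\rangle+\lambda_{\rm e}\,\mathrm{tr}(\nabla\widetilde u-\widetilde P)\,\mathrm{tr}(\nabla\overline u-\overline P)$$ $$\qquad+2\mu_{\rm micro}\langle\mathrm{sym}\,\widetilde P,\mathrm{sym}\,\overline P\rangle+\lambda_{\rm micro}\,\mathrm{tr}\,\widetilde P\,\mathrm{tr}\,\overline P+\mu_{\rm macro}L_{\rm c}^2\langle\mathrm{Curl}\,\widetilde P,\mathrm{Curl}\,\overline P\rangle\Big)\,dx=\int_\Omega\big(\langle\widetilde F,\overline u\rangle+\langle\widetilde M,\overline P\rangle\big)\,dx$$ for all $(\overline u,\overline P)\in H^1_0(\Omega)\times H_0(\mathrm{Curl};\Omega)$, with $$\widetilde F=F+\mathrm{Div}\big(2\mu_{\rm e}\,\mathrm{sym}(\nabla\widetilde g-\widetilde G)+2\mu_{\rm c}\,\mathrm{skew}(\nabla\widetilde g-\widetilde G)+\lambda_{\rm e}\,\mathrm{tr}(\nabla\widetilde g-\widetilde G)\,I\big),$$ $$\widetilde M=M+2\mu_{\rm e}\,\mathrm{sym}(\nabla\widetilde g-\widetilde G)+2\mu_{\rm c}\,\mathrm{skew}(\nabla\widetilde g-\widetilde G)+\lambda_{\rm e}\,\mathrm{tr}(\nabla\widetilde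 g-\widetilde G)\,I-\big(2\mu_{\rm micro}\,\mathrm{sym}\,\widetilde G+\lambda_{\rm micro}(\mathrm{tr}\,\widetilde G)\,I\big).$$
   Context: $\Omega\subset\mathbb{R}^3$ is a connected, bounded, open set with $C^{1,1}$ boundary $\partial\Omega$ and unit normal field $n$. The unknowns are $u:\Omega\to\mathbb{R}^3$ and $P:\Omega\to\mathbb{R}^{3\times3}$ with rows $P_1,P_2,P_3$; the data are $F:\Omega\to\mathbb{R}^3$, $M:\Omega\to\mathbb{R}^{3\times3}$ and the $\mathbb{R}^3$-valued boundary data $g,G_1,G_2,G_3$. The constitutive coefficients are real constants. For $X,Y\in\mathbb{R}^{3\times 3}$: $\mathrm{sym}\,X=\frac12(X^T+X)$, $\mathrm{skew}\,X=\frac12(X-X^T)$, $\mathrm{tr}\,X$ is the trace, $\langle X,Y\rangle=\mathrm{tr}(XY^T)$, and $I$ is the identity matrix; on $\mathbb{R}^3$, $\langle\cdot,\cdot\rangle$ is the Euclidean scalar product. $\nabla u$ is the matrix whose rows are the gradients of the components of $u$; $\mathrm{Div}$ and $\mathrm{Curl}$ of a matrix field act row-wise by $\mathrm{div}$ and $\mathrm{curl}$. Function spaces are vector- or matrix-valued as appropriate. $H(\mathrm{curl};\Omega)=\{v\in L^2(\Omega):\mathrm{curl}\,v\in L^2(\Omega)\}$ with its graph norm, and $H_0(\mathrm{curl};\Omega)$ is the closed subspace of those $v$ with $v\times n=0$ on $\partial\Omega$ in the sense of $H^{-1/2}(\partial\Omega)$. $H(\mathrm{Curl};\Omega)$ and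 $H_0(\mathrm{Curl};\Omega)$ are the spaces of $3\times3$ matrix fields whose rows lie in $H(\mathrm{curl};\Omega)$ and $H_0(\mathrm{curl};\Omega)$, respectively. $H^1_0(\Omega)$ is the space of $H^1(\Omega)$ functions with zero trace. Moreover $$\widetilde{\chi}_{\partial\Omega}=\{v\in H^{1/2}(\partial\Omega):\langle v,n\rangle=0\ \text{on }\partial\Omega\}.$$ Extensions of the boundary data: $\widetilde g\in H^2(\Omega)$ is an extension of $g$, i.e. $\widetilde g|_{\partial\Omega}=g$; $\widetilde G$ is the $3\times3$ matrix field with rows $\widetilde G_1,\widetilde G_2,\widetilde G_3\in H^1(\Omega)$ satisfying $\widetilde G_i\times n=G_i$ on $\partial\Omega$ in the sense of $H^{-1/2}(\partial\Omega)$ and $\mathrm{curl}\,\mathrm{curl}\,\widetilde G_i=0$ in $\Omega$. Such extensions exist (for $\widetilde g$ by the standard trace theorem, for $\widetilde G_i$ by the extension operator of Alonso and Valli for tangential traces of $H(\mathrm{curl};\Omega)$); they are fixed throughout. A weak solution of the non-homogeneous boundary value problem means a pair $(u,P)=(\widetilde u+\widetilde g,\widetilde P+\widetilde G)$ with $(\widetilde u,\widetilde P)\in H^1_0(\Omega)\times H_0(\mathrm{Curl};\Omega)$ satisfying the variational identity displayed in the claim. *)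

theory Defs
  imports "HOL-Analysis.Analysis"
begin

section \<open>Matrices\<close>

definition msym :: "real^3^3 \<Rightarrow> real^3^3" where
  "msym X = (1/2) *\<^sub>R (transpose X + X)"

definition mskew :: "real^3^3 \<Rightarrow> real^3^3" where
  "mskew X = (1/2) *\<^sub>R (X - transpose X)"

text \<open>The library inner product on matrices is the Frobenius product.\<close>

lemma inner_matrix_eq_trace: "X \<bullet> Y = trace (X ** transpose Y)" for X Y :: "real^3^3"
  by (simp add: trace_def matrix_matrix_mult_def transpose_def inner_vec_def)


section \<open>Test functions\<close>

definition partial :: "'n::finite \<Rightarrow> (real^'n \<Rightarrow> real) \<Rightarrow> real^'n \<Rightarrow> real" where
  "partial i f x = frechet_derivative f (at x) (axis i 1)"

primrec Ck :: "nat \<Rightarrow> (real^'n::finite \<Rightarrow> real) \<Rightarrow> bool" where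
  "Ck 0 f \<longleftrightarrow> continuous_on UNIV f"
| "Ck (Suc k) f \<longleftrightarrow> (\<forall>x. f differentiable (at x)) \<and> (\<forall>i. Ck k (partial i f))"

definition smooth :: "(real^'n::finite \<Rightarrow> real) \<Rightarrow> bool" where
  "smooth f \<longleftrightarrow> (\<forall>k. Ck k f)"

definition test_fun :: "(real^'n::finite) set \<Rightarrow> (real^'n \<Rightarrow> real) \<Rightarrow> bool" where
  "test_fun \<Omega> \<phi> \<longleftrightarrow> smooth \<phi> \<and> compact (closure {x. \<phi> x \<noteq> 0}) \<and> closure {x. \<phi> x \<noteq> 0} \<subseteq> \<Omega>"

definition test_field :: "(real^3) set \<Rightarrow> (real^3 \<Rightarrow> real^3) \<Rightarrow> bool" where
  "test_field \<Omega> \<phi> \<longleftrightarrow> (\<forall>i. test_fun \<Omega> (\<lambda>x. \<phi> x $ i))"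

definition curl :: "(real^3 \<Rightarrow> real^3) \<Rightarrow> real^3 \<Rightarrow> real^3" where
  "curl v x = vector
     [partial 2 (\<lambda>y. v y $ 3) x - partial 3 (\<lambda>y. v y $ 2) x,
      partial 3 (\<lambda>y. v y $ 1) x - partial 1 (\<lambda>y. v y $ 3) x,
      partial 1 (\<lambda>y. v y $ 2) x - partial 2 (\<lambda>y. v y $ 1) x]"


section \<open>Square-integrable functions and weak differential operators\<close>

text \<open>Elements of function spaces are represented by everywhere defined functions, of which
  only the values on the relevant set, up to null sets, matter. The operators
  \<open>wpartial\<close>, \<open>wcurl\<close>, \<open>wdiv\<close> choose one representative of the (almost everywhere unique)
  weak derivative; their values are meaningful only if an \<open>L\<^sup>2\<close> weak derivative exists.\<close>

definition L2 :: "'a measure \<Rightarrow> ('a \<Rightarrow> 'b::euclidean_space) \<Rightarrow> bool" where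
  "L2 M f \<longleftrightarrow> f \<in> borel_measurable M \<and> integrable M (\<lambda>x. (norm (f x))\<^sup>2)"

definition L2_tendsto :: "'a measure \<Rightarrow> (nat \<Rightarrow> 'a \<Rightarrow> 'b::euclidean_space) \<Rightarrow> ('a \<Rightarrow> 'b) \<Rightarrow> bool" where
  "L2_tendsto M f g \<longleftrightarrow> (\<lambda>k. \<integral>\<^sup>+x. ennreal ((norm (f k x - g x))\<^sup>2) \<partial>M) \<longlonglongrightarrow> 0"

definition has_weak_partial ::
    "(real^'n::finite) set \<Rightarrow> 'n \<Rightarrow> (real^'n \<Rightarrow> real) \<Rightarrow> (real^'n \<Rightarrow> real) \<Rightarrow> bool" where
  "has_weak_partial \<Omega> i f g \<longleftrightarrow> (\<forall>\<phi>. test_fun \<Omega> \<phi> \<longrightarrow>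
     (LINT x|lebesgue_on \<Omega>. f x * partial i \<phi> x) = - (LINT x|lebesgue_on \<Omega>. g x * \<phi> x))"

definition wpartial :: "(real^'n::finite) set \<Rightarrow> 'n \<Rightarrow> (real^'n \<Rightarrow> real) \<Rightarrow> real^'n \<Rightarrow> real" where
  "wpartial \<Omega> i f = (SOME g. L2 (lebesgue_on \<Omega>) g \<and> has_weak_partial \<Omega> i f g)"

definition has_weak_curl :: "(real^3) set \<Rightarrow> (real^3 \<Rightarrow> real^3) \<Rightarrow> (real^3 \<Rightarrow> real^3) \<Rightarrow> bool" where
  "has_weak_curl \<Omega> v w \<longleftrightarrow> (\<forall>\<phi>. test_field \<Omega> \<phi> \<longrightarrow>
     (LINT x|lebesgue_on \<Omega>. v x \<bullet> curl \<phi> x) = (LINT x|lebesgue_on \<Omega>. w x \<bullet> \<phi> x))"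

definition wcurl :: "(real^3) set \<Rightarrow> (real^3 \<Rightarrow> real^3) \<Rightarrow> real^3 \<Rightarrow> real^3" where
  "wcurl \<Omega> v = (SOME w. L2 (lebesgue_on \<Omega>) w \<and> has_weak_curl \<Omega> v w)"

definition has_weak_div :: "(real^3) set \<Rightarrow> (real^3 \<Rightarrow> real^3) \<Rightarrow> (real^3 \<Rightarrow> real) \<Rightarrow> bool" where
  "has_weak_div \<Omega> v g \<longleftrightarrow> (\<forall>\<phi>. test_fun \<Omega> \<phi> \<longrightarrow>
     (LINT x|lebesgue_on \<Omega>. v x \<bullet> (\<chi> i. partial i \<phi> x)) = - (LINT x|lebesgue_on \<Omega>. g x * \<phi> x))"

definition wdiv :: "(real^3) set \<Rightarrow> (real^3 \<Rightarrow> real^3) \<Rightarrow> real^3 \<Rightarrow> real" where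
  "wdiv \<Omega> v = (SOME g. L2 (lebesgue_on \<Omega>) g \<and> has_weak_div \<Omega> v g)"

text \<open>\<open>A $ i\<close> is the \<open>i\<close>-th row of the matrix \<open>A\<close>.\<close>

definition wgrad :: "(real^3) set \<Rightarrow> (real^3 \<Rightarrow> real^3) \<Rightarrow> real^3 \<Rightarrow> real^3^3" where
  "wgrad \<Omega> u x = (\<chi> i j. wpartial \<Omega> j (\<lambda>y. u y $ i) x)"

definition wDiv :: "(real^3) set \<Rightarrow> (real^3 \<Rightarrow> real^3^3) \<Rightarrow> real^3 \<Rightarrow> real^3" where
  "wDiv \<Omega> S x = (\<chi> i. wdiv \<Omega> (\<lambda>y. S y $ i) x)"

definition wCurl :: "(real^3) set \<Rightarrow> (real^3 \<Rightarrow> real^3^3) \<Rightarrow> real^3 \<Rightarrow> real^3^3" where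
  "wCurl \<Omega> P x = (\<chi> i. wcurl \<Omega> (\<lambda>y. P y $ i) x)"


section \<open>Sobolev spaces on an open set\<close>

definition H1 :: "(real^'n::finite) set \<Rightarrow> (real^'n \<Rightarrow> real) \<Rightarrow> bool" where
  "H1 \<Omega> f \<longleftrightarrow> L2 (lebesgue_on \<Omega>) f \<and>
     (\<forall>i. \<exists>g. L2 (lebesgue_on \<Omega>) g \<and> has_weak_partial \<Omega> i f g)"

definition H2 :: "(real^'n::finite) set \<Rightarrow> (real^'n \<Rightarrow> real) \<Rightarrow> bool" where
  "H2 \<Omega> f \<longleftrightarrow> H1 \<Omega> f \<and> (\<forall>i. H1 \<Omega> (wpartial \<Omega> i f))"

definition H1_vec :: "(real^3) set \<Rightarrow> (real^3 \<Rightarrow> real^3) \<Rightarrow> bool" where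
  "H1_vec \<Omega> v \<longleftrightarrow> (\<forall>i. H1 \<Omega> (\<lambda>x. v x $ i))"

definition H2_vec :: "(real^3) set \<Rightarrow> (real^3 \<Rightarrow> real^3) \<Rightarrow> bool" where
  "H2_vec \<Omega> v \<longleftrightarrow> (\<forall>i. H2 \<Omega> (\<lambda>x. v x $ i))"

definition H_curl :: "(real^3) set \<Rightarrow> (real^3 \<Rightarrow> real^3) \<Rightarrow> bool" where
  "H_curl \<Omega> v \<longleftrightarrow> L2 (lebesgue_on \<Omega>) v \<and> (\<exists>w. L2 (lebesgue_on \<Omega>) w \<and> has_weak_curl \<Omega> v w)"

text \<open>Sobolev--Slobodeckij seminorm of order \<open>s = 1/2\<close> in dimension \<open>N\<close>: the exponent is
  \<open>N + 2 s = N + 1\<close>.\<close>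

definition slobodeckij_half :: "(real^'n::finite) set \<Rightarrow> (real^'n \<Rightarrow> real) \<Rightarrow> ennreal" where
  "slobodeckij_half V w =
     (\<integral>\<^sup>+x. \<integral>\<^sup>+y. ennreal ((w x - w y)\<^sup>2 / norm (x - y) ^ (CARD('n) + 1))
        \<partial>lebesgue_on V \<partial>lebesgue_on V)"

definition H_half :: "(real^'n::finite) set \<Rightarrow> (real^'n \<Rightarrow> real) \<Rightarrow> bool" where
  "H_half V w \<longleftrightarrow> L2 (lebesgue_on V) w \<and> slobodeckij_half V w < \<infinity>"

definition H_three_halves :: "(real^'n::finite) set \<Rightarrow> (real^'n \<Rightarrow> real) \<Rightarrow> bool" where
  "H_three_halves V w \<longleftrightarrow> H1 V w \<and> (\<forall>i. H_half V (wpartial V i w))"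


section \<open>Boundaries of class \<open>C\<^sup>1\<^sup>,\<^sup>1\<close>\<close>

definition C11_on :: "(real^2) set \<Rightarrow> (real^2 \<Rightarrow> real) \<Rightarrow> bool" where
  "C11_on V \<gamma> \<longleftrightarrow> (\<exists>d L. (\<forall>y\<in>V. (\<gamma> has_derivative (\<lambda>h. d y \<bullet> h)) (at y)) \<and> L-lipschitz_on V d)"

text \<open>Orthogonal coordinates with origin \<open>p\<close> and axes the columns of \<open>Q\<close>:
  \<open>(y, t) \<in> \<real>\<^sup>2 \<times> \<real>\<close> are the coordinates of the point \<open>chart_point p Q y t\<close>.\<close>

definition chart_point :: "real^3 \<Rightarrow> real^3^3 \<Rightarrow> real^2 \<Rightarrow> real \<Rightarrow> real^3" where
  "chart_point p Q y t = p + Q *v vector [y$1, y$2, t]"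

text \<open>In the open cuboid \<open>\<bar>y\<^sub>i\<bar> < a\<^sub>i\<close>, \<open>\<bar>t\<bar> < b\<close> the set \<open>\<Omega>\<close> lies below the graph of \<open>\<gamma>\<close>, and
  the graph is its boundary.\<close>

definition graph_chart ::
    "(real^3) set \<Rightarrow> real^3 \<Rightarrow> real^3^3 \<Rightarrow> real^2 \<Rightarrow> real \<Rightarrow> (real^2 \<Rightarrow> real) \<Rightarrow> bool" where
  "graph_chart \<Omega> p Q a b \<gamma> \<longleftrightarrow>
     orthogonal_matrix Q \<and> (\<forall>i. 0 < a $ i) \<and> 0 < b \<and> C11_on (box (- a) a) \<gamma> \<and>
     (\<forall>y\<in>box (- a) a. \<bar>\<gamma> y\<bar> \<le> b / 2 \<and>
        (\<forall>t. \<bar>t\<bar> < b \<longrightarrow>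
           (chart_point p Q y t \<in> \<Omega> \<longleftrightarrow> t < \<gamma> y) \<and>
           (chart_point p Q y t \<in> frontier \<Omega> \<longleftrightarrow> t = \<gamma> y)))"

definition C11_boundary :: "(real^3) set \<Rightarrow> bool" where
  "C11_boundary \<Omega> \<longleftrightarrow> (\<forall>z\<in>frontier \<Omega>. \<exists>p Q a b \<gamma> y.
     graph_chart \<Omega> p Q a b \<gamma> \<and> y \<in> box (- a) a \<and> z = chart_point p Q y (\<gamma> y))"

text \<open>The unit normal is taken to point out of \<open>\<Omega>\<close>.\<close>

definition unit_normal_field :: "(real^3) set \<Rightarrow> (real^3 \<Rightarrow> real^3) \<Rightarrow> bool" where
  "unit_normal_field \<Omega> n \<longleftrightarrow> (\<forall>z\<in>frontier \<Omega>. \<exists>p Q a b \<gamma> y d.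
     graph_chart \<Omega> p Q a b \<gamma> \<and> y \<in> box (- a) a \<and> z = chart_point p Q y (\<gamma> y) \<and>
     (\<gamma> has_derivative (\<lambda>h. d \<bullet> h)) (at y) \<and>
     n z = (1 / sqrt (1 + (norm d)\<^sup>2)) *\<^sub>R (Q *v vector [- d$1, - d$2, 1]))"


section \<open>Surface measure and boundary spaces\<close>

text \<open>Two-dimensional Hausdorff outer measure, with the factor \<open>\<pi>/4\<close> that makes it agree with
  area. It is countably additive on Borel sets, so \<open>measure_of\<close> below yields it there.\<close>

definition hausdorff2_pre :: "real \<Rightarrow> (real^3) set \<Rightarrow> ennreal" where
  "hausdorff2_pre \<delta> A =
     (INF C \<in> {C :: nat \<Rightarrow> (real^3) set. A \<subseteq> (\<Union>i. C i) \<and> (\<forall>i. bounded (C i) \<and> diameter (C i) \<le> \<delta>)}.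
        \<Sum>i. ennreal (pi / 4 * (diameter (C i))\<^sup>2))"

definition hausdorff2 :: "(real^3) set \<Rightarrow> ennreal" where
  "hausdorff2 A = (SUP \<delta>\<in>{0<..}. hausdorff2_pre \<delta> A)"

definition surface_measure :: "(real^3) set \<Rightarrow> (real^3) measure" where
  "surface_measure \<Omega> =
     completion (restrict_space (measure_of UNIV (sets borel) hausdorff2) (frontier \<Omega>))"

text \<open>Sobolev spaces on the boundary are defined by pull-back along all local graph charts.\<close>

definition H_half_bd :: "(real^3) set \<Rightarrow> (real^3 \<Rightarrow> real^3) \<Rightarrow> bool" where
  "H_half_bd \<Omega> v \<longleftrightarrow> L2 (surface_measure \<Omega>) v \<and>
     (\<forall>p Q a b \<gamma> i. graph_chart \<Omega> p Q a b \<gamma> \<longrightarrow>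
        H_half (box (- a) a) (\<lambda>y. v (chart_point p Q y (\<gamma> y)) $ i))"

definition H_three_halves_bd :: "(real^3) set \<Rightarrow> (real^3 \<Rightarrow> real^3) \<Rightarrow> bool" where
  "H_three_halves_bd \<Omega> v \<longleftrightarrow> L2 (surface_measure \<Omega>) v \<and>
     (\<forall>p Q a b \<gamma> i. graph_chart \<Omega> p Q a b \<gamma> \<longrightarrow>
        H_three_halves (box (- a) a) (\<lambda>y. v (chart_point p Q y (\<gamma> y)) $ i))"

definition chi_tilde :: "(real^3) set \<Rightarrow> (real^3 \<Rightarrow> real^3) \<Rightarrow> (real^3 \<Rightarrow> real^3) \<Rightarrow> bool" where
  "chi_tilde \<Omega> n v \<longleftrightarrow> H_half_bd \<Omega> v \<and> (AE x in surface_measure \<Omega>. v x \<bullet> n x = 0)"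


section \<open>Traces\<close>

text \<open>The trace operator is the continuous extension to \<open>H\<^sup>1(\<Omega>)\<close>, with values in \<open>L\<^sup>2(\<partial>\<Omega>)\<close>, of the
  restriction of functions that are smooth up to the boundary.\<close>

definition has_trace :: "(real^3) set \<Rightarrow> (real^3 \<Rightarrow> real) \<Rightarrow> (real^3 \<Rightarrow> real) \<Rightarrow> bool" where
  "has_trace \<Omega> f g \<longleftrightarrow> H1 \<Omega> f \<and> L2 (surface_measure \<Omega>) g \<and>
     (\<exists>\<phi> :: nat \<Rightarrow> real^3 \<Rightarrow> real. (\<forall>k. smooth (\<phi> k)) \<and>
        L2_tendsto (lebesgue_on \<Omega>) \<phi> f \<and>
        (\<forall>i. L2_tendsto (lebesgue_on \<Omega>) (\<lambda>k. partial i (\<phi> k)) (wpartial \<Omega> i f)) \<and>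
        L2_tendsto (surface_measure \<Omega>) \<phi> g)"

definition has_trace_vec :: "(real^3) set \<Rightarrow> (real^3 \<Rightarrow> real^3) \<Rightarrow> (real^3 \<Rightarrow> real^3) \<Rightarrow> bool" where
  "has_trace_vec \<Omega> v g \<longleftrightarrow> (\<forall>i. has_trace \<Omega> (\<lambda>x. v x $ i) (\<lambda>x. g x $ i))"

definition H1_0 :: "(real^3) set \<Rightarrow> (real^3 \<Rightarrow> real^3) \<Rightarrow> bool" where
  "H1_0 \<Omega> u \<longleftrightarrow> H1_vec \<Omega> u \<and> has_trace_vec \<Omega> u (\<lambda>_. 0)"

text \<open>The tangential trace \<open>v \<times> n \<in> H\<^sup>-\<^sup>1\<^sup>/\<^sup>2(\<partial>\<Omega>)\<close> of \<open>v \<in> H(curl;\<Omega>)\<close>, \<open>n\<close> the outward normal, is the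
  functional on \<open>H\<^sup>1\<^sup>/\<^sup>2(\<partial>\<Omega>)\<close> whose value at the trace of \<open>\<phi> \<in> H\<^sup>1(\<Omega>)\<close> is given by Green's formula:
  for smooth \<open>v\<close>, \<open>\<phi>\<close> the following number is the surface integral of \<open>\<langle>v \<times> n, \<phi>\<rangle>\<close>.\<close>

definition tangential_trace ::
    "(real^3) set \<Rightarrow> (real^3 \<Rightarrow> real^3) \<Rightarrow> (real^3 \<Rightarrow> real^3) \<Rightarrow> real" where
  "tangential_trace \<Omega> v \<phi> =
     (LINT x|lebesgue_on \<Omega>. v x \<bullet> wcurl \<Omega> \<phi> x - wcurl \<Omega> v x \<bullet> \<phi> x)"

definition H0_curl :: "(real^3) set \<Rightarrow> (real^3 \<Rightarrow> real^3) \<Rightarrow> bool" where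
  "H0_curl \<Omega> v \<longleftrightarrow> H_curl \<Omega> v \<and> (\<forall>\<phi>. H1_vec \<Omega> \<phi> \<longrightarrow> tangential_trace \<Omega> v \<phi> = 0)"

text \<open>\<open>v \<times> n = G\<close> on \<open>\<partial>\<Omega>\<close> in the sense of \<open>H\<^sup>-\<^sup>1\<^sup>/\<^sup>2(\<partial>\<Omega>)\<close>, for \<open>G \<in> L\<^sup>2(\<partial>\<Omega>)\<close> acting as a functional
  by the \<open>L\<^sup>2(\<partial>\<Omega>)\<close> product.\<close>

definition has_tangential_trace ::
    "(real^3) set \<Rightarrow> (real^3 \<Rightarrow> real^3) \<Rightarrow> (real^3 \<Rightarrow> real^3) \<Rightarrow> bool" where
  "has_tangential_trace \<Omega> v G \<longleftrightarrow> H_curl \<Omega> v \<and> L2 (surface_measure \<Omega>) G \<and>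
     (\<forall>\<phi> \<psi>. H1_vec \<Omega> \<phi> \<and> has_trace_vec \<Omega> \<phi> \<psi> \<longrightarrow>
        tangential_trace \<Omega> v \<phi> = (LINT x|surface_measure \<Omega>. G x \<bullet> \<psi> x))"

definition H0_Curl :: "(real^3) set \<Rightarrow> (real^3 \<Rightarrow> real^3^3) \<Rightarrow> bool" where
  "H0_Curl \<Omega> P \<longleftrightarrow> (\<forall>i. H0_curl \<Omega> (\<lambda>x. P x $ i))"

text \<open>\<open>gt\<close> extends \<open>g\<close>; the rows of \<open>Gt\<close> extend the tangential data \<open>G i\<close> with vanishing double curl.\<close>

definition displacement_extension ::
    "(real^3) set \<Rightarrow> (real^3 \<Rightarrow> real^3) \<Rightarrow> (real^3 \<Rightarrow> real^3) \<Rightarrow> bool" where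
  "displacement_extension \<Omega> g gt \<longleftrightarrow> H2_vec \<Omega> gt \<and> has_trace_vec \<Omega> gt g"

definition distortion_extension ::
    "(real^3) set \<Rightarrow> (3 \<Rightarrow> real^3 \<Rightarrow> real^3) \<Rightarrow> (real^3 \<Rightarrow> real^3^3) \<Rightarrow> bool" where
  "distortion_extension \<Omega> G Gt \<longleftrightarrow> (\<forall>i.
     H1_vec \<Omega> (\<lambda>x. Gt x $ i) \<and>
     has_tangential_trace \<Omega> (\<lambda>x. Gt x $ i) (G i) \<and>
     has_weak_curl \<Omega> (wcurl \<Omega> (\<lambda>x. Gt x $ i)) (\<lambda>_. 0))"


section \<open>The relaxed micromorphic model\<close>

definition force_stress :: "real \<Rightarrow> real \<Rightarrow> real \<Rightarrow> real^3^3 \<Rightarrow> real^3^3" where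
  "force_stress mu_e mu_c lam_e X =
     (2 * mu_e) *\<^sub>R msym X + (2 * mu_c) *\<^sub>R mskew X + (lam_e * trace X) *\<^sub>R mat 1"

definition micro_stress :: "real \<Rightarrow> real \<Rightarrow> real^3^3 \<Rightarrow> real^3^3" where
  "micro_stress mu_micro lam_micro X =
     (2 * mu_micro) *\<^sub>R msym X + (lam_micro * trace X) *\<^sub>R mat 1"

text \<open>\<open>(ut, Pt)\<close> solves the variational problem with homogeneous boundary data and
  right-hand side \<open>(F, M)\<close>.\<close>

definition weak_solution_hom ::
    "(real^3) set \<Rightarrow> real \<Rightarrow> real \<Rightarrow> real \<Rightarrow> real \<Rightarrow> real \<Rightarrow> real \<Rightarrow> real \<Rightarrow>
     (real^3 \<Rightarrow> real^3) \<Rightarrow> (real^3 \<Rightarrow> real^3^3) \<Rightarrow> (real^3 \<Rightarrow> real^3) \<Rightarrow> (real^3 \<Rightarrow> real^3^3) \<Rightarrow> bool" where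
  "weak_solution_hom \<Omega> mu_e lam_e mu_c mu_micro lam_micro mu_macro L_c F M ut Pt \<longleftrightarrow>
     H1_0 \<Omega> ut \<and> H0_Curl \<Omega> Pt \<and>
     (\<forall>ub Pb. H1_0 \<Omega> ub \<and> H0_Curl \<Omega> Pb \<longrightarrow>
       (LINT x|lebesgue_on \<Omega>.
            2 * mu_e * (msym (wgrad \<Omega> ut x - Pt x) \<bullet> msym (wgrad \<Omega> ub x - Pb x))
          + 2 * mu_c * (mskew (wgrad \<Omega> ut x - Pt x) \<bullet> mskew (wgrad \<Omega> ub x - Pb x))
          + lam_e * trace (wgrad \<Omega> ut x - Pt x) * trace (wgrad \<Omega> ub x - Pb x)
          + 2 * mu_micro * (msym (Pt x) \<bullet> msym (Pb x))
          + lam_micro * trace (Pt x) * trace (Pb x)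
          + mu_macro * L_c\<^sup>2 * (wCurl \<Omega> Pt x \<bullet> wCurl \<Omega> Pb x))
       = (LINT x|lebesgue_on \<Omega>. F x \<bullet> ub x + M x \<bullet> Pb x))"

text \<open>A weak solution of the boundary value problem with the data extended by \<open>gt\<close>, \<open>Gt\<close> is
  \<open>(ut + gt, Pt + Gt)\<close>, where \<open>(ut, Pt)\<close> solves the homogeneous problem with modified loads. No
  double curl of \<open>Gt\<close> enters these loads because the extensions make it vanish.\<close>

definition weak_solution ::
    "(real^3) set \<Rightarrow> real \<Rightarrow> real \<Rightarrow> real \<Rightarrow> real \<Rightarrow> real \<Rightarrow> real \<Rightarrow> real \<Rightarrow>
     (real^3 \<Rightarrow> real^3) \<Rightarrow> (real^3 \<Rightarrow> real^3^3) \<Rightarrow> (real^3 \<Rightarrow> real^3) \<Rightarrow> (real^3 \<Rightarrow> real^3^3) \<Rightarrow>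
     (real^3 \<Rightarrow> real^3) \<Rightarrow> (real^3 \<Rightarrow> real^3^3) \<Rightarrow> bool" where
  "weak_solution \<Omega> mu_e lam_e mu_c mu_micro lam_micro mu_macro L_c F M gt Gt u P \<longleftrightarrow>
     (\<exists>ut Pt.
        (AE x in lebesgue_on \<Omega>. u x = ut x + gt x \<and> P x = Pt x + Gt x) \<and>
        weak_solution_hom \<Omega> mu_e lam_e mu_c mu_micro lam_micro mu_macro L_c
          (\<lambda>x. F x + wDiv \<Omega> (\<lambda>y. force_stress mu_e mu_c lam_e (wgrad \<Omega> gt y - Gt y)) x)
          (\<lambda>x. M x + force_stress mu_e mu_c lam_e (wgrad \<Omega> gt x - Gt x)
                   - micro_stress mu_micro lam_micro (Gt x))
          ut Pt)"

end

theory Submission imports Defs begin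

text \<open>The left-hand side of the variational identity is the integral of a symmetric bilinear form in the
  values of the state \<open>(u, grad u, P, Curl P)\<close>. Up to null sets, the states of the
  pairs \<open>(u, P)\<close> in \<open>H1_0 \<times> H0_Curl\<close> form a closed subspace
  \<open>admissible\<close> of the square-integrable functions (\<open>admissible_lin\<close>,
  \<open>admissible_closed\<close>). The right-hand side is continuous on it, because the
  extensions of the boundary data are regular enough to keep the modified loads square-integrable
  (\<open>modified_loads_L2\<close>). By the Riesz representation
  (\<open>Riesz_on_L2_subspace\<close>) existence is a consequence of coercivity
  (\<open>energy_coercive\<close>), and so is uniqueness, since the difference of two solutions
  has zero energy.

  Pointwise, the energy controls \<open>sym (grad u - P)\<close>, \<open>sym P\<close> and
  \<open>Curl P\<close> only; for \<open>\<mu>\<^sub>c = 0\<close> there is no information on the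
  skew-symmetric parts. Coercivity (\<open>lift_coercive\<close>) therefore rests on Korn's
  inequality for incompatible fields, \<open>\<parallel>P\<parallel> \<le> C (\<parallel>sym
  P\<parallel> + \<parallel>Curl P\<parallel>)\<close> for \<open>P\<close> with zero tangential
  trace, on the same inequality for the curl-free field \<open>grad u\<close>, and on Poincare's
  inequality. All three are proved by Fourier series on a cube of twice the size of
  \<open>\<Omega>\<close>. Fields with zero boundary values, extended by zero, satisfy the rules
  of calculus for Fourier coefficients: a partial derivative becomes the product with a component
  of the frequency \<open>K\<close>, and the curl becomes the cross product with \<open>K\<close>
  (\<open>zero_trace_modes\<close>, \<open>H0_curl_modes\<close>). For a single frequency \<open>K
  \<noteq> 0\<close> Korn's inequality is an inequality between matrices
  (\<open>matrix_le_sym_and_cross\<close>), and Parseval's identity sums it up. The zero frequency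
  escapes this argument, but as \<open>\<Omega>\<close> fills at most half of the cube, the mean
  value carries at most half of the squared norm and is absorbed (\<open>l2n_le_of_modes\<close>).

  That the rules of calculus hold up to the boundary is Green's formula for \<open>H0_curl\<close>,
  where it defines the zero tangential trace. For \<open>H1_0\<close> the trace is a limit in the
  square-integrable functions on the boundary, and one has to show that functions with zero trace
  can be integrated by parts against waves (\<open>zero_trace_by_parts\<close>). For this it is
  enough to bound the integral of \<open>\<partial>\<^sub>i f\<close> over \<open>\<Omega>\<close>
  by the values of \<open>f\<close> on the boundary (\<open>boundary_controls_integral\<close>). A
  cut-off at distance \<open>\<epsilon>\<close> from the boundary bounds it by the mean of
  \<open>\<bar>f\<bar>\<close> over a strip of width proportional to \<open>\<epsilon>\<close>
  (\<open>cutoff_integral_bound\<close>); the strip is covered by finitely many layers around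
  graphs (\<open>strip_cover\<close>), the integral over a layer is an integral over the base of
  the chart (\<open>layer_integral_le\<close>), and this is a surface integral up to a factor,
  since projections do not increase Hausdorff measure (\<open>area_of_projection_le\<close>).

  Weak derivatives are unique almost everywhere by Parseval's identity again, applied to products
  with bump functions (\<open>AE_zero_of_test_funs\<close>).\<close>

section \<open>The space of square-integrable functions\<close>

definition l2n :: "'a measure \<Rightarrow> ('a \<Rightarrow> 'b::euclidean_space) \<Rightarrow> real" where
  "l2n M f = sqrt (LINT x|M. (norm (f x))\<^sup>2)"

lemma L2_measurable: "L2 M f \<Longrightarrow> f \<in> borel_measurable M"
  by (simp add: L2_def)

lemma L2_sq_integrable: "L2 M f \<Longrightarrow> integrable M (\<lambda>x. (norm (f x))\<^sup>2)"
  by (simp add: L2_def)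

lemma l2n_nonneg: "0 \<le> l2n M f"
  by (simp add: l2n_def)

lemma l2n_power2: "(l2n M f)\<^sup>2 = (LINT x|M. (norm (f x))\<^sup>2)"
  by (simp add: l2n_def)

lemma L2_dominated:
  assumes "L2 M f" and g: "g \<in> borel_measurable M"
    and le: "\<And>x. x \<in> space M \<Longrightarrow> norm (g x) \<le> C * norm (f x)"
  shows "L2 M g"
proof -
  have "integrable M (\<lambda>x. C\<^sup>2 * (norm (f x))\<^sup>2)"
    using assms(1) by (simp add: L2_def)
  moreover have "(\<lambda>x. (norm (g x))\<^sup>2) \<in> borel_measurable M"
    using g by measurable
  moreover have "AE x in M. norm ((norm (g x))\<^sup>2) \<le> norm (C\<^sup>2 * (norm (f x))\<^sup>2)"
    using power_mono[OF le, of _ 2] by (auto simp: power_mult_distrib)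
  ultimately show ?thesis
    using g unfolding L2_def by (blast intro: Bochner_Integration.integrable_bound)
qed

lemma L2_add:
  assumes "L2 M f" "L2 M g" shows "L2 M (\<lambda>x. f x + g x)"
proof -
  have [measurable]: "f \<in> borel_measurable M" "g \<in> borel_measurable M"
    using assms by (auto simp: L2_def)
  have "(norm (f x + g x))\<^sup>2 \<le> 2 * (norm (f x))\<^sup>2 + 2 * (norm (g x))\<^sup>2" for x
  proof -
    have "(norm (f x + g x))\<^sup>2 \<le> (norm (f x) + norm (g x))\<^sup>2"
      by (intro power_mono norm_triangle_ineq) auto
    also have "\<dots> \<le> 2 * (norm (f x))\<^sup>2 + 2 * (norm (g x))\<^sup>2"
      using sum_squares_bound[of "norm (f x)" "norm (g x)"] by (simp add: power2_sum)
    finally show ?thesis .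
  qed
  moreover have "integrable M (\<lambda>x. 2 * (norm (f x))\<^sup>2 + 2 * (norm (g x))\<^sup>2)"
    using assms by (auto simp: L2_def)
  ultimately have "integrable M (\<lambda>x. (norm (f x + g x))\<^sup>2)"
    by (elim Bochner_Integration.integrable_bound) auto
  then show ?thesis
    by (auto simp: L2_def)
qed

lemma L2_bounded_linear:
  assumes "bounded_linear h" "L2 M f" shows "L2 M (\<lambda>x. h (f x))"
proof -
  obtain C where "norm (h y) \<le> norm y * C" for y
    using bounded_linear.bounded[OF assms(1)] by blast
  moreover have "(\<lambda>x. h (f x)) \<in> borel_measurable M"
    using assms by (intro borel_measurable_continuous_on[OF _ L2_measurable])
      (auto intro: linear_continuous_on)
  ultimately show ?thesis
    by (intro L2_dominated[OF assms(2), where C=C]) (auto simp: mult.commute[of C])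
qed

lemma L2_scaleR: "L2 M f \<Longrightarrow> L2 M (\<lambda>x. c *\<^sub>R f x)"
  by (rule L2_bounded_linear[OF bounded_linear_scaleR_right])

lemma L2_minus: "L2 M f \<Longrightarrow> L2 M (\<lambda>x. - f x)"
  by (rule L2_bounded_linear[OF bounded_linear_minus[OF bounded_linear_ident]])

lemma L2_cmult: "L2 M f \<Longrightarrow> L2 M (\<lambda>x. c * f x :: real)"
  by (rule L2_bounded_linear[OF bounded_linear_mult_right])

lemma L2_diff: "L2 M f \<Longrightarrow> L2 M g \<Longrightarrow> L2 M (\<lambda>x. f x - g x)"
  using L2_add[of M f "\<lambda>x. - g x"] L2_minus[of M g] by simp

lemma L2_zero [simp]: "L2 M (\<lambda>_. 0)"
  by (simp add: L2_def)

lemma L2_sum: "(\<And>i. i \<in> I \<Longrightarrow> L2 M (f i)) \<Longrightarrow> L2 M (\<lambda>x. \<Sum>i\<in>I. f i x)"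
  by (induction I rule: infinite_finite_induct) (auto intro: L2_add)

lemma L2_nth: "L2 M f \<Longrightarrow> L2 M (\<lambda>x. f x $ i)"
  by (rule L2_bounded_linear[OF bounded_linear_vec_nth])

lemma L2_component: "L2 M f \<Longrightarrow> L2 M (\<lambda>x. f x \<bullet> b)"
  by (rule L2_bounded_linear[OF bounded_linear_inner_left])

lemma L2_via_components:
  assumes "\<And>b. b \<in> Basis \<Longrightarrow> L2 M (\<lambda>x. f x \<bullet> b)" shows "L2 M f"
proof -
  have "L2 M (\<lambda>x. \<Sum>b\<in>Basis. (f x \<bullet> b) *\<^sub>R b)"
    by (intro L2_sum L2_bounded_linear[OF bounded_linear_scaleR_left] assms)
  then show ?thesis by (simp add: euclidean_representation)
qed

lemma L2_vecI:
  fixes f :: "'a \<Rightarrow> 'b::euclidean_space^'n::finite"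
  assumes "\<And>i. L2 M (\<lambda>x. f x $ i)" shows "L2 M f"
proof (rule L2_via_components)
  fix b :: "'b^'n" assume "b \<in> Basis"
  then obtain i u where "b = axis i u" by (auto simp: Basis_vec_def)
  then show "L2 M (\<lambda>x. f x \<bullet> b)"
    using L2_component[OF assms[of i], of u] by (simp add: inner_axis)
qed

lemma L2_Pair:
  assumes "L2 M f" "L2 M g" shows "L2 M (\<lambda>x. (f x, g x))"
proof -
  have "bounded_linear (\<lambda>y. (y, 0::'c))" "bounded_linear (\<lambda>y. (0::'b, y))"
    by (auto intro!: bounded_linear_Pair)
  from L2_add[OF L2_bounded_linear[OF this(1) assms(1)] L2_bounded_linear[OF this(2) assms(2)]]
  show ?thesis by simp
qed

lemma L2_bilinear_integrable:
  fixes B :: "'b::euclidean_space \<Rightarrow> 'c::euclidean_space \<Rightarrow> 'd::euclidean_space"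
  assumes B: "bounded_bilinear B" and "L2 M f" "L2 M g"
  shows "integrable M (\<lambda>x. B (f x) (g x))"
proof -
  interpret bounded_bilinear B by fact
  obtain K where K: "0 \<le> K" "\<And>a b. norm (B a b) \<le> norm a * norm b * K"
    using nonneg_bounded by blast
  have [measurable]: "f \<in> borel_measurable M" "g \<in> borel_measurable M"
    using assms by (auto simp: L2_def)
  have [measurable]: "(\<lambda>x. B (f x) (g x)) \<in> borel_measurable M"
    by (rule borel_measurable_continuous_Pair[where H=B])
       (auto intro!: continuous_on[OF continuous_on_fst[OF continuous_on_id] continuous_on_snd[OF continuous_on_id]])
  have "norm (B (f x) (g x)) \<le> K * ((norm (f x))\<^sup>2 + (norm (g x))\<^sup>2)" for x
  proof -
    have "norm (f x) * norm (g x) \<le> (norm (f x))\<^sup>2 + (norm (g x))\<^sup>2"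
      using sum_squares_bound[of "norm (f x)" "norm (g x)"]
        mult_nonneg_nonneg[OF norm_ge_zero[of "f x"] norm_ge_zero[of "g x"]] by linarith
    from mult_right_mono[OF this K(1)] K(2)[of "f x" "g x"] show ?thesis
      by (simp add: mult.commute)
  qed
  moreover have "integrable M (\<lambda>x. K * ((norm (f x))\<^sup>2 + (norm (g x))\<^sup>2))"
    using assms by (auto simp: L2_def)
  ultimately show ?thesis
    by (intro Bochner_Integration.integrable_bound[where g="\<lambda>x. B (f x) (g x)"
          and f="\<lambda>x. K * ((norm (f x))\<^sup>2 + (norm (g x))\<^sup>2)"])
       (auto intro!: AE_I2 order_trans[OF _ abs_ge_self])
qed

lemmas L2_inner_integrable = L2_bilinear_integrable[OF bounded_bilinear_inner]
lemmas L2_mult_integrable = L2_bilinear_integrable[OF bounded_bilinear_mult]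

lemma L2_norm: "L2 M f \<Longrightarrow> L2 M (\<lambda>x. norm (f x))"
  by (auto simp: L2_def)

lemma Cauchy_Schwarz_L2:
  fixes f g :: "'a \<Rightarrow> real"
  assumes f: "L2 M f" and g: "L2 M g"
  shows "(LINT x|M. f x * g x) \<le> l2n M f * l2n M g"
proof -
  define a b where "a = l2n M f" and "b = l2n M g"
  have fg: "integrable M (\<lambda>x. f x * g x)" by (rule L2_mult_integrable[OF f g])
  have f2: "integrable M (\<lambda>x. (f x)\<^sup>2)" "integrable M (\<lambda>x. (g x)\<^sup>2)"
    using f g by (auto simp: L2_def)
  have ab: "a\<^sup>2 = (LINT x|M. (f x)\<^sup>2)" "b\<^sup>2 = (LINT x|M. (g x)\<^sup>2)" "0 \<le> a" "0 \<le> b"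
    by (auto simp: a_def b_def l2n_power2 l2n_nonneg)
  have quad: "0 \<le> s\<^sup>2 * a\<^sup>2 - 2 * s * t * (LINT x|M. f x * g x) + t\<^sup>2 * b\<^sup>2" for s t
  proof -
    have "0 \<le> (LINT x|M. (s * f x - t * g x)\<^sup>2)" by simp
    also have "(\<lambda>x. (s * f x - t * g x)\<^sup>2)
        = (\<lambda>x. s\<^sup>2 * (f x)\<^sup>2 - 2 * s * t * (f x * g x) + t\<^sup>2 * (g x)\<^sup>2)"
      by (auto simp: power2_eq_square algebra_simps)
    also have "(LINT x|M. s\<^sup>2 * (f x)\<^sup>2 - 2 * s * t * (f x * g x) + t\<^sup>2 * (g x)\<^sup>2)
       = s\<^sup>2 * a\<^sup>2 - 2 * s * t * (LINT x|M. f x * g x) + t\<^sup>2 * b\<^sup>2"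
      unfolding ab using fg f2 by simp
    finally show ?thesis .
  qed
  let ?I = "LINT x|M. f x * g x"
  have nonpos: "?I \<le> 0" if "\<And>s. 2 * s * ?I \<le> c" for c
  proof (rule ccontr)
    assume "\<not> ?I \<le> 0"
    then show False using that[of "(c + 1) / (2 * ?I)"] by simp
  qed
  consider "a = 0" | "b = 0" | "a > 0" "b > 0" using ab by linarith
  then show ?thesis
  proof cases
    case 1
    then show ?thesis using nonpos[of "b\<^sup>2"] quad[of _ 1] by (simp add: a_def)
  next
    case 2
    then show ?thesis using nonpos[of "a\<^sup>2"] quad[of 1] by (simp add: b_def)
  next
    case 3
    have "2 * (a * b) * ?I \<le> 2 * (a * b) * (a * b)"
      using quad[of b a] by (simp add: power2_eq_square algebra_simps)
    then show ?thesis using 3 by (simp add: a_def b_def)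
  qed
qed

lemma bilinear_Cauchy_Schwarz_L2:
  fixes B :: "'b::euclidean_space \<Rightarrow> 'c::euclidean_space \<Rightarrow> 'd::euclidean_space"
  assumes B: "bounded_bilinear B" and K: "\<And>a b. norm (B a b) \<le> norm a * norm b * K"
    and K0: "0 \<le> K" and f: "L2 M f" and g: "L2 M g"
  shows "norm (LINT x|M. B (f x) (g x)) \<le> K * (l2n M f * l2n M g)"
proof -
  have "norm (LINT x|M. B (f x) (g x)) \<le> (LINT x|M. norm (B (f x) (g x)))"
    by (rule integral_norm_bound)
  also have "\<dots> \<le> (LINT x|M. K * (norm (f x) * norm (g x)))"
    using L2_bilinear_integrable[OF B f g] K
      L2_mult_integrable[OF L2_norm[OF f] L2_norm[OF g]]
    by (intro integral_mono) (auto simp: mult_ac)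
  also have "\<dots> = K * (LINT x|M. norm (f x) * norm (g x))" by simp
  also have "\<dots> \<le> K * (l2n M f * l2n M g)"
    using Cauchy_Schwarz_L2[OF L2_norm[OF f] L2_norm[OF g]] K0
    by (intro mult_left_mono) (auto simp: l2n_def)
  finally show ?thesis .
qed

lemma l2n_mono:
  assumes "L2 M f" "L2 M g" "\<And>x. x \<in> space M \<Longrightarrow> norm (f x) \<le> norm (g x)"
  shows "l2n M f \<le> l2n M g"
  using assms unfolding l2n_def L2_def
  by (intro real_sqrt_le_mono integral_mono) (auto intro!: power_mono)

lemma l2n_triangle:
  assumes f: "L2 M f" and g: "L2 M g"
  shows "l2n M (\<lambda>x. f x + g x) \<le> l2n M f + l2n M g"
proof (rule power2_le_imp_le)
  have i: "integrable M (\<lambda>x. norm (f x) * norm (g x))"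
    by (rule L2_mult_integrable[OF L2_norm[OF f] L2_norm[OF g]])
  have fg: "integrable M (\<lambda>x. (norm (f x))\<^sup>2)" "integrable M (\<lambda>x. (norm (g x))\<^sup>2)"
    using f g by (auto simp: L2_def)
  have "(l2n M (\<lambda>x. f x + g x))\<^sup>2
     \<le> (LINT x|M. (norm (f x))\<^sup>2 + (norm (g x))\<^sup>2 + 2 * (norm (f x) * norm (g x)))"
    unfolding l2n_power2
  proof (rule integral_mono)
    fix x
    have "(norm (f x + g x))\<^sup>2 \<le> (norm (f x) + norm (g x))\<^sup>2"
      by (intro power_mono norm_triangle_ineq) auto
    then show "(norm (f x + g x))\<^sup>2 \<le> (norm (f x))\<^sup>2 + (norm (g x))\<^sup>2 + 2 * (norm (f x) * norm (g x))"
      by (simp add: power2_sum)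
  qed (use i fg L2_add[OF f g] in \<open>auto simp: L2_def\<close>)
  also have "\<dots> = (l2n M f)\<^sup>2 + (l2n M g)\<^sup>2 + 2 * (LINT x|M. norm (f x) * norm (g x))"
    using i fg by (simp add: l2n_power2)
  also have "\<dots> \<le> (l2n M f)\<^sup>2 + (l2n M g)\<^sup>2 + 2 * (l2n M f * l2n M g)"
    using Cauchy_Schwarz_L2[OF L2_norm[OF f] L2_norm[OF g]] by (simp add: l2n_def)
  also have "\<dots> = (l2n M f + l2n M g)\<^sup>2" by (simp add: power2_sum)
  finally show "(l2n M (\<lambda>x. f x + g x))\<^sup>2 \<le> (l2n M f + l2n M g)\<^sup>2" .
qed (simp add: l2n_nonneg)

lemma l2n_triangle3:
  assumes "L2 M f" "L2 M g" "L2 M h"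
  shows "l2n M (\<lambda>x. f x - h x) \<le> l2n M (\<lambda>x. f x - g x) + l2n M (\<lambda>x. g x - h x)"
  using l2n_triangle[OF L2_diff[OF assms(1,2)] L2_diff[OF assms(2,3)]] by simp

lemma nn_integral_sq_eq:
  assumes "L2 M f" shows "(\<integral>\<^sup>+x. ennreal ((norm (f x))\<^sup>2) \<partial>M) = ennreal ((l2n M f)\<^sup>2)"
  using assms unfolding l2n_power2 by (intro nn_integral_eq_integral) (auto simp: L2_def)

lemma L2_tendsto_iff:
  assumes "\<And>k. L2 M (f k)" "L2 M g"
  shows "L2_tendsto M f g \<longleftrightarrow> (\<lambda>k. l2n M (\<lambda>x. f k x - g x)) \<longlonglongrightarrow> 0"
proof -
  have "L2_tendsto M f g \<longleftrightarrow> (\<lambda>k. ennreal ((l2n M (\<lambda>x. f k x - g x))\<^sup>2)) \<longlonglongrightarrow> ennreal 0"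
    unfolding L2_tendsto_def using nn_integral_sq_eq[OF L2_diff[OF assms]] by simp
  also have "\<dots> \<longleftrightarrow> (\<lambda>k. (l2n M (\<lambda>x. f k x - g x))\<^sup>2) \<longlonglongrightarrow> 0"
    by (subst tendsto_ennreal_iff) auto
  also have "\<dots> \<longleftrightarrow> (\<lambda>k. l2n M (\<lambda>x. f k x - g x)) \<longlonglongrightarrow> 0"
  proof
    assume "(\<lambda>k. (l2n M (\<lambda>x. f k x - g x))\<^sup>2) \<longlonglongrightarrow> 0"
    from tendsto_real_sqrt[OF this] show "(\<lambda>k. l2n M (\<lambda>x. f k x - g x)) \<longlonglongrightarrow> 0"
      by (simp add: l2n_nonneg)
  next
    assume "(\<lambda>k. l2n M (\<lambda>x. f k x - g x)) \<longlonglongrightarrow> 0"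
    from tendsto_power[OF this, of 2] show "(\<lambda>k. (l2n M (\<lambda>x. f k x - g x))\<^sup>2) \<longlonglongrightarrow> 0" by simp
  qed
  finally show ?thesis .
qed

lemma L2_tendsto_bilinear:
  fixes B :: "'b::euclidean_space \<Rightarrow> 'c::euclidean_space \<Rightarrow> 'd::euclidean_space"
  assumes B: "bounded_bilinear B"
    and f: "\<And>k. L2 M (f k)" "L2 M F" "L2_tendsto M f F"
    and g: "\<And>k. L2 M (g k)" "L2 M G" "L2_tendsto M g G"
  shows "(\<lambda>k. LINT x|M. B (f k x) (g k x)) \<longlonglongrightarrow> (LINT x|M. B (F x) (G x))"
proof -
  interpret bounded_bilinear B by fact
  obtain K where K: "0 \<le> K" "\<And>a b. norm (B a b) \<le> norm a * norm b * K"
    using nonneg_bounded by blast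
  note CS = bilinear_Cauchy_Schwarz_L2[OF B K(2) K(1)]
  have lf: "(\<lambda>k. l2n M (\<lambda>x. f k x - F x)) \<longlonglongrightarrow> 0" and lg: "(\<lambda>k. l2n M (\<lambda>x. g k x - G x)) \<longlonglongrightarrow> 0"
    using f g L2_tendsto_iff[of M f F] L2_tendsto_iff[of M g G] by auto
  have bound: "norm ((LINT x|M. B (f k x) (g k x)) - (LINT x|M. B (F x) (G x)))
    \<le> K * (l2n M (\<lambda>x. f k x - F x) * (l2n M G + l2n M (\<lambda>x. g k x - G x)))
      + K * (l2n M F * l2n M (\<lambda>x. g k x - G x))" for k
  proof -
    have i: "integrable M (\<lambda>x. B (f k x - F x) (g k x))" "integrable M (\<lambda>x. B (F x) (g k x - G x))"
      using f g by (auto intro!: L2_bilinear_integrable[OF B] L2_diff)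
    have "(LINT x|M. B (f k x) (g k x)) - (LINT x|M. B (F x) (G x))
       = (LINT x|M. B (f k x) (g k x) - B (F x) (G x))"
      using f g by (intro Bochner_Integration.integral_diff[symmetric] L2_bilinear_integrable[OF B])
    also have "\<dots> = (LINT x|M. B (f k x - F x) (g k x) + B (F x) (g k x - G x))"
      by (simp add: diff_left diff_right)
    also have "\<dots> = (LINT x|M. B (f k x - F x) (g k x)) + (LINT x|M. B (F x) (g k x - G x))"
      using i by simp
    also have "norm \<dots> \<le> K * (l2n M (\<lambda>x. f k x - F x) * l2n M (g k)) + K * (l2n M F * l2n M (\<lambda>x. g k x - G x))"
      using f g by (intro order_trans[OF norm_triangle_ineq] add_mono CS L2_diff)
    also have "l2n M (g k) \<le> l2n M G + l2n M (\<lambda>x. g k x - G x)"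
      using l2n_triangle[OF g(2) L2_diff[OF g(1)[of k] g(2)]] by simp
    finally show ?thesis
      using K(1) by (auto simp: l2n_nonneg mult_left_mono)
  qed
  have "(\<lambda>k. K * (l2n M (\<lambda>x. f k x - F x) * (l2n M G + l2n M (\<lambda>x. g k x - G x)))
      + K * (l2n M F * l2n M (\<lambda>x. g k x - G x))) \<longlonglongrightarrow> K * (0 * (l2n M G + 0)) + K * (l2n M F * 0)"
    by (intro tendsto_intros lf lg)
  then have "(\<lambda>k. (LINT x|M. B (f k x) (g k x)) - (LINT x|M. B (F x) (G x))) \<longlonglongrightarrow> 0"
    by (intro Lim_null_comparison[OF always_eventually[OF allI[OF bound]]]) simp
  then show ?thesis by (rule LIM_zero_cancel)
qed

lemma L2_tendsto_const: "L2_tendsto M (\<lambda>_. f) f"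
  by (simp add: L2_tendsto_def)

lemma L2_tendsto_add:
  assumes f: "\<And>k. L2 M (f k)" "L2 M F" "L2_tendsto M f F"
    and g: "\<And>k. L2 M (g k)" "L2 M G" "L2_tendsto M g G"
  shows "L2_tendsto M (\<lambda>k x. f k x + g k x) (\<lambda>x. F x + G x)"
proof -
  have lf: "(\<lambda>k. l2n M (\<lambda>x. f k x - F x)) \<longlonglongrightarrow> 0" and lg: "(\<lambda>k. l2n M (\<lambda>x. g k x - G x)) \<longlonglongrightarrow> 0"
    using f g L2_tendsto_iff[of M f F] L2_tendsto_iff[of M g G] by auto
  have "(\<lambda>k. l2n M (\<lambda>x. (f k x + g k x) - (F x + G x))) \<longlonglongrightarrow> 0"
  proof (rule tendsto_sandwich[OF _ _ tendsto_const])
    show "\<forall>\<^sub>F k in sequentially. l2n M (\<lambda>x. (f k x + g k x) - (F x + G x))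
        \<le> l2n M (\<lambda>x. f k x - F x) + l2n M (\<lambda>x. g k x - G x)"
      using l2n_triangle[OF L2_diff[OF f(1) f(2)] L2_diff[OF g(1) g(2)]]
      by (simp add: algebra_simps)
    show "(\<lambda>k. l2n M (\<lambda>x. f k x - F x) + l2n M (\<lambda>x. g k x - G x)) \<longlonglongrightarrow> 0"
      using tendsto_add[OF lf lg] by simp
  qed (simp add: l2n_nonneg)
  then show ?thesis using f g by (subst L2_tendsto_iff) (auto intro: L2_add)
qed

lemma L2_tendsto_bounded_linear:
  assumes h: "bounded_linear h" and f: "\<And>k. L2 M (f k)" "L2 M F" "L2_tendsto M f F"
  shows "L2_tendsto M (\<lambda>k x. h (f k x)) (\<lambda>x. h (F x))"
proof -
  obtain C where C: "0 < C" "\<And>y. norm (h y) \<le> norm y * C"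
    using bounded_linear.pos_bounded[OF h] by blast
  have "l2n M (\<lambda>x. h (f k x) - h (F x)) \<le> C * l2n M (\<lambda>x. f k x - F x)" for k
  proof -
    have "l2n M (\<lambda>x. h (f k x) - h (F x)) \<le> l2n M (\<lambda>x. C *\<^sub>R (f k x - F x))"
      using C f by (intro l2n_mono L2_diff L2_bounded_linear[OF h] L2_scaleR)
        (auto simp: linear_diff[OF bounded_linear.linear[OF h], symmetric] mult.commute)
    also have "\<dots> = C * l2n M (\<lambda>x. f k x - F x)"
      using C by (simp add: l2n_def power_mult_distrib real_sqrt_mult)
    finally show ?thesis .
  qed
  moreover have "(\<lambda>k. C * l2n M (\<lambda>x. f k x - F x)) \<longlonglongrightarrow> 0"
    using f L2_tendsto_iff[of M f F] by (intro tendsto_mult_right_zero) auto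
  ultimately have "(\<lambda>k. l2n M (\<lambda>x. h (f k x) - h (F x))) \<longlonglongrightarrow> 0"
    by (rule tendsto_sandwich[OF always_eventually[OF allI[OF l2n_nonneg]]
          always_eventually[OF allI] tendsto_const])
  then show ?thesis
    using f L2_bounded_linear[OF h] by (subst L2_tendsto_iff) auto
qed

lemma L2_tendsto_cong_AE:
  assumes "L2_tendsto M f F" "\<And>k. AE x in M. f k x = g k x" "AE x in M. F x = G x"
  shows "L2_tendsto M g G"
proof -
  have "(\<integral>\<^sup>+x. ennreal ((norm (g k x - G x))\<^sup>2) \<partial>M) = (\<integral>\<^sup>+x. ennreal ((norm (f k x - F x))\<^sup>2) \<partial>M)" for k
    using assms(2)[of k] assms(3) by (intro nn_integral_cong_AE) auto
  then show ?thesis using assms(1) by (simp add: L2_tendsto_def)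
qed

text \<open>Completeness (Riesz--Fischer). Along a subsequence whose steps \<open>d n\<close> have norm below
  \<open>2 ^ - n\<close> the function \<open>\<Sum>n. 2 ^ n * \<bar>d n\<bar>\<^sup>2\<close> is integrable, hence finite almost everywhere, and
  where it is finite the steps decay geometrically. Fatou's lemma turns the pointwise limit into a
  limit in norm.\<close>

lemma L2_complete:
  fixes f :: "nat \<Rightarrow> 'a \<Rightarrow> 'b::euclidean_space"
  assumes f: "\<And>k. L2 M (f k)"
    and Cau: "\<And>e. e > 0 \<Longrightarrow> \<exists>N. \<forall>m\<ge>N. \<forall>n\<ge>N. l2n M (\<lambda>x. f m x - f n x) < e"
  shows "\<exists>g. L2 M g \<and> L2_tendsto M f g"
proof -
  have [measurable]: "f k \<in> borel_measurable M" for k using f by (simp add: L2_def)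
  have "\<exists>N. \<forall>m\<ge>N. \<forall>n\<ge>N. l2n M (\<lambda>x. f m x - f n x) < (1/2)^j" for j :: nat
    by (rule Cau) simp
  then obtain N where N: "\<And>j m n. m \<ge> N j \<Longrightarrow> n \<ge> N j \<Longrightarrow> l2n M (\<lambda>x. f m x - f n x) < (1/2)^j"
    by metis
  define r where "r j = j + (\<Sum>i\<le>j. N i)" for j
  have "N j \<le> (\<Sum>i\<le>k. N i)" if "j \<le> k" for j k
    using that by (intro member_le_sum) auto
  then have "N j \<le> (\<Sum>i\<le>j. N i)" "N j \<le> (\<Sum>i\<le>Suc j. N i)" for j
    by (blast intro: le_SucI)+
  then have r: "j \<le> r j" "N j \<le> r j" "N j \<le> r (Suc j)" for j
    unfolding r_def by (blast intro: le_add1 trans_le_add2)+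
  define d where "d j x = f (r (Suc j)) x - f (r j) x" for j x
  have [measurable]: "d j \<in> borel_measurable M" for j unfolding d_def by simp
  have dL2: "L2 M (d j)" for j unfolding d_def by (intro L2_diff f)
  have dn: "l2n M (d j) \<le> (1/2)^j" for j
    unfolding d_def by (rule less_imp_le[OF N]) (use r in auto)
  define G where "G x = (\<Sum>j. ennreal (2^j * (norm (d j x))\<^sup>2))" for x
  have [measurable]: "G \<in> borel_measurable M" unfolding G_def by measurable
  have "(\<integral>\<^sup>+x. G x \<partial>M) = (\<Sum>j. \<integral>\<^sup>+x. ennreal (2^j * (norm (d j x))\<^sup>2) \<partial>M)"
    unfolding G_def by (rule nn_integral_suminf) measurable
  also have "\<dots> \<le> (\<Sum>j. ennreal ((1/2)^j))"
  proof (rule suminf_le)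
    fix j
    have "(\<integral>\<^sup>+x. ennreal (2^j * (norm (d j x))\<^sup>2) \<partial>M) = ennreal (2^j) * ennreal ((l2n M (d j))\<^sup>2)"
      using dL2 by (subst nn_integral_sq_eq[OF dL2, symmetric], subst nn_integral_cmult[symmetric])
        (auto simp: ennreal_mult)
    also have "\<dots> \<le> ennreal (2^j * ((1/2)^j)\<^sup>2)"
      by (subst ennreal_mult[symmetric])
         (auto intro!: ennreal_leI mult_left_mono power_mono dn simp: l2n_nonneg)
    also have "(2::real)^j * ((1/2)^j)\<^sup>2 = (1/2)^j"
      by (simp add: power2_eq_square power_mult_distrib[symmetric])
    finally show "(\<integral>\<^sup>+x. ennreal (2^j * (norm (d j x))\<^sup>2) \<partial>M) \<le> ennreal ((1/2)^j)" .
  qed auto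
  also have "\<dots> < \<infinity>"
    by (subst suminf_ennreal2) (auto simp: summable_geometric)
  finally have "AE x in M. G x \<noteq> \<infinity>"
    by (intro nn_integral_PInf_AE) auto
  then have conv: "AE x in M. convergent (\<lambda>j. f (r j) x)"
  proof (eventually_elim)
    case (elim x)
    then obtain c where c: "G x = ennreal c" "0 \<le> c" by (cases "G x") auto
    have dle: "norm (d j x) \<le> sqrt c * (sqrt (1/2))^j" for j
    proof -
      have "ennreal (2^j * (norm (d j x))\<^sup>2) \<le> G x"
        unfolding G_def using sum_le_suminf[OF summableI, of "{j}"] by simp
      then have "2^j * (norm (d j x))\<^sup>2 \<le> c" using c by (simp add: ennreal_le_iff)
      then have "(norm (d j x))\<^sup>2 \<le> c * (1/2)^j" by (simp add: field_simps power_divide)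
      from real_sqrt_le_mono[OF this] show ?thesis
        by (simp add: real_sqrt_mult real_sqrt_power)
    qed
    have "summable (\<lambda>j. sqrt c * (sqrt (1/2))^j)"
      by (intro summable_mult summable_geometric) (simp add: real_sqrt_divide field_simps)
    then have "summable (\<lambda>j. d j x)"
      by (rule summable_comparison_test'[where N=0]) (use dle in auto)
    then have "convergent (\<lambda>n. \<Sum>j<n. d j x)" by (simp add: summable_iff_convergent)
    moreover have "(\<Sum>j<n. d j x) = f (r n) x - f (r 0) x" for n
      unfolding d_def by (rule sum_lessThan_telescope)
    ultimately show ?case by (simp add: convergent_diff_const_right_iff)
  qed
  define g where "g x = lim (\<lambda>j. f (r j) x)" for x
  have [measurable]: "g \<in> borel_measurable M" unfolding g_def by measurable
  have fg: "AE x in M. (\<lambda>j. f (r j) x) \<longlonglongrightarrow> g x"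
    using conv by eventually_elim (simp add: g_def convergent_LIMSEQ_iff)
  have key: "\<exists>K. \<forall>k\<ge>K. (\<integral>\<^sup>+x. ennreal ((norm (f k x - g x))\<^sup>2) \<partial>M) \<le> ennreal (e\<^sup>2)" if e: "e > 0" for e
  proof -
    obtain K where K: "\<And>m n. m \<ge> K \<Longrightarrow> n \<ge> K \<Longrightarrow> l2n M (\<lambda>x. f m x - f n x) < e"
      using Cau[OF e] by blast
    have "(\<integral>\<^sup>+x. ennreal ((norm (f k x - g x))\<^sup>2) \<partial>M) \<le> ennreal (e\<^sup>2)" if k: "k \<ge> K" for k
    proof -
      have "(\<integral>\<^sup>+x. ennreal ((norm (f k x - g x))\<^sup>2) \<partial>M)
          = (\<integral>\<^sup>+x. liminf (\<lambda>j. ennreal ((norm (f k x - f (r j) x))\<^sup>2)) \<partial>M)"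
      proof (rule nn_integral_cong_AE)
        show "AE x in M. ennreal ((norm (f k x - g x))\<^sup>2) = liminf (\<lambda>j. ennreal ((norm (f k x - f (r j) x))\<^sup>2))"
          using fg
        proof eventually_elim
          case (elim x)
          then have "(\<lambda>j. ennreal ((norm (f k x - f (r j) x))\<^sup>2)) \<longlonglongrightarrow> ennreal ((norm (f k x - g x))\<^sup>2)"
            by (intro tendsto_intros tendsto_ennrealI)
          from lim_imp_Liminf[OF _ this] show ?case by simp
        qed
      qed
      also have "\<dots> \<le> liminf (\<lambda>j. \<integral>\<^sup>+x. ennreal ((norm (f k x - f (r j) x))\<^sup>2) \<partial>M)"
        by (rule nn_integral_liminf) measurable
      also have "\<dots> \<le> ennreal (e\<^sup>2)"
      proof (rule order_trans[OF Liminf_le_Limsup Limsup_bounded])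
        show "\<forall>\<^sub>F j in sequentially. (\<integral>\<^sup>+x. ennreal ((norm (f k x - f (r j) x))\<^sup>2) \<partial>M) \<le> ennreal (e\<^sup>2)"
          using eventually_ge_at_top[of K]
        proof eventually_elim
          case (elim j)
          then have "l2n M (\<lambda>x. f k x - f (r j) x) \<le> e"
            using K[OF k, of "r j"] r(1)[of j] by auto
          then show ?case
            by (subst nn_integral_sq_eq[OF L2_diff[OF f f]]) (auto intro!: ennreal_leI power_mono simp: l2n_nonneg)
        qed
      qed auto
      finally show ?thesis .
    qed
    then show ?thesis by blast
  qed
  obtain K where K: "\<forall>k\<ge>K. (\<integral>\<^sup>+x. ennreal ((norm (f k x - g x))\<^sup>2) \<partial>M) \<le> ennreal (1\<^sup>2)"
    using key[of 1] by auto
  have "L2 M (\<lambda>x. f K x - g x)"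
    using K[rule_format, of K]
    by (auto simp: L2_def integrable_iff_bounded power2_norm_eq_inner intro: le_less_trans)
  from L2_diff[OF f[of K] this] have g: "L2 M g" by simp
  have "L2_tendsto M f g"
    unfolding L2_tendsto_iff[OF f g]
  proof (rule LIMSEQ_I)
    fix e :: real assume "e > 0"
    obtain K where K: "\<forall>k\<ge>K. (\<integral>\<^sup>+x. ennreal ((norm (f k x - g x))\<^sup>2) \<partial>M) \<le> ennreal ((e/2)\<^sup>2)"
      using key[of "e/2"] \<open>e > 0\<close> by auto
    have "l2n M (\<lambda>x. f k x - g x) < e" if "k \<ge> K" for k
    proof -
      have "(l2n M (\<lambda>x. f k x - g x))\<^sup>2 \<le> (e/2)\<^sup>2"
        using K[rule_format, OF that, unfolded nn_integral_sq_eq[OF L2_diff[OF f[of k] g]]]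
        by (rule ennreal_le_iff[THEN iffD1, rotated]) (rule zero_le_power2)
      then have "l2n M (\<lambda>x. f k x - g x) \<le> e/2"
        by (rule power2_le_imp_le) (use \<open>e > 0\<close> in simp)
      then show ?thesis using \<open>e > 0\<close> by simp
    qed
    then show "\<exists>K. \<forall>k\<ge>K. norm (l2n M (\<lambda>x. f k x - g x) - 0) < e"
      by (auto simp: l2n_nonneg)
  qed
  with g show ?thesis by blast
qed

section \<open>The Riesz representation on closed subspaces of square-integrable functions\<close>

text \<open>The solution is the minimiser over \<open>V\<close> of \<open>J f = \<integral> A f f - 2 \<integral> h \<bullet> f\<close>. The parallelogram identity
  makes minimising sequences Cauchy, and the first variation of \<open>J\<close> at the minimiser is the
  asserted identity.\<close>

lemma Riesz_on_L2_subspace: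
  fixes A :: "'e::euclidean_space \<Rightarrow> 'e \<Rightarrow> real" and V :: "('a \<Rightarrow> 'e) set"
  assumes V: "\<And>f. f \<in> V \<Longrightarrow> L2 M f" and zero: "(\<lambda>_. 0) \<in> V"
    and lin: "\<And>f g c. f \<in> V \<Longrightarrow> g \<in> V \<Longrightarrow> (\<lambda>x. f x + c *\<^sub>R g x) \<in> V"
    and closed: "\<And>f F. (\<And>k. f k \<in> V) \<Longrightarrow> L2 M F \<Longrightarrow> L2_tendsto M f F \<Longrightarrow> F \<in> V"
    and A: "bounded_bilinear A" and sym: "\<And>a b. A a b = A b a"
    and coercive: "\<And>f. f \<in> V \<Longrightarrow> (l2n M f)\<^sup>2 \<le> C * (LINT x|M. A (f x) (f x))" and C: "0 < C"
    and h: "L2 M h"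
  shows "\<exists>f\<in>V. \<forall>g\<in>V. (LINT x|M. A (f x) (g x)) = (LINT x|M. h x \<bullet> g x)"
proof -
  interpret A: bounded_bilinear A by fact
  define a where "a f g = (LINT x|M. A (f x) (g x))" for f g
  define l where "l g = (LINT x|M. h x \<bullet> g x)" for g
  define J where "J f = a f f - 2 * l f" for f
  have J_line: "J (\<lambda>x. f x + c *\<^sub>R g x) = J f + 2 * c * (a f g - l g) + c\<^sup>2 * a g g"
    if "L2 M f" "L2 M g" for f g c
  proof -
    have i: "integrable M (\<lambda>x. A (f x) (f x))" "integrable M (\<lambda>x. A (f x) (g x))"
        "integrable M (\<lambda>x. A (g x) (g x))"
      and j: "integrable M (\<lambda>x. h x \<bullet> f x)" "integrable M (\<lambda>x. h x \<bullet> g x)"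
      using that h by (auto intro: L2_bilinear_integrable[OF A] L2_inner_integrable)
    have "A (f x + c *\<^sub>R g x) (f x + c *\<^sub>R g x)
        = A (f x) (f x) + 2 * c * A (f x) (g x) + c\<^sup>2 * A (g x) (g x)" for x
      by (simp add: A.add_left A.add_right A.scaleR_left A.scaleR_right sym[of "g x" "f x"] power2_eq_square
          algebra_simps)
    then have "a (\<lambda>x. f x + c *\<^sub>R g x) (\<lambda>x. f x + c *\<^sub>R g x) = a f f + 2 * c * a f g + c\<^sup>2 * a g g"
      unfolding a_def using i by simp
    moreover have "l (\<lambda>x. f x + c *\<^sub>R g x) = l f + c * l g"
      unfolding l_def using j by (simp add: inner_add_right)
    ultimately show ?thesis by (simp add: J_def algebra_simps)
  qed
  have J_lower: "- C * (l2n M h)\<^sup>2 \<le> J f" if "f \<in> V" for f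
  proof -
    have "l f \<le> l2n M h * l2n M f"
      using bilinear_Cauchy_Schwarz_L2[OF bounded_bilinear_inner, of 1 M h f] h V[OF that]
      by (auto simp: l_def Cauchy_Schwarz_ineq2)
    moreover have "(l2n M f)\<^sup>2 / C \<le> a f f"
      using coercive[OF that] C by (simp add: a_def field_simps)
    moreover have "0 \<le> (l2n M f - C * l2n M h)\<^sup>2 / C" using C by simp
    moreover have "(l2n M f - C * l2n M h)\<^sup>2 / C = (l2n M f)\<^sup>2 / C - 2 * (l2n M h * l2n M f) + C * (l2n M h)\<^sup>2"
      using C by (simp add: field_simps power2_eq_square)
    ultimately show ?thesis by (simp add: J_def)
  qed
  define m where "m = Inf (J ` V)"
  have bdd: "bdd_below (J ` V)" using J_lower by (intro bdd_belowI2)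
  have m_le: "m \<le> J f" if "f \<in> V" for f
    unfolding m_def using bdd that by (intro cINF_lower)
  have "\<exists>f\<in>V. J f < m + 1 / Suc k" for k
  proof -
    have "m < m + 1 / Suc k" by simp
    then show ?thesis unfolding m_def using bdd zero by (subst (asm) cINF_less_iff) auto
  qed
  then obtain f where f: "\<And>k. f k \<in> V" "\<And>k. J (f k) < m + 1 / Suc k" by metis
  have dist: "(l2n M (\<lambda>x. f j x - f k x))\<^sup>2 \<le> C * (2 * (1 / Suc j + 1 / Suc k))" for j k
  proof -
    define d where "d = (\<lambda>x. f j x + (-1) *\<^sub>R f k x)"
    have d: "d \<in> V" unfolding d_def by (intro lin f)
    have "J (f j) = J (\<lambda>x. f k x + 1 *\<^sub>R d x)" by (simp add: d_def)
    also have "\<dots> = J (f k) + 2 * (a (f k) d - l d) + a d d"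
      by (subst J_line) (auto intro: V f d)
    finally have 1: "J (f j) = J (f k) + 2 * (a (f k) d - l d) + a d d" .
    have "m \<le> J (\<lambda>x. f k x + (1/2) *\<^sub>R d x)" by (intro m_le lin f d)
    also have "\<dots> = J (f k) + (a (f k) d - l d) + a d d / 4"
      by (subst J_line) (auto intro: V f d simp: power2_eq_square)
    finally have "a d d \<le> 2 * (J (f j) + J (f k) - 2 * m)" using 1 by simp
    also have "\<dots> \<le> 2 * (1 / Suc j + 1 / Suc k)" using f(2)[of j] f(2)[of k] by simp
    finally have "C * a d d \<le> C * (2 * (1 / Suc j + 1 / Suc k))" using C by (intro mult_left_mono) auto
    with coercive[OF d] show ?thesis by (simp add: d_def a_def)
  qed
  have "\<exists>F. L2 M F \<and> L2_tendsto M f F"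
  proof (rule L2_complete)
    fix e :: real assume e: "e > 0"
    obtain N where N: "4 * C / e\<^sup>2 < real N" using reals_Archimedean2 by blast
    have "l2n M (\<lambda>x. f j x - f k x) < e" if "j \<ge> N" "k \<ge> N" for j k
    proof (rule power2_less_imp_less)
      have N0: "0 < real N" using N C e by (smt (verit) divide_nonneg_pos zero_less_power)
      have "1 / real (Suc j) \<le> 1 / real N" "1 / real (Suc k) \<le> 1 / real N"
        using N0 that by (auto intro!: divide_left_mono)
      then have "C * (2 * (1 / Suc j + 1 / Suc k)) \<le> C * (2 * (1 / N + 1 / N))"
        using C by (intro mult_left_mono) linarith+
      also have "\<dots> < e\<^sup>2" using N N0 e by (simp add: field_simps)
      finally show "(l2n M (\<lambda>x. f j x - f k x))\<^sup>2 < e\<^sup>2" using dist[of j k] by simp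
    qed (use e in simp)
    then show "\<exists>N. \<forall>j\<ge>N. \<forall>k\<ge>N. l2n M (\<lambda>x. f j x - f k x) < e" by blast
  qed (rule V[OF f(1)])
  then obtain F where F: "L2 M F" "L2_tendsto M f F" by blast
  have FV: "F \<in> V" by (rule closed[OF f(1) F])
  note VL = V[OF f(1)]
  have "(\<lambda>k. J (f k)) \<longlonglongrightarrow> J F"
    unfolding J_def a_def l_def
    by (intro tendsto_intros L2_tendsto_bilinear[OF A] L2_tendsto_bilinear[OF bounded_bilinear_inner]
        VL F L2_tendsto_const h)
  moreover have "(\<lambda>k. m + 1 / Suc k) \<longlonglongrightarrow> m + 0"
    by (intro tendsto_intros LIMSEQ_Suc[OF lim_const_over_n])
  ultimately have JF: "J F \<le> m"
    using f(2) by (intro LIMSEQ_le[of "\<lambda>k. J (f k)" _ "\<lambda>k. m + 1 / Suc k"]) (auto intro: less_imp_le)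
  have "a F g = l g" if g: "g \<in> V" for g
  proof (rule ccontr)
    assume ne: "a F g \<noteq> l g"
    define b q where "b = a F g - l g" and "q = a g g"
    have q: "0 \<le> q"
      using order_trans[OF zero_le_power2 coercive[OF g]] C by (simp add: q_def a_def zero_le_mult_iff)
    \<comment> \<open>The optimal step is \<open>- b / q\<close>; adding \<open>1\<close> admits
      \<open>q = 0\<close> and still decreases \<open>J\<close>.\<close>
    define c where "c = - b / (q + 1)"
    have "m \<le> J (\<lambda>x. F x + c *\<^sub>R g x)" by (intro m_le lin FV g)
    also have "\<dots> = J F + 2 * c * b + c\<^sup>2 * q"
      by (subst J_line) (auto intro: V FV g simp: b_def q_def)
    finally have "0 \<le> 2 * c * b + c\<^sup>2 * q" using JF by simp
    moreover have "2 * c * b + c\<^sup>2 * q = - (b\<^sup>2 * (q + 2)) / (q + 1)\<^sup>2"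
    proof -
      have "2 * (- b / s) * b + (- b / s)\<^sup>2 * (s - 1) = - (b\<^sup>2 * (s + 1)) / s\<^sup>2" if "0 < s" for s
        using that by (simp add: field_simps power2_eq_square)
      from this[of "q + 1"] q show ?thesis by (simp add: c_def add.assoc)
    qed
    moreover have "b\<^sup>2 * (q + 2) > 0" using ne q by (simp add: b_def)
    ultimately show False using q
      by (smt (verit) divide_less_0_iff zero_less_power)
  qed
  then show ?thesis using FV unfolding a_def l_def by blast
qed

section \<open>Smooth functions\<close>

lemma partial_eq: "(f has_derivative D) (at x) \<Longrightarrow> partial i f x = D (axis i 1)"
  unfolding partial_def by (metis frechet_derivative_at)

lemma frechet_derivative_worksI:
  "f differentiable (at x) \<Longrightarrow> (f has_derivative frechet_derivative f (at x)) (at x)"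
  using frechet_derivative_works by blast

lemma Ck_Suc_imp: "Ck (Suc k) f \<Longrightarrow> Ck k f"
proof (induction k arbitrary: f)
  case 0
  then show ?case
    by (auto intro!: continuous_at_imp_continuous_on differentiable_imp_continuous_within)
qed (metis Ck.simps(2))

lemma smooth_continuous: "smooth f \<Longrightarrow> continuous_on UNIV f"
  unfolding smooth_def by (metis Ck.simps(1))

lemma smooth_differentiable: "smooth f \<Longrightarrow> f differentiable (at x)"
  unfolding smooth_def by (metis Ck.simps(2))

lemma smooth_partial: "smooth f \<Longrightarrow> smooth (partial i f)"
  unfolding smooth_def by (metis Ck.simps(2))

lemma partial_const: "partial i (\<lambda>_. c) = (\<lambda>_. 0)"
  using partial_eq[OF has_derivative_const] by (auto simp: fun_eq_iff)

lemma Ck_const: "Ck k (\<lambda>_. c)"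
  by (induction k arbitrary: c) (auto simp: partial_const)

lemma partial_add:
  assumes "f differentiable (at x)" "g differentiable (at x)"
  shows "partial i (\<lambda>x. f x + g x) x = partial i f x + partial i g x"
  using partial_eq[OF has_derivative_add[OF assms[THEN frechet_derivative_worksI]], of i]
  by (simp only: partial_def)

lemma partial_mult:
  assumes "f differentiable (at x)" "g differentiable (at x)"
  shows "partial i (\<lambda>x. f x * g x) x = f x * partial i g x + partial i f x * g x"
  using partial_eq[OF has_derivative_mult[OF assms[THEN frechet_derivative_worksI]], of i]
  by (simp only: partial_def)

lemma Ck_add: "Ck k f \<Longrightarrow> Ck k g \<Longrightarrow> Ck k (\<lambda>x. f x + g x)"
proof (induction k arbitrary: f g)
  case (Suc k)
  then have d: "f differentiable (at x)" "g differentiable (at x)" for x by auto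
  then have "partial i (\<lambda>x. f x + g x) = (\<lambda>x. partial i f x + partial i g x)" for i
    by (auto simp: fun_eq_iff partial_add)
  then show ?case using Suc d by simp
qed (auto intro: continuous_intros)

lemma Ck_mult: "Ck k f \<Longrightarrow> Ck k g \<Longrightarrow> Ck k (\<lambda>x. f x * g x)"
proof (induction k arbitrary: f g)
  case (Suc k)
  then have d: "f differentiable (at x)" "g differentiable (at x)" for x by auto
  then have "partial i (\<lambda>x. f x * g x) = (\<lambda>x. f x * partial i g x + partial i f x * g x)" for i
    by (auto simp: fun_eq_iff partial_mult)
  moreover have "Ck k f" "Ck k g" using Suc.prems by (auto dest: Ck_Suc_imp simp del: Ck.simps)
  moreover have "Ck k (partial i f)" "Ck k (partial i g)" for i using Suc.prems by auto
  ultimately show ?case using Suc.IH d by (simp add: Ck_add)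
qed (auto intro: continuous_intros)

lemma smooth_const: "smooth (\<lambda>_. c)"
  by (simp add: smooth_def Ck_const)

lemma smooth_add: "smooth f \<Longrightarrow> smooth g \<Longrightarrow> smooth (\<lambda>x. f x + g x)"
  by (simp add: smooth_def Ck_add)

lemma smooth_mult: "smooth f \<Longrightarrow> smooth g \<Longrightarrow> smooth (\<lambda>x. f x * g x)"
  by (simp add: smooth_def Ck_mult)

lemma smooth_cmult: "smooth f \<Longrightarrow> smooth (\<lambda>x. c * f x)"
  using smooth_mult[OF smooth_const] .

lemma smooth_prod: "(\<And>i. i \<in> I \<Longrightarrow> smooth (f i)) \<Longrightarrow> smooth (\<lambda>x. \<Prod>i\<in>I. f i x)"
  by (induction I rule: infinite_finite_induct) (auto intro: smooth_const smooth_mult)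

lemma partial_ridge:
  assumes "\<And>t. (h has_real_derivative h' t) (at t)"
  shows "((\<lambda>x. h (a \<bullet> x + b)) has_derivative (\<lambda>y. h' (a \<bullet> x + b) * (a \<bullet> y))) (at x)"
    and "partial i (\<lambda>x. h (a \<bullet> x + b)) x = a $ i * h' (a \<bullet> x + b)"
proof -
  have "((\<lambda>x. a \<bullet> x + b) has_derivative (\<lambda>y. a \<bullet> y)) (at x)"
    by (auto intro!: derivative_eq_intros)
  from has_derivative_compose[OF this assms[unfolded has_field_derivative_def]]
  show *: "((\<lambda>x. h (a \<bullet> x + b)) has_derivative (\<lambda>y. h' (a \<bullet> x + b) * (a \<bullet> y))) (at x)" .
  show "partial i (\<lambda>x. h (a \<bullet> x + b)) x = a $ i * h' (a \<bullet> x + b)"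
    by (simp add: partial_eq[OF *] inner_axis)
qed

text \<open>A family of functions of one real variable that is closed under differentiation
  consists of smooth functions; composed with an affine functional they stay smooth.\<close>

lemma smooth_ridge:
  fixes a :: "real^'n::finite"
  assumes S: "\<And>h. h \<in> S \<Longrightarrow> \<exists>h'\<in>S. \<forall>t. (h has_real_derivative h' t) (at t)" and h: "h \<in> S"
  shows "smooth (\<lambda>x. h (a \<bullet> x + b))"
proof -
  have "Ck k (\<lambda>x. h (a \<bullet> x + b))" if "h \<in> S" for k h
    using that
  proof (induction k arbitrary: h)
    case 0
    obtain h' where "\<And>t. (h has_real_derivative h' t) (at t)" using S[OF 0] by blast
    then have "continuous_on UNIV h" by (meson DERIV_isCont continuous_at_imp_continuous_on)
    then show ?case by (auto intro!: continuous_intros continuous_on_compose2[of UNIV h])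
  next
    case (Suc k)
    obtain h' where h': "h' \<in> S" "\<And>t. (h has_real_derivative h' t) (at t)" using S[OF Suc.prems] by blast
    have "partial i (\<lambda>x. h (a \<bullet> x + b)) = (\<lambda>x. a $ i * h' (a \<bullet> x + b))" for i
      by (auto simp: fun_eq_iff partial_ridge(2)[OF h'(2)])
    moreover have "(\<lambda>x. h (a \<bullet> x + b)) differentiable (at x)" for x
      using partial_ridge(1)[OF h'(2)] by (auto simp: differentiable_def)
    ultimately show ?case using Ck_mult[OF Ck_const Suc.IH[OF h'(1)]] by simp
  qed
  then show ?thesis using h by (simp add: smooth_def)
qed

definition flat_exp :: "real \<Rightarrow> real" where
  "flat_exp t = (if t > 0 then exp (- (1 / t)) else 0)"

text \<open>The functions that vanish for \<open>t \<le> 0\<close> and equal \<open>p (1/t) * exp (- 1/t)\<close>, \<open>p\<close> a polynomial, for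
  \<open>t > 0\<close> are closed under differentiation, since the exponential beats every polynomial.\<close>

lemma smooth_flat_exp:
  fixes a :: "real^'n::finite"
  shows "smooth (\<lambda>x. flat_exp (a \<bullet> x + b))"
proof -
  define E where "E p t = (if t > 0 then poly p (1 / t) * exp (- (1 / t)) else 0)" for p and t :: real
  define S where "S = range E"
  have "\<exists>h'\<in>S. \<forall>t. (h has_real_derivative h' t) (at t)" if h: "h \<in> S" for h
  proof -
    obtain p where p: "h = E p" using h by (auto simp: S_def)
    \<comment> \<open>The derivative of \<open>p (1/t) * exp (- 1/t)\<close> is \<open>(p (1/t) -
      p' (1/t)) / t\<^sup>2 * exp (- 1/t)\<close>.\<close>
    define q where "q = (p - pderiv p) * [:0, 0, 1:]"
    have "(E p has_real_derivative E q t) (at t)" for t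
    proof -
      consider "t > 0" | "t < 0" | "t = 0" by linarith
      then show ?thesis
      proof cases
        case 1
        have "((\<lambda>t. poly p (1 / t) * exp (- (1 / t))) has_real_derivative E q t) (at t)"
          using 1 by (auto intro!: derivative_eq_intros DERIV_chain2[OF poly_DERIV]
              simp: E_def q_def field_simps)
        then show ?thesis
        proof (rule has_field_derivative_transform_within_open[where S="{0<..}"])
        qed (use 1 in \<open>auto simp: E_def\<close>)
      next
        case 2
        have "((\<lambda>_. 0) has_real_derivative E q t) (at t)"
          using 2 by (auto simp: E_def)
        then show ?thesis
        proof (rule has_field_derivative_transform_within_open[where S="{..<0}"])
        qed (use 2 in \<open>auto simp: E_def\<close>)
      next
        case 3
        have "((\<lambda>s. \<Sum>i\<le>degree r. coeff r i * (s ^ i / exp s)) \<longlongrightarrow> (\<Sum>i\<le>degree r. coeff r i * 0)) at_top"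
          for r :: "real poly"
          by (intro tendsto_sum tendsto_mult tendsto_const tendsto_power_div_exp_0)
        then have lim: "((\<lambda>s. poly r s / exp s) \<longlongrightarrow> 0) at_top" for r :: "real poly"
          by (simp add: poly_altdef sum_divide_distrib)
        have "((\<lambda>h. poly (pCons 0 p) (inverse h) / exp (inverse h)) \<longlongrightarrow> 0) (at_right 0)"
          by (rule filterlim_compose[OF lim filterlim_inverse_at_top_right])
        then have "((\<lambda>h. (E p (0 + h) - E p 0) / h) \<longlongrightarrow> 0) (at_right 0)"
          by (rule Lim_transform_eventually)
             (auto simp: eventually_at_filter E_def exp_minus field_simps)
        moreover have "((\<lambda>h. (E p (0 + h) - E p 0) / h) \<longlongrightarrow> 0) (at_left 0)"
          by (rule Lim_transform_eventually[OF tendsto_const]) (auto simp: eventually_at_filter E_def)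
        ultimately show ?thesis
          using 3 by (simp add: DERIV_def filterlim_split_at E_def)
      qed
    qed
    then show ?thesis using p by (auto simp: S_def)
  qed
  moreover have "flat_exp \<in> S"
    unfolding S_def by (rule image_eqI[where x="[:1:]"]) (auto simp: flat_exp_def E_def fun_eq_iff)
  ultimately show ?thesis by (rule smooth_ridge)
qed

lemma smooth_trig:
  fixes a :: "real^'n::finite"
  shows "smooth (\<lambda>x. cos (a \<bullet> x))" "smooth (\<lambda>x. sin (a \<bullet> x))"
proof -
  define S where "S = {\<lambda>t::real. c * cos t + d * sin t | c d. True}"
  have step: "\<exists>h'\<in>S. \<forall>t. (h has_real_derivative h' t) (at t)" if hS: "h \<in> S" for h
  proof -
    obtain c d where h: "h = (\<lambda>t. c * cos t + d * sin t)" using hS by (auto simp: S_def)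
    have "(\<lambda>t. d * cos t + (- c) * sin t) \<in> S" unfolding S_def by blast
    moreover have "\<forall>t. (h has_real_derivative d * cos t + (- c) * sin t) (at t)"
      unfolding h by (auto intro!: derivative_eq_intros)
    ultimately show ?thesis by - (rule bexI[where x="\<lambda>t. d * cos t + (- c) * sin t"])
  qed
  have ridge: "smooth (\<lambda>x. h (a \<bullet> x + 0))" if "h \<in> S" for h
    by (rule smooth_ridge[OF step that])
  have "(\<lambda>t. 1 * cos t + 0 * sin t) \<in> S" "(\<lambda>t. 0 * cos t + 1 * sin t) \<in> S" unfolding S_def by blast+
  from this[THEN ridge] show "smooth (\<lambda>x. cos (a \<bullet> x))" "smooth (\<lambda>x. sin (a \<bullet> x))"
    by simp_all
qed

lemma partial_cos: "partial i (\<lambda>x. cos (a \<bullet> x)) x = - (a $ i) * sin (a \<bullet> x)"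
  and partial_sin: "partial i (\<lambda>x. sin (a \<bullet> x)) x = a $ i * cos (a \<bullet> x)"
  using partial_ridge(2)[of cos "\<lambda>t. - sin t" i a 0 x] partial_ridge(2)[of sin cos i a 0 x]
  by (auto intro!: derivative_eq_intros)

subsection \<open>Test functions\<close>

definition box_bump :: "real^'n \<Rightarrow> real^'n \<Rightarrow> real^'n::finite \<Rightarrow> real" where
  "box_bump a b x = (\<Prod>i\<in>UNIV. flat_exp (x $ i - a $ i) * flat_exp (b $ i - x $ i))"

lemma smooth_box_bump: "smooth (box_bump a b)"
proof -
  have "smooth (\<lambda>x. flat_exp (axis i 1 \<bullet> x + - a $ i) * flat_exp (axis i (-1) \<bullet> x + b $ i))" for i
    by (intro smooth_mult smooth_flat_exp)
  then have "smooth (\<lambda>x. \<Prod>i\<in>UNIV. flat_exp (axis i 1 \<bullet> x + - a $ i) * flat_exp (axis i (-1) \<bullet> x + b $ i))"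
    by (intro smooth_prod)
  then show ?thesis
    by (simp add: box_bump_def[abs_def] inner_axis' algebra_simps)
qed

lemma box_bump_pos_iff: "box_bump a b x \<noteq> 0 \<longleftrightarrow> x \<in> box a b"
  unfolding box_bump_def mem_box_cart by (auto simp: flat_exp_def)

lemma smooth_mult_test_fun:
  assumes "test_fun \<Omega> \<phi>" "smooth f" shows "test_fun \<Omega> (\<lambda>x. f x * \<phi> x)"
proof -
  have sub: "closure {x. f x * \<phi> x \<noteq> 0} \<subseteq> closure {x. \<phi> x \<noteq> 0}"
    by (rule closure_mono) auto
  show ?thesis
    using assms sub bounded_subset[OF compact_imp_bounded sub] unfolding test_fun_def
    by (auto intro: smooth_mult simp: compact_eq_bounded_closed)
qed

lemma test_fun_box_bump: "cbox a b \<subseteq> \<Omega> \<Longrightarrow> test_fun \<Omega> (box_bump a b)"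
proof -
  assume ab: "cbox a b \<subseteq> \<Omega>"
  have "closure (box a b) \<subseteq> cbox a b"
    by (simp add: box_subset_cbox closure_minimal closed_cbox)
  then show ?thesis
    using ab unfolding test_fun_def box_bump_pos_iff
    by (auto intro: smooth_box_bump bounded_subset[OF bounded_cbox] simp: compact_eq_bounded_closed)
qed

lemma test_fun_outside:
  assumes "test_fun \<Omega> \<phi>" "x \<notin> closure {x. \<phi> x \<noteq> 0}"
  shows "\<phi> x = 0" and "partial i \<phi> x = 0"
proof -
  have zero: "\<phi> y = 0" if "y \<notin> closure {x. \<phi> x \<noteq> 0}" for y
    using that closure_subset[of "{x. \<phi> x \<noteq> 0}"] by auto
  show "\<phi> x = 0" using zero[of x] assms(2) by blast
  have "(\<phi> has_derivative (\<lambda>_. 0)) (at x)"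
    by (rule has_derivative_transform_within_open[where f="\<lambda>_. 0" and s="- closure {x. \<phi> x \<noteq> 0}"])
       (use assms(2) in \<open>auto simp only: open_Compl closed_closure Compl_iff intro: has_derivative_const zero[symmetric]\<close>)
  then show "partial i \<phi> x = 0" by (simp add: partial_eq)
qed

section \<open>Integration by parts\<close>

lemma lebesgue_on_integral_borel:
  fixes f :: "'a::euclidean_space \<Rightarrow> 'b::{banach, second_countable_topology}"
  assumes "\<Omega> \<in> sets borel" "f \<in> borel_measurable borel"
  shows "(LINT x|lebesgue_on \<Omega>. f x) = (LINT x|lborel. indicator \<Omega> x *\<^sub>R f x)"
  using assms by (subst integral_restrict_space) (auto intro!: integral_completion borel_measurable_scaleR)

lemma integrable_continuous_compact_support:
  fixes f :: "'a::euclidean_space \<Rightarrow> real"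
  assumes "continuous_on UNIV f" "\<And>x. r < norm x \<Longrightarrow> f x = 0"
  shows "integrable lborel f"
proof -
  have "integrable lborel (\<lambda>x. indicator (cball 0 r) x *\<^sub>R f x)"
    using assms(1) by (intro borel_integrable_compact) (auto intro: continuous_on_subset)
  also have "(\<lambda>x. indicator (cball 0 r) x *\<^sub>R f x) = f"
    using assms(2) by (force simp: fun_eq_iff indicator_def)
  finally show ?thesis .
qed

lemma DERIV_along_axis:
  assumes "f differentiable (at (x + t *\<^sub>R axis i 1))"
  shows "((\<lambda>t. f (x + t *\<^sub>R axis i 1)) has_real_derivative partial i f (x + t *\<^sub>R axis i 1)) (at t)"
proof -
  let ?D = "frechet_derivative f (at (x + t *\<^sub>R axis i 1))"
  have D: "(f has_derivative ?D) (at (x + t *\<^sub>R axis i 1))"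
    using assms frechet_derivative_works by blast
  have "((\<lambda>t. x + t *\<^sub>R axis i 1) has_derivative (\<lambda>t. t *\<^sub>R axis i 1)) (at t)"
    by (auto intro!: derivative_eq_intros)
  from has_derivative_compose[OF this D] linear_scale[OF has_derivative_linear[OF D]]
  show ?thesis
    by (simp add: has_field_derivative_def partial_def mult.commute[of _ "?D (axis i 1)"])
qed

text \<open>A discrete product rule: a translation moves the difference quotient from
  \<open>f\<close> to \<open>\<eta>\<close>, so that Lipschitz cut-off functions can take the
  place of \<open>\<eta>\<close>.\<close>

lemma difference_quotient_limit:
  fixes f \<eta> :: "real^'n::finite \<Rightarrow> real"
  assumes f: "\<And>x. f differentiable (at x)" "continuous_on UNIV (partial i f)"
    and \<eta>: "continuous_on UNIV \<eta>" "\<And>x. r < norm x \<Longrightarrow> \<eta> x = 0"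
  shows "(\<lambda>n. LINT x|lborel. f x * ((\<eta> (x - (1 / Suc n) *\<^sub>R axis i 1) - \<eta> x) / (1 / Suc n)))
           \<longlonglongrightarrow> (LINT x|lborel. partial i f x * \<eta> x)"
proof -
  define e where "e = (axis i 1 :: real^'n)"
  have e: "norm e = 1" by (simp add: e_def)
  have fc: "continuous_on UNIV f"
    using f(1) by (intro continuous_at_imp_continuous_on) (auto intro: differentiable_imp_continuous_within)
  have move: "(LINT x|lborel. f x * ((\<eta> (x - s *\<^sub>R e) - \<eta> x) / s))
      = (LINT x|lborel. (f (x + s *\<^sub>R e) - f x) / s * \<eta> x)" if s: "0 < s" for s
  proof -
    have i1: "integrable lborel (\<lambda>x. f (x + s *\<^sub>R e) * \<eta> x)" "integrable lborel (\<lambda>x. f x * \<eta> x)"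
      by (rule integrable_continuous_compact_support[where r=r];
          auto intro!: continuous_intros continuous_on_compose2[OF fc] fc \<eta>)+
    have i2: "integrable lborel (\<lambda>x. f x * \<eta> (x - s *\<^sub>R e))"
    proof (rule integrable_continuous_compact_support[where r="r + s"])
      show "continuous_on UNIV (\<lambda>x. f x * \<eta> (x - s *\<^sub>R e))"
        by (auto intro!: continuous_intros continuous_on_compose2[OF \<eta>(1)] fc)
      fix x :: "real^'n" assume "r + s < norm x"
      moreover have "norm x \<le> norm (x - s *\<^sub>R e) + s"
        using norm_triangle_ineq[of "x - s *\<^sub>R e" "s *\<^sub>R e"] e s by simp
      ultimately show "f x * \<eta> (x - s *\<^sub>R e) = 0" using \<eta>(2) by simp
    qed
    have "(LINT x|lborel. f x * \<eta> (x - s *\<^sub>R e)) = (LINT x|distr lborel borel ((+) (s *\<^sub>R e)). f x * \<eta> (x - s *\<^sub>R e))"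
      by (simp add: lborel_distr_plus)
    also have "\<dots> = (LINT x|lborel. f (s *\<^sub>R e + x) * \<eta> (s *\<^sub>R e + x - s *\<^sub>R e))"
      using borel_measurable_integrable[OF i2] by (subst integral_distr) auto
    finally have "(LINT x|lborel. f x * \<eta> (x - s *\<^sub>R e)) = (LINT x|lborel. f (x + s *\<^sub>R e) * \<eta> x)"
      by (simp add: add.commute)
    moreover have "(LINT x|lborel. f x * ((\<eta> (x - s *\<^sub>R e) - \<eta> x) / s))
        = ((LINT x|lborel. f x * \<eta> (x - s *\<^sub>R e)) - (LINT x|lborel. f x * \<eta> x)) / s"
      using i1 i2 by (simp add: right_diff_distrib)
    moreover have "(LINT x|lborel. (f (x + s *\<^sub>R e) - f x) / s * \<eta> x)
        = ((LINT x|lborel. f (x + s *\<^sub>R e) * \<eta> x) - (LINT x|lborel. f x * \<eta> x)) / s"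
      using i1 i2 by (simp add: left_diff_distrib)
    ultimately show ?thesis by (simp only:)
  qed
  have "compact (partial i f ` cball 0 (r + 1))"
    using f(2) by (intro compact_continuous_image) (auto intro: continuous_on_subset)
  then obtain K where "\<forall>y\<in>partial i f ` cball 0 (r + 1). norm y \<le> K"
    using compact_imp_bounded bounded_iff by blast
  then have K: "\<bar>partial i f x\<bar> \<le> K" if "norm x \<le> r + 1" for x
    using that by auto
  have quot: "\<bar>(f (x + s *\<^sub>R e) - f x) / s\<bar> \<le> K" if "norm x \<le> r" "0 < s" "s \<le> 1" for x s
  proof -
    have "\<exists>z>0. z < s \<and> f (x + s *\<^sub>R e) - f (x + 0 *\<^sub>R e) = (s - 0) * partial i f (x + z *\<^sub>R e)"
      unfolding e_def using that(2) by (intro MVT2 DERIV_along_axis f)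
    then obtain z where z: "0 < z" "z < s" "f (x + s *\<^sub>R e) - f x = s * partial i f (x + z *\<^sub>R e)" by auto
    have "norm (x + z *\<^sub>R e) \<le> r + 1"
      using norm_triangle_ineq[of x "z *\<^sub>R e"] e z that by simp
    from K[OF this] show ?thesis using z that by simp
  qed
  have "(\<lambda>n. LINT x|lborel. (f (x + (1 / Suc n) *\<^sub>R e) - f x) / (1 / Suc n) * \<eta> x)
      \<longlonglongrightarrow> (LINT x|lborel. partial i f x * \<eta> x)"
  proof (rule integral_dominated_convergence[where w="\<lambda>x. K * \<bar>\<eta> x\<bar>"])
    have "continuous_on UNIV (\<lambda>x. partial i f x * \<eta> x)"
      using f(2) \<eta>(1) by (intro continuous_intros)
    then show "(\<lambda>x. partial i f x * \<eta> x) \<in> borel_measurable lborel"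
      by (simp add: borel_measurable_continuous_onI)
    have "continuous_on UNIV (\<lambda>x. (f (x + (1 / Suc n) *\<^sub>R e) - f x) / (1 / Suc n) * \<eta> x)" for n
      using fc \<eta>(1) by (auto intro!: continuous_intros continuous_on_compose2[OF fc])
    then show "(\<lambda>x. (f (x + (1 / Suc n) *\<^sub>R e) - f x) / (1 / Suc n) * \<eta> x) \<in> borel_measurable lborel" for n
      using borel_measurable_continuous_onI measurable_lborel2 by blast
    show "integrable lborel (\<lambda>x. K * \<bar>\<eta> x\<bar>)"
      by (rule integrable_continuous_compact_support[where r=r]) (auto intro!: continuous_intros \<eta>)
    have "(\<lambda>n. 1 / real (Suc n)) \<longlonglongrightarrow> 0" by (rule LIMSEQ_Suc[OF lim_const_over_n])
    then have to0: "filterlim (\<lambda>n. 1 / real (Suc n)) (at 0) sequentially"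
      by (auto simp: filterlim_at)
    have "(\<lambda>n. (f (x + (1 / Suc n) *\<^sub>R e) - f x) / (1 / Suc n)) \<longlonglongrightarrow> partial i f x" for x
    proof -
      have "((\<lambda>s. (f (x + s *\<^sub>R e) - f x) / s) \<longlongrightarrow> partial i f x) (at 0)"
        using DERIV_along_axis[of f x 0 i] f(1) by (simp add: DERIV_def e_def)
      from filterlim_compose[OF this to0] show ?thesis .
    qed
    then show "AE x in lborel. (\<lambda>n. (f (x + (1 / Suc n) *\<^sub>R e) - f x) / (1 / Suc n) * \<eta> x)
        \<longlonglongrightarrow> partial i f x * \<eta> x"
      by (intro AE_I2 tendsto_mult tendsto_const)
    show "AE x in lborel. norm ((f (x + (1 / Suc n) *\<^sub>R e) - f x) / (1 / Suc n) * \<eta> x) \<le> K * \<bar>\<eta> x\<bar>" for n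
    proof (intro AE_I2)
      fix x
      show "norm ((f (x + (1 / Suc n) *\<^sub>R e) - f x) / (1 / Suc n) * \<eta> x) \<le> K * \<bar>\<eta> x\<bar>"
      proof (cases "norm x \<le> r")
        case True
        then have "\<bar>(f (x + (1 / Suc n) *\<^sub>R e) - f x) / (1 / Suc n)\<bar> \<le> K" by (intro quot) auto
        then show ?thesis by (simp only: real_norm_def abs_mult mult_right_mono abs_ge_zero)
      qed (use \<eta>(2)[of x] in simp)
    qed
  qed
  then show ?thesis using move[of "1 / Suc n" for n] by (simp add: e_def)
qed

lemma integral_partial_compact_support:
  fixes h :: "real^'n::finite \<Rightarrow> real"
  assumes h: "\<And>x. h differentiable (at x)" "continuous_on UNIV (partial i h)"
    and supp: "\<And>x. r < norm x \<Longrightarrow> h x = 0"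
  shows "(LINT x|lborel. partial i h x) = 0"
proof -
  \<comment> \<open>Equal to \<open>1\<close> on the ball of radius \<open>r + 2\<close>; on the
    support of \<open>h\<close> its difference quotients with steps at most \<open>1\<close>
    therefore vanish.\<close>
  define \<eta> :: "real^'n \<Rightarrow> real" where "\<eta> x = max 0 (min 1 (r + 3 - norm x))" for x
  have zero: "h x * ((\<eta> (x - (1 / Suc n) *\<^sub>R axis i 1) - \<eta> x) / (1 / Suc n)) = 0" for n x
  proof (cases "norm x \<le> r")
    case True
    have "norm (x - (1 / Suc n) *\<^sub>R axis i 1 :: real^'n) \<le> norm x + 1 / Suc n"
      using norm_triangle_ineq4[of x "(1 / Suc n) *\<^sub>R axis i 1"] by simp
    moreover have "1 / real (Suc n) \<le> 1" by simp
    ultimately have "\<eta> (x - (1 / Suc n) *\<^sub>R axis i 1) = 1" "\<eta> x = 1"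
      using True unfolding \<eta>_def by linarith+
    then show ?thesis by simp
  qed (use supp[of x] in simp)
  have "(\<lambda>n. LINT x|lborel. h x * ((\<eta> (x - (1 / Suc n) *\<^sub>R axis i 1) - \<eta> x) / (1 / Suc n)))
      \<longlonglongrightarrow> (LINT x|lborel. partial i h x * \<eta> x)"
    by (rule difference_quotient_limit[OF h, where r="r+3"]) (auto simp: \<eta>_def intro!: continuous_intros)
  then have "(\<lambda>n::nat. 0) \<longlonglongrightarrow> (LINT x|lborel. partial i h x * \<eta> x)"
    unfolding zero by simp
  then have "(LINT x|lborel. partial i h x * \<eta> x) = 0"
    using LIMSEQ_unique[OF _ tendsto_const] by blast
  moreover have "partial i h x * \<eta> x = partial i h x" for x
  proof (cases "norm x \<le> r")
    case False
    have "(h has_derivative (\<lambda>_. 0)) (at x)"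
      by (rule has_derivative_transform_within_open[where f="\<lambda>_. 0" and s="- cball 0 r"])
         (use False supp in \<open>auto simp: open_Compl\<close>)
    then show ?thesis by (simp add: partial_eq)
  qed (auto simp: \<eta>_def)
  ultimately show ?thesis by simp
qed

lemma smooth_has_weak_partial:
  fixes f :: "real^'n::finite \<Rightarrow> real"
  assumes "open \<Omega>" and f: "smooth f"
  shows "has_weak_partial \<Omega> i f (partial i f)"
  unfolding has_weak_partial_def
proof (intro allI impI)
  fix \<phi> assume \<phi>: "test_fun \<Omega> \<phi>"
  have sm: "smooth \<phi>" using \<phi> by (simp add: test_fun_def)
  obtain r where r: "\<And>x. x \<in> closure {x. \<phi> x \<noteq> 0} \<Longrightarrow> norm x \<le> r"
    using \<phi> unfolding test_fun_def by (meson compact_imp_bounded bounded_iff)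
  have out: "\<phi> x = 0" "partial i \<phi> x = 0" if "x \<notin> \<Omega> \<or> r < norm x" for x
  proof -
    have "x \<notin> closure {x. \<phi> x \<noteq> 0}" using r[of x] that \<phi> by (auto simp only: test_fun_def not_le[symmetric])
    from test_fun_outside[OF \<phi> this] show "\<phi> x = 0" "partial i \<phi> x = 0" .
  qed
  have c: "continuous_on UNIV f" "continuous_on UNIV \<phi>"
      "continuous_on UNIV (partial i f)" "continuous_on UNIV (partial i \<phi>)"
    by (auto intro!: smooth_continuous smooth_partial f sm)
  have prod: "partial i (\<lambda>x. f x * \<phi> x) = (\<lambda>x. f x * partial i \<phi> x + partial i f x * \<phi> x)"
    by (auto simp: fun_eq_iff intro!: partial_mult smooth_differentiable f sm)
  have int: "integrable lborel (\<lambda>x. f x * partial i \<phi> x)" "integrable lborel (\<lambda>x. partial i f x * \<phi> x)"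
    by (rule integrable_continuous_compact_support[where r=r]; auto simp: out intro!: continuous_intros c)+
  have "(LINT x|lborel. partial i (\<lambda>x. f x * \<phi> x) x) = 0"
    by (rule integral_partial_compact_support[where r=r])
       (auto simp: out intro!: smooth_differentiable smooth_continuous smooth_partial smooth_mult f sm)
  then have "(LINT x|lborel. f x * partial i \<phi> x) = - (LINT x|lborel. partial i f x * \<phi> x)"
    unfolding prod using int by simp
  moreover have red: "(LINT x|lebesgue_on \<Omega>. g x) = (LINT x|lborel. g x)"
    if "continuous_on UNIV g" "\<And>x. x \<notin> \<Omega> \<Longrightarrow> g x = 0" for g :: "real^'n \<Rightarrow> real"
    using that \<open>open \<Omega>\<close>
    by (subst lebesgue_on_integral_borel)
       (auto intro!: borel_measurable_continuous_onI Bochner_Integration.integral_cong simp: indicator_def)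
  have "(LINT x|lebesgue_on \<Omega>. f x * partial i \<phi> x) = (LINT x|lborel. f x * partial i \<phi> x)"
    "(LINT x|lebesgue_on \<Omega>. partial i f x * \<phi> x) = (LINT x|lborel. partial i f x * \<phi> x)"
    by (rule red; simp add: out continuous_on_mult c)+
  ultimately show "(LINT x|lebesgue_on \<Omega>. f x * partial i \<phi> x) = - (LINT x|lebesgue_on \<Omega>. partial i f x * \<phi> x)"
    by simp
qed

subsection \<open>Functions that do not vanish at the boundary\<close>

lemma infdist_frontier_le:
  fixes x y :: "'a::real_normed_vector"
  assumes "x \<in> \<Omega> \<longleftrightarrow> y \<notin> \<Omega>"
  shows "infdist x (frontier \<Omega>) \<le> dist x y"
proof -
  have "closed_segment x y \<inter> frontier \<Omega> \<noteq> {}"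
    using assms by (intro connected_Int_frontier) auto
  then obtain z where z: "z \<in> closed_segment x y" "z \<in> frontier \<Omega>" by blast
  have "infdist x (frontier \<Omega>) \<le> dist x z" using z(2) by (rule infdist_le)
  also have "\<dots> \<le> dist x y" using segment_bound(1)[OF z(1)] by (simp add: dist_norm norm_minus_commute)
  finally show ?thesis .
qed

text \<open>The cut-off \<open>min 1 (dist(x, complement of \<Omega>) / \<epsilon>)\<close> vanishes at the boundary and has slope at
  most \<open>1 / \<epsilon>\<close>, in a strip of width \<open>\<epsilon>\<close> only; so the boundary integral of the divergence theorem is
  dominated by the mean of \<open>\<bar>f\<bar>\<close> over that strip.\<close>

lemma cutoff_integral_bound:
  fixes f :: "real^'n::finite \<Rightarrow> real"
  assumes \<Omega>: "open \<Omega>" "bounded \<Omega>" and f: "\<And>x. f differentiable (at x)" "continuous_on UNIV (partial i f)"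
    and \<epsilon>: "0 < \<epsilon>"
  shows "\<bar>LINT x|lborel. partial i f x * min 1 (infdist x (- \<Omega>) / \<epsilon>)\<bar>
      \<le> (LINT x|lborel. indicator {x. infdist x (frontier \<Omega>) \<le> 2 * \<epsilon>} x * \<bar>f x\<bar>) / \<epsilon>"
proof (cases "\<Omega> = {}")
  case False
  note nonempty = False
  define \<eta> where "\<eta> x = min 1 (infdist x (- \<Omega>) / \<epsilon>)" for x
  define S where "S = {x. infdist x (frontier \<Omega>) \<le> 2 * \<epsilon>}"
  obtain r where r: "\<Omega> \<subseteq> cball 0 r" using \<Omega>(2) by (auto simp: bounded_iff subset_iff)
  have ne: "- \<Omega> \<noteq> {}" using \<Omega>(2) not_bounded_UNIV[where 'a="real^'n"] by (metis Compl_empty_eq double_complement)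
  have lip: "\<bar>\<eta> x - \<eta> y\<bar> \<le> dist x y / \<epsilon>" for x y
  proof -
    have "\<bar>\<eta> x - \<eta> y\<bar> \<le> \<bar>infdist x (- \<Omega>) / \<epsilon> - infdist y (- \<Omega>) / \<epsilon>\<bar>" unfolding \<eta>_def by linarith
    also have "\<dots> = \<bar>infdist x (- \<Omega>) - infdist y (- \<Omega>)\<bar> / \<epsilon>" using \<epsilon> by (simp add: diff_divide_distrib[symmetric])
    also have "\<dots> \<le> dist x y / \<epsilon>" using \<epsilon> by (intro divide_right_mono infdist_triangle_abs) auto
    finally show ?thesis .
  qed
  have out: "\<eta> x = 0" if "x \<notin> \<Omega>" for x using that \<epsilon> by (simp add: \<eta>_def)
  have change: "x \<in> S" if "\<eta> x \<noteq> \<eta> y" "dist x y \<le> \<epsilon>" for x y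
  proof (cases "x \<in> \<Omega>")
    case True
    have "infdist x (- \<Omega>) < 2 * \<epsilon>"
    proof (rule ccontr)
      assume "\<not> ?thesis"
      then have "\<epsilon> \<le> infdist x (- \<Omega>)" "\<epsilon> \<le> infdist y (- \<Omega>)"
        using infdist_triangle[of x "- \<Omega>" y] that(2) \<epsilon> by (auto simp: dist_commute)
      then show False using that(1) \<epsilon> by (simp add: \<eta>_def)
    qed
    moreover obtain z where "z \<in> - \<Omega>" "infdist x (- \<Omega>) = dist x z"
      using infdist_attains_inf[of "- \<Omega>" x] ne \<Omega>(1) by (auto simp: closed_Compl)
    ultimately show ?thesis using infdist_frontier_le[of x \<Omega> z] True by (auto simp: S_def)
  next
    case False
    then have "y \<in> \<Omega>" using out that(1) by metis
    then show ?thesis using infdist_frontier_le[of x \<Omega> y] False that(2) \<epsilon> by (auto simp: S_def)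
  qed
  have fc: "continuous_on UNIV f"
    using f(1) by (intro continuous_at_imp_continuous_on) (auto intro: differentiable_imp_continuous_within)
  have S: "compact S"
  proof -
    have "S \<subseteq> cball 0 (r + 2 * \<epsilon> + 1)" if fr: "frontier \<Omega> \<noteq> {}"
    proof
      fix x assume "x \<in> S"
      obtain z where z: "z \<in> frontier \<Omega>" "infdist x (frontier \<Omega>) = dist x z"
        using infdist_attains_inf[OF frontier_closed fr] by blast
      have "norm z \<le> r"
        using z(1) closure_minimal[OF r closed_cball] by (auto simp: frontier_def)
      then show "x \<in> cball 0 (r + 2 * \<epsilon> + 1)"
        using \<open>x \<in> S\<close> z(2) norm_triangle_sub[of x z] by (auto simp: S_def dist_norm)
    qed
    moreover have "frontier \<Omega> \<noteq> {}" using nonempty ne by (auto simp: frontier_eq_empty)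
    moreover have "closed S" unfolding S_def by (intro closed_Collect_le continuous_intros)
    ultimately show ?thesis by (metis bounded_cball bounded_subset compact_eq_bounded_closed)
  qed
  have int: "integrable lborel (\<lambda>x. indicator S x * \<bar>f x\<bar> / \<epsilon>)"
  proof -
    have "continuous_on S (\<lambda>x. \<bar>f x\<bar> / \<epsilon>)"
      using \<epsilon> by (intro continuous_intros continuous_on_subset[OF fc]) auto
    from borel_integrable_compact[OF S this] show ?thesis by simp
  qed
  have \<eta>c: "continuous_on UNIV \<eta>"
    unfolding \<eta>_def using \<epsilon> by (auto intro!: continuous_intros)
  let ?q = "\<lambda>n x. f x * ((\<eta> (x - (1 / Suc n) *\<^sub>R axis i 1) - \<eta> x) / (1 / Suc n))"
  have lim: "(\<lambda>n. \<bar>LINT x|lborel. ?q n x\<bar>) \<longlonglongrightarrow> \<bar>LINT x|lborel. partial i f x * \<eta> x\<bar>"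
    using r by (intro tendsto_rabs difference_quotient_limit[OF f \<eta>c, where r=r] out) fastforce
  have "\<forall>\<^sub>F n in sequentially. \<bar>LINT x|lborel. ?q n x\<bar> \<le> (LINT x|lborel. indicator S x * \<bar>f x\<bar> / \<epsilon>)"
  proof -
    obtain N where N: "1 / \<epsilon> < real N" using reals_Archimedean2 by blast
    show ?thesis
      using eventually_ge_at_top[of N]
    proof eventually_elim
      case (elim n)
      then have s: "1 / real (Suc n) \<le> \<epsilon>" using N \<epsilon> by (simp add: field_simps) (smt (verit) mult_left_mono of_nat_mono)
      have le: "norm (?q n x) \<le> indicator S x * \<bar>f x\<bar> / \<epsilon>" for x
      proof (cases "\<eta> x = \<eta> (x - (1 / Suc n) *\<^sub>R axis i 1)")
        case False
        have d: "dist x (x - (1 / Suc n) *\<^sub>R axis i 1) = 1 / Suc n" by (simp add: dist_norm)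
        from change[OF False] d s have "x \<in> S" by simp
        moreover have "\<bar>(\<eta> (x - (1 / Suc n) *\<^sub>R axis i 1) - \<eta> x) / (1 / Suc n)\<bar> \<le> 1 / \<epsilon>"
        proof -
          have "\<bar>\<eta> (x - (1 / Suc n) *\<^sub>R axis i 1) - \<eta> x\<bar> / (1 / Suc n) \<le> (1 / Suc n) / \<epsilon> / (1 / Suc n)"
            using lip[of x "x - (1 / Suc n) *\<^sub>R axis i 1"] unfolding d
            by (intro divide_right_mono) (auto simp: abs_minus_commute)
          then show ?thesis by (simp add: abs_mult)
        qed
        from mult_left_mono[OF this abs_ge_zero[of "f x"]]
        have "norm (?q n x) \<le> \<bar>f x\<bar> * (1 / \<epsilon>)" by (simp only: real_norm_def abs_mult)
        ultimately show ?thesis by simp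
      qed (use \<epsilon> in simp)
      have "\<bar>LINT x|lborel. ?q n x\<bar> \<le> (LINT x|lborel. norm (?q n x))"
        using integral_norm_bound[of lborel "?q n"] by simp
      also have "\<dots> \<le> (LINT x|lborel. indicator S x * \<bar>f x\<bar> / \<epsilon>)"
        using le by (intro integral_mono' int) (use \<epsilon> in auto)
      finally show ?case .
    qed
  qed
  from tendsto_upperbound[OF lim this] show ?thesis
    by (simp add: \<eta>_def S_def)
qed (use \<epsilon> in simp)

text \<open>Letting \<open>\<epsilon>\<close> tend to zero removes the cut-off.\<close>

lemma integral_partial_le_strip_limit:
  fixes f :: "real^'n::finite \<Rightarrow> real"
  assumes \<Omega>: "open \<Omega>" "bounded \<Omega>" and f: "\<And>x. f differentiable (at x)" "continuous_on UNIV (partial i f)"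
    and B: "\<And>\<delta>. 0 < \<delta> \<Longrightarrow> \<exists>\<epsilon>0>0. \<forall>\<epsilon>. 0 < \<epsilon> \<and> \<epsilon> < \<epsilon>0 \<longrightarrow>
      (LINT x|lborel. indicator {x. infdist x (frontier \<Omega>) \<le> 2 * \<epsilon>} x * \<bar>f x\<bar>) / \<epsilon> \<le> B + \<delta>"
  shows "\<bar>LINT x|lebesgue_on \<Omega>. partial i f x\<bar> \<le> B"
proof (rule field_le_epsilon)
  fix \<delta> :: real assume "0 < \<delta>"
  from B[OF this] obtain \<epsilon>0 where \<epsilon>0: "0 < \<epsilon>0" and le:
    "\<And>\<epsilon>. 0 < \<epsilon> \<Longrightarrow> \<epsilon> < \<epsilon>0 \<Longrightarrow>
      (LINT x|lborel. indicator {x. infdist x (frontier \<Omega>) \<le> 2 * \<epsilon>} x * \<bar>f x\<bar>) / \<epsilon> \<le> B + \<delta>"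
    by blast
  let ?\<eta> = "\<lambda>n x. min 1 (infdist x (- \<Omega>) / (1 / Suc n))"
  have closed: "closed (- \<Omega>)" using \<Omega>(1) by (simp add: closed_Compl)
  have ne: "- \<Omega> \<noteq> {}" using \<Omega>(2) not_bounded_UNIV[where 'a="real^'n"] by (metis Compl_empty_eq double_complement)
  have meas: "\<Omega> \<in> sets borel" using \<Omega>(1) by simp
  have fm: "partial i f \<in> borel_measurable borel" using f(2) by (rule borel_measurable_continuous_onI)
  have "(\<lambda>n. LINT x|lborel. partial i f x * ?\<eta> n x) \<longlonglongrightarrow> (LINT x|lborel. indicator \<Omega> x *\<^sub>R partial i f x)"
  proof (rule integral_dominated_convergence[where w="\<lambda>x. indicator \<Omega> x *\<^sub>R \<bar>partial i f x\<bar>"])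
    have "integrable lborel (\<lambda>x. indicator (closure \<Omega>) x *\<^sub>R \<bar>partial i f x\<bar>)"
      using \<Omega>(2) by (intro borel_integrable_compact continuous_intros continuous_on_subset[OF f(2)]) auto
    then show "integrable lborel (\<lambda>x. indicator \<Omega> x *\<^sub>R \<bar>partial i f x\<bar>)"
      by (rule Bochner_Integration.integrable_bound)
         (use meas fm closure_subset[of \<Omega>] in \<open>auto simp: indicator_def\<close>)
    show "(\<lambda>x. indicator \<Omega> x *\<^sub>R partial i f x) \<in> borel_measurable lborel"
      using meas fm by measurable
    have "continuous_on UNIV (?\<eta> n)" for n by (auto intro!: continuous_intros)
    then have "?\<eta> n \<in> borel_measurable borel" for n by (rule borel_measurable_continuous_onI)
    then show "(\<lambda>x. partial i f x * ?\<eta> n x) \<in> borel_measurable lborel" for n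
      using fm by simp
    have pos: "0 < infdist x (- \<Omega>)" if "x \<in> \<Omega>" for x
      using in_closed_iff_infdist_zero[OF closed ne, of x] that infdist_nonneg[of x "- \<Omega>"] by force
    show "AE x in lborel. (\<lambda>n. partial i f x * ?\<eta> n x) \<longlonglongrightarrow> indicator \<Omega> x *\<^sub>R partial i f x"
    proof (intro AE_I2)
      fix x
      have "(\<lambda>n. ?\<eta> n x) \<longlonglongrightarrow> indicator \<Omega> x"
      proof (cases "x \<in> \<Omega>")
        case True
        obtain N where N: "1 / infdist x (- \<Omega>) < real N" using reals_Archimedean2 by blast
        have "?\<eta> n x = 1" if "n \<ge> N" for n
        proof -
          have "1 / infdist x (- \<Omega>) \<le> real (Suc n)" using N that by linarith
          then show ?thesis using pos[OF True] by (simp add: field_simps)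
        qed
        then have "\<forall>\<^sub>F n in sequentially. ?\<eta> n x = 1" by (auto simp: eventually_sequentially)
        then show ?thesis using True by (simp add: tendsto_eventually)
      qed auto
      from tendsto_mult[OF tendsto_const this, of "partial i f x"]
      show "(\<lambda>n. partial i f x * ?\<eta> n x) \<longlonglongrightarrow> indicator \<Omega> x *\<^sub>R partial i f x" by (simp add: mult.commute)
    qed
    show "AE x in lborel. norm (partial i f x * ?\<eta> n x) \<le> indicator \<Omega> x *\<^sub>R \<bar>partial i f x\<bar>" for n
    proof (intro AE_I2)
      fix x
      have "0 \<le> ?\<eta> n x" by (simp add: infdist_nonneg)
      moreover have "?\<eta> n x \<le> indicator \<Omega> x" by (cases "x \<in> \<Omega>") auto
      ultimately show "norm (partial i f x * ?\<eta> n x) \<le> indicator \<Omega> x *\<^sub>R \<bar>partial i f x\<bar>"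
        using mult_left_mono[of "?\<eta> n x" "indicator \<Omega> x" "\<bar>partial i f x\<bar>"]
        by (simp add: abs_mult mult.commute)
    qed
  qed
  from tendsto_rabs[OF this]
  have lim: "(\<lambda>n. \<bar>LINT x|lborel. partial i f x * ?\<eta> n x\<bar>) \<longlonglongrightarrow> \<bar>LINT x|lebesgue_on \<Omega>. partial i f x\<bar>"
    using lebesgue_on_integral_borel[OF meas fm] by simp
  have "\<forall>\<^sub>F n in sequentially. \<bar>LINT x|lborel. partial i f x * ?\<eta> n x\<bar> \<le> B + \<delta>"
  proof -
    obtain N where N: "1 / \<epsilon>0 < real N" using reals_Archimedean2 by blast
    show ?thesis
      using eventually_ge_at_top[of N]
    proof eventually_elim
      case (elim n)
      then have "1 / \<epsilon>0 < real (Suc n)" using N by linarith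
      then have "1 / real (Suc n) < \<epsilon>0" using \<epsilon>0 by (simp add: field_simps)
      from order_trans[OF cutoff_integral_bound[OF \<Omega> f, of "1 / Suc n"] le[OF _ this]]
      show ?case by simp
    qed
  qed
  from tendsto_upperbound[OF lim this] show "\<bar>LINT x|lebesgue_on \<Omega>. partial i f x\<bar> \<le> B + \<delta>" by simp
qed

section \<open>Fourier series on a cube\<close>

definition wave :: "real \<Rightarrow> int^'n \<Rightarrow> real^'n::finite" where
  "wave R k = (\<chi> i. pi / R * of_int (k $ i))"

definition cube :: "real \<Rightarrow> (real^'n::finite) set" where
  "cube R = cbox (\<chi> i. - R) (\<chi> i. R)"

lemma wave_add: "wave R (k + l) = wave R k + wave R l"
  by (simp add: wave_def vec_eq_iff algebra_simps add_divide_distrib)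

lemma wave_diff: "wave R (k - l) = wave R k - wave R l"
  by (simp add: wave_def vec_eq_iff algebra_simps diff_divide_distrib)

lemma lborel_integral_prod:
  fixes f :: "'a::euclidean_space \<Rightarrow> real \<Rightarrow> 'b::{real_normed_field,banach,second_countable_topology}"
  assumes int: "\<And>b. b \<in> Basis \<Longrightarrow> integrable lborel (f b)"
  shows "(LINT x|lborel. (\<Prod>b\<in>Basis. f b (x \<bullet> b))) = (\<Prod>b\<in>Basis. LINT t|lborel. f b t)"
proof -
  interpret product_sigma_finite "\<lambda>_. lborel :: real measure"
    by unfold_locales
  have [measurable]: "b \<in> Basis \<Longrightarrow> f b \<in> borel_measurable borel" for b
    using borel_measurable_integrable[OF int] by simp
  have "(LINT x|lborel. (\<Prod>b\<in>Basis. f b (x \<bullet> b)))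
      = (LINT y|(\<Pi>\<^sub>M b\<in>(Basis::'a set). lborel). (\<Prod>b\<in>Basis. f b ((\<Sum>c\<in>Basis. y c *\<^sub>R c) \<bullet> b)))"
    by (subst lborel_eq, subst integral_distr) auto
  also have "\<dots> = (LINT y|(\<Pi>\<^sub>M b\<in>(Basis::'a set). lborel). (\<Prod>b\<in>Basis. f b (y b)))"
    by (intro Bochner_Integration.integral_cong prod.cong refl) simp
  also have "\<dots> = (\<Prod>b\<in>Basis. LINT t|lborel. f b t)"
    by (rule product_integral_prod) (auto intro: int)
  finally show ?thesis .
qed

lemma integral_cis_period:
  assumes R: "0 < R"
  shows "(LINT t|lborel. indicator {-R..R} t *\<^sub>R cis (pi / R * of_int m * t)) = (if m = 0 then 2 * R else 0)"
proof (cases "m = 0")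
  case False
  define a where "a = pi / R * of_int m"
  have a: "a \<noteq> 0" using False R by (simp add: a_def)
  have "(LINT t|lborel. indicator {-R..R} t *\<^sub>R cis (a * t)) = - \<i> * cis (a * R) / a - (- \<i> * cis (a * - R) / a)"
  proof (rule integral_FTC_atLeastAtMost)
    fix x
    have "((\<lambda>t. - \<i> * cis (a * t) / a) has_vector_derivative - \<i> * (of_real a * (\<i> * cis (a * x))) / a)
        (at x within {-R..R})"
      unfolding cis_conv_exp
      by (auto intro!: derivative_eq_intros has_vector_derivative_real_field simp: algebra_simps)
    then show "((\<lambda>t. - \<i> * cis (a * t) / a) has_vector_derivative cis (a * x)) (at x within {-R..R})"
      using a by simp
  qed (use R in \<open>auto intro!: continuous_intros simp: cis_conv_exp\<close>)
  moreover have "cis (a * R) = cis (a * - R)"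
  proof -
    have "cis (a * R) = cis (a * - R) * cis (2 * pi * of_int m)"
      using R by (simp add: cis_mult a_def algebra_simps)
    also have "cis (2 * pi * of_int m) = 1" by (rule cis_multiple_2pi) simp
    finally show ?thesis by simp
  qed
  ultimately show ?thesis using False by (simp add: a_def)
qed (use R in \<open>simp add: scaleR_conv_of_real\<close>)

lemma continuous_on_cis_wave: "continuous_on S (\<lambda>x. cis (w \<bullet> x))"
  unfolding cis_conv_exp by (intro continuous_intros)

lemma measurable_cis_wave: "(\<lambda>x. cis (w \<bullet> x)) \<in> borel_measurable (lebesgue_on S)"
proof -
  have "(\<lambda>x. cis (w \<bullet> x)) \<in> borel_measurable borel"
    by (rule borel_measurable_continuous_onI[OF continuous_on_cis_wave])
  then have "(\<lambda>x. cis (w \<bullet> x)) \<in> borel_measurable lebesgue"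
    by (simp add: measurable_completion)
  then show ?thesis by (rule measurable_restrict_space1)
qed

lemma finite_measure_cube: "finite_measure (lebesgue_on (cube R))"
  by (rule finite_measure_lebesgue_on) (simp add: cube_def)

text \<open>The integral over the cube factors into integrals of exponentials over whole
  periods.\<close>

lemma waves_orthogonal:
  fixes k :: "int^'n::finite"
  assumes R: "0 < R"
  shows "(LINT x|lebesgue_on (cube R). cis (wave R k \<bullet> x)) = (if k = 0 then (2 * R) ^ CARD('n) else 0)"
proof -
  have cube_borel: "cube R \<in> sets borel" by (simp add: cube_def)
  define m where "m b = (\<Sum>i\<in>UNIV. if b = axis i 1 then k $ i else 0)" for b :: "real^'n"
  have m: "m (axis i 1) = k $ i" for i
    by (simp add: m_def axis_eq_axis if_distrib cong: if_cong)
  define f where "f b t = indicator {-R..R} t *\<^sub>R cis (pi / R * of_int (m b) * t)" for b :: "real^'n" and t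
  have int: "integrable lborel (f b)" for b
    unfolding f_def cis_conv_exp by (intro borel_integrable_compact continuous_intros) simp_all
  have pt: "indicator (cube R) x *\<^sub>R cis (wave R k \<bullet> x) = (\<Prod>b\<in>Basis. f b (x \<bullet> b))" for x
  proof -
    have "(\<Prod>b\<in>Basis. f b (x \<bullet> b)) = (\<Prod>i\<in>UNIV. f (axis i 1) (x $ i))"
      by (subst prod.reindex_bij_betw[symmetric, where h="\<lambda>i. axis i 1" and S=UNIV])
         (auto simp: bij_betw_def inj_on_def axis_eq_axis Basis_vec_def inner_axis)
    also have "\<dots> = (\<Prod>i\<in>UNIV. of_real (indicator {-R..R} (x $ i))) * (\<Prod>i\<in>UNIV. cis (wave R k $ i * x $ i))"
      by (simp add: f_def m scaleR_conv_of_real wave_def prod.distrib)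
    also have "(\<Prod>i\<in>UNIV. cis (wave R k $ i * x $ i)) = cis (wave R k \<bullet> x)"
      by (simp add: inner_vec_def cis_conv_exp exp_sum sum_distrib_left of_real_sum)
    also have "(\<Prod>i\<in>UNIV. of_real (indicator {-R..R} (x $ i)) :: complex) = of_real (indicator (cube R) x)"
    proof (cases "x \<in> cube R")
      case False
      then obtain i where "x $ i \<notin> {-R..R}" by (auto simp: cube_def mem_box_cart)
      then show ?thesis using False by (intro trans[OF prod_zero]) (auto intro!: exI[of _ i])
    qed (auto simp: cube_def mem_box_cart)
    finally show ?thesis by (simp add: scaleR_conv_of_real)
  qed
  have fint: "(LINT t|lborel. f (axis i 1) t) = (if k $ i = 0 then 2 * R else 0)" for i
    using integral_cis_period[OF R, of "k $ i"] by (simp add: f_def m)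
  have "(LINT x|lebesgue_on (cube R). cis (wave R k \<bullet> x)) = (LINT x|lborel. indicator (cube R) x *\<^sub>R cis (wave R k \<bullet> x))"
    by (rule lebesgue_on_integral_borel[OF cube_borel])
       (rule borel_measurable_continuous_onI[OF continuous_on_cis_wave])
  also have "\<dots> = (\<Prod>b\<in>Basis. LINT t|lborel. f b t)"
    unfolding pt by (rule lborel_integral_prod[OF int])
  also have "\<dots> = (\<Prod>i\<in>(UNIV::'n set). if k $ i = 0 then 2 * R else 0)"
    by (subst prod.reindex_bij_betw[symmetric, where h="\<lambda>i. axis i 1" and S=UNIV])
       (auto simp: bij_betw_def inj_on_def axis_eq_axis Basis_vec_def fint intro!: prod.cong)
  also have "\<dots> = (if k = 0 then (2 * R) ^ CARD('n) else 0)"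
    by (auto simp: vec_eq_iff)
  finally show ?thesis .
qed

subsection \<open>Trigonometric polynomials are dense\<close>

inductive trig_poly :: "real \<Rightarrow> (real^'n::finite \<Rightarrow> complex) \<Rightarrow> bool" for R where
  wave: "trig_poly R (\<lambda>x. c * cis (wave R k \<bullet> x))"
| add: "trig_poly R f \<Longrightarrow> trig_poly R g \<Longrightarrow> trig_poly R (\<lambda>x. f x + g x)"

lemma trig_poly_mult: "trig_poly R f \<Longrightarrow> trig_poly R g \<Longrightarrow> trig_poly R (\<lambda>x. f x * g x)"
proof (induction arbitrary: g rule: trig_poly.induct)
  case (wave c k)
  then show ?case
  proof (induction rule: trig_poly.induct)
    case (wave d l)
    have "(\<lambda>x. c * cis (wave R k \<bullet> x) * (d * cis (wave R l \<bullet> x))) = (\<lambda>x. (c * d) * cis (wave R (k + l) \<bullet> x))"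
      by (simp add: fun_eq_iff wave_add inner_add_left cis_mult[symmetric])
    then show ?case by (simp add: trig_poly.wave)
  qed (simp add: distrib_left trig_poly.add)
qed (simp add: distrib_right trig_poly.add)

lemma trig_poly_const: "trig_poly R (\<lambda>_. c)"
  using trig_poly.wave[of R c 0] by (simp add: wave_def zero_vec_def[symmetric])

lemma trig_poly_sum: "(\<And>i. i \<in> I \<Longrightarrow> trig_poly R (f i)) \<Longrightarrow> trig_poly R (\<lambda>x. \<Sum>i\<in>I. f i x)"
  by (induction I rule: infinite_finite_induct) (auto intro: trig_poly.add trig_poly_const)

lemma trig_poly_expansion:
  "trig_poly R f \<Longrightarrow> \<exists>K t. finite K \<and> f = (\<lambda>x. \<Sum>k\<in>K. t k * cis (wave R k \<bullet> x))"
proof (induction rule: trig_poly.induct)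
  case (wave c k)
  show ?case by (rule exI[of _ "{k}"], rule exI[of _ "\<lambda>_. c"]) simp
next
  case (add f g)
  then obtain K t L s where "finite K" "f = (\<lambda>x. \<Sum>k\<in>K. t k * cis (wave R k \<bullet> x))"
      "finite L" "g = (\<lambda>x. \<Sum>k\<in>L. s k * cis (wave R k \<bullet> x))" by blast
  moreover have "(\<Sum>k\<in>K. t k * cis (wave R k \<bullet> x)) + (\<Sum>k\<in>L. s k * cis (wave R k \<bullet> x))
     = (\<Sum>k\<in>K \<union> L. ((if k \<in> K then t k else 0) + (if k \<in> L then s k else 0)) * cis (wave R k \<bullet> x))"
    if "finite K" "finite L" for x
  proof -
    have "(\<Sum>k\<in>K. t k * cis (wave R k \<bullet> x)) = (\<Sum>k\<in>K \<union> L. (if k \<in> K then t k else 0) * cis (wave R k \<bullet> x))"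
      "(\<Sum>k\<in>L. s k * cis (wave R k \<bullet> x)) = (\<Sum>k\<in>K \<union> L. (if k \<in> L then s k else 0) * cis (wave R k \<bullet> x))"
      using that by (auto intro!: sum.mono_neutral_cong_left)
    then show ?thesis by (simp add: distrib_right sum.distrib)
  qed
  ultimately show ?case
    by (intro exI[of _ "K \<union> L"] exI[of _ "\<lambda>k. (if k \<in> K then t k else 0) + (if k \<in> L then s k else 0)"]) auto
qed

definition torus :: "real \<Rightarrow> real^'n \<Rightarrow> complex^'n::finite" where
  "torus R x = (\<chi> i. cis (pi / R * x $ i))"

lemma trig_poly_torus:
  fixes p :: "complex^'n::finite \<Rightarrow> real"
  assumes "real_polynomial_function p" shows "trig_poly R (\<lambda>x. of_real (p (torus R x)))"
  using assms
proof (induction rule: real_polynomial_function.induct)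
  case (linear h)
  interpret bounded_linear h by fact
  have wave_axis: "wave R (axis i m) \<bullet> x = pi / R * of_int m * x $ i" for i m and x :: "real^'n"
  proof -
    have "wave R (axis i m) = axis i (pi / R * of_int m)" by (auto simp: wave_def axis_def vec_eq_iff)
    then show ?thesis by (simp add: inner_axis')
  qed
  \<comment> \<open>\<open>h\<close> is linear over the reals only, hence the two coefficients for
    each complex coordinate; cosine and sine are combinations of the waves with frequencies
    \<open>axis i 1\<close> and \<open>axis i (- 1)\<close>.\<close>
  define u v where "u i = complex_of_real (h (axis i 1))" and "v i = complex_of_real (h (axis i \<i>))" for i
  have "of_real (h (torus R x)) = (\<Sum>i\<in>UNIV. (u i / 2 - \<i> * v i / 2) * cis (wave R (axis i 1) \<bullet> x)
      + (u i / 2 + \<i> * v i / 2) * cis (wave R (axis i (- 1)) \<bullet> x))" for x :: "real^'n"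
  proof -
    have "torus R x = (\<Sum>i\<in>UNIV. cos (pi / R * x $ i) *\<^sub>R axis i 1 + sin (pi / R * x $ i) *\<^sub>R axis i \<i>)"
      by (auto simp: vec_eq_iff torus_def axis_def complex_eq_iff if_distrib[of "\<lambda>z. z *\<^sub>R _"] if_distrib[of "(*\<^sub>R) _"]
           if_distrib[of Re] if_distrib[of Im] sum.distrib cong: if_cong)
    then have "of_real (h (torus R x)) = (\<Sum>i\<in>UNIV. cos (pi / R * x $ i) * u i + sin (pi / R * x $ i) * v i)"
      by (simp add: sum add scaleR u_def v_def)
    also have "\<dots> = (\<Sum>i\<in>UNIV. (u i / 2 - \<i> * v i / 2) * cis (wave R (axis i 1) \<bullet> x)
      + (u i / 2 + \<i> * v i / 2) * cis (wave R (axis i (- 1)) \<bullet> x))"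
    proof (rule sum.cong[OF refl])
      fix i
      let ?t = "pi / R * x $ i"
      have w: "cis (wave R (axis i 1) \<bullet> x) = cos ?t + \<i> * sin ?t" 
          "cis (wave R (axis i (- 1)) \<bullet> x) = cos ?t - \<i> * sin ?t"
        unfolding wave_axis by (auto simp: complex_eq_iff)
      show "cos ?t * u i + sin ?t * v i = (u i / 2 - \<i> * v i / 2) * cis (wave R (axis i 1) \<bullet> x)
          + (u i / 2 + \<i> * v i / 2) * cis (wave R (axis i (- 1)) \<bullet> x)"
        unfolding w by (simp add: field_simps)
    qed
    finally show ?thesis .
  qed
  then show ?case by (simp only:) (intro trig_poly_sum trig_poly.add trig_poly.wave)
qed (simp_all add: trig_poly_const trig_poly.add trig_poly_mult)

text \<open>The map \<open>torus R\<close> identifies opposite faces of the cube and nothing else.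
  A continuous function on the cube that vanishes on the faces is therefore a continuous function
  on the torus, where Stone--Weierstrass applies.\<close>

lemma trig_poly_uniform_approx:
  fixes f :: "real^'n::finite \<Rightarrow> real"
  assumes R: "0 < R" and f: "continuous_on (cube R) f"
    and faces: "\<And>x i. x \<in> cube R \<Longrightarrow> \<bar>x $ i\<bar> = R \<Longrightarrow> f x = 0" and e: "0 < e"
  shows "\<exists>T. trig_poly R T \<and> (\<forall>x\<in>cube R. norm (of_real (f x) - T x) < e)"
proof -
  have comp: "compact (cube R :: (real^'n) set)" by (simp add: cube_def)
  have tc: "continuous_on (cube R) (torus R)"
    unfolding torus_def cis_conv_exp by (intro continuous_intros)
  have inj: "f x = f y" if "x \<in> cube R" "y \<in> cube R" "torus R x = torus R y" for x y
  proof (cases "x = y")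
    case False
    then obtain i where i: "x $ i \<noteq> y $ i" by (auto simp: vec_eq_iff)
    have "cis (pi / R * x $ i) = cis (pi / R * y $ i)"
      using that(3) by (simp add: torus_def vec_eq_iff)
    then have "cos (pi / R * x $ i - pi / R * y $ i) = 1"
      by (simp add: complex_eq_iff cos_diff sin_cos_squared_add3)
    then obtain m :: int where "pi / R * x $ i - pi / R * y $ i = of_int m * (2 * pi)"
      unfolding cos_one_2pi_int by auto
    then have "pi * (x $ i - y $ i) = pi * (2 * of_int m * R)" using R by (simp add: field_simps)
    then have m: "x $ i - y $ i = 2 * of_int m * R" using pi_neq_zero mult_left_cancel by blast
    have b: "\<bar>x $ i\<bar> \<le> R" "\<bar>y $ i\<bar> \<le> R" using that(1,2) by (auto simp: cube_def mem_box_cart abs_le_iff minus_le_iff)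
    have "m \<noteq> 0" using i m by auto
    then have "1 \<le> \<bar>of_int m :: real\<bar>" by (simp flip: of_int_abs)
    then have "2 * R \<le> \<bar>x $ i - y $ i\<bar>" using R unfolding m by (simp add: abs_mult)
    with b have "\<bar>x $ i\<bar> = R" "\<bar>y $ i\<bar> = R" by linarith+
    then show ?thesis using faces that(1,2) by metis
  qed simp
  define g where "g z = f (SOME x. x \<in> cube R \<and> torus R x = z)" for z
  have g: "g (torus R x) = f x" if x: "x \<in> cube R" for x
  proof -
    let ?y = "SOME y. y \<in> cube R \<and> torus R y = torus R x"
    have "?y \<in> cube R \<and> torus R ?y = torus R x" by (rule someI[where x=x]) (simp add: x)
    then show ?thesis unfolding g_def using inj x by blast
  qed
  have gc: "continuous_on (torus R ` cube R) g"
    unfolding continuous_on_closed_vimage[OF compact_imp_closed[OF compact_continuous_image[OF tc comp]]]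
  proof (intro allI impI)
    fix B :: "real set" assume "closed B"
    have "g -` B \<inter> torus R ` cube R = torus R ` (cube R \<inter> f -` B)"
      using g by auto
    moreover have "closed (cube R \<inter> f -` B)"
      by (rule continuous_closed_preimage[OF f compact_imp_closed[OF comp] \<open>closed B\<close>])
    then have "compact (cube R \<inter> f -` B)"
      using comp by (meson bounded_subset compact_eq_bounded_closed inf_le1)
    then have "compact (torus R ` (cube R \<inter> f -` B))"
      by (intro compact_continuous_image continuous_on_subset[OF tc]) auto
    ultimately show "closed (g -` B \<inter> torus R ` cube R)" by (simp add: compact_imp_closed)
  qed
  obtain p where p: "real_polynomial_function p" "\<And>z. z \<in> torus R ` cube R \<Longrightarrow> \<bar>g z - p z\<bar> < e"
    using Stone_Weierstrass_real_polynomial_function[OF compact_continuous_image[OF tc comp] gc e] by blast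
  show ?thesis
  proof (intro exI conjI ballI)
    show "trig_poly R (\<lambda>x. of_real (p (torus R x)))" by (rule trig_poly_torus[OF p(1)])
    fix x :: "real^'n" assume x: "x \<in> cube R"
    then show "norm (of_real (f x) - complex_of_real (p (torus R x))) < e"
      using p(2)[of "torus R x"] g[OF x] by (simp flip: of_real_diff)
  qed
qed

lemma integral_lebesgue_on_extend:
  fixes h :: "'a::euclidean_space \<Rightarrow> 'b::{banach, second_countable_topology}"
  assumes "\<Omega> \<subseteq> S" "\<Omega> \<in> sets lebesgue" "S \<in> sets lebesgue"
  shows "(LINT x|lebesgue_on S. (if x \<in> \<Omega> then h x else 0)) = (LINT x|lebesgue_on \<Omega>. h x)"
  using assms
  by (subst (1 2) integral_restrict_space)
     (auto intro!: Bochner_Integration.integral_cong simp: indicator_def)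

lemma L2_lebesgue_on_extend:
  fixes f :: "'a::euclidean_space \<Rightarrow> 'b::euclidean_space"
  assumes "\<Omega> \<subseteq> S" "\<Omega> \<in> sets lebesgue" "S \<in> sets lebesgue" "L2 (lebesgue_on \<Omega>) f"
  shows "L2 (lebesgue_on S) (\<lambda>x. if x \<in> \<Omega> then f x else 0)"
proof -
  have m: "(\<lambda>x. if x \<in> \<Omega> then f x else 0) \<in> borel_measurable lebesgue"
    using assms by (subst borel_measurable_if) (auto simp: L2_def)
  have "integrable lebesgue (\<lambda>x. indicator \<Omega> x *\<^sub>R (norm (f x))\<^sup>2)"
    using assms by (subst integrable_restrict_space[symmetric]) (auto simp: L2_def)
  then have "integrable lebesgue (\<lambda>x. indicator S x *\<^sub>R (norm (if x \<in> \<Omega> then f x else 0))\<^sup>2)"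
    by (rule Bochner_Integration.integrable_cong[THEN iffD1, rotated -1])
       (use assms(1) in \<open>auto simp: indicator_def\<close>)
  then have "integrable (lebesgue_on S) (\<lambda>x. (norm (if x \<in> \<Omega> then f x else 0))\<^sup>2)"
    using assms by (subst integrable_restrict_space) auto
  then show ?thesis using m by (auto simp: L2_def measurable_restrict_space1)
qed

text \<open>Orthogonality of the waves leaves only the diagonal terms of the expanded square. The
  Fourier coefficients \<open>c\<close> are taken without conjugation; as \<open>F\<close> is
  real, conjugation would only replace \<open>k\<close> by \<open>- k\<close>.\<close>

lemma trig_distance:
  fixes F :: "real^'n::finite \<Rightarrow> real" and t c :: "int^'n \<Rightarrow> complex"
  assumes V_def: "V = (2 * R) ^ CARD('n)"
    and c_def: "\<And>k. c k = (LINT x|lebesgue_on (cube R). of_real (F x) * cis (wave R k \<bullet> x))"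
    and R: "0 < R" and F: "L2 (lebesgue_on (cube R)) F" and K: "finite K"
  shows "(LINT x|lebesgue_on (cube R). (cmod (of_real (F x) - (\<Sum>k\<in>K. t k * cis (wave R k \<bullet> x))))\<^sup>2)
      = (LINT x|lebesgue_on (cube R). (F x)\<^sup>2) - 2 * Re (\<Sum>k\<in>K. t k * c k) + V * (\<Sum>k\<in>K. (cmod (t k))\<^sup>2)"
proof -
  let ?M = "lebesgue_on (cube R) :: (real^'n) measure"
  interpret finite_measure ?M by (rule finite_measure_cube)
  have ci: "integrable ?M (\<lambda>x. cis (w \<bullet> x))" for w
    by (rule integrable_const_bound[where B=1]) (auto simp: measurable_cis_wave)
  have [measurable]: "F \<in> borel_measurable ?M" using F by (simp add: L2_def)
  have F2: "integrable ?M (\<lambda>x. (F x)\<^sup>2)" using F by (simp add: L2_def)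
  have "\<bar>y\<bar> \<le> 1 + y\<^sup>2" for y :: real
    using zero_le_power2[of "\<bar>y\<bar> - 1"] by (simp add: power2_diff)
  then have F1: "integrable ?M F"
    by (intro Bochner_Integration.integrable_bound[where f="\<lambda>x. 1 + (F x)\<^sup>2" and g=F]) (use F2 in auto)
  have Fc: "integrable ?M (\<lambda>x. of_real (F x) * cis (w \<bullet> x))" for w
  proof (rule Bochner_Integration.integrable_bound[OF F1])
    show "(\<lambda>x. of_real (F x) * cis (w \<bullet> x)) \<in> borel_measurable ?M"
      using measurable_cis_wave by measurable
  qed (simp add: norm_mult)
  let ?T = "\<lambda>x. \<Sum>k\<in>K. t k * cis (wave R k \<bullet> x)"
  have pt: "(cmod (of_real (F x) - ?T x))\<^sup>2
      = (F x)\<^sup>2 - 2 * Re (\<Sum>k\<in>K. t k * (of_real (F x) * cis (wave R k \<bullet> x)))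
        + Re (\<Sum>k\<in>K. \<Sum>l\<in>K. t k * cnj (t l) * cis (wave R (k - l) \<bullet> x))" for x
  proof -
    have "(cmod (of_real y - z))\<^sup>2 = y\<^sup>2 - 2 * Re (of_real y * z) + Re (z * cnj z)" for y z
      unfolding cmod_power2 by (simp add: power2_eq_square algebra_simps)
    then have "(cmod (of_real (F x) - ?T x))\<^sup>2 = (F x)\<^sup>2 - 2 * Re (of_real (F x) * ?T x) + Re (?T x * cnj (?T x))" .
    also have "of_real (F x) * ?T x = (\<Sum>k\<in>K. t k * (of_real (F x) * cis (wave R k \<bullet> x)))"
      by (simp add: sum_distrib_left mult_ac)
    also have "?T x * cnj (?T x) = (\<Sum>k\<in>K. \<Sum>l\<in>K. t k * cnj (t l) * (cis (wave R k \<bullet> x) * cnj (cis (wave R l \<bullet> x))))"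
      by (simp add: sum_product mult_ac)
    also have "(\<lambda>k l. cis (wave R k \<bullet> x) * cnj (cis (wave R l \<bullet> x))) = (\<lambda>k l. cis (wave R (k - l) \<bullet> x))"
      by (simp add: wave_diff inner_diff_left cis_cnj cis_mult fun_eq_iff)
    then have "(\<Sum>k\<in>K. \<Sum>l\<in>K. t k * cnj (t l) * (cis (wave R k \<bullet> x) * cnj (cis (wave R l \<bullet> x))))
        = (\<Sum>k\<in>K. \<Sum>l\<in>K. t k * cnj (t l) * cis (wave R (k - l) \<bullet> x))"
      by (auto simp: fun_eq_iff)
    finally show ?thesis .
  qed
  have i1: "integrable ?M (\<lambda>x. \<Sum>k\<in>K. t k * (of_real (F x) * cis (wave R k \<bullet> x)))"
    using Fc by auto
  have i2: "integrable ?M (\<lambda>x. \<Sum>k\<in>K. \<Sum>l\<in>K. t k * cnj (t l) * cis (wave R (k - l) \<bullet> x))"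
    using ci by auto
  have "(LINT x|?M. (cmod (of_real (F x) - ?T x))\<^sup>2)
     = (LINT x|?M. (F x)\<^sup>2) - 2 * Re (LINT x|?M. (\<Sum>k\<in>K. t k * (of_real (F x) * cis (wave R k \<bullet> x))))
       + Re (LINT x|?M. (\<Sum>k\<in>K. \<Sum>l\<in>K. t k * cnj (t l) * cis (wave R (k - l) \<bullet> x)))"
    unfolding pt using F2 integrable_Re[OF i1] integrable_Re[OF i2] integral_Re[OF i1] integral_Re[OF i2]
    by (simp del: Re_sum)
  also have "(LINT x|?M. (\<Sum>k\<in>K. t k * (of_real (F x) * cis (wave R k \<bullet> x)))) = (\<Sum>k\<in>K. t k * c k)"
    using Fc by (simp add: c_def)
  also have "(LINT x|?M. (\<Sum>k\<in>K. \<Sum>l\<in>K. t k * cnj (t l) * cis (wave R (k - l) \<bullet> x)))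
      = (\<Sum>k\<in>K. \<Sum>l\<in>K. t k * cnj (t l) * (if k - l = 0 then V else 0))"
  proof -
    have "(LINT x|?M. cis (wave R (k - l) \<bullet> x)) = (if k - l = 0 then V else 0)" for k l
      unfolding V_def by (rule waves_orthogonal[OF R])
    then show ?thesis using ci by simp
  qed
  also have "\<dots> = (\<Sum>k\<in>K. V * (cmod (t k))\<^sup>2)"
  proof -
    have "t k * cnj (t l) * complex_of_real (if k - l = 0 then V else 0)
        = (if k = l then complex_of_real (V * (cmod (t k))\<^sup>2) else 0)" for k l
      using complex_norm_square[of "t k"] by (cases "k = l") simp_all
    then show ?thesis using K by simp
  qed
  finally show ?thesis by (simp add: sum_distrib_left)
qed

text \<open>Measurable functions are pointwise limits of continuous functions. Truncation at a
  large height \<open>m\<close> costs little in norm and makes these limits dominated. The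
  function \<open>cut\<close> is \<open>1\<close> on the ball that contains
  \<open>\<Omega>\<close> and vanishes on the faces, whose points have norm at least
  \<open>R\<close>.\<close>

lemma L2_approx_vanishing_on_faces:
  fixes f :: "real^'n::finite \<Rightarrow> real"
  assumes \<Omega>: "\<Omega> \<in> sets lebesgue" "\<Omega> \<subseteq> cball 0 r" and r: "0 < r" "r < R"
    and f: "L2 (lebesgue_on \<Omega>) f" and e: "0 < e"
  shows "\<exists>h. continuous_on UNIV h \<and> (\<forall>x i. \<bar>x $ i\<bar> = R \<longrightarrow> h x = 0) \<and>
     (LINT x|lebesgue_on (cube R). ((if x \<in> \<Omega> then f x else 0) - h x)\<^sup>2) < e"
proof -
  let ?M = "lebesgue_on (cube R) :: (real^'n) measure"
  interpret finite_measure ?M by (rule finite_measure_cube)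
  define F where "F x = (if x \<in> \<Omega> then f x else 0)" for x
  have sub: "\<Omega> \<subseteq> cube R"
  proof
    fix x assume "x \<in> \<Omega>"
    then have "\<bar>x $ i\<bar> \<le> R" for i using \<Omega>(2) r component_le_norm_cart[of x i] by force
    then show "x \<in> cube R" by (simp add: cube_def mem_box_cart abs_le_iff minus_le_iff)
  qed
  have cube: "cube R \<in> sets lebesgue" by (simp add: cube_def)
  have FL2: "L2 ?M F" unfolding F_def by (rule L2_lebesgue_on_extend[OF sub \<Omega>(1) cube f])
  then have [measurable]: "F \<in> borel_measurable ?M" by (simp add: L2_def)
  have "F \<in> borel_measurable lebesgue"
    using f \<Omega>(1) unfolding F_def by (subst borel_measurable_if) (auto simp: L2_def)
  then obtain N g where N: "negligible N" and g: "\<And>n. continuous_on UNIV (g n)"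
      and lim: "\<And>x. x \<notin> N \<Longrightarrow> (\<lambda>n. g n x) \<longlonglongrightarrow> F x"
    using lebesgue_measurable_imp_measurable_on_real[of F UNIV] unfolding measurable_on_def by auto
  have "AE x in lebesgue. x \<notin> N"
    using N unfolding negligible_iff_null_sets by (rule AE_not_in)
  then have AE_N: "AE x in ?M. x \<notin> N"
    by (auto simp: AE_restrict_space_iff cube elim: eventually_mono)
  define clamp where "clamp m y = max (- real m) (min (real m) y)" for m :: nat and y
  have clamp_cont: "continuous_on UNIV (clamp m)" for m
    unfolding clamp_def by (intro continuous_intros)
  have clamp_meas: "clamp m \<in> borel_measurable borel" for m
    by (rule borel_measurable_continuous_onI[OF clamp_cont])
  have clamp_bound: "\<bar>clamp m y\<bar> \<le> m" for m y unfolding clamp_def by auto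
  have "(\<lambda>m. LINT x|?M. (F x - clamp m (F x))\<^sup>2) \<longlonglongrightarrow> (LINT x|?M. 0)"
  proof (rule integral_dominated_convergence[where w="\<lambda>x. (F x)\<^sup>2"])
    show "integrable ?M (\<lambda>x. (F x)\<^sup>2)" using FL2 by (simp add: L2_def)
    show "AE x in ?M. (\<lambda>m. (F x - clamp m (F x))\<^sup>2) \<longlonglongrightarrow> 0"
    proof (intro AE_I2)
      fix x
      obtain m0 :: nat where "\<bar>F x\<bar> \<le> real m0" using real_arch_simple by blast
      then have "\<forall>\<^sub>F m in sequentially. (F x - clamp m (F x))\<^sup>2 = 0"
        unfolding eventually_sequentially clamp_def by (intro exI[of _ m0]) auto
      then show "(\<lambda>m. (F x - clamp m (F x))\<^sup>2) \<longlonglongrightarrow> 0" by (rule tendsto_eventually)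
    qed
    show "AE x in ?M. norm ((F x - clamp m (F x))\<^sup>2) \<le> (F x)\<^sup>2" for m
      by (intro AE_I2) (auto simp: clamp_def abs_le_square_iff[symmetric])
    show "(\<lambda>x. (F x - clamp m (F x))\<^sup>2) \<in> borel_measurable ?M" for m
      using clamp_meas[of m] by measurable
  qed simp
  then have "\<forall>\<^sub>F m in sequentially. (LINT x|?M. (F x - clamp m (F x))\<^sup>2) < e / 4"
    using e by (intro order_tendstoD(2)) auto
  then obtain m where m: "(LINT x|?M. (F x - clamp m (F x))\<^sup>2) < e / 4"
    using eventually_happens'[OF sequentially_bot] by blast
  define cut :: "real^'n \<Rightarrow> real" where "cut x = max 0 (min 1 ((R - norm x) / (R - r)))" for x
  have cut_cont: "continuous_on UNIV cut" unfolding cut_def using r by (intro continuous_intros) auto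
  have cut01: "0 \<le> cut x" "cut x \<le> 1" for x by (auto simp: cut_def)
  have cut1: "cut x = 1" if "x \<in> \<Omega>" for x
  proof -
    have "norm x \<le> r" using \<Omega>(2) that by auto
    then show ?thesis using r by (simp add: cut_def field_simps)
  qed
  define h where "h n x = cut x * clamp m (g n x)" for n x
  have h_cont: "continuous_on UNIV (h n)" for n
    unfolding h_def by (intro continuous_intros cut_cont continuous_on_compose2[OF clamp_cont g]) auto
  have h_meas: "h n \<in> borel_measurable ?M" for n
    using h_cont by (auto intro!: measurable_restrict_space1 measurable_completion borel_measurable_continuous_onI)
  have h_bound: "\<bar>h n x\<bar> \<le> m" for n x
    using mult_mono[OF cut01(2)[of x] clamp_bound[of m "g n x"]] cut01(1)[of x] by (simp add: h_def abs_mult)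
  have "(\<lambda>n. LINT x|?M. (clamp m (F x) - h n x)\<^sup>2) \<longlonglongrightarrow> (LINT x|?M. 0)"
  proof (rule integral_dominated_convergence[where w="\<lambda>_. (2 * real m)\<^sup>2"])
    show "AE x in ?M. (\<lambda>n. (clamp m (F x) - h n x)\<^sup>2) \<longlonglongrightarrow> 0"
      using AE_N
    proof eventually_elim
      case (elim x)
      have "isCont (clamp m) (F x)" using clamp_cont by (simp add: continuous_on_eq_continuous_at)
      from tendsto_mult[OF tendsto_const isCont_tendsto_compose[OF this lim[OF elim]], of "cut x"]
      have "(\<lambda>n. h n x) \<longlonglongrightarrow> cut x * clamp m (F x)" by (simp add: h_def)
      also have "cut x * clamp m (F x) = clamp m (F x)"
        using cut1[of x] by (cases "x \<in> \<Omega>") (auto simp: F_def clamp_def)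
      finally have "(\<lambda>n. (clamp m (F x) - h n x)\<^sup>2) \<longlonglongrightarrow> (clamp m (F x) - clamp m (F x))\<^sup>2"
        by (intro tendsto_intros)
      then show ?case by simp
    qed
    show "AE x in ?M. norm ((clamp m (F x) - h n x)\<^sup>2) \<le> (2 * real m)\<^sup>2" for n
    proof (intro AE_I2)
      fix x
      have "\<bar>clamp m (F x) - h n x\<bar> \<le> 2 * real m"
        using clamp_bound[of m "F x"] h_bound[of n x] by linarith
      then show "norm ((clamp m (F x) - h n x)\<^sup>2) \<le> (2 * real m)\<^sup>2"
        using power_mono[of "\<bar>clamp m (F x) - h n x\<bar>" "2 * real m" 2] by simp
    qed
    show "(\<lambda>x. (clamp m (F x) - h n x)\<^sup>2) \<in> borel_measurable ?M" for n
      using clamp_meas[of m] h_meas[of n] by measurable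
  qed auto
  then have "\<forall>\<^sub>F n in sequentially. (LINT x|?M. (clamp m (F x) - h n x)\<^sup>2) < e / 4"
    using e by (intro order_tendstoD(2)) auto
  then obtain n where n: "(LINT x|?M. (clamp m (F x) - h n x)\<^sup>2) < e / 4"
    using eventually_happens'[OF sequentially_bot] by blast
  have i1: "integrable ?M (\<lambda>x. (F x - clamp m (F x))\<^sup>2)"
    by (rule Bochner_Integration.integrable_bound[OF L2_sq_integrable[OF FL2]])
       (use clamp_meas[of m] in \<open>auto simp: clamp_def abs_le_square_iff[symmetric] intro!: AE_I2\<close>)
  have i2: "integrable ?M (\<lambda>x. (clamp m (F x) - h n x)\<^sup>2)"
  proof (rule integrable_const_bound[where B="(2 * real m)\<^sup>2"])
    show "AE x in ?M. norm ((clamp m (F x) - h n x)\<^sup>2) \<le> (2 * real m)\<^sup>2"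
    proof (intro AE_I2)
      fix x
      have "\<bar>clamp m (F x) - h n x\<bar> \<le> 2 * real m"
        using clamp_bound[of m "F x"] h_bound[of n x] by linarith
      then show "norm ((clamp m (F x) - h n x)\<^sup>2) \<le> (2 * real m)\<^sup>2"
        using power_mono[of "\<bar>clamp m (F x) - h n x\<bar>" "2 * real m" 2] by simp
    qed
  qed (use clamp_meas[of m] h_meas[of n] in measurable)
  have "(LINT x|?M. (F x - h n x)\<^sup>2) \<le> (LINT x|?M. 2 * (F x - clamp m (F x))\<^sup>2 + 2 * (clamp m (F x) - h n x)\<^sup>2)"
  proof (rule integral_mono')
    fix x
    show "(F x - h n x)\<^sup>2 \<le> 2 * (F x - clamp m (F x))\<^sup>2 + 2 * (clamp m (F x) - h n x)\<^sup>2"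
      using sum_squares_bound[of "F x - clamp m (F x)" "clamp m (F x) - h n x"]
      by (simp add: power2_eq_square algebra_simps)
  qed (use i1 i2 in auto)
  also have "\<dots> < e" using i1 i2 m n by simp
  finally have "(LINT x|?M. (F x - h n x)\<^sup>2) < e" .
  moreover have "h n x = 0" if "\<bar>x $ i\<bar> = R" for x i
  proof -
    have "R \<le> norm x" using component_le_norm_cart[of x i] that by simp
    then have "cut x = 0" using r by (simp add: cut_def divide_nonpos_pos)
    then show ?thesis by (simp add: h_def)
  qed
  ultimately show ?thesis using h_cont unfolding F_def by blast
qed


subsection \<open>Bessel's inequality and Parseval's identity\<close>

definition cos_mode :: "real \<Rightarrow> (real^'n::finite) set \<Rightarrow> (real^'n \<Rightarrow> 'b::euclidean_space) \<Rightarrow> int^'n \<Rightarrow> 'b" where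
  "cos_mode R \<Omega> f k = (LINT x|lebesgue_on \<Omega>. cos (wave R k \<bullet> x) *\<^sub>R f x)"

definition sin_mode :: "real \<Rightarrow> (real^'n::finite) set \<Rightarrow> (real^'n \<Rightarrow> 'b::euclidean_space) \<Rightarrow> int^'n \<Rightarrow> 'b" where
  "sin_mode R \<Omega> f k = (LINT x|lebesgue_on \<Omega>. sin (wave R k \<bullet> x) *\<^sub>R f x)"

definition mode_sq :: "real \<Rightarrow> (real^'n::finite) set \<Rightarrow> (real^'n \<Rightarrow> 'b::euclidean_space) \<Rightarrow> int^'n \<Rightarrow> real" where
  "mode_sq R \<Omega> f k = (norm (cos_mode R \<Omega> f k))\<^sup>2 + (norm (sin_mode R \<Omega> f k))\<^sup>2"

lemma mode_sq_nonneg: "0 \<le> mode_sq R \<Omega> f k"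
  by (simp add: mode_sq_def)

lemma finite_measure_lebesgue_on_bounded:
  "\<Omega> \<in> sets lebesgue \<Longrightarrow> bounded \<Omega> \<Longrightarrow> finite_measure (lebesgue_on \<Omega>)"
  by (intro finite_measure_lebesgue_on bounded_set_imp_lmeasurable)

lemma L2_bounded_continuous:
  fixes h :: "'a::euclidean_space \<Rightarrow> 'b::euclidean_space"
  assumes \<Omega>: "\<Omega> \<in> sets lebesgue" "bounded \<Omega>" and h: "continuous_on UNIV h"
  shows "L2 (lebesgue_on \<Omega>) h"
proof -
  interpret finite_measure "lebesgue_on \<Omega>" by (rule finite_measure_lebesgue_on_bounded[OF \<Omega>])
  have m: "h \<in> borel_measurable (lebesgue_on \<Omega>)"
    using h by (auto intro!: measurable_restrict_space1 measurable_completion borel_measurable_continuous_onI)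
  have "compact (h ` closure \<Omega>)"
    using \<Omega>(2) by (intro compact_continuous_image continuous_on_subset[OF h]) auto
  then obtain K where "\<forall>y\<in>h ` closure \<Omega>. norm y \<le> K"
    using compact_imp_bounded bounded_iff by blast
  then have K: "norm (h x) \<le> K" if "x \<in> \<Omega>" for x
    using that closure_subset by blast
  have "integrable (lebesgue_on \<Omega>) (\<lambda>x. (norm (h x))\<^sup>2)"
  proof (rule integrable_const_bound[where B="K\<^sup>2"])
    show "AE x in lebesgue_on \<Omega>. norm ((norm (h x))\<^sup>2) \<le> K\<^sup>2"
      using K by (intro AE_I2) (simp add: power_mono)
  qed (use m in measurable)
  then show ?thesis using m by (simp add: L2_def)
qed

lemma trig_coeff_integrable:
  fixes f :: "real^'n::finite \<Rightarrow> 'b::euclidean_space"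
  assumes "\<Omega> \<in> sets lebesgue" "bounded \<Omega>" "L2 (lebesgue_on \<Omega>) f"
  shows "integrable (lebesgue_on \<Omega>) (\<lambda>x. cos (w \<bullet> x) *\<^sub>R f x)"
    and "integrable (lebesgue_on \<Omega>) (\<lambda>x. sin (w \<bullet> x) *\<^sub>R f x)"
  using assms by (auto intro!: L2_bilinear_integrable[OF bounded_bilinear_scaleR] L2_bounded_continuous continuous_intros)

lemma mode_sq_components:
  fixes f :: "real^'n::finite \<Rightarrow> 'b::euclidean_space"
  assumes "\<Omega> \<in> sets lebesgue" "bounded \<Omega>" "L2 (lebesgue_on \<Omega>) f"
  shows "mode_sq R \<Omega> f k = (\<Sum>b\<in>Basis. mode_sq R \<Omega> (\<lambda>x. f x \<bullet> b) k)"
proof -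
  have *: "(norm v)\<^sup>2 = (\<Sum>b\<in>Basis. (v \<bullet> b)\<^sup>2)" for v :: 'b
    by (simp add: power2_norm_eq_inner) (simp add: euclidean_inner[of v v] power2_eq_square)
  have "cos_mode R \<Omega> f k \<bullet> b = cos_mode R \<Omega> (\<lambda>x. f x \<bullet> b) k"
    "sin_mode R \<Omega> f k \<bullet> b = sin_mode R \<Omega> (\<lambda>x. f x \<bullet> b) k" for b
    unfolding cos_mode_def sin_mode_def
    using trig_coeff_integrable[OF assms, of "wave R k"]
    by (simp_all flip: Bochner_Integration.integral_inner_left)
  then show ?thesis
    unfolding mode_sq_def * by (simp add: sum.distrib)
qed

lemma l2n_components:
  fixes f :: "'a \<Rightarrow> 'b::euclidean_space"
  assumes "L2 M f"
  shows "(l2n M f)\<^sup>2 = (\<Sum>b\<in>Basis. (l2n M (\<lambda>x. f x \<bullet> b))\<^sup>2)"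
proof -
  have "(norm v)\<^sup>2 = (\<Sum>b\<in>Basis. (v \<bullet> b)\<^sup>2)" for v :: 'b
    by (simp add: power2_norm_eq_inner) (simp add: euclidean_inner[of v v] power2_eq_square)
  then show ?thesis
    using L2_sq_integrable[OF L2_component[OF assms]] by (simp add: l2n_power2)
qed

lemma mode_sq_real:
  fixes f :: "real^'n::finite \<Rightarrow> real"
  assumes \<Omega>: "\<Omega> \<in> sets lebesgue" "bounded \<Omega>" "\<Omega> \<subseteq> cube R" and f: "L2 (lebesgue_on \<Omega>) f"
  shows "(cmod (LINT x|lebesgue_on (cube R). of_real (if x \<in> \<Omega> then f x else 0) * cis (wave R k \<bullet> x)))\<^sup>2
      = mode_sq R \<Omega> f k"
proof -
  have "(LINT x|lebesgue_on (cube R). of_real (if x \<in> \<Omega> then f x else 0) * cis (wave R k \<bullet> x))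
     = (LINT x|lebesgue_on (cube R). (if x \<in> \<Omega> then of_real (f x) * cis (wave R k \<bullet> x) else 0))"
    by (rule Bochner_Integration.integral_cong) auto
  also have "\<dots> = (LINT x|lebesgue_on \<Omega>. of_real (f x) * cis (wave R k \<bullet> x))"
    using \<Omega> by (intro integral_lebesgue_on_extend) (auto simp: cube_def)
  also have "(\<lambda>x. of_real (f x) * cis (wave R k \<bullet> x)) = (\<lambda>x. of_real (cos (wave R k \<bullet> x) *\<^sub>R f x)
      + \<i> * of_real (sin (wave R k \<bullet> x) *\<^sub>R f x))"
    by (auto simp: fun_eq_iff complex_eq_iff)
  also have "(LINT x|lebesgue_on \<Omega>. complex_of_real (cos (wave R k \<bullet> x) *\<^sub>R f x)
      + \<i> * of_real (sin (wave R k \<bullet> x) *\<^sub>R f x)) = of_real (cos_mode R \<Omega> f k) + \<i> * of_real (sin_mode R \<Omega> f k)"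
    unfolding cos_mode_def sin_mode_def
    using trig_coeff_integrable[OF \<Omega>(1,2) f, of "wave R k"]
    by (subst Bochner_Integration.integral_add) (auto simp del: of_real_mult real_scaleR_def)
  finally show ?thesis by (simp add: mode_sq_def cmod_power2)
qed

text \<open>Completing the square, the squared distance of \<open>f\<close> to a trigonometric
  polynomial is the defect in Bessel's inequality plus a weighted sum of squared deviations of its
  coefficients from the optimal ones, \<open>cnj c / V\<close>. The optimal polynomial gives
  Bessel's inequality; an approximating polynomial shows that the defect becomes arbitrarily
  small.\<close>

lemma Bessel_Parseval_real:
  fixes f :: "real^'n::finite \<Rightarrow> real"
  assumes \<Omega>: "\<Omega> \<in> sets lebesgue" "\<Omega> \<subseteq> cball 0 r" and r: "0 < r" "r < R" and f: "L2 (lebesgue_on \<Omega>) f"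
  defines "V \<equiv> (2 * R) ^ CARD('n)"
  shows "finite K \<Longrightarrow> (\<Sum>k\<in>K. mode_sq R \<Omega> f k) \<le> V * (l2n (lebesgue_on \<Omega>) f)\<^sup>2"
    and "0 < e \<Longrightarrow> \<exists>K. finite K \<and> V * (l2n (lebesgue_on \<Omega>) f)\<^sup>2 \<le> (\<Sum>k\<in>K. mode_sq R \<Omega> f k) + e"
proof -
  let ?M = "lebesgue_on (cube R) :: (real^'n) measure"
  interpret finite_measure ?M by (rule finite_measure_cube)
  have R: "0 < R" and V: "0 < V" using r by (auto simp: V_def)
  have bdd: "bounded \<Omega>" using \<Omega>(2) bounded_subset by blast
  define F where "F x = (if x \<in> \<Omega> then f x else 0)" for x
  have sub: "\<Omega> \<subseteq> cube R"
  proof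
    fix x assume "x \<in> \<Omega>"
    then have "\<bar>x $ i\<bar> \<le> R" for i using \<Omega>(2) r component_le_norm_cart[of x i] by force
    then show "x \<in> cube R" by (simp add: cube_def mem_box_cart abs_le_iff minus_le_iff)
  qed
  have cube: "cube R \<in> sets lebesgue" by (simp add: cube_def)
  have FL2: "L2 ?M F" unfolding F_def by (rule L2_lebesgue_on_extend[OF sub \<Omega>(1) cube f])
  have F2: "(LINT x|?M. (F x)\<^sup>2) = (l2n (lebesgue_on \<Omega>) f)\<^sup>2"
    unfolding l2n_power2 F_def
    by (subst integral_lebesgue_on_extend[OF sub \<Omega>(1) cube, symmetric])
       (auto intro!: Bochner_Integration.integral_cong)
  define c where "c k = (LINT x|?M. of_real (F x) * cis (wave R k \<bullet> x))" for k
  have c: "(cmod (c k))\<^sup>2 = mode_sq R \<Omega> f k" for k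
    unfolding c_def F_def by (rule mode_sq_real[OF \<Omega>(1) bdd sub f])
  note dist = trig_distance[OF V_def[THEN meta_eq_to_obj_eq] c_def R FL2]
  have square: "V * (cmod (z - cnj w / V))\<^sup>2 = V * (cmod z)\<^sup>2 - 2 * Re (z * w) + (cmod w)\<^sup>2 / V" for z w
    unfolding cmod_power2 using V by (simp add: power2_eq_square field_simps)
  have defect: "(LINT x|?M. (cmod (of_real (F x) - (\<Sum>k\<in>K. t k * cis (wave R k \<bullet> x))))\<^sup>2)
      = (l2n (lebesgue_on \<Omega>) f)\<^sup>2 - (\<Sum>k\<in>K. mode_sq R \<Omega> f k) / V + (\<Sum>k\<in>K. V * (cmod (t k - cnj (c k) / V))\<^sup>2)"
    if "finite K" for K t
    unfolding square dist[OF that] F2 c[symmetric]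
    by (simp add: sum.distrib sum_subtractf sum_distrib_left sum_divide_distrib)
  show "(\<Sum>k\<in>K. mode_sq R \<Omega> f k) \<le> V * (l2n (lebesgue_on \<Omega>) f)\<^sup>2" if "finite K"
  proof -
    have "0 \<le> (LINT x|?M. (cmod (of_real (F x) - (\<Sum>k\<in>K. cnj (c k) / V * cis (wave R k \<bullet> x))))\<^sup>2)" by simp
    also note defect[OF that]
    finally show ?thesis using V by (simp add: field_simps)
  qed
  show "\<exists>K. finite K \<and> V * (l2n (lebesgue_on \<Omega>) f)\<^sup>2 \<le> (\<Sum>k\<in>K. mode_sq R \<Omega> f k) + e" if e: "0 < e"
  proof -
    obtain h where h: "continuous_on UNIV h" "\<And>x i. \<bar>x $ i\<bar> = R \<Longrightarrow> h x = 0"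
        and hF: "(LINT x|?M. (F x - h x)\<^sup>2) < e / (4 * V)"
      using L2_approx_vanishing_on_faces[OF \<Omega> r f, of "e / (4 * V)"] e V unfolding F_def by auto
    define d where "d = sqrt (e / (4 * V * (measure ?M (cube R) + 1)))"
    have d: "0 < d" using e V measure_nonneg[of ?M "cube R"] by (auto simp: d_def intro!: divide_pos_pos mult_pos_pos add_nonneg_pos)
    obtain T where T: "trig_poly R T" "\<And>x. x \<in> cube R \<Longrightarrow> cmod (of_real (h x) - T x) < d"
      using trig_poly_uniform_approx[OF R continuous_on_subset[OF h(1) subset_UNIV] _ d] h(2) by blast
    obtain K t where K: "finite K" "T = (\<lambda>x. \<Sum>k\<in>K. t k * cis (wave R k \<bullet> x))"
      using trig_poly_expansion[OF T(1)] by blast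
    have hL2: "L2 ?M h" by (rule L2_bounded_continuous[OF cube _ h(1)]) (simp add: cube_def)
    have i: "integrable ?M (\<lambda>x. (F x - h x)\<^sup>2)" using L2_diff[OF FL2 hL2] by (simp add: L2_def)
    have "(LINT x|?M. (cmod (of_real (F x) - T x))\<^sup>2) \<le> (LINT x|?M. 2 * (F x - h x)\<^sup>2 + 2 * d\<^sup>2)"
    proof (rule integral_mono')
      fix x assume "x \<in> space ?M"
      then have x: "cmod (of_real (h x) - T x) \<le> d" using T(2) by fastforce
      have "cmod (of_real (F x) - T x) \<le> \<bar>F x - h x\<bar> + d"
        using norm_triangle_ineq[of "of_real (F x - h x)" "of_real (h x) - T x"] x
        by (simp del: of_real_diff) (simp add: algebra_simps)
      then have "(cmod (of_real (F x) - T x))\<^sup>2 \<le> (\<bar>F x - h x\<bar> + d)\<^sup>2" by (intro power_mono) auto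
      also have "\<dots> \<le> 2 * (F x - h x)\<^sup>2 + 2 * d\<^sup>2"
        using sum_squares_bound[of "\<bar>F x - h x\<bar>" d] by (simp add: power2_sum)
      finally show "(cmod (of_real (F x) - T x))\<^sup>2 \<le> 2 * (F x - h x)\<^sup>2 + 2 * d\<^sup>2" .
    qed (use i in auto)
    also have "\<dots> = 2 * (LINT x|?M. (F x - h x)\<^sup>2) + 2 * d\<^sup>2 * measure ?M (cube R)"
      using i by simp
    also have "\<dots> \<le> e / V"
    proof -
      have "d\<^sup>2 * (measure ?M (cube R) + 1) = e / (4 * V)"
      proof -
        have "0 < measure ?M (cube R) + 1" using measure_nonneg[of ?M "cube R"] by linarith
        then show ?thesis using e V unfolding d_def by simp
      qed
      then have "d\<^sup>2 * measure ?M (cube R) \<le> e / (4 * V)"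
        using zero_le_power2[of d] unfolding distrib_left mult_1_right by linarith
      then show ?thesis using hF by (simp add: field_simps)
    qed
    finally have "(l2n (lebesgue_on \<Omega>) f)\<^sup>2 - (\<Sum>k\<in>K. mode_sq R \<Omega> f k) / V
        + (\<Sum>k\<in>K. V * (cmod (t k - cnj (c k) / V))\<^sup>2) \<le> e / V"
      unfolding K(2) defect[OF K(1)] .
    moreover have "0 \<le> (\<Sum>k\<in>K. V * (cmod (t k - cnj (c k) / V))\<^sup>2)"
      using V by (intro sum_nonneg) auto
    ultimately have "(l2n (lebesgue_on \<Omega>) f)\<^sup>2 - (\<Sum>k\<in>K. mode_sq R \<Omega> f k) / V \<le> e / V" by linarith
    then have "(l2n (lebesgue_on \<Omega>) f)\<^sup>2 \<le> ((\<Sum>k\<in>K. mode_sq R \<Omega> f k) + e) / V"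
      by (simp add: add_divide_distrib)
    then have "V * (l2n (lebesgue_on \<Omega>) f)\<^sup>2 \<le> (\<Sum>k\<in>K. mode_sq R \<Omega> f k) + e"
      using V by (simp add: pos_le_divide_eq mult.commute)
    then show ?thesis using K(1) by blast
  qed
qed

lemma Bessel_Parseval:
  fixes f :: "real^'n::finite \<Rightarrow> 'b::euclidean_space"
  assumes \<Omega>: "\<Omega> \<in> sets lebesgue" "\<Omega> \<subseteq> cball 0 r" and r: "0 < r" "r < R" and f: "L2 (lebesgue_on \<Omega>) f"
  defines "V \<equiv> (2 * R) ^ CARD('n)"
  shows "finite K \<Longrightarrow> (\<Sum>k\<in>K. mode_sq R \<Omega> f k) \<le> V * (l2n (lebesgue_on \<Omega>) f)\<^sup>2"
    and "0 < e \<Longrightarrow> \<exists>K. finite K \<and> V * (l2n (lebesgue_on \<Omega>) f)\<^sup>2 \<le> (\<Sum>k\<in>K. mode_sq R \<Omega> f k) + e"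
proof -
  have bdd: "bounded \<Omega>" using \<Omega>(2) bounded_subset by blast
  note BP = Bessel_Parseval_real[OF \<Omega> r L2_component[OF f], folded V_def]
  have modes: "(\<Sum>k\<in>K. mode_sq R \<Omega> f k) = (\<Sum>b\<in>Basis. \<Sum>k\<in>K. mode_sq R \<Omega> (\<lambda>x. f x \<bullet> b) k)" for K
    unfolding mode_sq_components[OF \<Omega>(1) bdd f] by (rule sum.swap)
  show "(\<Sum>k\<in>K. mode_sq R \<Omega> f k) \<le> V * (l2n (lebesgue_on \<Omega>) f)\<^sup>2" if "finite K"
    unfolding modes l2n_components[OF f] sum_distrib_left by (intro sum_mono BP(1) that)
  show "\<exists>K. finite K \<and> V * (l2n (lebesgue_on \<Omega>) f)\<^sup>2 \<le> (\<Sum>k\<in>K. mode_sq R \<Omega> f k) + e" if e: "0 < e"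
  proof -
    define e' where "e' = e / DIM('b)"
    have "0 < e'" using e by (simp add: e'_def)
    then obtain K where K: "\<And>b. finite (K b)"
      "\<And>b. V * (l2n (lebesgue_on \<Omega>) (\<lambda>x. f x \<bullet> b))\<^sup>2 \<le> (\<Sum>k\<in>K b. mode_sq R \<Omega> (\<lambda>x. f x \<bullet> b) k) + e'"
      using BP(2) by metis
    let ?K = "\<Union>b\<in>Basis. K b"
    have fin: "finite ?K" by (intro finite_UN_I K(1)) auto
    have "V * (l2n (lebesgue_on \<Omega>) f)\<^sup>2 \<le> (\<Sum>b\<in>Basis. (\<Sum>k\<in>?K. mode_sq R \<Omega> (\<lambda>x. f x \<bullet> b) k) + e')"
      unfolding l2n_components[OF f] sum_distrib_left
    proof (rule sum_mono)
      fix b :: 'b assume "b \<in> Basis"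
      then have "(\<Sum>k\<in>K b. mode_sq R \<Omega> (\<lambda>x. f x \<bullet> b) k) \<le> (\<Sum>k\<in>?K. mode_sq R \<Omega> (\<lambda>x. f x \<bullet> b) k)"
        using fin by (intro sum_mono2) (auto simp: mode_sq_nonneg)
      then show "V * (l2n (lebesgue_on \<Omega>) (\<lambda>x. f x \<bullet> b))\<^sup>2 \<le> (\<Sum>k\<in>?K. mode_sq R \<Omega> (\<lambda>x. f x \<bullet> b) k) + e'"
        using K(2)[of b] by linarith
    qed
    also have "\<dots> = (\<Sum>k\<in>?K. mode_sq R \<Omega> f k) + e"
      by (simp add: modes sum.distrib e'_def)
    finally show ?thesis using fin by blast
  qed
qed

text \<open>An estimate between the Fourier modes of \<open>f\<close> and \<open>g\<close>, for non-zero frequencies only, is an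
  estimate between their norms: as \<open>\<Omega>\<close> fills at most half of the cube, the zero mode carries at most
  half of the norm of \<open>f\<close> and can be absorbed.\<close>

lemma l2n_le_of_modes:
  fixes f :: "real^'n::finite \<Rightarrow> 'b::euclidean_space" and g :: "real^'n \<Rightarrow> 'c::euclidean_space"
  assumes \<Omega>: "\<Omega> \<in> sets lebesgue" "\<Omega> \<subseteq> cball 0 r" and r: "0 < r" and R: "R = 2 * r"
    and f: "L2 (lebesgue_on \<Omega>) f" and g: "L2 (lebesgue_on \<Omega>) g" and A: "0 \<le> A"
    and modes: "\<And>k. k \<noteq> 0 \<Longrightarrow> mode_sq R \<Omega> f k \<le> A * mode_sq R \<Omega> g k"
  shows "(l2n (lebesgue_on \<Omega>) f)\<^sup>2 \<le> 2 * A * (l2n (lebesgue_on \<Omega>) g)\<^sup>2"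
proof -
  let ?M = "lebesgue_on \<Omega>"
  have bdd: "bounded \<Omega>" using \<Omega>(2) bounded_subset by blast
  interpret finite_measure ?M by (rule finite_measure_lebesgue_on_bounded[OF \<Omega>(1) bdd])
  define V where "V = (2 * R) ^ CARD('n)"
  have V: "0 < V" and rR: "r < R" using r by (auto simp: V_def R)
  have one: "L2 ?M (\<lambda>_. 1 :: real)" by (simp add: L2_def)
  \<comment> \<open>\<open>\<Omega>\<close> lies in a cube of half the side length of \<open>cube
    R\<close>.\<close>
  have meas: "measure ?M \<Omega> \<le> V / 2"
  proof -
    have "\<Omega> \<subseteq> cube r"
    proof
      fix x assume "x \<in> \<Omega>"
      then have "\<bar>x $ i\<bar> \<le> r" for i using \<Omega>(2) component_le_norm_cart[of x i] by force
      then show "x \<in> cube r" by (simp add: cube_def mem_box_cart abs_le_iff minus_le_iff)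
    qed
    then have "measure lebesgue \<Omega> \<le> measure lebesgue (cube r :: (real^'n) set)"
      using \<Omega>(1) by (intro measure_mono_fmeasurable) (auto simp: cube_def)
    also have "\<dots> = (2 * r) ^ CARD('n)"
    proof -
      have "0 \<in> (cube r :: (real^'n) set)" using r by (simp add: cube_def mem_box_cart)
      then show ?thesis using r unfolding cube_def
        by (subst measure_completion, simp, subst content_cbox_cart) auto
    qed
    also have "\<dots> = V / 2 ^ CARD('n)"
      unfolding V_def R power_mult_distrib[of 2 "2 * r"] by simp
    also have "\<dots> \<le> V / 2"
      using V power_increasing[of 1 "CARD('n)" "2::real"] by (intro divide_left_mono) auto
    finally show ?thesis using \<Omega>(1) by (simp add: measure_restrict_space)
  qed
  have zero: "mode_sq R \<Omega> f 0 \<le> V / 2 * (l2n ?M f)\<^sup>2"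
  proof -
    have "norm (LINT x|?M. 1 *\<^sub>R f x) \<le> 1 * (l2n ?M (\<lambda>_. 1 :: real) * l2n ?M f)"
      by (rule bilinear_Cauchy_Schwarz_L2[OF bounded_bilinear_scaleR _ _ one f]) auto
    then have "(norm (LINT x|?M. f x))\<^sup>2 \<le> (l2n ?M (\<lambda>_. 1 :: real) * l2n ?M f)\<^sup>2"
      by (intro power_mono) auto
    also have "\<dots> = measure ?M \<Omega> * (l2n ?M f)\<^sup>2" by (simp add: power_mult_distrib l2n_power2[of ?M "\<lambda>_. 1"])
    also have "\<dots> \<le> V / 2 * (l2n ?M f)\<^sup>2" using meas by (intro mult_right_mono) auto
    finally show ?thesis
      by (simp add: mode_sq_def cos_mode_def sin_mode_def wave_def zero_vec_def[symmetric])
  qed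
  have "V / 2 * (l2n ?M f)\<^sup>2 \<le> A * (V * (l2n ?M g)\<^sup>2)"
  proof (rule field_le_epsilon)
    fix e :: real assume "0 < e"
    from Bessel_Parseval(2)[OF \<Omega> r rR f this] obtain K where K: "finite K"
      "V * (l2n ?M f)\<^sup>2 \<le> (\<Sum>k\<in>K. mode_sq R \<Omega> f k) + e" unfolding V_def by blast
    have "(\<Sum>k\<in>K. mode_sq R \<Omega> f k) \<le> mode_sq R \<Omega> f 0 + (\<Sum>k\<in>K - {0}. mode_sq R \<Omega> f k)"
      using K(1) mode_sq_nonneg[of R \<Omega> f 0] by (cases "0 \<in> K") (auto simp: sum.remove)
    also have "\<dots> \<le> V / 2 * (l2n ?M f)\<^sup>2 + (\<Sum>k\<in>K - {0}. A * mode_sq R \<Omega> g k)"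
      by (intro add_mono zero sum_mono modes) auto
    also have "(\<Sum>k\<in>K - {0}. A * mode_sq R \<Omega> g k) \<le> A * (V * (l2n ?M g)\<^sup>2)"
      unfolding sum_distrib_left[symmetric] V_def
      using Bessel_Parseval(1)[OF \<Omega> r rR g, of "K - {0}"] K(1) A by (intro mult_left_mono) auto
    finally show "V / 2 * (l2n ?M f)\<^sup>2 \<le> A * (V * (l2n ?M g)\<^sup>2) + e" using K(2) by linarith
  qed
  then show ?thesis using V by (simp add: field_simps)
qed

lemma AE_zero_of_modes:
  fixes f :: "real^'n::finite \<Rightarrow> 'b::euclidean_space"
  assumes \<Omega>: "\<Omega> \<in> sets lebesgue" "\<Omega> \<subseteq> cball 0 r" and r: "0 < r" "r < R"
    and f: "L2 (lebesgue_on \<Omega>) f" and modes: "\<And>k. mode_sq R \<Omega> f k = 0"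
  shows "AE x in lebesgue_on \<Omega>. f x = 0"
proof -
  define V where "V = (2 * R) ^ CARD('n)"
  have V: "0 < V" using r by (simp add: V_def)
  have "V * (l2n (lebesgue_on \<Omega>) f)\<^sup>2 \<le> 0"
    by (rule field_le_epsilon) (use Bessel_Parseval(2)[OF \<Omega> r f] modes in \<open>auto simp: V_def\<close>)
  then have "(LINT x|lebesgue_on \<Omega>. (norm (f x))\<^sup>2) \<le> 0"
    using V by (simp add: l2n_power2[symmetric] mult_le_0_iff)
  moreover have "0 \<le> (LINT x|lebesgue_on \<Omega>. (norm (f x))\<^sup>2)" by simp
  ultimately have "(LINT x|lebesgue_on \<Omega>. (norm (f x))\<^sup>2) = 0" by linarith
  then show ?thesis
    using f by (subst (asm) integral_nonneg_eq_0_iff_AE) (auto simp: L2_def)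
qed

section \<open>The surface measure\<close>

definition covers2 :: "real \<Rightarrow> (real^3) set \<Rightarrow> (nat \<Rightarrow> (real^3) set) set" where
  "covers2 \<delta> A = {C. A \<subseteq> (\<Union>i. C i) \<and> (\<forall>i. bounded (C i) \<and> diameter (C i) \<le> \<delta>)}"

definition area_sum :: "(nat \<Rightarrow> (real^3) set) \<Rightarrow> ennreal" where
  "area_sum C = (\<Sum>i. ennreal (pi / 4 * (diameter (C i))\<^sup>2))"

lemma hausdorff2_pre_eq: "hausdorff2_pre \<delta> A = (INF C\<in>covers2 \<delta> A. area_sum C)"
  by (simp add: hausdorff2_pre_def covers2_def area_sum_def)

lemma hausdorff2_pre_le: "C \<in> covers2 \<delta> A \<Longrightarrow> hausdorff2_pre \<delta> A \<le> area_sum C"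
  unfolding hausdorff2_pre_eq by (rule INF_lower)

lemma hausdorff2_pre_le_hausdorff2: "0 < \<delta> \<Longrightarrow> hausdorff2_pre \<delta> A \<le> hausdorff2 A"
  unfolding hausdorff2_def by (rule SUP_upper) simp

lemma hausdorff2_leI: "(\<And>\<delta>. 0 < \<delta> \<Longrightarrow> hausdorff2_pre \<delta> A \<le> b) \<Longrightarrow> hausdorff2 A \<le> b"
  unfolding hausdorff2_def by (rule SUP_least) simp

lemma hausdorff2_pre_antimono: "\<delta> \<le> \<delta>' \<Longrightarrow> hausdorff2_pre \<delta>' A \<le> hausdorff2_pre \<delta> A"
  unfolding hausdorff2_pre_eq by (rule INF_superset_mono) (auto simp: covers2_def intro: order_trans)

lemma hausdorff2_mono: "A \<subseteq> B \<Longrightarrow> hausdorff2 A \<le> hausdorff2 B"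
  unfolding hausdorff2_def hausdorff2_pre_eq
  by (intro SUP_mono' INF_superset_mono) (auto simp: covers2_def)

lemma hausdorff2_empty: "hausdorff2 {} = 0"
proof -
  have "hausdorff2_pre \<delta> {} \<le> 0" if "0 < \<delta>" for \<delta>
    using hausdorff2_pre_le[of "\<lambda>_. {}" \<delta> "{}"] that by (simp add: covers2_def area_sum_def)
  then show ?thesis using hausdorff2_leI[of "{}" 0] by simp
qed

lemma hausdorff2_countably_subadditive: "hausdorff2 (\<Union>i. A i) \<le> (\<Sum>i. hausdorff2 (A i))"
proof (rule hausdorff2_leI)
  fix \<delta> :: real assume \<delta>: "0 < \<delta>"
  show "hausdorff2_pre \<delta> (\<Union>i. A i) \<le> (\<Sum>i. hausdorff2 (A i))"
  proof (rule ennreal_le_epsilon)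
    fix e :: real assume e: "0 < e" and fin: "(\<Sum>i. hausdorff2 (A i)) < top"
    have "\<exists>C\<in>covers2 \<delta> (A n). area_sum C \<le> hausdorff2 (A n) + e * (1/2)^Suc n" for n
    proof -
      have "hausdorff2 (A n) < top" using fin by (auto dest!: ennreal_suminf_lessD)
      then have "hausdorff2_pre \<delta> (A n) < hausdorff2 (A n) + ennreal (e * (1/2)^Suc n)"
        using hausdorff2_pre_le_hausdorff2[OF \<delta>, of "A n"] e
        by (intro le_less_trans[OF _ ennreal_add_left_cancel_less[THEN iffD2, of _ 0, simplified add_0_right]]) auto
      then obtain C where "C \<in> covers2 \<delta> (A n)" "area_sum C < hausdorff2 (A n) + ennreal (e * (1/2)^Suc n)"
        unfolding hausdorff2_pre_eq INF_less_iff by blast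
      then show ?thesis using e by (auto simp: ennreal_mult intro: less_imp_le)
    qed
    then obtain B where B: "\<And>n. B n \<in> covers2 \<delta> (A n)"
      "\<And>n. area_sum (B n) \<le> hausdorff2 (A n) + e * (1/2)^Suc n" by metis
    define C where "C = case_prod B o prod_decode"
    have "(\<Union>i. A i) \<subseteq> (\<Union>i. C i)"
    proof
      fix x assume "x \<in> (\<Union>i. A i)"
      then obtain i where "x \<in> A i" by blast
      then obtain j where "x \<in> B i j" using B(1)[of i] by (auto simp: covers2_def)
      then have "x \<in> C (prod_encode (i, j))" by (simp add: C_def)
      then show "x \<in> (\<Union>i. C i)" by blast
    qed
    then have "C \<in> covers2 \<delta> (\<Union>i. A i)"
      using B(1) by (auto simp: covers2_def C_def split_def)
    then have "hausdorff2_pre \<delta> (\<Union>i. A i) \<le> area_sum C" by (rule hausdorff2_pre_le)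
    also have "\<dots> = (\<Sum>n. area_sum (B n))"
      unfolding area_sum_def C_def comp_def
      by (rule suminf_ennreal_2dimen[where f="\<lambda>(n, i). ennreal (pi / 4 * (diameter (B n i))\<^sup>2)",
            simplified split_def, symmetric, THEN sym, THEN trans[rotated]]) (auto simp: split_def)
    also have "\<dots> \<le> (\<Sum>n. hausdorff2 (A n) + e * (1/2) ^ Suc n)"
      by (intro suminf_le B(2)) auto
    also have "\<dots> = (\<Sum>n. hausdorff2 (A n)) + (\<Sum>n. ennreal e * ennreal ((1/2) ^ Suc n))"
      using e by (subst suminf_add[symmetric])
        (auto simp del: ennreal_suminf_cmult simp add: ennreal_mult[symmetric])
    also have "\<dots> = (\<Sum>n. hausdorff2 (A n)) + e"
      unfolding ennreal_suminf_cmult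
      by (subst suminf_ennreal_eq[OF zero_le_power power_half_series]) auto
    finally show "hausdorff2_pre \<delta> (\<Union>i. A i) \<le> (\<Sum>i. hausdorff2 (A i)) + ennreal e" .
  qed
qed

lemma hausdorff2_subadditive: "hausdorff2 (A \<union> B) \<le> hausdorff2 A + hausdorff2 B"
proof -
  have "hausdorff2 (\<Union>i::nat. if i = 0 then A else if i = 1 then B else {})
     \<le> (\<Sum>i::nat. hausdorff2 (if i = 0 then A else if i = 1 then B else {}))"
    by (rule hausdorff2_countably_subadditive)
  also have "(\<Sum>i::nat. hausdorff2 (if i = 0 then A else if i = 1 then B else {}))
      = (\<Sum>i\<in>{0, 1::nat}. hausdorff2 (if i = 0 then A else if i = 1 then B else {}))"
    by (rule suminf_finite) (auto simp: hausdorff2_empty)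
  also have "(\<Union>i::nat. if i = 0 then A else if i = 1 then B else {}) = A \<union> B"
    by (auto split: if_splits)
  finally show ?thesis by simp
qed

text \<open>Covers by sets of diameter below the distance of \<open>A\<close> and \<open>B\<close> split into covers of \<open>A\<close> and of \<open>B\<close>.\<close>

lemma hausdorff2_separated:
  assumes d: "0 < d" "\<And>x y. x \<in> A \<Longrightarrow> y \<in> B \<Longrightarrow> d \<le> dist x y"
  shows "hausdorff2 A + hausdorff2 B \<le> hausdorff2 (A \<union> B)"
proof -
  have key: "hausdorff2_pre \<delta> A + hausdorff2_pre \<delta> B \<le> hausdorff2 (A \<union> B)" if \<delta>: "0 < \<delta>" "\<delta> < d" for \<delta>
  proof -
    have "hausdorff2_pre \<delta> A + hausdorff2_pre \<delta> B \<le> area_sum C" if C: "C \<in> covers2 \<delta> (A \<union> B)" for C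
    proof -
      define CA CB where "CA i = (if C i \<inter> A = {} then {} else C i)" and "CB i = (if C i \<inter> A = {} then C i else {})" for i
      have "A \<subseteq> (\<Union>i. CA i)"
      proof
        fix x assume x: "x \<in> A"
        then obtain i where "x \<in> C i" using C by (auto simp: covers2_def)
        then have "x \<in> CA i" using x by (auto simp: CA_def)
        then show "x \<in> (\<Union>i. CA i)" by blast
      qed
      then have "CA \<in> covers2 \<delta> A" using C \<delta>(1) by (auto simp: covers2_def CA_def)
      moreover have "CB \<in> covers2 \<delta> B"
      proof -
        have "B \<subseteq> (\<Union>i. CB i)"
        proof
          fix y assume y: "y \<in> B"
          then obtain i where i: "y \<in> C i" using C by (auto simp: covers2_def)
          have "C i \<inter> A = {}"
          proof (rule ccontr)
            assume "C i \<inter> A \<noteq> {}"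
            then obtain x where x: "x \<in> C i" "x \<in> A" by blast
            have "dist x y \<le> diameter (C i)"
              using C x i by (intro diameter_bounded_bound) (auto simp: covers2_def)
            also have "\<dots> \<le> \<delta>" using C by (auto simp: covers2_def)
            finally show False using d(2)[OF x(2) y] \<delta>(2) by simp
          qed
          then show "y \<in> (\<Union>i. CB i)" using i by (auto simp: CB_def)
        qed
        then show ?thesis using C \<delta>(1) by (auto simp: covers2_def CB_def)
      qed
      ultimately have "hausdorff2_pre \<delta> A + hausdorff2_pre \<delta> B \<le> area_sum CA + area_sum CB"
        by (intro add_mono hausdorff2_pre_le)
      also have "\<dots> = area_sum C"
        unfolding area_sum_def
        by (subst suminf_add) (auto simp: CA_def CB_def intro!: suminf_cong)
      finally show ?thesis .
    qed
    then have "hausdorff2_pre \<delta> A + hausdorff2_pre \<delta> B \<le> hausdorff2_pre \<delta> (A \<union> B)"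
      unfolding hausdorff2_pre_eq[of \<delta> "A \<union> B"] by (rule INF_greatest)
    also have "\<dots> \<le> hausdorff2 (A \<union> B)" by (rule hausdorff2_pre_le_hausdorff2[OF \<delta>(1)])
    finally show ?thesis .
  qed
  have "hausdorff2 A + hausdorff2 B = (SUP \<delta>\<in>{0<..}. hausdorff2_pre \<delta> A + hausdorff2 B)"
    unfolding hausdorff2_def[of A] by (rule ennreal_SUP_add_left[symmetric]) auto
  also have "\<dots> \<le> hausdorff2 (A \<union> B)"
  proof (rule SUP_least)
    fix \<delta> :: real assume "\<delta> \<in> {0<..}"
    then have \<delta>: "0 < \<delta>" by simp
    have "hausdorff2 B + hausdorff2_pre \<delta> A = (SUP \<epsilon>\<in>{0<..}. hausdorff2_pre \<epsilon> B + hausdorff2_pre \<delta> A)"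
      unfolding hausdorff2_def[of B] by (rule ennreal_SUP_add_left[symmetric]) auto
    also have "\<dots> \<le> hausdorff2 (A \<union> B)"
    proof (rule SUP_least)
      fix \<epsilon> :: real assume "\<epsilon> \<in> {0<..}"
      define \<rho> where "\<rho> = min (d / 2) (min \<delta> \<epsilon>)"
      have \<rho>: "0 < \<rho>" "\<rho> < d" "\<rho> \<le> \<delta>" "\<rho> \<le> \<epsilon>"
        using \<delta> \<open>\<epsilon> \<in> {0<..}\<close> d(1) by (auto simp: \<rho>_def)
      have "hausdorff2_pre \<epsilon> B + hausdorff2_pre \<delta> A \<le> hausdorff2_pre \<rho> B + hausdorff2_pre \<rho> A"
        by (intro add_mono hausdorff2_pre_antimono \<rho>)
      also have "\<dots> \<le> hausdorff2 (A \<union> B)" using key[OF \<rho>(1,2)] by (simp add: add.commute)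
      finally show "hausdorff2_pre \<epsilon> B + hausdorff2_pre \<delta> A \<le> hausdorff2 (A \<union> B)" .
    qed
    finally have "hausdorff2 B + hausdorff2_pre \<delta> A \<le> hausdorff2 (A \<union> B)" .
    then show "hausdorff2_pre \<delta> A + hausdorff2 B \<le> hausdorff2 (A \<union> B)" by (simp add: add.commute)
  qed
  finally show ?thesis .
qed

text \<open>Caratheodory's criterion. Away from a closed set \<open>F\<close>, the set \<open>X\<close> is exhausted by the parts \<open>Y n\<close>
  at distance at least \<open>1/(n+1)\<close> from \<open>F\<close>, to which the previous lemma applies. The remainder is
  covered by the layers \<open>L k\<close>, \<open>k \<ge> n\<close>; every second layer is separated from the others, so that the
  measures of the layers have a finite sum.\<close>

lemma hausdorff2_closed_split:
  assumes F: "closed F"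
  shows "hausdorff2 (F \<inter> X) + hausdorff2 (X - F) \<le> hausdorff2 X"
proof (cases "F = {} \<or> hausdorff2 X = top")
  case True
  then show ?thesis by (auto simp: hausdorff2_empty)
next
  case False
  define D where "D x = infdist x F" for x
  define Y where "Y n = {x \<in> X. 1 / real (Suc n) \<le> D x}" for n
  define L where "L k = {x \<in> X. 1 / real (Suc (Suc k)) \<le> D x \<and> D x < 1 / real (Suc k)}" for k
  have sep: "hausdorff2 A + hausdorff2 B \<le> hausdorff2 (A \<union> B)"
    if "b < a" "\<And>x. x \<in> A \<Longrightarrow> a \<le> D x" "\<And>x. x \<in> B \<Longrightarrow> D x \<le> b" for A B a b
  proof (rule hausdorff2_separated[where d="a - b"])
    fix x y assume "x \<in> A" "y \<in> B"
    then have "a \<le> D x" "D y \<le> b" using that by auto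
    moreover have "D x \<le> D y + dist x y" unfolding D_def by (rule infdist_triangle)
    ultimately show "a - b \<le> dist x y" by linarith
  qed (use that in simp)
  have Y: "hausdorff2 (Y n) + hausdorff2 (F \<inter> X) \<le> hausdorff2 X" for n
  proof -
    have "hausdorff2 (Y n) + hausdorff2 (F \<inter> X) \<le> hausdorff2 (Y n \<union> (F \<inter> X))"
      by (rule sep[of 0 "1 / real (Suc n)"]) (auto simp: Y_def D_def)
    also have "\<dots> \<le> hausdorff2 X" by (rule hausdorff2_mono) (auto simp: Y_def)
    finally show ?thesis .
  qed
  \<comment> \<open>\<open>p\<close> is the parity of the layers.\<close>
  have alternate: "(\<Sum>j<n. hausdorff2 (L (2 * j + p))) \<le> hausdorff2 (\<Union>j<n. L (2 * j + p))" for n p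
  proof (induction n)
    case (Suc n)
    have "(\<Sum>j<Suc n. hausdorff2 (L (2 * j + p))) \<le> hausdorff2 (\<Union>j<n. L (2 * j + p)) + hausdorff2 (L (2 * n + p))"
      using Suc by (simp add: add_mono)
    also have "\<dots> \<le> hausdorff2 ((\<Union>j<n. L (2 * j + p)) \<union> L (2 * n + p))"
    proof (cases "n = 0")
      case False
      show ?thesis
      proof (rule sep[where a="1 / real (2 * n + p)" and b="1 / real (Suc (2 * n + p))"])
        show "1 / real (Suc (2 * n + p)) < 1 / real (2 * n + p)" using False by (intro divide_strict_left_mono) auto
        fix x assume "x \<in> (\<Union>j<n. L (2 * j + p))"
        then obtain j where j: "j < n" "1 / real (Suc (Suc (2 * j + p))) \<le> D x" by (auto simp: L_def)
        have "1 / real (2 * n + p) \<le> 1 / real (Suc (Suc (2 * j + p)))"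
          using j(1) by (intro divide_left_mono) auto
        then show "1 / real (2 * n + p) \<le> D x" using j(2) by linarith
      qed (auto simp: L_def intro: less_imp_le)
    qed (simp add: hausdorff2_empty)
    also have "(\<Union>j<n. L (2 * j + p)) \<union> L (2 * n + p) = (\<Union>j<Suc n. L (2 * j + p))"
      by (auto simp: less_Suc_eq)
    finally show ?case .
  qed (simp add: hausdorff2_empty)
  have "(\<Sum>k<n. hausdorff2 (L k)) \<le> 2 * hausdorff2 X" for n
  proof -
    have "(\<Sum>k<n. hausdorff2 (L k)) \<le> (\<Sum>k<2 * n. hausdorff2 (L k))"
      by (intro sum_mono2) auto
    also have "\<dots> = (\<Sum>j<n. hausdorff2 (L (2 * j + 0))) + (\<Sum>j<n. hausdorff2 (L (2 * j + 1)))"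
      by (induction n) (auto simp: ac_simps)
    also have "\<dots> \<le> hausdorff2 X + hausdorff2 X"
      by (intro add_mono order_trans[OF alternate] hausdorff2_mono) (auto simp: L_def)
    finally show ?thesis by (simp add: mult_2)
  qed
  then have "(\<Sum>k. hausdorff2 (L k)) \<le> 2 * hausdorff2 X"
    by (intro suminf_le_const) auto
  also have "\<dots> < top" using False by (simp add: ennreal_mult_less_top less_top)
  finally have fin: "(\<Sum>k. hausdorff2 (L k)) < top" .
  have split: "hausdorff2 (X - F) \<le> hausdorff2 (Y n) + ((\<Sum>k. hausdorff2 (L k)) - (\<Sum>k<n. hausdorff2 (L k)))" for n
  proof -
    have "X - F \<subseteq> Y n \<union> (\<Union>k. L (k + n))"
    proof
      fix x assume x: "x \<in> X - F"
      then have D: "0 < D x" using in_closed_iff_infdist_zero[OF F, of x] False infdist_nonneg[of x F]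
        unfolding D_def by auto
      show "x \<in> Y n \<union> (\<Union>k. L (k + n))"
      proof (cases "1 / real (Suc n) \<le> D x")
        case small: False
        define m where "m = (LEAST m. 1 / real (Suc m) \<le> D x)"
        obtain m0 :: nat where "inverse (real (Suc m0)) < D x" using reals_Archimedean[OF D] by blast
        then have ex: "1 / real (Suc m0) \<le> D x" by (simp add: inverse_eq_divide)
        have m: "1 / real (Suc m) \<le> D x" unfolding m_def by (rule LeastI[where P="\<lambda>m. 1 / real (Suc m) \<le> D x", OF ex])
        have nm: "n < m"
        proof (rule ccontr)
          assume "\<not> n < m"
          then have "1 / real (Suc n) \<le> 1 / real (Suc m)" by (intro divide_left_mono) auto
          then show False using m small by linarith
        qed
        then obtain k where k: "m = Suc (k + n)" by (metis add.commute less_imp_Suc_add)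
        have "\<not> 1 / real (Suc (k + n)) \<le> D x"
          using not_less_Least[of "k + n" "\<lambda>m. 1 / real (Suc m) \<le> D x"] k unfolding m_def by simp
        then have "x \<in> L (k + n)" using m x unfolding k L_def by auto
        then show ?thesis by blast
      qed (use x in \<open>auto simp: Y_def\<close>)
    qed
    then have "hausdorff2 (X - F) \<le> hausdorff2 (Y n) + hausdorff2 (\<Union>k. L (k + n))"
      using hausdorff2_mono hausdorff2_subadditive order_trans by metis
    also have "\<dots> \<le> hausdorff2 (Y n) + (\<Sum>k. hausdorff2 (L (k + n)))"
      by (intro add_left_mono hausdorff2_countably_subadditive)
    also have "(\<Sum>k. hausdorff2 (L (k + n))) = (\<Sum>k. hausdorff2 (L k)) - (\<Sum>k<n. hausdorff2 (L k))"
    proof -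
      have "(\<Sum>k<n. hausdorff2 (L k)) < top"
        using fin by (meson le_less_trans sum_le_suminf summableI finite_lessThan zero_le)
      then show ?thesis
        using suminf_offset[OF summableI, of "\<lambda>k. hausdorff2 (L k)" n]
        by (metis add_diff_eq_ennreal ennreal_add_diff_cancel_right less_top order_refl)
    qed
    finally show ?thesis .
  qed
  have lim: "(\<lambda>n. hausdorff2 X + ((\<Sum>k. hausdorff2 (L k)) - (\<Sum>k<n. hausdorff2 (L k)))) 
      \<longlonglongrightarrow> hausdorff2 X + ((\<Sum>k. hausdorff2 (L k)) - (\<Sum>k. hausdorff2 (L k)))"
    using fin by (intro tendsto_add tendsto_const tendsto_diff_ennreal summable_LIMSEQ summableI) auto
  have "hausdorff2 (F \<inter> X) + hausdorff2 (X - F)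
      \<le> hausdorff2 X + ((\<Sum>k. hausdorff2 (L k)) - (\<Sum>k<n. hausdorff2 (L k)))" for n
  proof -
    let ?T = "(\<Sum>k. hausdorff2 (L k)) - (\<Sum>k<n. hausdorff2 (L k))"
    have "hausdorff2 (F \<inter> X) + hausdorff2 (X - F) \<le> hausdorff2 (F \<inter> X) + (hausdorff2 (Y n) + ?T)"
      by (rule add_left_mono[OF split])
    also have "\<dots> = hausdorff2 (Y n) + hausdorff2 (F \<inter> X) + ?T" by (simp only: ac_simps)
    also have "\<dots> \<le> hausdorff2 X + ?T" by (rule add_right_mono[OF Y])
    finally show ?thesis .
  qed
  then have "hausdorff2 (F \<inter> X) + hausdorff2 (X - F)
     \<le> hausdorff2 X + ((\<Sum>k. hausdorff2 (L k)) - (\<Sum>k. hausdorff2 (L k)))"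
    by (intro LIMSEQ_le_const[OF lim]) blast
  then show ?thesis using fin by simp
qed

lemma hausdorff2_measure_space: "measure_space UNIV (sets borel) hausdorff2"
proof -
  let ?L = "lambda_system UNIV (Pow UNIV) hausdorff2"
  interpret sigma_algebra UNIV "Pow UNIV :: (real^3) set set" by (rule sigma_algebra_Pow)
  have "outer_measure_space (Pow UNIV) hausdorff2"
    unfolding outer_measure_space_def positive_def increasing_def countably_subadditive_def
    by (auto simp: hausdorff2_empty intro: hausdorff2_mono hausdorff2_countably_subadditive)
  then have ms: "measure_space UNIV ?L hausdorff2" by (rule caratheodory_lemma)
  then have L: "sigma_algebra UNIV ?L" by (simp add: measure_space_def)
  have "F \<in> ?L" if "closed F" for F
  proof -
    have "hausdorff2 (F \<inter> X) + hausdorff2 ((UNIV - F) \<inter> X) = hausdorff2 X" for X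
    proof (rule antisym)
      have "(UNIV - F) \<inter> X = X - F" by auto
      then show "hausdorff2 (F \<inter> X) + hausdorff2 ((UNIV - F) \<inter> X) \<le> hausdorff2 X"
        using hausdorff2_closed_split[OF that] by simp
      have "X = (F \<inter> X) \<union> ((UNIV - F) \<inter> X)" by auto
      then show "hausdorff2 X \<le> hausdorff2 (F \<inter> X) + hausdorff2 ((UNIV - F) \<inter> X)"
        by (metis hausdorff2_subadditive)
    qed
    then show ?thesis by (simp add: lambda_system_def)
  qed
  then have "sigma_sets UNIV (Collect closed) \<subseteq> ?L"
    by (intro sigma_algebra.sigma_sets_subset[OF L]) auto
  then have "sets borel \<subseteq> ?L" by (simp add: borel_eq_closed)
  moreover have "sigma_algebra UNIV (sets borel :: (real^3) set set)"
    using sets.sigma_algebra_axioms[of borel] by simp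
  ultimately show ?thesis using measure_down[OF ms] by blast
qed

lemma emeasure_hausdorff2:
  "A \<in> sets borel \<Longrightarrow> emeasure (measure_of UNIV (sets borel) hausdorff2) A = hausdorff2 A"
  using hausdorff2_measure_space
  by (intro emeasure_measure_of_sigma) (auto simp: measure_space_def)

text \<open>A planar set of diameter \<open>d\<close> lies in a disc of radius \<open>d\<close>, whose area is four times \<open>\<pi>/4 * d\<^sup>2\<close>.\<close>

lemma area_of_projection_le:
  fixes T :: "real^3 \<Rightarrow> real^2"
  assumes T: "\<And>x y. dist (T x) (T y) \<le> dist x y" and S: "S \<in> sets borel" "S \<subseteq> T ` A"
  shows "emeasure lborel S \<le> 4 * hausdorff2 A"
proof -
  have "emeasure lborel S \<le> 4 * area_sum C" if C: "C \<in> covers2 1 A" for C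
  proof -
    define B where "B i = (if C i = {} then {} else cball (T (SOME c. c \<in> C i)) (diameter (C i)))" for i
    have B: "T ` C i \<subseteq> B i" for i
    proof
      fix y assume "y \<in> T ` C i"
      then obtain x where x: "x \<in> C i" "y = T x" by blast
      then have c: "(SOME c. c \<in> C i) \<in> C i" by (metis someI)
      have "dist (T (SOME c. c \<in> C i)) (T x) \<le> dist (SOME c. c \<in> C i) x" by (rule T)
      also have "\<dots> \<le> diameter (C i)"
        using C c x(1) by (intro diameter_bounded_bound) (auto simp: covers2_def)
      finally show "y \<in> B i" using x by (auto simp: B_def)
    qed
    have Bm: "B i \<in> sets borel" for i by (simp add: B_def)
    have dp: "0 \<le> diameter (C i)" for i using C by (intro diameter_ge_0) (auto simp: covers2_def)
    have area: "emeasure lborel (B i) \<le> 4 * ennreal (pi / 4 * (diameter (C i))\<^sup>2)" for i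
    proof (cases "C i = {}")
      case False
      have "emeasure lborel (B i) = ennreal (pi * (diameter (C i))\<^sup>2)"
        using False dp[of i] by (simp add: B_def emeasure_cball unit_ball_vol_2 ennreal_mult)
      also have "\<dots> = 4 * ennreal (pi / 4 * (diameter (C i))\<^sup>2)"
        using ennreal_mult[of 4 "pi / 4 * (diameter (C i))\<^sup>2"] by simp
      finally show ?thesis by simp
    qed (simp add: B_def)
    have "S \<subseteq> (\<Union>i. B i)"
    proof
      fix y assume "y \<in> S"
      then obtain x where x: "x \<in> A" "y = T x" using S(2) by blast
      then obtain i where "x \<in> C i" using C by (auto simp: covers2_def)
      then show "y \<in> (\<Union>i. B i)" using B[of i] x(2) by blast
    qed
    then have "emeasure lborel S \<le> emeasure lborel (\<Union>i. B i)"
      using Bm by (intro emeasure_mono) auto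
    also have "\<dots> \<le> (\<Sum>i. emeasure lborel (B i))"
      using Bm by (intro emeasure_subadditive_countably) auto
    also have "\<dots> \<le> (\<Sum>i. 4 * ennreal (pi / 4 * (diameter (C i))\<^sup>2))"
      by (intro suminf_le area) auto
    also have "\<dots> = 4 * area_sum C" by (simp add: area_sum_def)
    finally show ?thesis .
  qed
  then have "emeasure lborel S / 4 \<le> area_sum C" if "C \<in> covers2 1 A" for C
    using that by (intro divide_le_posI_ennreal) (auto simp: mult.commute)
  then have "emeasure lborel S / 4 \<le> hausdorff2_pre 1 A"
    unfolding hausdorff2_pre_eq by (rule INF_greatest)
  also have "\<dots> \<le> hausdorff2 A"
    by (intro hausdorff2_pre_le_hausdorff2) auto
  finally have "4 * (emeasure lborel S / 4) \<le> 4 * hausdorff2 A" by (intro mult_left_mono) auto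
  also have "4 * (emeasure lborel S / 4) = emeasure lborel S"
    by (simp add: ennreal_times_divide mult.commute[of 4] ennreal_mult_divide_eq)
  finally show ?thesis .
qed

section \<open>Boundary charts\<close>

lemma prod_Basis_vec: "(\<Prod>b\<in>Basis. f b) = (\<Prod>i\<in>UNIV. f (axis i 1 :: real^'n::finite))"
  by (subst prod.reindex_bij_betw[symmetric, where h="\<lambda>i. axis i 1" and S=UNIV])
     (auto simp: bij_betw_def inj_on_def axis_eq_axis Basis_vec_def)

lemma prod_UNIV_3: "(\<Prod>i\<in>(UNIV :: 3 set). f i) = f 1 * f 2 * f 3"
  unfolding UNIV_3 by (simp add: mult.assoc)

lemma distr_vector_lborel:
  "distr (lborel \<Otimes>\<^sub>M lborel) borel (\<lambda>(y :: real^2, t :: real). vector [y$1, y$2, t] :: real^3) = lborel"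
proof (rule lborel_eqI[symmetric])
  let ?V = "\<lambda>(y :: real^2, t :: real). vector [y$1, y$2, t] :: real^3"
  have "continuous_on UNIV ?V"
    by (subst continuous_on_componentwise)
       (auto simp: split_def Basis_vec_def inner_axis exhaust_3 vector_3 forall_3 intro!: continuous_intros)
  then have V: "?V \<in> borel_measurable (lborel \<Otimes>\<^sub>M lborel)"
    unfolding lborel_prod by (simp add: borel_measurable_continuous_onI)
  fix l u :: "real^3"
  assume "\<And>b. b \<in> Basis \<Longrightarrow> l \<bullet> b \<le> u \<bullet> b"
  then have le: "l $ i \<le> u $ i" for i
    using inner_axis[of l i 1] inner_axis[of u i 1] by (metis Basis_vec_def axis_in_Basis_iff inner_real_def mult.right_neutral Basis_real_def insertI1)
  define l' u' :: "real^2" where "l' = vector [l$1, l$2]" and "u' = vector [u$1, u$2]"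
  have "?V -` box l u = box l' u' \<times> box (l$3) (u$3)"
    by (auto simp: mem_box_cart forall_3 forall_2 vector_3 l'_def u'_def)
  then have "emeasure (distr (lborel \<Otimes>\<^sub>M lborel) borel ?V) (box l u)
      = emeasure (lborel \<Otimes>\<^sub>M lborel) (box l' u' \<times> box (l$3) (u$3))"
    using V by (simp add: emeasure_distr space_pair_measure)
  also have "\<dots> = emeasure lborel (box l' u') * emeasure lborel (box (l$3) (u$3))"
    by (rule lborel.emeasure_pair_measure_Times) auto
  also have "emeasure lborel (box l' u') = ennreal ((u$1 - l$1) * (u$2 - l$2))"
  proof -
    have "l' \<bullet> b \<le> u' \<bullet> b" if b: "b \<in> Basis" for b
    proof -
      obtain i where "b = axis i 1" using b by (auto simp: Basis_vec_def)
      then show ?thesis using le exhaust_2[of i] by (auto simp: inner_axis l'_def u'_def)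
    qed
    from emeasure_lborel_box[OF this] show ?thesis
      unfolding prod_Basis_vec by (simp add: UNIV_2 inner_axis l'_def u'_def mult.commute)
  qed
  also have "emeasure lborel (box (l$3) (u$3)) = ennreal (u$3 - l$3)"
    using le by simp
  also have "ennreal ((u$1 - l$1) * (u$2 - l$2)) * ennreal (u$3 - l$3) = (\<Prod>b\<in>Basis. (u - l) \<bullet> b)"
  proof -
    have "(\<Prod>b\<in>Basis. (u - l) \<bullet> b) = (u$1 - l$1) * (u$2 - l$2) * (u$3 - l$3)"
      unfolding prod_Basis_vec prod_UNIV_3 inner_axis by simp
    then show ?thesis
      using le by (simp only:) (rule ennreal_mult[symmetric], auto)
  qed
  finally show "emeasure (distr (lborel \<Otimes>\<^sub>M lborel) borel ?V) (box l u) = (\<Prod>b\<in>Basis. (u - l) \<bullet> b)" .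
qed simp

lemma orthogonal_matrix_norm:
  fixes Q :: "real^'n^'n::finite"
  assumes "orthogonal_matrix Q" shows "norm (Q *v x) = norm x"
proof -
  have "orthogonal_transformation ((*v) Q)"
    using assms by (simp add: orthogonal_transformation_matrix)
  then show ?thesis by (simp add: orthogonal_transformation_norm)
qed

lemma orthogonal_matrix_inverse:
  fixes Q :: "real^'n^'n::finite"
  assumes "orthogonal_matrix Q"
  shows "transpose Q *v (Q *v x) = x" and "Q *v (transpose Q *v x) = x"
  using assms unfolding orthogonal_matrix_def matrix_vector_mul_assoc by (simp_all only: matrix_vector_mul_lid)

lemma distr_rigid_motion_lborel:
  fixes Q :: "real^3^3"
  assumes Q: "orthogonal_matrix Q"
  shows "distr lborel borel (\<lambda>x. p + Q *v x) = lborel"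
proof (rule lborel_eqI[symmetric])
  fix l u :: "real^3" assume le: "\<And>b. b \<in> Basis \<Longrightarrow> l \<bullet> b \<le> u \<bullet> b"
  let ?Q' = "transpose Q"
  have "orthogonal_matrix ?Q'" using Q by simp
  then have Q': "orthogonal_transformation ((*v) ?Q')"
    unfolding orthogonal_transformation_matrix by simp
  have m: "(\<lambda>x. p + Q *v x) \<in> borel_measurable borel"
    by (intro borel_measurable_continuous_onI continuous_intros) 
  have pre: "(\<lambda>x. p + Q *v x) -` box l u = (*v) ?Q' ` box (l - p) (u - p)"
  proof (intro set_eqI iffI)
    fix x assume "x \<in> (\<lambda>x. p + Q *v x) -` box l u"
    then have "Q *v x \<in> box (l - p) (u - p)" by (auto simp: mem_box_cart algebra_simps)
    then show "x \<in> (*v) ?Q' ` box (l - p) (u - p)"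
      using orthogonal_matrix_inverse(1)[OF Q, of x] by (metis imageI)
  next
    fix x assume "x \<in> (*v) ?Q' ` box (l - p) (u - p)"
    then obtain z where "z \<in> box (l - p) (u - p)" "x = ?Q' *v z" by blast
    then show "x \<in> (\<lambda>x. p + Q *v x) -` box l u"
      using orthogonal_matrix_inverse(2)[OF Q, of z] by (auto simp: mem_box_cart algebra_simps)
  qed
  have sets: "(*v) ?Q' ` box (l - p) (u - p) \<in> sets borel"
    unfolding pre[symmetric] using measurable_sets[OF m, of "box l u"] by simp
  have lm: "(*v) ?Q' ` box (l - p) (u - p) \<in> lmeasurable"
    by (rule measurable_orthogonal_image[OF Q']) simp
  have "emeasure (distr lborel borel (\<lambda>x. p + Q *v x)) (box l u) = emeasure lborel ((*v) ?Q' ` box (l - p) (u - p))"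
    using m by (simp add: emeasure_distr pre)
  also have "\<dots> = emeasure lebesgue ((*v) ?Q' ` box (l - p) (u - p))"
    using sets by simp
  also have "\<dots> = emeasure lebesgue (box (l - p) (u - p))"
    unfolding emeasure_eq_ennreal_measure[OF fmeasurableD2[OF lm]]
      emeasure_eq_ennreal_measure[OF fmeasurableD2[OF lmeasurable_box]]
    by (subst measure_orthogonal_image[OF Q' lmeasurable_box]) (rule refl)
  also have "\<dots> = (\<Prod>b\<in>Basis. (u - l) \<bullet> b)"
    using le by (simp add: emeasure_lborel_box inner_diff_left)
  finally show "emeasure (distr lborel borel (\<lambda>x. p + Q *v x)) (box l u) = (\<Prod>b\<in>Basis. (u - l) \<bullet> b)" .
qed simp

lemma nn_integral_chart:
  assumes Q: "orthogonal_matrix Q" and g[measurable]: "g \<in> borel_measurable borel"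
  shows "(\<integral>\<^sup>+x. g x \<partial>lborel) = (\<integral>\<^sup>+y. \<integral>\<^sup>+t. g (chart_point p Q y t) \<partial>lborel \<partial>lborel)"
proof -
  let ?V = "\<lambda>(y :: real^2, t :: real). vector [y$1, y$2, t] :: real^3"
  have "continuous_on UNIV ?V"
    by (subst continuous_on_componentwise)
       (auto simp: split_def Basis_vec_def inner_axis exhaust_3 vector_3 forall_3 intro!: continuous_intros)
  then have V[measurable]: "?V \<in> borel_measurable (lborel \<Otimes>\<^sub>M lborel)"
    unfolding lborel_prod by (simp add: borel_measurable_continuous_onI)
  have m[measurable]: "(\<lambda>x. p + Q *v x) \<in> borel_measurable borel"
    by (intro borel_measurable_continuous_onI continuous_intros)
  have "(\<integral>\<^sup>+x. g x \<partial>lborel) = (\<integral>\<^sup>+x. g (p + Q *v x) \<partial>lborel)"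
    by (subst distr_rigid_motion_lborel[OF Q, of p, symmetric], subst nn_integral_distr) auto
  also have "\<dots> = (\<integral>\<^sup>+z. g (p + Q *v ?V z) \<partial>(lborel \<Otimes>\<^sub>M lborel))"
    by (subst distr_vector_lborel[symmetric], subst nn_integral_distr) auto
  also have "\<dots> = (\<integral>\<^sup>+y. \<integral>\<^sup>+t. g (p + Q *v ?V (y, t)) \<partial>lborel \<partial>lborel)"
    by (subst lborel.nn_integral_fst[symmetric]) auto
  finally show ?thesis by (simp add: chart_point_def)
qed

definition chart_base :: "real^3 \<Rightarrow> real^3^3 \<Rightarrow> real^3 \<Rightarrow> real^2" where
  "chart_base p Q x = (let z = transpose Q *v (x - p) in vector [z$1, z$2])"

definition chart_height :: "real^3 \<Rightarrow> real^3^3 \<Rightarrow> real^3 \<Rightarrow> real" where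
  "chart_height p Q x = (transpose Q *v (x - p)) $ 3"

lemma vec_eq_2: "x = y \<longleftrightarrow> x $ 1 = y $ 1 \<and> x $ 2 = y $ 2" for x y :: "'a^2"
  by (simp add: vec_eq_iff forall_2)

lemma vec_eq_3: "x = y \<longleftrightarrow> x $ 1 = y $ 1 \<and> x $ 2 = y $ 2 \<and> x $ 3 = y $ 3" for x y :: "'a^3"
  by (simp add: vec_eq_iff forall_3)

lemma chart_coordinates:
  assumes Q: "orthogonal_matrix Q"
  shows "chart_base p Q (chart_point p Q y t) = y" "chart_height p Q (chart_point p Q y t) = t"
    and "chart_point p Q (chart_base p Q x) (chart_height p Q x) = x"
proof -
  show "chart_base p Q (chart_point p Q y t) = y" "chart_height p Q (chart_point p Q y t) = t"
    using orthogonal_matrix_inverse(1)[OF Q]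
    by (simp_all add: chart_base_def chart_height_def chart_point_def vec_eq_2)
  let ?z = "transpose Q *v (x - p)"
  have "vector [?z $ 1, ?z $ 2, ?z $ 3] = ?z" by (simp add: vec_eq_3)
  then show "chart_point p Q (chart_base p Q x) (chart_height p Q x) = x"
    using orthogonal_matrix_inverse(2)[OF Q, of "x - p"]
    by (simp add: chart_base_def chart_height_def chart_point_def Let_def)
qed

lemma chart_Lipschitz:
  assumes Q: "orthogonal_matrix Q"
  shows "dist (chart_base p Q x) (chart_base p Q x') \<le> dist x x'"
    and "\<bar>chart_height p Q x - chart_height p Q x'\<bar> \<le> dist x x'"
    and "dist (chart_point p Q y t) (chart_point p Q y s) = \<bar>t - s\<bar>"
proof -
  define z where "z = transpose Q *v (x - x')"
  have z: "transpose Q *v (x - p) - transpose Q *v (x' - p) = z"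
    by (simp add: z_def matrix_vector_mult_diff_distrib)
  have nz: "norm z = dist x x'"
    using orthogonal_matrix_norm[of "transpose Q"] Q by (simp add: z_def dist_norm)
  have base: "chart_base p Q x - chart_base p Q x' = vector [z$1, z$2]"
    unfolding chart_base_def z[symmetric] by (simp add: vec_eq_2 Let_def)
  have "norm (vector [z$1, z$2] :: real^2) \<le> norm z"
    by (rule power2_le_imp_le, unfold power2_norm_eq_inner) (simp_all add: inner_vec_def sum_2 sum_3)
  then show "dist (chart_base p Q x) (chart_base p Q x') \<le> dist x x'"
    using nz by (simp add: dist_norm base)
  have "\<bar>z $ 3\<bar> \<le> norm z" by (rule component_le_norm_cart)
  then show "\<bar>chart_height p Q x - chart_height p Q x'\<bar> \<le> dist x x'"
    using nz unfolding chart_height_def z[symmetric] by simp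
  have "vector [y$1, y$2, t] - vector [y$1, y$2, s] = (axis 3 (t - s) :: real^3)"
    by (simp add: vec_eq_3 axis_def)
  then have "chart_point p Q y t - chart_point p Q y s = Q *v axis 3 (t - s)"
    unfolding chart_point_def by (simp only: add_diff_cancel_left matrix_vector_mult_diff_distrib[symmetric])
  then show "dist (chart_point p Q y t) (chart_point p Q y s) = \<bar>t - s\<bar>"
    using orthogonal_matrix_norm[OF Q, of "axis 3 (t - s)"] by (simp add: dist_norm norm_eq_sqrt_inner[of "axis _ _"] inner_axis_axis)
qed

lemma chart_continuous:
  "continuous_on S (chart_base p Q)" "continuous_on S (chart_height p Q)"
  "continuous_on T (\<lambda>z. chart_point p Q (fst z) (snd z))"
proof -
  have c2: "continuous_on S (\<lambda>x. vector [f x, g x] :: real^2)"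
    if "continuous_on S f" "continuous_on S g" for S and f g :: "'b::t2_space \<Rightarrow> real"
    using that by (subst continuous_on_componentwise)
       (auto simp: Basis_vec_def inner_axis exhaust_2 vector_2 forall_2)
  have c3: "continuous_on S (\<lambda>x. vector [f x, g x, h x] :: real^3)"
    if "continuous_on S f" "continuous_on S g" "continuous_on S h" for S and f g h :: "'b::t2_space \<Rightarrow> real"
    using that by (subst continuous_on_componentwise)
       (auto simp: Basis_vec_def inner_axis exhaust_3 vector_3 forall_3)
  have cm: "continuous_on S (\<lambda>x. A *v f x)" if "continuous_on S f"
    for S and A :: "real^3^3" and f :: "'b::t2_space \<Rightarrow> real^3"
    using continuous_on_compose2[OF linear_continuous_on[OF matrix_vector_mul_bounded_linear] that subset_UNIV] .
  show "continuous_on S (chart_base p Q)" "continuous_on S (chart_height p Q)"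
    "continuous_on T (\<lambda>z. chart_point p Q (fst z) (snd z))"
    unfolding chart_base_def chart_height_def chart_point_def Let_def
    by (intro c2 c3 cm continuous_intros)+
qed

lemma C11_on_Lipschitz:
  assumes "C11_on (box (- a) a) \<gamma>"
  shows "\<exists>L. 0 \<le> L \<and> L-lipschitz_on (box (- a) a) \<gamma>"
proof -
  obtain d K where d: "\<And>y. y \<in> box (- a) a \<Longrightarrow> (\<gamma> has_derivative (\<lambda>h. d y \<bullet> h)) (at y)"
    and K: "K-lipschitz_on (box (- a) a) d"
    using assms unfolding C11_on_def by blast
  have "bounded (d ` box (- a) a)"
    using K by (meson bounded_box bounded_uniformly_continuous_image lipschitz_on_uniformly_continuous)
  then obtain C where C: "\<And>y. y \<in> box (- a) a \<Longrightarrow> norm (d y) \<le> C" by (auto simp: bounded_iff)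
  have "(max C 0)-lipschitz_on (box (- a) a) \<gamma>"
  proof (rule bounded_derivative_imp_lipschitz[where f'="\<lambda>y h. d y \<bullet> h"])
    fix y assume y: "y \<in> box (- a) a"
    show "(\<gamma> has_derivative (\<lambda>h. d y \<bullet> h)) (at y within box (- a) a)"
      by (rule has_derivative_at_withinI[OF d[OF y]])
    show "onorm (\<lambda>h. d y \<bullet> h) \<le> max C 0"
    proof (rule onorm_le)
      fix h
      have "norm (d y \<bullet> h) \<le> norm (d y) * norm h" by (simp add: Cauchy_Schwarz_ineq2)
      also have "\<dots> \<le> max C 0 * norm h" using C[OF y] by (intro mult_right_mono) auto
      finally show "norm (d y \<bullet> h) \<le> max C 0 * norm h" .
    qed
  qed (auto simp: convex_box)
  then show ?thesis by (intro exI[of _ "max C 0"]) auto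
qed

lemma nn_integral_surface_measure:
  "(\<integral>\<^sup>+x. g x \<partial>surface_measure \<Omega>)
     = (\<integral>\<^sup>+x. g x * indicator (frontier \<Omega>) x \<partial>measure_of UNIV (sets borel) hausdorff2)"
proof -
  have "frontier \<Omega> \<in> sets (measure_of UNIV (sets borel) hausdorff2)"
    by (simp add: sets_measure_of_conv sets.sigma_sets_eq[of borel, simplified])
  then show ?thesis
    unfolding surface_measure_def nn_integral_completion
    by (subst nn_integral_restrict_space) (auto simp: space_measure_of_conv)
qed

text \<open>The projection of the graph of \<open>\<gamma>\<close> to its base does not increase area by more than the factor \<open>4\<close>.\<close>

lemma graph_integral_le_surface_integral:
  assumes chart: "graph_chart \<Omega> p Q a b \<gamma>" and g[measurable]: "g \<in> borel_measurable borel"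
  shows "(\<integral>\<^sup>+y. indicator (box (- a) a) y * g (chart_point p Q y (\<gamma> y)) \<partial>lborel)
      \<le> 4 * (\<integral>\<^sup>+x. g x \<partial>surface_measure \<Omega>)"
proof -
  let ?B = "box (- a) a" and ?H = "measure_of UNIV (sets borel) hausdorff2 :: (real^3) measure"
  have Q: "orthogonal_matrix Q" and \<gamma>: "C11_on ?B \<gamma>"
    and fr: "\<And>y. y \<in> ?B \<Longrightarrow> chart_point p Q y (\<gamma> y) \<in> frontier \<Omega>"
    using chart unfolding graph_chart_def by force+
  have sH: "sets ?H = sets borel"
    by (simp add: sets_measure_of_conv sets.sigma_sets_eq[of borel, simplified])
  obtain L where "L-lipschitz_on ?B \<gamma>" using C11_on_Lipschitz[OF \<gamma>] by blast
  then have "continuous_on ?B \<gamma>" by (rule lipschitz_on_continuous_on)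
  then have "continuous_on ?B (\<lambda>y. chart_point p Q (fst (y, \<gamma> y)) (snd (y, \<gamma> y)))"
    by (intro continuous_on_compose2[OF chart_continuous(3)[of UNIV]] continuous_intros) auto
  then have \<Gamma>: "(\<lambda>y. chart_point p Q y (\<gamma> y)) \<in> borel_measurable (restrict_space lborel ?B)"
    by (auto intro: borel_measurable_continuous_on_restrict simp: measurable_cong_sets[OF sets_restrict_space_cong[OF sets_lborel] refl])
  define N where "N = distr (restrict_space lborel ?B) borel (\<lambda>y. chart_point p Q y (\<gamma> y))"
  define H' where "H' = density ?H (indicator (frontier \<Omega>))"
  have "N \<le> scale_measure 4 H'"
  proof (rule le_measure[THEN iffD2])
    show sets: "sets N = sets (scale_measure 4 H')" by (simp add: N_def H'_def sH)
    show "\<forall>A\<in>sets N. emeasure N A \<le> emeasure (scale_measure 4 H') A"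
    proof
      fix A assume "A \<in> sets N"
      then have A: "A \<in> sets borel" by (simp add: N_def)
      define S where "S = (\<lambda>y. chart_point p Q y (\<gamma> y)) -` A \<inter> ?B"
      have "S \<in> sets (restrict_space lborel ?B)"
        using measurable_sets[OF \<Gamma> A] by (simp add: S_def space_restrict_space)
      then have S: "S \<in> sets borel" by (auto simp: sets_restrict_space)
      have "emeasure N A = emeasure lborel S"
        using \<Gamma> A by (simp add: N_def emeasure_distr S_def space_restrict_space emeasure_restrict_space)
      also have "\<dots> \<le> 4 * hausdorff2 (A \<inter> frontier \<Omega>)"
      proof (rule area_of_projection_le[OF chart_Lipschitz(1)[OF Q] S])
        show "S \<subseteq> chart_base p Q ` (A \<inter> frontier \<Omega>)"
        proof
          fix y assume y: "y \<in> S"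
          show "y \<in> chart_base p Q ` (A \<inter> frontier \<Omega>)"
          proof (rule image_eqI)
            show "y = chart_base p Q (chart_point p Q y (\<gamma> y))" by (simp add: chart_coordinates[OF Q])
          qed (use y fr in \<open>auto simp: S_def\<close>)
        qed
      qed
      also have "hausdorff2 (A \<inter> frontier \<Omega>) = emeasure H' A"
      proof -
        have AH: "A \<in> sets ?H" "frontier \<Omega> \<in> sets ?H" using A sH by auto
        then have "emeasure H' A = (\<integral>\<^sup>+x. indicator (frontier \<Omega>) x * indicator A x \<partial>?H)"
          unfolding H'_def by (intro emeasure_density borel_measurable_indicator)
        also have "\<dots> = (\<integral>\<^sup>+x. indicator (A \<inter> frontier \<Omega>) x \<partial>?H)"
          by (intro nn_integral_cong) (auto simp: indicator_def)
        also have "\<dots> = emeasure ?H (A \<inter> frontier \<Omega>)" using AH by (intro nn_integral_indicator sets.Int)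
        also have "\<dots> = hausdorff2 (A \<inter> frontier \<Omega>)" using A by (intro emeasure_hausdorff2) auto
        finally show ?thesis by simp
      qed
      finally show "emeasure N A \<le> emeasure (scale_measure 4 H') A" by simp
    qed
  qed
  then have "(\<integral>\<^sup>+x. g x \<partial>N) \<le> (\<integral>\<^sup>+x. g x \<partial>scale_measure 4 H')"
    by (intro nn_integral_mono_measure) (auto simp: N_def H'_def sH)
  also have "\<dots> = 4 * (\<integral>\<^sup>+x. g x \<partial>H')"
    by (rule nn_integral_scale_measure) (simp add: H'_def sH measurable_cong_sets[OF sH refl])
  also have "(\<integral>\<^sup>+x. g x \<partial>H') = (\<integral>\<^sup>+x. g x \<partial>surface_measure \<Omega>)"
    unfolding nn_integral_surface_measure H'_def
    by (subst nn_integral_density) (auto simp: mult.commute sH measurable_cong_sets[OF sH refl])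
  also have "(\<integral>\<^sup>+x. g x \<partial>N) = (\<integral>\<^sup>+y. g (chart_point p Q y (\<gamma> y)) \<partial>restrict_space lborel ?B)"
    unfolding N_def by (rule nn_integral_distr[OF \<Gamma>]) simp
  also have "\<dots> = (\<integral>\<^sup>+y. indicator ?B y * g (chart_point p Q y (\<gamma> y)) \<partial>lborel)"
    by (subst nn_integral_restrict_space) (auto simp: mult.commute)
  finally show ?thesis .
qed

text \<open>The strip around the boundary is covered by finitely many layers around graphs. A point of the
  strip and a nearest boundary point lie in a common chart, by Lebesgue's number lemma, and the
  Lipschitz bound of the graph turns their distance into a bound for the height over the graph.\<close>

lemma strip_cover:
  fixes \<Omega> :: "(real^3) set"
  assumes \<Omega>: "open \<Omega>" "bounded \<Omega>" "\<Omega> \<noteq> {}" and bd: "C11_boundary \<Omega>"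
  obtains D :: "(real^3) set" and p Q a b \<gamma> C \<delta> where "finite D" "0 < C" "0 < \<delta>"
    "\<forall>z\<in>D. graph_chart \<Omega> (p z) (Q z) (a z) (b z) (\<gamma> z)"
    "\<forall>\<epsilon> x. 0 < \<epsilon> \<longrightarrow> \<epsilon> < \<delta> \<longrightarrow> infdist x (frontier \<Omega>) \<le> 2 * \<epsilon> \<longrightarrow>
       (\<exists>z\<in>D. chart_base (p z) (Q z) x \<in> box (- a z) (a z) \<and>
         \<bar>chart_height (p z) (Q z) x - \<gamma> z (chart_base (p z) (Q z) x)\<bar> \<le> C * \<epsilon>)"
proof -
  have "\<forall>z. \<exists>p Q a b \<gamma> y. z \<in> frontier \<Omega> \<longrightarrow>
      graph_chart \<Omega> p Q a b \<gamma> \<and> y \<in> box (- a) a \<and> z = chart_point p Q y (\<gamma> y)"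
    using bd unfolding C11_boundary_def by blast
  then obtain p Q a b \<gamma> y where chart: "\<And>z. z \<in> frontier \<Omega> \<Longrightarrow> graph_chart \<Omega> (p z) (Q z) (a z) (b z) (\<gamma> z)"
    and y: "\<And>z. z \<in> frontier \<Omega> \<Longrightarrow> y z \<in> box (- a z) (a z)"
    and z: "\<And>z. z \<in> frontier \<Omega> \<Longrightarrow> z = chart_point (p z) (Q z) (y z) (\<gamma> z (y z))"
    by metis
  have Q: "orthogonal_matrix (Q z)" if "z \<in> frontier \<Omega>" for z
    using chart[OF that] by (simp add: graph_chart_def)
  have "\<exists>L. 0 \<le> L \<and> L-lipschitz_on (box (- a z) (a z)) (\<gamma> z)" if "z \<in> frontier \<Omega>" for z
    using chart[OF that] by (intro C11_on_Lipschitz) (simp add: graph_chart_def)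
  then obtain L where L: "\<And>z. z \<in> frontier \<Omega> \<Longrightarrow> 0 \<le> L z"
      "\<And>z. z \<in> frontier \<Omega> \<Longrightarrow> (L z)-lipschitz_on (box (- a z) (a z)) (\<gamma> z)"
    by metis
  define U where "U z = chart_base (p z) (Q z) -` box (- a z) (a z) \<inter> chart_height (p z) (Q z) -` {- b z <..< b z}" for z
  have openU: "open (U z)" for z
    unfolding U_def by (intro open_Int open_vimage open_box open_greaterThanLessThan chart_continuous)
  have zU: "z \<in> U z" if zf: "z \<in> frontier \<Omega>" for z
  proof -
    have "\<bar>\<gamma> z (y z)\<bar> \<le> b z / 2" "0 < b z" using chart[OF zf] y[OF zf] by (auto simp: graph_chart_def)
    then have "chart_base (p z) (Q z) z \<in> box (- a z) (a z)" "\<bar>chart_height (p z) (Q z) z\<bar> < b z"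
      using y[OF zf] chart_coordinates(1,2)[OF Q[OF zf], of "p z" "y z" "\<gamma> z (y z)"] z[OF zf, symmetric] by auto
    then show ?thesis by (auto simp: U_def abs_less_iff)
  qed
  have comp: "compact (frontier \<Omega>)" using \<Omega>(2) by (rule compact_frontier_bounded)
  have "\<exists>D\<subseteq>frontier \<Omega>. finite D \<and> frontier \<Omega> \<subseteq> \<Union> (U ` D)"
    using comp zU openU by (elim compactE_image[where f=U and C="frontier \<Omega>"]) blast+
  then obtain D where D: "D \<subseteq> frontier \<Omega>" "finite D" "frontier \<Omega> \<subseteq> \<Union> (U ` D)" by blast
  obtain e where e: "0 < e" "\<And>x. x \<in> frontier \<Omega> \<Longrightarrow> \<exists>G\<in>U ` D. ball x e \<subseteq> G"
    using Heine_Borel_lemma[OF comp D(3)] openU by blast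
  have ne: "frontier \<Omega> \<noteq> {}"
    using \<Omega>(2,3) not_bounded_UNIV[where 'a="real^3"] by (auto simp: frontier_eq_empty)
  define C where "C = 2 * (1 + (\<Sum>z\<in>D. L z))"
  have "0 \<le> (\<Sum>z\<in>D. L z)" using D(1) L(1) by (intro sum_nonneg) auto
  then have C: "0 < C" by (simp add: C_def)
  show thesis
  proof (rule that[OF D(2) C, of "e / 2" p Q a b \<gamma>])
    show "0 < e / 2" using e by simp
    show "\<forall>z\<in>D. graph_chart \<Omega> (p z) (Q z) (a z) (b z) (\<gamma> z)" using chart D(1) by blast
  next
    show "\<forall>\<epsilon> x. 0 < \<epsilon> \<longrightarrow> \<epsilon> < e / 2 \<longrightarrow> infdist x (frontier \<Omega>) \<le> 2 * \<epsilon> \<longrightarrow>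
       (\<exists>z\<in>D. chart_base (p z) (Q z) x \<in> box (- a z) (a z) \<and>
         \<bar>chart_height (p z) (Q z) x - \<gamma> z (chart_base (p z) (Q z) x)\<bar> \<le> C * \<epsilon>)"
    proof (intro allI impI)
    fix \<epsilon> x assume \<epsilon>: "0 < \<epsilon>" "\<epsilon> < e / 2" and x: "infdist x (frontier \<Omega>) \<le> 2 * \<epsilon>"
    obtain w where w: "w \<in> frontier \<Omega>" "infdist x (frontier \<Omega>) = dist x w"
      using infdist_attains_inf[OF frontier_closed ne] by blast
    obtain v where v: "v \<in> D" "ball w e \<subseteq> U v" using e(2)[OF w(1)] by blast
    then have vf: "v \<in> frontier \<Omega>" using D(1) by blast
    note Qv = Q[OF vf]
    let ?base = "chart_base (p v) (Q v)" and ?h = "chart_height (p v) (Q v)"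
    have d: "dist x w \<le> 2 * \<epsilon>" using x w(2) by simp
    then have xU: "x \<in> U v" and wU: "w \<in> U v" using v(2) \<epsilon> e(1) by (auto simp: subset_iff dist_commute)
    have bx: "?base x \<in> box (- a v) (a v)" and bw: "?base w \<in> box (- a v) (a v)" and hw: "\<bar>?h w\<bar> < b v"
      using xU wU by (auto simp: U_def abs_less_iff)
    have "chart_point (p v) (Q v) (?base w) (?h w) \<in> frontier \<Omega> \<longleftrightarrow> ?h w = \<gamma> v (?base w)"
      using chart[OF vf] bw hw unfolding graph_chart_def by blast
    then have "?h w = \<gamma> v (?base w)" using chart_coordinates(3)[OF Qv] w(1) by simp
    then have "\<bar>?h x - \<gamma> v (?base x)\<bar> \<le> \<bar>?h x - ?h w\<bar> + \<bar>\<gamma> v (?base w) - \<gamma> v (?base x)\<bar>" by linarith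
    also have "\<dots> \<le> dist x w + L v * dist (?base w) (?base x)"
      using chart_Lipschitz(2)[OF Qv] lipschitz_onD[OF L(2)[OF vf] bw bx] by (auto simp: dist_real_def intro!: add_mono)
    also have "\<dots> \<le> dist x w + L v * dist x w"
      using chart_Lipschitz(1)[OF Qv, of "p v" w x] L(1)[OF vf] by (intro add_left_mono mult_left_mono) (auto simp: dist_commute)
    also have "\<dots> = (1 + L v) * dist x w" by (simp add: algebra_simps)
    also have "\<dots> \<le> (1 + (\<Sum>z\<in>D. L z)) * (2 * \<epsilon>)"
    proof (rule mult_mono)
      show "1 + L v \<le> 1 + (\<Sum>z\<in>D. L z)" using v(1) D(1,2) L(1) by (auto intro!: member_le_sum)
    qed (use d \<open>0 \<le> (\<Sum>z\<in>D. L z)\<close> in auto)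
    finally have "\<bar>?h x - \<gamma> v (?base x)\<bar> \<le> C * \<epsilon>" by (simp add: C_def algebra_simps)
    then show "\<exists>z\<in>D. chart_base (p z) (Q z) x \<in> box (- a z) (a z) \<and>
         \<bar>chart_height (p z) (Q z) x - \<gamma> z (chart_base (p z) (Q z) x)\<bar> \<le> C * \<epsilon>"
      using v(1) bx by blast
    qed
  qed
qed

definition graph_layer :: "real^3 \<Rightarrow> real^3^3 \<Rightarrow> real^2 \<Rightarrow> (real^2 \<Rightarrow> real) \<Rightarrow> real \<Rightarrow> (real^3) set" where
  "graph_layer p Q a \<gamma> h =
     {x. chart_base p Q x \<in> box (- a) a \<and> \<bar>chart_height p Q x - \<gamma> (chart_base p Q x)\<bar> \<le> h}"

lemma continuous_on_chart_graph:
  assumes "continuous_on (box (- a) a) \<gamma>"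
  shows "continuous_on (box (- a) a) (\<lambda>y. chart_point p Q y (\<gamma> y))"
proof -
  have "continuous_on (box (- a) a) (\<lambda>y. chart_point p Q (fst (y, \<gamma> y)) (snd (y, \<gamma> y)))"
    by (intro continuous_on_compose2[OF chart_continuous(3)[of UNIV]] continuous_intros assms) auto
  then show ?thesis by simp
qed

lemma graph_chart_continuous:
  assumes "graph_chart \<Omega> p Q a b \<gamma>" shows "continuous_on (box (- a) a) \<gamma>"
  using assms C11_on_Lipschitz[of a \<gamma>] unfolding graph_chart_def by (auto intro: lipschitz_on_continuous_on)

lemma graph_layer_borel:
  assumes "continuous_on (box (- a) a) \<gamma>"
  shows "graph_layer p Q a \<gamma> h \<in> sets borel"
proof -
  let ?U = "chart_base p Q -` box (- a) a"
  have U: "open ?U" by (intro open_vimage open_box chart_continuous)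
  have "continuous_on ?U (\<lambda>x. \<bar>chart_height p Q x - \<gamma> (chart_base p Q x)\<bar>)"
    by (intro continuous_intros chart_continuous continuous_on_compose2[OF assms chart_continuous(1)]) auto
  from continuous_closedin_preimage[OF this, of "{..h}"]
  obtain T where T: "closed T" "?U \<inter> (\<lambda>x. \<bar>chart_height p Q x - \<gamma> (chart_base p Q x)\<bar>) -` {..h} = ?U \<inter> T"
    by (auto simp: closedin_closed)
  moreover have "graph_layer p Q a \<gamma> h = ?U \<inter> (\<lambda>x. \<bar>chart_height p Q x - \<gamma> (chart_base p Q x)\<bar>) -` {..h}"
    by (auto simp: graph_layer_def)
  ultimately show ?thesis using U by auto
qed

text \<open>Fubini's theorem in the coordinates of the chart. In a thin layer \<open>f\<close>
  differs from its value on the graph by at most \<open>\<omega>\<close>, by uniform continuity,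
  and the layer has height \<open>2 * h\<close> over each point of the base.\<close>

lemma layer_integral_le:
  fixes f :: "real^3 \<Rightarrow> real"
  assumes chart: "graph_chart \<Omega> p Q a b \<gamma>" and \<Omega>: "bounded \<Omega>" and f: "continuous_on UNIV f"
    and \<omega>: "0 < \<omega>"
  shows "\<exists>h0>0. \<forall>h. 0 < h \<and> h < h0 \<longrightarrow>
    (\<integral>\<^sup>+x. indicator (graph_layer p Q a \<gamma> h) x * ennreal \<bar>f x\<bar> \<partial>lborel)
      \<le> ennreal (2 * h) * ((\<integral>\<^sup>+y. indicator (box (- a) a) y * ennreal \<bar>f (chart_point p Q y (\<gamma> y))\<bar> \<partial>lborel)
          + ennreal \<omega> * emeasure lborel (box (- a) a))"
proof -
  let ?B = "box (- a) a" and ?\<Gamma> = "\<lambda>y. chart_point p Q y (\<gamma> y)"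
  have Q: "orthogonal_matrix Q" and fr: "\<And>y. y \<in> ?B \<Longrightarrow> ?\<Gamma> y \<in> frontier \<Omega>"
    using chart unfolding graph_chart_def by force+
  have \<gamma>: "continuous_on ?B \<gamma>" by (rule graph_chart_continuous[OF chart])
  obtain r where r: "\<And>x. x \<in> frontier \<Omega> \<Longrightarrow> norm x \<le> r"
    using compact_imp_bounded[OF compact_frontier_bounded[OF \<Omega>]] by (auto simp: bounded_iff)
  have "uniformly_continuous_on (cball 0 (r + 1)) f"
    by (intro compact_uniformly_continuous continuous_on_subset[OF f]) auto
  then obtain d where d: "0 < d" "\<And>x x'. x \<in> cball 0 (r + 1) \<Longrightarrow> x' \<in> cball 0 (r + 1) \<Longrightarrow> dist x' x < d \<Longrightarrow> dist (f x') (f x) < \<omega>"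
    unfolding uniformly_continuous_on_def using \<omega> by metis
  have fm[measurable]: "f \<in> borel_measurable borel" using f by (rule borel_measurable_continuous_onI)
  have "(\<lambda>y. indicator ?B y *\<^sub>R f (?\<Gamma> y)) \<in> borel_measurable borel"
    by (intro borel_measurable_continuous_on_indicator continuous_on_compose2[OF f continuous_on_chart_graph[OF \<gamma>]]) auto
  then have "(\<lambda>y. ennreal \<bar>indicator ?B y *\<^sub>R f (?\<Gamma> y)\<bar>) \<in> borel_measurable borel" by measurable
  also have "(\<lambda>y. ennreal \<bar>indicator ?B y *\<^sub>R f (?\<Gamma> y)\<bar>) = (\<lambda>y. indicator ?B y * ennreal \<bar>f (?\<Gamma> y)\<bar>)"
    by (auto simp: fun_eq_iff indicator_def)
  finally have gm[measurable]: "(\<lambda>y. indicator ?B y * ennreal \<bar>f (?\<Gamma> y)\<bar>) \<in> borel_measurable borel" .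
  show ?thesis
  proof (intro exI conjI allI impI)
    show "0 < min d 1" using d by simp
    fix h assume h: "0 < h \<and> h < min d 1"
    let ?S = "graph_layer p Q a \<gamma> h"
    have [measurable]: "?S \<in> sets borel" by (rule graph_layer_borel[OF \<gamma>])
    have pt: "indicator ?S (chart_point p Q y t) * ennreal \<bar>f (chart_point p Q y t)\<bar>
        \<le> (indicator ?B y * ennreal (\<bar>f (?\<Gamma> y)\<bar> + \<omega>)) * indicator {\<gamma> y - h..\<gamma> y + h} t" for y t
    proof (cases "y \<in> ?B \<and> \<bar>t - \<gamma> y\<bar> \<le> h")
      case True
      have "norm (?\<Gamma> y) \<le> r" using r fr True by blast
      moreover have dist: "dist (chart_point p Q y t) (?\<Gamma> y) = \<bar>t - \<gamma> y\<bar>" by (rule chart_Lipschitz(3)[OF Q])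
      moreover have "norm (chart_point p Q y t) \<le> norm (?\<Gamma> y) + dist (chart_point p Q y t) (?\<Gamma> y)"
        by (metis dist_norm norm_triangle_sub)
      ultimately have "dist (f (chart_point p Q y t)) (f (?\<Gamma> y)) < \<omega>"
        using True h by (intro d(2)) auto
      then have "\<bar>f (chart_point p Q y t)\<bar> \<le> \<bar>f (?\<Gamma> y)\<bar> + \<omega>" by (simp add: dist_real_def)
      moreover have "t \<in> {\<gamma> y - h..\<gamma> y + h}" using True by auto
      ultimately show ?thesis using True by (simp add: ennreal_leI indicator_def)
    next
      case False
      then have "chart_point p Q y t \<notin> ?S" by (auto simp: graph_layer_def chart_coordinates[OF Q])
      then show ?thesis by simp
    qed
    have "(\<integral>\<^sup>+x. indicator ?S x * ennreal \<bar>f x\<bar> \<partial>lborel)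
        = (\<integral>\<^sup>+y. \<integral>\<^sup>+t. indicator ?S (chart_point p Q y t) * ennreal \<bar>f (chart_point p Q y t)\<bar> \<partial>lborel \<partial>lborel)"
      by (rule nn_integral_chart[OF Q]) measurable
    also have "\<dots> \<le> (\<integral>\<^sup>+y. \<integral>\<^sup>+t. (indicator ?B y * ennreal (\<bar>f (?\<Gamma> y)\<bar> + \<omega>)) * indicator {\<gamma> y - h..\<gamma> y + h} t \<partial>lborel \<partial>lborel)"
      by (intro nn_integral_mono pt)
    also have "\<dots> = (\<integral>\<^sup>+y. ennreal (2 * h) * (indicator ?B y * ennreal \<bar>f (?\<Gamma> y)\<bar> + ennreal \<omega> * indicator ?B y) \<partial>lborel)"
      using h \<omega> by (subst nn_integral_cmult_indicator)
        (auto simp: mult.commute distrib_left indicator_def intro!: nn_integral_cong)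
    also have "\<dots> = ennreal (2 * h) * ((\<integral>\<^sup>+y. indicator ?B y * ennreal \<bar>f (?\<Gamma> y)\<bar> \<partial>lborel)
          + ennreal \<omega> * emeasure lborel ?B)"
      by (subst nn_integral_cmult, measurable, subst nn_integral_add, measurable)
         (simp add: nn_integral_cmult_indicator)
    finally show "(\<integral>\<^sup>+x. indicator ?S x * ennreal \<bar>f x\<bar> \<partial>lborel)
      \<le> ennreal (2 * h) * ((\<integral>\<^sup>+y. indicator ?B y * ennreal \<bar>f (?\<Gamma> y)\<bar> \<partial>lborel)
          + ennreal \<omega> * emeasure lborel ?B)" .
  qed
qed

lemma chart_integrand_measurable:
  assumes "graph_chart \<Omega> p Q a b \<gamma>" "continuous_on UNIV g"
  shows "(\<lambda>y. indicator (box (- a) a) y * ennreal (g (chart_point p Q y (\<gamma> y)))) \<in> borel_measurable borel"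
proof -
  have "(\<lambda>y. indicator (box (- a) a) y *\<^sub>R g (chart_point p Q y (\<gamma> y))) \<in> borel_measurable borel"
    by (intro borel_measurable_continuous_on_indicator
        continuous_on_compose2[OF assms(2) continuous_on_chart_graph[OF graph_chart_continuous[OF assms(1)]]]) auto
  then have "(\<lambda>y. ennreal (indicator (box (- a) a) y *\<^sub>R g (chart_point p Q y (\<gamma> y)))) \<in> borel_measurable borel"
    by measurable
  also have "(\<lambda>y. ennreal (indicator (box (- a) a) y *\<^sub>R g (chart_point p Q y (\<gamma> y))))
      = (\<lambda>y. indicator (box (- a) a) y * ennreal (g (chart_point p Q y (\<gamma> y))))"
    by (auto simp: fun_eq_iff indicator_def)
  finally show ?thesis .
qed

text \<open>Young's inequality in place of the Cauchy--Schwarz inequality: the factor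
  \<open>s\<close> makes the first term arbitrarily small, and for functions with boundary values
  tending to zero the second term vanishes in the limit.\<close>

lemma graph_integral_Young:
  fixes f :: "real^3 \<Rightarrow> real"
  assumes chart: "graph_chart \<Omega> p Q a b \<gamma>" and f: "continuous_on UNIV f" and s: "0 < s"
  shows "(\<integral>\<^sup>+y. indicator (box (- a) a) y * ennreal \<bar>f (chart_point p Q y (\<gamma> y))\<bar> \<partial>lborel)
    \<le> ennreal (s / 2) * emeasure lborel (box (- a) a)
      + ennreal (1 / (2 * s)) * (4 * (\<integral>\<^sup>+x. ennreal ((f x)\<^sup>2) \<partial>surface_measure \<Omega>))"
proof -
  let ?B = "box (- a) a" and ?\<Gamma> = "\<lambda>y. chart_point p Q y (\<gamma> y)"
  have fm: "(\<lambda>x. ennreal ((f x)\<^sup>2)) \<in> borel_measurable borel"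
    using borel_measurable_continuous_onI[OF f] by measurable
  have m[measurable]: "(\<lambda>y. indicator ?B y * ennreal ((f (?\<Gamma> y))\<^sup>2)) \<in> borel_measurable borel"
    using f by (intro chart_integrand_measurable[OF chart, of "\<lambda>x. (f x)\<^sup>2"] continuous_intros)
  have "(\<integral>\<^sup>+y. indicator ?B y * ennreal \<bar>f (?\<Gamma> y)\<bar> \<partial>lborel)
      \<le> (\<integral>\<^sup>+y. ennreal (s / 2) * indicator ?B y + ennreal (1 / (2 * s)) * (indicator ?B y * ennreal ((f (?\<Gamma> y))\<^sup>2)) \<partial>lborel)"
  proof (rule nn_integral_mono)
    fix y
    have "\<bar>t\<bar> \<le> s / 2 + 1 / (2 * s) * t\<^sup>2" for t
    proof -
      have "0 \<le> (s - \<bar>t\<bar>)\<^sup>2" by simp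
      then have "2 * s * \<bar>t\<bar> \<le> s\<^sup>2 + t\<^sup>2" by (simp add: power2_diff)
      then show ?thesis using s by (simp add: field_simps power2_eq_square)
    qed
    then have "ennreal \<bar>f (?\<Gamma> y)\<bar> \<le> ennreal (s / 2 + 1 / (2 * s) * (f (?\<Gamma> y))\<^sup>2)" by (rule ennreal_leI)
    also have "\<dots> = ennreal (s / 2) + ennreal (1 / (2 * s)) * ennreal ((f (?\<Gamma> y))\<^sup>2)"
      using s by (subst ennreal_plus) (auto simp only: ennreal_mult zero_le_power2 divide_nonneg_pos intro!: mult_nonneg_nonneg)
    finally show "indicator ?B y * ennreal \<bar>f (?\<Gamma> y)\<bar>
        \<le> ennreal (s / 2) * indicator ?B y + ennreal (1 / (2 * s)) * (indicator ?B y * ennreal ((f (?\<Gamma> y))\<^sup>2))"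
      by (simp add: indicator_def)
  qed
  also have "\<dots> = ennreal (s / 2) * emeasure lborel ?B
      + ennreal (1 / (2 * s)) * (\<integral>\<^sup>+y. indicator ?B y * ennreal ((f (?\<Gamma> y))\<^sup>2) \<partial>lborel)"
    by (subst nn_integral_add, measurable, subst nn_integral_cmult, measurable)
       (simp add: nn_integral_cmult_indicator)
  also have "\<dots> \<le> ennreal (s / 2) * emeasure lborel ?B
      + ennreal (1 / (2 * s)) * (4 * (\<integral>\<^sup>+x. ennreal ((f x)\<^sup>2) \<partial>surface_measure \<Omega>))"
    by (intro add_left_mono mult_left_mono graph_integral_le_surface_integral[OF chart fm]) auto
  finally show ?thesis .
qed

lemma emeasure_lborel_box_finite_real:
  "emeasure lborel (box l u :: 'a::euclidean_space set) = ennreal (measure lborel (box l u))"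
  by (rule emeasure_eq_ennreal_measure) (simp add: emeasure_lborel_box_eq ennreal_prod_eq_top)

text \<open>What remains of the divergence theorem. In the limit of thin strips, the mean of
  \<open>\<bar>f\<bar>\<close> over the strip is bounded by the integrals of
  \<open>\<bar>f\<bar>\<close> over the finitely many graphs, and these by Young's
  inequality.\<close>

lemma boundary_controls_integral:
  fixes \<Omega> :: "(real^3) set"
  assumes \<Omega>: "open \<Omega>" "bounded \<Omega>" and bd: "C11_boundary \<Omega>"
  shows "\<exists>A>0. \<forall>f i s. smooth f \<longrightarrow> 0 < s \<longrightarrow>
    ennreal \<bar>LINT x|lebesgue_on \<Omega>. partial i f x\<bar>
      \<le> ennreal (A * s) + ennreal (A / s) * (\<integral>\<^sup>+x. ennreal ((f x)\<^sup>2) \<partial>surface_measure \<Omega>)"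
proof (cases "\<Omega> = {}")
  case True
  have "(LINT x|lebesgue_on \<Omega>. h x) = 0" for h :: "real^3 \<Rightarrow> real"
    using True by (simp add: integral_restrict_space)
  then show ?thesis by (intro exI[of _ 1]) auto
next
  case False
  obtain D :: "(real^3) set" and p Q a b \<gamma> C \<delta> where D: "finite D" and C: "0 < C" and \<delta>: "0 < \<delta>"
    and charts: "\<forall>z\<in>D. graph_chart \<Omega> (p z) (Q z) (a z) (b z) (\<gamma> z)"
    and covers: "\<forall>\<epsilon> x. 0 < \<epsilon> \<longrightarrow> \<epsilon> < \<delta> \<longrightarrow> infdist x (frontier \<Omega>) \<le> 2 * \<epsilon> \<longrightarrow>
       (\<exists>z\<in>D. chart_base (p z) (Q z) x \<in> box (- a z) (a z) \<and>
         \<bar>chart_height (p z) (Q z) x - \<gamma> z (chart_base (p z) (Q z) x)\<bar> \<le> C * \<epsilon>)"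
    by (rule strip_cover[OF \<Omega> False bd]) (rule that)
  note chart = charts[rule_format] and cover = covers[rule_format]
  define \<alpha> where "\<alpha> z = measure lborel (box (- a z) (a z))" for z :: "real^3"
  have \<alpha>: "0 \<le> \<alpha> z" "emeasure lborel (box (- a z) (a z)) = ennreal (\<alpha> z)" for z
    by (auto simp: \<alpha>_def emeasure_lborel_box_finite_real)
  \<comment> \<open>\<open>2 * C\<close> is the height of a layer in units of
    \<open>\<epsilon>\<close>; \<open>\<alpha> z / 2\<close> and \<open>2\<close> are the
    coefficients of \<open>s\<close> and \<open>1 / s\<close> in Young's inequality. The summand
    \<open>1\<close> makes \<open>A\<close> positive for empty \<open>D\<close>.\<close>
  define A where "A = (\<Sum>z\<in>D. 2 * C * (\<alpha> z / 2 + 2)) + 1"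
  have A: "0 < A" unfolding A_def using C \<alpha>(1) by (intro add_nonneg_pos sum_nonneg) auto
  have main: "ennreal \<bar>LINT x|lebesgue_on \<Omega>. partial i f x\<bar>
      \<le> ennreal (A * s) + ennreal (A / s) * (\<integral>\<^sup>+x. ennreal ((f x)\<^sup>2) \<partial>surface_measure \<Omega>)"
    if f: "smooth f" and s: "0 < s" for f i s
  proof (cases "\<integral>\<^sup>+x. ennreal ((f x)\<^sup>2) \<partial>surface_measure \<Omega>")
    case top
    then show ?thesis using A s by (simp add: ennreal_mult_top)
  next
    case (real X)
    have fc: "continuous_on UNIV f" by (rule smooth_continuous[OF f])
    define I where "I z = (\<integral>\<^sup>+y. indicator (box (- a z) (a z)) y * ennreal \<bar>f (chart_point (p z) (Q z) y (\<gamma> z y))\<bar> \<partial>lborel)" for z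
    define \<iota> where "\<iota> z = enn2real (I z)" for z
    have Ile: "I z \<le> ennreal (s * \<alpha> z / 2 + 2 * X / s)" if z: "z \<in> D" for z
    proof -
      have "I z \<le> ennreal (s / 2) * ennreal (\<alpha> z) + ennreal (1 / (2 * s)) * (4 * ennreal X)"
        using graph_integral_Young[OF chart[OF z] fc s] unfolding I_def \<alpha>(2) real(2) .
      also have "\<dots> = ennreal (s / 2 * \<alpha> z) + ennreal (1 / (2 * s) * (4 * X))"
        using s real(1) \<alpha>(1)[of z] by (simp only: ennreal_mult[symmetric] ennreal_numeral[symmetric]
          divide_nonneg_pos mult_nonneg_nonneg zero_le_numeral less_imp_le zero_less_numeral zero_le_one mult_pos_pos)
      also have "\<dots> = ennreal (s / 2 * \<alpha> z + 1 / (2 * s) * (4 * X))"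
        using s real(1) \<alpha>(1)[of z] by (intro ennreal_plus[symmetric]) auto
      also have "s / 2 * \<alpha> z + 1 / (2 * s) * (4 * X) = s * \<alpha> z / 2 + 2 * X / s" using s by (simp add: field_simps)
      finally show ?thesis .
    qed
    have \<iota>: "I z = ennreal (\<iota> z)" "0 \<le> \<iota> z" "\<iota> z \<le> s * \<alpha> z / 2 + 2 * X / s" if z: "z \<in> D" for z
    proof -
      have "I z < top" using Ile[OF z] by (meson ennreal_less_top le_less_trans)
      then show "I z = ennreal (\<iota> z)" by (simp add: \<iota>_def)
      show "0 \<le> \<iota> z" by (simp add: \<iota>_def)
      show "\<iota> z \<le> s * \<alpha> z / 2 + 2 * X / s"
        unfolding \<iota>_def using Ile[OF z] s real(1) \<alpha>(1)[of z] by (intro enn2real_leI) auto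
    qed
    define B where "B = (\<Sum>z\<in>D. 2 * C * \<iota> z)"
    have "\<bar>LINT x|lebesgue_on \<Omega>. partial i f x\<bar> \<le> B"
    proof (rule integral_partial_le_strip_limit[OF \<Omega> smooth_differentiable[OF f] smooth_continuous[OF smooth_partial[OF f]]])
      fix \<eta> :: real assume \<eta>: "0 < \<eta>"
      define S where "S = (\<Sum>z\<in>D. 2 * C * \<alpha> z)"
      have S: "0 \<le> S" unfolding S_def using C \<alpha>(1) by (intro sum_nonneg) auto
      define \<omega> where "\<omega> = \<eta> / (S + 1)"
      have \<omega>: "0 < \<omega>" using \<eta> S by (simp add: \<omega>_def)
      have \<omega>S: "\<omega> * S \<le> \<eta>" using \<eta> S by (simp add: \<omega>_def field_simps)
      let ?lay = "\<lambda>z \<epsilon>. \<integral>\<^sup>+x. indicator (graph_layer (p z) (Q z) (a z) (\<gamma> z) (C * \<epsilon>)) x * ennreal \<bar>f x\<bar> \<partial>lborel"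
      have "\<forall>\<^sub>F \<epsilon> in at_right 0. ?lay z \<epsilon> \<le> ennreal (2 * (C * \<epsilon>)) * (I z + ennreal \<omega> * ennreal (\<alpha> z))" if z: "z \<in> D" for z
      proof -
        obtain h0 where h0: "0 < h0" "\<And>h. 0 < h \<Longrightarrow> h < h0 \<Longrightarrow>
           (\<integral>\<^sup>+x. indicator (graph_layer (p z) (Q z) (a z) (\<gamma> z) h) x * ennreal \<bar>f x\<bar> \<partial>lborel)
            \<le> ennreal (2 * h) * (I z + ennreal \<omega> * ennreal (\<alpha> z))"
          using layer_integral_le[OF chart[OF z] \<Omega>(2) fc \<omega>] unfolding I_def \<alpha>(2) by blast
        show ?thesis
          unfolding eventually_at_right_field
        proof (intro exI[of _ "h0 / C"] conjI allI impI)
          show "0 < h0 / C" using h0(1) C by simp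
          fix \<epsilon> :: real assume "0 < \<epsilon>" "\<epsilon> < h0 / C"
          then show "?lay z \<epsilon> \<le> ennreal (2 * (C * \<epsilon>)) * (I z + ennreal \<omega> * ennreal (\<alpha> z))"
            using C by (intro h0(2)) (auto simp: field_simps)
        qed
      qed
      then have "\<forall>\<^sub>F \<epsilon> in at_right 0. \<forall>z\<in>D. ?lay z \<epsilon> \<le> ennreal (2 * (C * \<epsilon>)) * (I z + ennreal \<omega> * ennreal (\<alpha> z))"
        using D by (intro eventually_ball_finite) auto
      then obtain e where e: "0 < e" "\<And>\<epsilon>. 0 < \<epsilon> \<Longrightarrow> \<epsilon> < e \<Longrightarrow>
          \<forall>z\<in>D. ?lay z \<epsilon> \<le> ennreal (2 * (C * \<epsilon>)) * (I z + ennreal \<omega> * ennreal (\<alpha> z))"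
        unfolding eventually_at_right_field by blast
      show "\<exists>\<epsilon>0>0. \<forall>\<epsilon>. 0 < \<epsilon> \<and> \<epsilon> < \<epsilon>0 \<longrightarrow>
        (LINT x|lborel. indicator {x. infdist x (frontier \<Omega>) \<le> 2 * \<epsilon>} x * \<bar>f x\<bar>) / \<epsilon> \<le> B + \<eta>"
      proof (intro exI conjI allI impI)
        show "0 < min e \<delta>" using e \<delta> by simp
        fix \<epsilon> assume \<epsilon>: "0 < \<epsilon> \<and> \<epsilon> < min e \<delta>"
        let ?T = "{x. infdist x (frontier \<Omega>) \<le> 2 * \<epsilon>}"
        have "closed ?T" by (intro closed_Collect_le continuous_intros)
        then have T[measurable]: "?T \<in> sets borel" by simp
        have [measurable]: "f \<in> borel_measurable borel" by (rule borel_measurable_continuous_onI[OF fc])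
        have [measurable]: "z \<in> D \<Longrightarrow> graph_layer (p z) (Q z) (a z) (\<gamma> z) (C * \<epsilon>) \<in> sets borel" for z
          by (rule graph_layer_borel[OF graph_chart_continuous[OF chart]])
        have "(LINT x|lborel. indicator ?T x * \<bar>f x\<bar>) = enn2real (\<integral>\<^sup>+x. ennreal (indicator ?T x * \<bar>f x\<bar>) \<partial>lborel)"
          by (intro integral_eq_nn_integral) auto
        also have "\<dots> \<le> \<epsilon> * (B + \<eta>)"
        proof (rule enn2real_leI)
          have "(\<integral>\<^sup>+x. ennreal (indicator ?T x * \<bar>f x\<bar>) \<partial>lborel)
            \<le> (\<integral>\<^sup>+x. (\<Sum>z\<in>D. indicator (graph_layer (p z) (Q z) (a z) (\<gamma> z) (C * \<epsilon>)) x * ennreal \<bar>f x\<bar>) \<partial>lborel)"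
          proof (rule nn_integral_mono)
            fix x
            show "ennreal (indicator ?T x * \<bar>f x\<bar>)
              \<le> (\<Sum>z\<in>D. indicator (graph_layer (p z) (Q z) (a z) (\<gamma> z) (C * \<epsilon>)) x * ennreal \<bar>f x\<bar>)"
            proof (cases "x \<in> ?T")
              case True
              then obtain z where z: "z \<in> D" "x \<in> graph_layer (p z) (Q z) (a z) (\<gamma> z) (C * \<epsilon>)"
                using cover[of \<epsilon> x] \<epsilon> by (auto simp: graph_layer_def)
              have "indicator (graph_layer (p z) (Q z) (a z) (\<gamma> z) (C * \<epsilon>)) x * ennreal \<bar>f x\<bar>
                \<le> (\<Sum>z\<in>D. indicator (graph_layer (p z) (Q z) (a z) (\<gamma> z) (C * \<epsilon>)) x * ennreal \<bar>f x\<bar>)"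
                using D z(1) by (intro member_le_sum[of z D "\<lambda>z. indicator (graph_layer (p z) (Q z) (a z) (\<gamma> z) (C * \<epsilon>)) x * ennreal \<bar>f x\<bar>"]) auto
              then show ?thesis using True z(2) by simp
            qed simp
          qed
          also have "\<dots> = (\<Sum>z\<in>D. ?lay z \<epsilon>)" by (rule nn_integral_sum) measurable
          also have "\<dots> \<le> (\<Sum>z\<in>D. ennreal (2 * (C * \<epsilon>)) * (I z + ennreal \<omega> * ennreal (\<alpha> z)))"
            using e(2)[of \<epsilon>] \<epsilon> by (intro sum_mono) auto
          also have "\<dots> = (\<Sum>z\<in>D. ennreal (2 * (C * \<epsilon>) * (\<iota> z + \<omega> * \<alpha> z)))"
            using \<iota> \<alpha>(1) \<omega> C \<epsilon> by (intro sum.cong refl) (simp add: ennreal_mult[symmetric] ennreal_plus[symmetric] del: ennreal_plus)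
          also have "\<dots> = ennreal (\<Sum>z\<in>D. 2 * (C * \<epsilon>) * (\<iota> z + \<omega> * \<alpha> z))"
            using \<iota> \<alpha>(1) \<omega> C \<epsilon> by (intro sum_ennreal) auto
          also have "(\<Sum>z\<in>D. 2 * (C * \<epsilon>) * (\<iota> z + \<omega> * \<alpha> z)) = \<epsilon> * (B + \<omega> * S)"
            unfolding B_def S_def by (simp add: sum_distrib_left sum.distrib[symmetric] algebra_simps)
          also have "ennreal (\<epsilon> * (B + \<omega> * S)) \<le> ennreal (\<epsilon> * (B + \<eta>))"
            using \<epsilon> \<omega>S by (intro ennreal_leI mult_left_mono) auto
          finally show "(\<integral>\<^sup>+x. ennreal (indicator ?T x * \<bar>f x\<bar>) \<partial>lborel) \<le> ennreal (\<epsilon> * (B + \<eta>))" .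
          have "0 \<le> B" unfolding B_def using \<iota>(2) C by (intro sum_nonneg) auto
          then show "0 \<le> \<epsilon> * (B + \<eta>)" using \<epsilon> \<eta> by auto
        qed
        finally show "(LINT x|lborel. indicator ?T x * \<bar>f x\<bar>) / \<epsilon> \<le> B + \<eta>"
          using \<epsilon> by (simp add: field_simps)
      qed
    qed
    also have "B \<le> (\<Sum>z\<in>D. 2 * C * (s * \<alpha> z / 2 + 2 * X / s))"
      unfolding B_def using \<iota>(3) C by (intro sum_mono mult_left_mono) auto
    also have "\<dots> \<le> (\<Sum>z\<in>D. 2 * C * (\<alpha> z / 2 + 2) * s + 2 * C * (\<alpha> z / 2 + 2) * (X / s))"
    proof (rule sum_mono)
      fix z
      have "0 \<le> 2 * C * 2 * s" "0 \<le> 2 * C * (\<alpha> z / 2) * (X / s)" using C s \<alpha>(1)[of z] real(1) by auto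
      then show "2 * C * (s * \<alpha> z / 2 + 2 * X / s) \<le> 2 * C * (\<alpha> z / 2 + 2) * s + 2 * C * (\<alpha> z / 2 + 2) * (X / s)"
        by (simp add: algebra_simps)
    qed
    also have "\<dots> = (A - 1) * s + (A - 1) * (X / s)"
      unfolding A_def by (simp add: sum.distrib sum_distrib_right sum_divide_distrib)
    also have "\<dots> \<le> A * s + A / s * X"
    proof (rule add_mono)
      show "(A - 1) * s \<le> A * s" using s by (intro mult_right_mono) auto
      have "(A - 1) * (X / s) \<le> A * (X / s)" using s real(1) by (intro mult_right_mono) auto
      then show "(A - 1) * (X / s) \<le> A / s * X" by simp
    qed
    finally have "ennreal \<bar>LINT x|lebesgue_on \<Omega>. partial i f x\<bar> \<le> ennreal (A * s + A / s * X)" by (rule ennreal_leI)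
    also have "\<dots> = ennreal (A * s) + ennreal (A / s * X)"
      using A s real(1) by (intro ennreal_plus) auto
    also have "ennreal (A / s * X) = ennreal (A / s) * ennreal X"
      using A s real(1) by (intro ennreal_mult) auto
    finally show ?thesis unfolding real(2) .
  qed
  show ?thesis using A main by blast
qed

lemma L2_wpartial:
  assumes "H1 \<Omega> f"
  shows "L2 (lebesgue_on \<Omega>) (wpartial \<Omega> i f)" "has_weak_partial \<Omega> i f (wpartial \<Omega> i f)"
proof -
  have "\<exists>g. L2 (lebesgue_on \<Omega>) g \<and> has_weak_partial \<Omega> i f g" using assms by (simp add: H1_def)
  from someI_ex[OF this] show "L2 (lebesgue_on \<Omega>) (wpartial \<Omega> i f)" "has_weak_partial \<Omega> i f (wpartial \<Omega> i f)"
    by (auto simp: wpartial_def)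
qed

lemma smooth_surface_measurable:
  assumes "smooth f" shows "f \<in> borel_measurable (surface_measure \<Omega>)"
proof -
  have "f \<in> borel_measurable borel" by (rule borel_measurable_continuous_onI[OF smooth_continuous[OF assms]])
  then have "f \<in> borel_measurable (measure_of UNIV (sets borel) hausdorff2)"
    by (simp add: measurable_def sets_measure_of_conv space_measure_of_conv sets.sigma_sets_eq[of borel, simplified])
  then show ?thesis
    unfolding surface_measure_def by (intro measurable_completion measurable_restrict_space1)
qed

text \<open>Let \<open>\<phi> k\<close> be smooth approximations of \<open>u\<close> whose
  boundary values tend to zero. The integrals of the derivatives of \<open>\<phi> k *
  \<psi>\<close> tend to the sum \<open>J\<close> of the two integrals in question, and they are
  controlled by the boundary values of \<open>\<phi> k * \<psi>\<close>. So \<open>\<bar>J\<bar>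
  \<le> A * s\<close> for every \<open>s > 0\<close>.\<close>

lemma zero_trace_by_parts:
  fixes \<Omega> :: "(real^3) set"
  assumes \<Omega>: "open \<Omega>" "bounded \<Omega>" and bd: "C11_boundary \<Omega>"
    and u: "has_trace \<Omega> u (\<lambda>_. 0)" and \<psi>: "smooth \<psi>"
  shows "(LINT x|lebesgue_on \<Omega>. wpartial \<Omega> i u x * \<psi> x) = - (LINT x|lebesgue_on \<Omega>. u x * partial i \<psi> x)"
proof -
  let ?M = "lebesgue_on \<Omega>" and ?S = "surface_measure \<Omega>"
  have meas: "\<Omega> \<in> sets lebesgue" using \<Omega>(1) by simp
  have u1: "H1 \<Omega> u" using u by (simp add: has_trace_def)
  then have uL2: "L2 ?M u" by (simp add: H1_def)
  obtain \<phi> where \<phi>: "\<And>k. smooth (\<phi> k)" "L2_tendsto ?M \<phi> u"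
      "L2_tendsto ?M (\<lambda>k. partial i (\<phi> k)) (wpartial \<Omega> i u)" "L2_tendsto ?S \<phi> (\<lambda>_. 0)"
    using u unfolding has_trace_def by blast
  have sL2: "L2 ?M f" if "smooth f" for f
    by (rule L2_bounded_continuous[OF meas \<Omega>(2) smooth_continuous[OF that]])
  obtain A where A: "0 < A" and ineq: "\<And>f i s. smooth f \<Longrightarrow> 0 < s \<Longrightarrow>
    ennreal \<bar>LINT x|?M. partial i f x\<bar> \<le> ennreal (A * s) + ennreal (A / s) * (\<integral>\<^sup>+x. ennreal ((f x)\<^sup>2) \<partial>?S)"
    using boundary_controls_integral[OF \<Omega> bd] by blast
  define J where "J = (LINT x|?M. u x * partial i \<psi> x) + (LINT x|?M. wpartial \<Omega> i u x * \<psi> x)"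
  have prod: "(LINT x|?M. partial i (\<lambda>x. \<phi> k x * \<psi> x) x)
      = (LINT x|?M. \<phi> k x * partial i \<psi> x) + (LINT x|?M. partial i (\<phi> k) x * \<psi> x)" for k
    using L2_mult_integrable[OF sL2[OF \<phi>(1)] sL2[OF smooth_partial[OF \<psi>]]]
      L2_mult_integrable[OF sL2[OF smooth_partial[OF \<phi>(1)]] sL2[OF \<psi>]]
    by (simp add: partial_mult[OF smooth_differentiable[OF \<phi>(1)] smooth_differentiable[OF \<psi>]])
  have lim: "(\<lambda>k. LINT x|?M. partial i (\<lambda>x. \<phi> k x * \<psi> x) x) \<longlonglongrightarrow> J"
    unfolding prod J_def
    by (intro tendsto_add L2_tendsto_bilinear[OF bounded_bilinear_mult] sL2 smooth_partial \<phi> \<psi> uL2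
        L2_wpartial[OF u1] L2_tendsto_const)
  have "compact (\<psi> ` frontier \<Omega>)"
    using \<Omega>(2) by (intro compact_continuous_image compact_frontier_bounded continuous_on_subset[OF smooth_continuous[OF \<psi>]]) auto
  then obtain K where "\<forall>y\<in>\<psi> ` frontier \<Omega>. norm y \<le> K"
    using compact_imp_bounded bounded_iff by blast
  then have K: "\<bar>\<psi> x\<bar> \<le> K" if "x \<in> frontier \<Omega>" for x using that by auto
  have surf: "(\<integral>\<^sup>+x. ennreal ((\<phi> k x * \<psi> x)\<^sup>2) \<partial>?S) \<le> ennreal (K\<^sup>2) * (\<integral>\<^sup>+x. ennreal ((norm (\<phi> k x - 0))\<^sup>2) \<partial>?S)" for k
  proof -
    have "(\<integral>\<^sup>+x. ennreal ((\<phi> k x * \<psi> x)\<^sup>2) \<partial>?S) \<le> (\<integral>\<^sup>+x. ennreal (K\<^sup>2) * ennreal ((norm (\<phi> k x - 0))\<^sup>2) \<partial>?S)"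
    proof (rule nn_integral_mono)
      fix x assume "x \<in> space ?S"
      then have "x \<in> frontier \<Omega>" by (auto simp: surface_measure_def space_restrict_space)
      from power_mono[OF K[OF this], of 2] have "(\<psi> x)\<^sup>2 \<le> K\<^sup>2" by simp
      then have "(\<phi> k x * \<psi> x)\<^sup>2 \<le> K\<^sup>2 * (norm (\<phi> k x - 0))\<^sup>2"
        by (simp add: power_mult_distrib mult.commute mult_right_mono)
      then show "ennreal ((\<phi> k x * \<psi> x)\<^sup>2) \<le> ennreal (K\<^sup>2) * ennreal ((norm (\<phi> k x - 0))\<^sup>2)"
        by (simp add: ennreal_mult[symmetric] ennreal_leI)
    qed
    also have "\<dots> = ennreal (K\<^sup>2) * (\<integral>\<^sup>+x. ennreal ((norm (\<phi> k x - 0))\<^sup>2) \<partial>?S)"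
    proof (rule nn_integral_cmult)
      have "\<phi> k \<in> borel_measurable ?S" by (rule smooth_surface_measurable[OF \<phi>(1)])
      then show "(\<lambda>x. ennreal ((norm (\<phi> k x - 0))\<^sup>2)) \<in> borel_measurable ?S" by measurable
    qed
    finally show ?thesis .
  qed
  have J: "\<bar>J\<bar> \<le> A * s" if s: "0 < s" for s
  proof -
    have "ennreal \<bar>J\<bar> \<le> ennreal (A * s)"
    proof (rule LIMSEQ_le)
      show "(\<lambda>k. ennreal \<bar>LINT x|?M. partial i (\<lambda>x. \<phi> k x * \<psi> x) x\<bar>) \<longlonglongrightarrow> ennreal \<bar>J\<bar>"
        by (intro tendsto_ennrealI tendsto_rabs lim)
      have "(\<lambda>k. ennreal (A / s) * (ennreal (K\<^sup>2) * (\<integral>\<^sup>+x. ennreal ((norm (\<phi> k x - 0))\<^sup>2) \<partial>?S)))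
          \<longlonglongrightarrow> ennreal (A / s) * (ennreal (K\<^sup>2) * 0)"
        using \<phi>(4) unfolding L2_tendsto_def by (intro ennreal_tendsto_cmult) auto
      from tendsto_add[OF tendsto_const this]
      show "(\<lambda>k. ennreal (A * s) + ennreal (A / s) * (ennreal (K\<^sup>2) * (\<integral>\<^sup>+x. ennreal ((norm (\<phi> k x - 0))\<^sup>2) \<partial>?S)))
          \<longlonglongrightarrow> ennreal (A * s)" by simp
      have "ennreal \<bar>LINT x|?M. partial i (\<lambda>x. \<phi> k x * \<psi> x) x\<bar>
          \<le> ennreal (A * s) + ennreal (A / s) * (ennreal (K\<^sup>2) * (\<integral>\<^sup>+x. ennreal ((norm (\<phi> k x - 0))\<^sup>2) \<partial>?S))" for k
        by (rule order_trans[OF ineq[OF smooth_mult[OF \<phi>(1) \<psi>] s]]) (intro add_left_mono mult_left_mono surf, simp)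
      then show "\<exists>N. \<forall>n\<ge>N. ennreal \<bar>LINT x|?M. partial i (\<lambda>x. \<phi> n x * \<psi> x) x\<bar>
          \<le> ennreal (A * s) + ennreal (A / s) * (ennreal (K\<^sup>2) * (\<integral>\<^sup>+x. ennreal ((norm (\<phi> n x - 0))\<^sup>2) \<partial>?S))" by blast
    qed
    then show ?thesis using A s by (simp add: ennreal_le_iff)
  qed
  then have "\<bar>J\<bar> \<le> 0 + e" if "0 < e" for e using J[of "e / A"] A that by simp
  then have "J = 0" using field_le_epsilon[of "\<bar>J\<bar>" 0] by simp
  then show ?thesis by (simp add: J_def)
qed

section \<open>Weak derivatives\<close>

lemma test_fun_smooth: "test_fun \<Omega> \<phi> \<Longrightarrow> smooth \<phi>"
  by (simp add: test_fun_def)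

lemma L2_smooth:
  fixes f :: "real^'n::finite \<Rightarrow> real"
  assumes "open \<Omega>" "bounded \<Omega>" "smooth f" shows "L2 (lebesgue_on \<Omega>) f"
  using assms by (intro L2_bounded_continuous smooth_continuous) auto

text \<open>The fundamental lemma of the calculus of variations. Products of a bump function with
  waves are test functions, so all Fourier coefficients of \<open>w\<close> times the bump
  function vanish, and \<open>w\<close> vanishes almost everywhere in the box that supports the
  bump function. Countably many such boxes cover \<open>\<Omega>\<close>.\<close>

lemma AE_zero_of_test_funs:
  fixes w :: "real^'n::finite \<Rightarrow> real"
  assumes \<Omega>: "open \<Omega>" "bounded \<Omega>" and w: "L2 (lebesgue_on \<Omega>) w"
    and zero: "\<And>\<phi>. test_fun \<Omega> \<phi> \<Longrightarrow> (LINT x|lebesgue_on \<Omega>. w x * \<phi> x) = 0"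
  shows "AE x in lebesgue_on \<Omega>. w x = 0"
proof -
  have meas: "\<Omega> \<in> sets lebesgue" using \<Omega>(1) by simp
  obtain r0 where r0: "\<Omega> \<subseteq> cball 0 r0" using \<Omega>(2) by (auto simp: bounded_iff subset_iff)
  define r where "r = max r0 1"
  have r: "\<Omega> \<subseteq> cball 0 r" "0 < r" using r0 by (auto simp: r_def)
  have local: "AE x in lebesgue_on \<Omega>. x \<in> box a b \<longrightarrow> w x = 0" if ab: "cbox a b \<subseteq> \<Omega>" for a b
  proof -
    note bump = test_fun_box_bump[OF ab]
    obtain K where K: "\<And>x. x \<in> \<Omega> \<Longrightarrow> norm (box_bump a b x) \<le> K"
    proof -
      have "compact (box_bump a b ` closure \<Omega>)"
        using \<Omega>(2) by (intro compact_continuous_image continuous_on_subset[OF smooth_continuous[OF smooth_box_bump]]) auto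
      then obtain K where "\<forall>y\<in>box_bump a b ` closure \<Omega>. norm y \<le> K"
        using compact_imp_bounded bounded_iff by blast
      then show thesis using that closure_subset by blast
    qed
    have wb: "L2 (lebesgue_on \<Omega>) (\<lambda>x. w x * box_bump a b x)"
    proof (rule L2_dominated[OF w, where C=K])
      show "(\<lambda>x. w x * box_bump a b x) \<in> borel_measurable (lebesgue_on \<Omega>)"
        using L2_measurable[OF w] L2_measurable[OF L2_smooth[OF \<Omega> smooth_box_bump]] by measurable
      fix x assume "x \<in> space (lebesgue_on \<Omega>)"
      then have "\<bar>w x\<bar> * \<bar>box_bump a b x\<bar> \<le> \<bar>w x\<bar> * K" using K[of x] by (intro mult_left_mono) auto
      then show "norm (w x * box_bump a b x) \<le> K * norm (w x)" by (simp add: abs_mult mult.commute)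
    qed
    have "mode_sq (2 * r) \<Omega> (\<lambda>x. w x * box_bump a b x) k = 0" for k
    proof -
      have "(LINT x|lebesgue_on \<Omega>. w x * (cos (wave (2 * r) k \<bullet> x) * box_bump a b x)) = 0"
        "(LINT x|lebesgue_on \<Omega>. w x * (sin (wave (2 * r) k \<bullet> x) * box_bump a b x)) = 0"
        by (intro zero smooth_mult_test_fun[OF bump] smooth_trig)+
      then show ?thesis by (simp add: mode_sq_def cos_mode_def sin_mode_def mult_ac)
    qed
    then have "AE x in lebesgue_on \<Omega>. w x * box_bump a b x = 0"
      using r by (intro AE_zero_of_modes[OF meas r(1) r(2) _ wb, of "2 * r"]) auto
    then show ?thesis
      by eventually_elim (use box_bump_pos_iff in auto)
  qed
  define F where "F = {box a b |a b. cbox a b \<subseteq> \<Omega>}"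
  have "open U" if "U \<in> F" for U using that by (auto simp: F_def open_box)
  then obtain F' where F': "F' \<subseteq> F" "countable F'" "\<Union>F' = \<Union>F" by (rule Lindelof)
  have cover: "\<Omega> \<subseteq> \<Union>F"
  proof
    fix x assume "x \<in> \<Omega>"
    then obtain a b where "x \<in> box a b" "cbox a b \<subseteq> \<Omega>"
      using open_contains_cbox[OF \<Omega>(1)] by metis
    then show "x \<in> \<Union>F" by (auto simp: F_def)
  qed
  have "AE x in lebesgue_on \<Omega>. \<forall>U\<in>F'. x \<in> U \<longrightarrow> w x = 0"
    using F' local by (subst AE_ball_countable) (auto simp: F_def)
  then have "AE x in lebesgue_on \<Omega>. x \<in> \<Omega> \<longrightarrow> w x = 0"
  proof eventually_elim
    case (elim x)
    show ?case
    proof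
      assume "x \<in> \<Omega>"
      then obtain U where "U \<in> F'" "x \<in> U" using cover F'(3) by (metis UnionE subsetD)
      then show "w x = 0" using elim by blast
    qed
  qed
  then show ?thesis using AE_space[of "lebesgue_on \<Omega>"] by eventually_elim simp
qed

lemma has_weak_partial_unique:
  fixes f :: "real^'n::finite \<Rightarrow> real"
  assumes \<Omega>: "open \<Omega>" "bounded \<Omega>" and g: "L2 (lebesgue_on \<Omega>) g" "has_weak_partial \<Omega> i f g"
    and h: "L2 (lebesgue_on \<Omega>) h" "has_weak_partial \<Omega> i f h"
  shows "AE x in lebesgue_on \<Omega>. g x = h x"
proof -
  have "AE x in lebesgue_on \<Omega>. g x - h x = 0"
  proof (rule AE_zero_of_test_funs[OF \<Omega> L2_diff[OF g(1) h(1)]])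
    fix \<phi> assume \<phi>: "test_fun \<Omega> \<phi>"
    note s = L2_smooth[OF \<Omega> test_fun_smooth[OF \<phi>]]
    have "(LINT x|lebesgue_on \<Omega>. g x * \<phi> x) = (LINT x|lebesgue_on \<Omega>. h x * \<phi> x)"
      using g(2) h(2) \<phi> by (simp add: has_weak_partial_def)
    then show "(LINT x|lebesgue_on \<Omega>. (g x - h x) * \<phi> x) = 0"
      using L2_mult_integrable[OF g(1) s] L2_mult_integrable[OF h(1) s] by (simp add: left_diff_distrib)
  qed
  then show ?thesis by simp
qed

lemma test_fun_zero: "test_fun \<Omega> (\<lambda>_. 0)"
  by (simp add: test_fun_def smooth_const)

lemma test_field_axis: "test_fun \<Omega> \<phi> \<Longrightarrow> test_field \<Omega> (\<lambda>x. \<phi> x *\<^sub>R axis i 1)"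
  unfolding test_field_def
proof
  fix j
  assume "test_fun \<Omega> \<phi>"
  then show "test_fun \<Omega> (\<lambda>x. (\<phi> x *\<^sub>R axis i 1) $ j)"
    by (cases "j = i") (simp_all add: axis_def test_fun_zero)
qed

lemma L2_smooth_field:
  fixes \<phi> :: "real^3 \<Rightarrow> real^3"
  assumes "open \<Omega>" "bounded \<Omega>" "\<And>i. smooth (\<lambda>x. \<phi> x $ i)" shows "L2 (lebesgue_on \<Omega>) \<phi>"
  using assms by (intro L2_vecI L2_smooth)

lemma smooth_curl:
  assumes "\<And>i. smooth (\<lambda>x. \<phi> x $ i)" shows "smooth (\<lambda>x. curl \<phi> x $ i)"
proof -
  have d: "smooth (\<lambda>x. partial j (\<lambda>y. \<phi> y $ l) x - partial j' (\<lambda>y. \<phi> y $ l') x)" for j l j' l'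
    using smooth_add[OF smooth_partial[OF assms] smooth_cmult[OF smooth_partial[OF assms], of "-1"]] by simp
  show ?thesis
    using exhaust_3[of i] by (auto simp: curl_def d)
qed

lemma has_weak_curl_unique:
  assumes \<Omega>: "open \<Omega>" "bounded \<Omega>" and g: "L2 (lebesgue_on \<Omega>) g" "has_weak_curl \<Omega> f g"
    and h: "L2 (lebesgue_on \<Omega>) h" "has_weak_curl \<Omega> f h"
  shows "AE x in lebesgue_on \<Omega>. g x = h x"
proof -
  have "AE x in lebesgue_on \<Omega>. g x $ i - h x $ i = 0" for i
  proof (rule AE_zero_of_test_funs[OF \<Omega> L2_diff[OF L2_nth[OF g(1)] L2_nth[OF h(1)]]])
    fix \<phi> assume \<phi>: "test_fun \<Omega> \<phi>"
    note s = L2_smooth[OF \<Omega> test_fun_smooth[OF \<phi>]]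
    have "(LINT x|lebesgue_on \<Omega>. g x \<bullet> (\<phi> x *\<^sub>R axis i 1)) = (LINT x|lebesgue_on \<Omega>. h x \<bullet> (\<phi> x *\<^sub>R axis i 1))"
      using g(2)[unfolded has_weak_curl_def, rule_format, OF test_field_axis[OF \<phi>, of i]]
        h(2)[unfolded has_weak_curl_def, rule_format, OF test_field_axis[OF \<phi>, of i]] by simp
    then show "(LINT x|lebesgue_on \<Omega>. (g x $ i - h x $ i) * \<phi> x) = 0"
      using L2_mult_integrable[OF L2_nth[OF g(1)] s, of i] L2_mult_integrable[OF L2_nth[OF h(1)] s, of i]
      by (simp add: right_diff_distrib inner_axis mult.commute)
  qed
  then have "AE x in lebesgue_on \<Omega>. \<forall>i. g x $ i = h x $ i"
    by (subst AE_all_countable) auto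
  then show ?thesis by (simp add: vec_eq_iff)
qed

lemma has_weak_partial_closed:
  fixes f :: "nat \<Rightarrow> real^'n::finite \<Rightarrow> real"
  assumes \<Omega>: "open \<Omega>" "bounded \<Omega>"
    and f: "\<And>k. L2 (lebesgue_on \<Omega>) (f k)" "L2 (lebesgue_on \<Omega>) F" "L2_tendsto (lebesgue_on \<Omega>) f F"
    and g: "\<And>k. L2 (lebesgue_on \<Omega>) (g k)" "L2 (lebesgue_on \<Omega>) G" "L2_tendsto (lebesgue_on \<Omega>) g G"
    and fg: "\<And>k. has_weak_partial \<Omega> i (f k) (g k)"
  shows "has_weak_partial \<Omega> i F G"
  unfolding has_weak_partial_def
proof (intro allI impI)
  fix \<phi> assume \<phi>: "test_fun \<Omega> \<phi>"
  note s = L2_smooth[OF \<Omega> test_fun_smooth[OF \<phi>]] L2_smooth[OF \<Omega> smooth_partial[OF test_fun_smooth[OF \<phi>]]]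
  have "(\<lambda>k. LINT x|lebesgue_on \<Omega>. f k x * partial i \<phi> x) \<longlonglongrightarrow> (LINT x|lebesgue_on \<Omega>. F x * partial i \<phi> x)"
    by (intro L2_tendsto_bilinear[OF bounded_bilinear_mult] f s L2_tendsto_const)
  moreover have "(\<lambda>k. - (LINT x|lebesgue_on \<Omega>. g k x * \<phi> x)) \<longlonglongrightarrow> - (LINT x|lebesgue_on \<Omega>. G x * \<phi> x)"
    by (intro tendsto_minus L2_tendsto_bilinear[OF bounded_bilinear_mult] g s L2_tendsto_const)
  moreover have "(LINT x|lebesgue_on \<Omega>. f k x * partial i \<phi> x) = - (LINT x|lebesgue_on \<Omega>. g k x * \<phi> x)" for k
    using fg \<phi> by (simp add: has_weak_partial_def)
  ultimately show "(LINT x|lebesgue_on \<Omega>. F x * partial i \<phi> x) = - (LINT x|lebesgue_on \<Omega>. G x * \<phi> x)"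
    using LIMSEQ_unique by auto
qed

lemma has_weak_curl_closed:
  assumes \<Omega>: "open \<Omega>" "bounded \<Omega>"
    and f: "\<And>k. L2 (lebesgue_on \<Omega>) (f k)" "L2 (lebesgue_on \<Omega>) F" "L2_tendsto (lebesgue_on \<Omega>) f F"
    and g: "\<And>k. L2 (lebesgue_on \<Omega>) (g k)" "L2 (lebesgue_on \<Omega>) G" "L2_tendsto (lebesgue_on \<Omega>) g G"
    and fg: "\<And>k. has_weak_curl \<Omega> (f k) (g k)"
  shows "has_weak_curl \<Omega> F G"
  unfolding has_weak_curl_def
proof (intro allI impI)
  fix \<phi> assume \<phi>: "test_field \<Omega> \<phi>"
  then have sm: "smooth (\<lambda>x. \<phi> x $ i)" for i by (simp add: test_field_def test_fun_def)
  note s = L2_smooth_field[OF \<Omega> sm] L2_smooth_field[OF \<Omega> smooth_curl[OF sm]]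
  have "(\<lambda>k. LINT x|lebesgue_on \<Omega>. f k x \<bullet> curl \<phi> x) \<longlonglongrightarrow> (LINT x|lebesgue_on \<Omega>. F x \<bullet> curl \<phi> x)"
    by (intro L2_tendsto_bilinear[OF bounded_bilinear_inner] f s L2_tendsto_const)
  moreover have "(\<lambda>k. LINT x|lebesgue_on \<Omega>. g k x \<bullet> \<phi> x) \<longlonglongrightarrow> (LINT x|lebesgue_on \<Omega>. G x \<bullet> \<phi> x)"
    by (intro L2_tendsto_bilinear[OF bounded_bilinear_inner] g s L2_tendsto_const)
  moreover have "(LINT x|lebesgue_on \<Omega>. f k x \<bullet> curl \<phi> x) = (LINT x|lebesgue_on \<Omega>. g k x \<bullet> \<phi> x)" for k
    using fg \<phi> by (simp add: has_weak_curl_def)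
  ultimately show "(LINT x|lebesgue_on \<Omega>. F x \<bullet> curl \<phi> x) = (LINT x|lebesgue_on \<Omega>. G x \<bullet> \<phi> x)"
    using LIMSEQ_unique by auto
qed

lemma has_weak_partial_lin:
  fixes f :: "real^'n::finite \<Rightarrow> real"
  assumes \<Omega>: "open \<Omega>" "bounded \<Omega>"
    and L2: "L2 (lebesgue_on \<Omega>) f" "L2 (lebesgue_on \<Omega>) g" "L2 (lebesgue_on \<Omega>) f'" "L2 (lebesgue_on \<Omega>) g'"
    and fg: "has_weak_partial \<Omega> i f g" "has_weak_partial \<Omega> i f' g'"
  shows "has_weak_partial \<Omega> i (\<lambda>x. f x + c * f' x) (\<lambda>x. g x + c * g' x)"
  unfolding has_weak_partial_def
proof (intro allI impI)
  fix \<phi> assume \<phi>: "test_fun \<Omega> \<phi>"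
  note s = L2_smooth[OF \<Omega> test_fun_smooth[OF \<phi>]] L2_smooth[OF \<Omega> smooth_partial[OF test_fun_smooth[OF \<phi>]]]
  note i = L2_mult_integrable[OF _ s(1)] L2_mult_integrable[OF _ s(2)]
  have "(LINT x|lebesgue_on \<Omega>. f x * partial i \<phi> x) = - (LINT x|lebesgue_on \<Omega>. g x * \<phi> x)"
    "(LINT x|lebesgue_on \<Omega>. f' x * partial i \<phi> x) = - (LINT x|lebesgue_on \<Omega>. g' x * \<phi> x)"
    using fg \<phi> by (auto simp: has_weak_partial_def)
  then show "(LINT x|lebesgue_on \<Omega>. (f x + c * f' x) * partial i \<phi> x) = - (LINT x|lebesgue_on \<Omega>. (g x + c * g' x) * \<phi> x)"
    using i(1)[OF L2(2)] i(1)[OF L2(4)] i(2)[OF L2(1)] i(2)[OF L2(3)]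
    by (simp add: distrib_right mult.assoc)
qed

lemma has_weak_curl_lin:
  assumes \<Omega>: "open \<Omega>" "bounded \<Omega>"
    and L2: "L2 (lebesgue_on \<Omega>) f" "L2 (lebesgue_on \<Omega>) g" "L2 (lebesgue_on \<Omega>) f'" "L2 (lebesgue_on \<Omega>) g'"
    and fg: "has_weak_curl \<Omega> f g" "has_weak_curl \<Omega> f' g'"
  shows "has_weak_curl \<Omega> (\<lambda>x. f x + c *\<^sub>R f' x) (\<lambda>x. g x + c *\<^sub>R g' x)"
  unfolding has_weak_curl_def
proof (intro allI impI)
  fix \<phi> assume \<phi>: "test_field \<Omega> \<phi>"
  then have sm: "smooth (\<lambda>x. \<phi> x $ i)" for i by (simp add: test_field_def test_fun_def)
  note s = L2_smooth_field[OF \<Omega> sm] L2_smooth_field[OF \<Omega> smooth_curl[OF sm]]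
  note i = L2_inner_integrable[OF _ s(1)] L2_inner_integrable[OF _ s(2)]
  have "(LINT x|lebesgue_on \<Omega>. f x \<bullet> curl \<phi> x) = (LINT x|lebesgue_on \<Omega>. g x \<bullet> \<phi> x)"
    "(LINT x|lebesgue_on \<Omega>. f' x \<bullet> curl \<phi> x) = (LINT x|lebesgue_on \<Omega>. g' x \<bullet> \<phi> x)"
    using fg \<phi> by (auto simp: has_weak_curl_def)
  then show "(LINT x|lebesgue_on \<Omega>. (f x + c *\<^sub>R f' x) \<bullet> curl \<phi> x) = (LINT x|lebesgue_on \<Omega>. (g x + c *\<^sub>R g' x) \<bullet> \<phi> x)"
    using i(1)[OF L2(2)] i(1)[OF L2(4)] i(2)[OF L2(1)] i(2)[OF L2(3)]
    by (simp add: inner_add_left)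
qed

lemma L2_wcurl:
  assumes "H_curl \<Omega> v"
  shows "L2 (lebesgue_on \<Omega>) (wcurl \<Omega> v)" "has_weak_curl \<Omega> v (wcurl \<Omega> v)"
proof -
  have "\<exists>w. L2 (lebesgue_on \<Omega>) w \<and> has_weak_curl \<Omega> v w" using assms by (simp add: H_curl_def)
  from someI_ex[OF this] show "L2 (lebesgue_on \<Omega>) (wcurl \<Omega> v)" "has_weak_curl \<Omega> v (wcurl \<Omega> v)"
    by (auto simp: wcurl_def)
qed

lemma wpartial_AE_eq:
  fixes f :: "real^'n::finite \<Rightarrow> real"
  assumes \<Omega>: "open \<Omega>" "bounded \<Omega>" and g: "L2 (lebesgue_on \<Omega>) g" "has_weak_partial \<Omega> i f g"
  shows "AE x in lebesgue_on \<Omega>. wpartial \<Omega> i f x = g x" "L2 (lebesgue_on \<Omega>) (wpartial \<Omega> i f)"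
    "has_weak_partial \<Omega> i f (wpartial \<Omega> i f)"
proof -
  have "\<exists>g. L2 (lebesgue_on \<Omega>) g \<and> has_weak_partial \<Omega> i f g" using g by blast
  from someI_ex[OF this] have *: "L2 (lebesgue_on \<Omega>) (wpartial \<Omega> i f)" "has_weak_partial \<Omega> i f (wpartial \<Omega> i f)"
    by (auto simp: wpartial_def)
  then show "L2 (lebesgue_on \<Omega>) (wpartial \<Omega> i f)" "has_weak_partial \<Omega> i f (wpartial \<Omega> i f)" by auto
  show "AE x in lebesgue_on \<Omega>. wpartial \<Omega> i f x = g x" by (rule has_weak_partial_unique[OF \<Omega> * g])
qed

lemma wcurl_AE_eq:
  assumes \<Omega>: "open \<Omega>" "bounded \<Omega>" and g: "L2 (lebesgue_on \<Omega>) g" "has_weak_curl \<Omega> f g"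
  shows "AE x in lebesgue_on \<Omega>. wcurl \<Omega> f x = g x" "L2 (lebesgue_on \<Omega>) (wcurl \<Omega> f)"
    "has_weak_curl \<Omega> f (wcurl \<Omega> f)"
proof -
  have "\<exists>g. L2 (lebesgue_on \<Omega>) g \<and> has_weak_curl \<Omega> f g" using g by blast
  from someI_ex[OF this] have *: "L2 (lebesgue_on \<Omega>) (wcurl \<Omega> f)" "has_weak_curl \<Omega> f (wcurl \<Omega> f)"
    by (auto simp: wcurl_def)
  then show "L2 (lebesgue_on \<Omega>) (wcurl \<Omega> f)" "has_weak_curl \<Omega> f (wcurl \<Omega> f)" by auto
  show "AE x in lebesgue_on \<Omega>. wcurl \<Omega> f x = g x" by (rule has_weak_curl_unique[OF \<Omega> * g])
qed

text \<open>The curl of weak partial derivatives.\<close>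

lemma has_weak_curl_of_partials:
  assumes \<Omega>: "open \<Omega>" "bounded \<Omega>"
    and v: "\<And>i. L2 (lebesgue_on \<Omega>) (\<lambda>x. v x $ i)"
    and d: "\<And>i j. L2 (lebesgue_on \<Omega>) (d i j)" "\<And>i j. has_weak_partial \<Omega> j (\<lambda>x. v x $ i) (d i j)"
  shows "has_weak_curl \<Omega> v (\<lambda>x. vector [d 3 2 x - d 2 3 x, d 1 3 x - d 3 1 x, d 2 1 x - d 1 2 x])"
  unfolding has_weak_curl_def
proof (intro allI impI)
  fix \<phi> assume \<phi>: "test_field \<Omega> \<phi>"
  let ?M = "lebesgue_on \<Omega>"
  have test: "test_fun \<Omega> (\<lambda>x. \<phi> x $ i)" for i using \<phi> by (simp add: test_field_def)
  note s = L2_smooth[OF \<Omega> test_fun_smooth[OF test]] L2_smooth[OF \<Omega> smooth_partial[OF test_fun_smooth[OF test]]]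
  have i1: "integrable ?M (\<lambda>x. v x $ i * partial j (\<lambda>y. \<phi> y $ l) x)" for i j l
    by (rule L2_mult_integrable[OF v s(2)])
  have i2: "integrable ?M (\<lambda>x. d i j x * \<phi> x $ l)" for i j l
    by (rule L2_mult_integrable[OF d(1) s(1)])
  have eq: "(LINT x|?M. v x $ i * partial j (\<lambda>y. \<phi> y $ l) x) = - (LINT x|?M. d i j x * \<phi> x $ l)" for i j l
    using d(2)[of j i] test[of l] by (simp add: has_weak_partial_def)
  have "(LINT x|?M. v x \<bullet> curl \<phi> x)
      = (LINT x|?M. (v x $ 1 * partial 2 (\<lambda>y. \<phi> y $ 3) x - v x $ 1 * partial 3 (\<lambda>y. \<phi> y $ 2) x)
        + (v x $ 2 * partial 3 (\<lambda>y. \<phi> y $ 1) x - v x $ 2 * partial 1 (\<lambda>y. \<phi> y $ 3) x)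
        + (v x $ 3 * partial 1 (\<lambda>y. \<phi> y $ 2) x - v x $ 3 * partial 2 (\<lambda>y. \<phi> y $ 1) x))"
    by (simp add: inner_vec_def sum_3 curl_def right_diff_distrib)
  also have "\<dots> = (LINT x|?M. (d 3 2 x * \<phi> x $ 1 - d 2 3 x * \<phi> x $ 1)
        + (d 1 3 x * \<phi> x $ 2 - d 3 1 x * \<phi> x $ 2) + (d 2 1 x * \<phi> x $ 3 - d 1 2 x * \<phi> x $ 3))"
    using i1 i2 by (simp add: eq)
  also have "\<dots> = (LINT x|?M. vector [d 3 2 x - d 2 3 x, d 1 3 x - d 3 1 x, d 2 1 x - d 1 2 x] \<bullet> \<phi> x)"
    by (simp add: inner_vec_def sum_3 left_diff_distrib)
  finally show "(LINT x|?M. v x \<bullet> curl \<phi> x)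
      = (LINT x|?M. vector [d 3 2 x - d 2 3 x, d 1 3 x - d 3 1 x, d 2 1 x - d 1 2 x] \<bullet> \<phi> x)" .
qed

lemma H1_vec_imp_H_curl:
  assumes \<Omega>: "open \<Omega>" "bounded \<Omega>" and v: "H1_vec \<Omega> v"
  shows "H_curl \<Omega> v"
proof -
  have h1: "H1 \<Omega> (\<lambda>x. v x $ i)" for i using v by (simp add: H1_vec_def)
  note d = L2_wpartial[OF h1]
  have v2: "L2 (lebesgue_on \<Omega>) (\<lambda>x. v x $ i)" for i using h1 by (simp add: H1_def)
  let ?w = "\<lambda>x. vector [wpartial \<Omega> 2 (\<lambda>y. v y $ 3) x - wpartial \<Omega> 3 (\<lambda>y. v y $ 2) x,
     wpartial \<Omega> 3 (\<lambda>y. v y $ 1) x - wpartial \<Omega> 1 (\<lambda>y. v y $ 3) x,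
     wpartial \<Omega> 1 (\<lambda>y. v y $ 2) x - wpartial \<Omega> 2 (\<lambda>y. v y $ 1) x] :: real^3"
  have "L2 (lebesgue_on \<Omega>) (\<lambda>x. ?w x $ i)" for i
    using exhaust_3[of i] by (auto intro!: L2_diff d)
  then have "L2 (lebesgue_on \<Omega>) ?w" by (rule L2_vecI)
  moreover have "has_weak_curl \<Omega> v ?w"
    using has_weak_curl_of_partials[OF \<Omega> v2 d(1) d(2)] by simp
  ultimately show ?thesis using L2_vecI[OF v2] unfolding H_curl_def by blast
qed

lemma smooth_H1:
  fixes f :: "real^'n::finite \<Rightarrow> real"
  assumes \<Omega>: "open \<Omega>" "bounded \<Omega>" and f: "smooth f"
  shows "H1 \<Omega> f"
  unfolding H1_def using L2_smooth[OF \<Omega>] smooth_has_weak_partial[OF \<Omega>(1) f] f smooth_partial by blast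

lemma smooth_field_wcurl:
  assumes \<Omega>: "open \<Omega>" "bounded \<Omega>" and \<phi>: "\<And>i. smooth (\<lambda>x. \<phi> x $ i)"
  shows "H1_vec \<Omega> \<phi>" "AE x in lebesgue_on \<Omega>. wcurl \<Omega> \<phi> x = curl \<phi> x"
proof -
  show "H1_vec \<Omega> \<phi>" unfolding H1_vec_def using smooth_H1[OF \<Omega> \<phi>] by blast
  have "has_weak_curl \<Omega> \<phi> (curl \<phi>)"
    using has_weak_curl_of_partials[OF \<Omega> L2_smooth[OF \<Omega> \<phi>] L2_smooth[OF \<Omega> smooth_partial[OF \<phi>]]
        smooth_has_weak_partial[OF \<Omega>(1) \<phi>]]
    by (simp add: curl_def[abs_def])
  then show "AE x in lebesgue_on \<Omega>. wcurl \<Omega> \<phi> x = curl \<phi> x"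
    by (rule wcurl_AE_eq(1)[OF \<Omega> L2_smooth_field[OF \<Omega> smooth_curl[OF \<phi>]]])
qed

section \<open>Closedness of the function spaces\<close>

lemma zero_trace_lin:
  fixes \<Omega> :: "(real^3) set"
  assumes \<Omega>: "open \<Omega>" "bounded \<Omega>" and u: "has_trace \<Omega> u (\<lambda>_. 0)" and v: "has_trace \<Omega> v (\<lambda>_. 0)"
  shows "has_trace \<Omega> (\<lambda>x. u x + c * v x) (\<lambda>_. 0)"
    and "AE x in lebesgue_on \<Omega>. wpartial \<Omega> i (\<lambda>x. u x + c * v x) x = wpartial \<Omega> i u x + c * wpartial \<Omega> i v x"
proof -
  let ?M = "lebesgue_on \<Omega>" and ?S = "surface_measure \<Omega>"
  have H1: "H1 \<Omega> u" "H1 \<Omega> v" using u v by (auto simp: has_trace_def)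
  have L: "L2 ?M u" "L2 ?M v" using H1 by (auto simp: H1_def)
  note Du = L2_wpartial[OF H1(1)] and Dv = L2_wpartial[OF H1(2)]
  have wp: "has_weak_partial \<Omega> i (\<lambda>x. u x + c * v x) (\<lambda>x. wpartial \<Omega> i u x + c * wpartial \<Omega> i v x)" for i
    by (rule has_weak_partial_lin[OF \<Omega> L(1) Du(1) L(2) Dv(1) Du(2) Dv(2)])
  have wL: "L2 ?M (\<lambda>x. wpartial \<Omega> i u x + c * wpartial \<Omega> i v x)" for i
    by (intro L2_add L2_cmult Du Dv)
  show ae: "AE x in lebesgue_on \<Omega>. wpartial \<Omega> i (\<lambda>x. u x + c * v x) x = wpartial \<Omega> i u x + c * wpartial \<Omega> i v x" for i
    by (rule wpartial_AE_eq(1)[OF \<Omega> wL wp])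
  obtain \<phi> where \<phi>: "\<And>k. smooth (\<phi> k)" "L2_tendsto ?M \<phi> u"
      "\<And>i. L2_tendsto ?M (\<lambda>k. partial i (\<phi> k)) (wpartial \<Omega> i u)" "L2_tendsto ?S \<phi> (\<lambda>_. 0)"
    using u unfolding has_trace_def by blast
  obtain \<psi> where \<psi>: "\<And>k. smooth (\<psi> k)" "L2_tendsto ?M \<psi> v"
      "\<And>i. L2_tendsto ?M (\<lambda>k. partial i (\<psi> k)) (wpartial \<Omega> i v)" "L2_tendsto ?S \<psi> (\<lambda>_. 0)"
    using v unfolding has_trace_def by blast
  note s\<phi> = L2_smooth[OF \<Omega> \<phi>(1)] L2_smooth[OF \<Omega> smooth_partial[OF \<phi>(1)]]
  note s\<psi> = L2_smooth[OF \<Omega> \<psi>(1)] L2_smooth[OF \<Omega> smooth_partial[OF \<psi>(1)]]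
  have sm: "smooth (\<lambda>x. \<phi> k x + c * \<psi> k x)" for k
    by (intro smooth_add smooth_cmult \<phi> \<psi>)
  have dp: "partial i (\<lambda>x. \<phi> k x + c * \<psi> k x) = (\<lambda>x. partial i (\<phi> k) x + c * partial i (\<psi> k) x)" for i k
  proof
    fix x
    have "partial i (\<lambda>x. c * \<psi> k x) x = c * partial i (\<psi> k) x"
      using partial_mult[of "\<lambda>_. c" x "\<psi> k" i] smooth_differentiable[OF \<psi>(1)] by (simp add: partial_const)
    then show "partial i (\<lambda>x. \<phi> k x + c * \<psi> k x) x = partial i (\<phi> k) x + c * partial i (\<psi> k) x"
      using partial_add[OF smooth_differentiable[OF \<phi>(1)] smooth_differentiable[OF smooth_cmult[OF \<psi>(1)]]] by simp
  qed
  have "L2_tendsto ?M (\<lambda>k x. \<phi> k x + c * \<psi> k x) (\<lambda>x. u x + c * v x)"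
    by (intro L2_tendsto_add s\<phi> s\<psi> L \<phi> L2_cmult L2_tendsto_bounded_linear[OF bounded_linear_mult_right] \<psi>)
  moreover have "L2_tendsto ?M (\<lambda>k. partial i (\<lambda>x. \<phi> k x + c * \<psi> k x)) (wpartial \<Omega> i (\<lambda>x. u x + c * v x))" for i
  proof (rule L2_tendsto_cong_AE)
    show "L2_tendsto ?M (\<lambda>k x. partial i (\<phi> k) x + c * partial i (\<psi> k) x) (\<lambda>x. wpartial \<Omega> i u x + c * wpartial \<Omega> i v x)"
      by (intro L2_tendsto_add s\<phi> s\<psi> Du Dv \<phi> L2_cmult L2_tendsto_bounded_linear[OF bounded_linear_mult_right] \<psi>)
    show "AE x in ?M. wpartial \<Omega> i u x + c * wpartial \<Omega> i v x = wpartial \<Omega> i (\<lambda>x. u x + c * v x) x"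
      using ae[of i] by eventually_elim simp
  qed (simp add: dp)
  moreover have "L2_tendsto ?S (\<lambda>k x. \<phi> k x + c * \<psi> k x) (\<lambda>_. 0)"
    unfolding L2_tendsto_def
  proof (rule tendsto_sandwich[OF _ _ tendsto_const])
    show "\<forall>\<^sub>F k in sequentially. (\<integral>\<^sup>+x. ennreal ((norm (\<phi> k x + c * \<psi> k x - 0))\<^sup>2) \<partial>?S)
       \<le> ennreal 2 * (\<integral>\<^sup>+x. ennreal ((norm (\<phi> k x - 0))\<^sup>2) \<partial>?S) + ennreal (2 * c\<^sup>2) * (\<integral>\<^sup>+x. ennreal ((norm (\<psi> k x - 0))\<^sup>2) \<partial>?S)"
    proof (intro always_eventually allI)
      fix k
      have [measurable]: "\<phi> k \<in> borel_measurable ?S" "\<psi> k \<in> borel_measurable ?S"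
        by (intro smooth_surface_measurable \<phi> \<psi>)+
      have "(\<integral>\<^sup>+x. ennreal ((norm (\<phi> k x + c * \<psi> k x - 0))\<^sup>2) \<partial>?S)
        \<le> (\<integral>\<^sup>+x. ennreal 2 * ennreal ((norm (\<phi> k x - 0))\<^sup>2) + ennreal (2 * c\<^sup>2) * ennreal ((norm (\<psi> k x - 0))\<^sup>2) \<partial>?S)"
      proof (rule nn_integral_mono)
        fix x
        have "(\<phi> k x + c * \<psi> k x)\<^sup>2 \<le> 2 * (\<phi> k x)\<^sup>2 + 2 * c\<^sup>2 * (\<psi> k x)\<^sup>2"
          using sum_squares_bound[of "\<phi> k x" "c * \<psi> k x"] by (simp add: power2_sum power_mult_distrib)
        then have "ennreal ((norm (\<phi> k x + c * \<psi> k x - 0))\<^sup>2) \<le> ennreal (2 * (norm (\<phi> k x - 0))\<^sup>2 + 2 * c\<^sup>2 * (norm (\<psi> k x - 0))\<^sup>2)"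
          by (intro ennreal_leI) simp
        also have "\<dots> = ennreal (2 * (norm (\<phi> k x - 0))\<^sup>2) + ennreal (2 * c\<^sup>2 * (norm (\<psi> k x - 0))\<^sup>2)"
          by (intro ennreal_plus) auto
        also have "\<dots> = ennreal 2 * ennreal ((norm (\<phi> k x - 0))\<^sup>2) + ennreal (2 * c\<^sup>2) * ennreal ((norm (\<psi> k x - 0))\<^sup>2)"
          by (intro arg_cong2[where f="(+)"] ennreal_mult) auto
        finally show "ennreal ((norm (\<phi> k x + c * \<psi> k x - 0))\<^sup>2)
          \<le> ennreal 2 * ennreal ((norm (\<phi> k x - 0))\<^sup>2) + ennreal (2 * c\<^sup>2) * ennreal ((norm (\<psi> k x - 0))\<^sup>2)" .
      qed
      also have "\<dots> = ennreal 2 * (\<integral>\<^sup>+x. ennreal ((norm (\<phi> k x - 0))\<^sup>2) \<partial>?S) + ennreal (2 * c\<^sup>2) * (\<integral>\<^sup>+x. ennreal ((norm (\<psi> k x - 0))\<^sup>2) \<partial>?S)"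
        by (subst nn_integral_add, measurable, subst (1 2) nn_integral_cmult, measurable)
      finally show "(\<integral>\<^sup>+x. ennreal ((norm (\<phi> k x + c * \<psi> k x - 0))\<^sup>2) \<partial>?S)
        \<le> ennreal 2 * (\<integral>\<^sup>+x. ennreal ((norm (\<phi> k x - 0))\<^sup>2) \<partial>?S) + ennreal (2 * c\<^sup>2) * (\<integral>\<^sup>+x. ennreal ((norm (\<psi> k x - 0))\<^sup>2) \<partial>?S)" .
    qed
    have "(\<lambda>k. ennreal 2 * (\<integral>\<^sup>+x. ennreal ((norm (\<phi> k x - 0))\<^sup>2) \<partial>?S) + ennreal (2 * c\<^sup>2) * (\<integral>\<^sup>+x. ennreal ((norm (\<psi> k x - 0))\<^sup>2) \<partial>?S))
        \<longlonglongrightarrow> ennreal 2 * 0 + ennreal (2 * c\<^sup>2) * 0"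
      using \<phi>(4) \<psi>(4) unfolding L2_tendsto_def by (intro tendsto_add ennreal_tendsto_cmult) auto
    then show "(\<lambda>k. ennreal 2 * (\<integral>\<^sup>+x. ennreal ((norm (\<phi> k x - 0))\<^sup>2) \<partial>?S) + ennreal (2 * c\<^sup>2) * (\<integral>\<^sup>+x. ennreal ((norm (\<psi> k x - 0))\<^sup>2) \<partial>?S))
        \<longlonglongrightarrow> 0" by simp
  qed simp
  moreover have "H1 \<Omega> (\<lambda>x. u x + c * v x)"
    unfolding H1_def using L2_add[OF L(1) L2_cmult[OF L(2)]] wL wp by blast
  ultimately show "has_trace \<Omega> (\<lambda>x. u x + c * v x) (\<lambda>_. 0)"
    unfolding has_trace_def using sm
    by (intro conjI L2_zero exI[of _ "\<lambda>k x. \<phi> k x + c * \<psi> k x"]) auto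
qed

lemma zero_trace_zero:
  fixes \<Omega> :: "(real^3) set"
  assumes \<Omega>: "open \<Omega>" "bounded \<Omega>"
  shows "has_trace \<Omega> (\<lambda>_. 0) (\<lambda>_. 0)"
proof -
  have wp: "has_weak_partial \<Omega> i (\<lambda>_. 0) (\<lambda>_. 0)" for i by (simp add: has_weak_partial_def)
  have "L2_tendsto (lebesgue_on \<Omega>) (\<lambda>k. partial i (\<lambda>_. 0)) (wpartial \<Omega> i (\<lambda>_. 0))" for i :: 3
  proof (rule L2_tendsto_cong_AE[OF L2_tendsto_const])
    show "AE x in lebesgue_on \<Omega>. 0 = wpartial \<Omega> i (\<lambda>_. 0) x"
      using wpartial_AE_eq(1)[OF \<Omega> L2_zero wp, of i] by eventually_elim simp
  qed (simp add: partial_const)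
  then show ?thesis
    unfolding has_trace_def
    by (intro conjI exI[of _ "\<lambda>k x. 0"] smooth_H1[OF \<Omega>] allI smooth_const L2_tendsto_const L2_zero)
qed

text \<open>A diagonal sequence: for each \<open>k\<close>, a smooth function within \<open>1 /
  Suc k\<close> of \<open>u k\<close> together with its derivatives, and within \<open>1 / Suc
  k\<close> of zero on the boundary.\<close>

lemma zero_trace_closed:
  fixes \<Omega> :: "(real^3) set"
  assumes \<Omega>: "open \<Omega>" "bounded \<Omega>" and u: "\<And>k. has_trace \<Omega> (u k) (\<lambda>_. 0)"
    and U: "L2 (lebesgue_on \<Omega>) U" "L2_tendsto (lebesgue_on \<Omega>) u U"
    and D: "\<And>i. L2 (lebesgue_on \<Omega>) (D i)" "\<And>i. L2_tendsto (lebesgue_on \<Omega>) (\<lambda>k. wpartial \<Omega> i (u k)) (D i)"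
  shows "has_trace \<Omega> U (\<lambda>_. 0)" "AE x in lebesgue_on \<Omega>. wpartial \<Omega> i U x = D i x"
proof -
  let ?M = "lebesgue_on \<Omega>" and ?S = "surface_measure \<Omega>"
  have H1: "H1 \<Omega> (u k)" for k using u by (auto simp: has_trace_def)
  have L: "L2 ?M (u k)" for k using H1 by (auto simp: H1_def)
  have wp: "has_weak_partial \<Omega> i U (D i)" for i
    by (rule has_weak_partial_closed[OF \<Omega> L U L2_wpartial(1)[OF H1] D L2_wpartial(2)[OF H1]])
  show ae: "AE x in lebesgue_on \<Omega>. wpartial \<Omega> i U x = D i x" for i
    by (rule wpartial_AE_eq(1)[OF \<Omega> D(1) wp])
  have ex: "\<exists>\<phi>. smooth \<phi> \<and> l2n ?M (\<lambda>x. \<phi> x - u k x) < 1 / Suc k \<and>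
      (\<forall>i. l2n ?M (\<lambda>x. partial i \<phi> x - wpartial \<Omega> i (u k) x) < 1 / Suc k) \<and>
      (\<integral>\<^sup>+x. ennreal ((norm (\<phi> x - 0))\<^sup>2) \<partial>?S) < ennreal (1 / Suc k)" for k
  proof -
    obtain \<phi> where \<phi>: "\<And>m. smooth (\<phi> m)" "L2_tendsto ?M \<phi> (u k)"
      "\<And>i. L2_tendsto ?M (\<lambda>m. partial i (\<phi> m)) (wpartial \<Omega> i (u k))" "L2_tendsto ?S \<phi> (\<lambda>_. 0)"
      using u[of k] unfolding has_trace_def by blast
    note s\<phi> = L2_smooth[OF \<Omega> \<phi>(1)] L2_smooth[OF \<Omega> smooth_partial[OF \<phi>(1)]]
    have "(\<lambda>m. l2n ?M (\<lambda>x. \<phi> m x - u k x)) \<longlonglongrightarrow> 0"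
      using \<phi>(2) L2_tendsto_iff[of ?M \<phi> "u k"] s\<phi>(1) L by simp
    then have "\<forall>\<^sub>F m in sequentially. l2n ?M (\<lambda>x. \<phi> m x - u k x) < 1 / Suc k"
      by (rule order_tendstoD) simp
    moreover have "\<forall>\<^sub>F m in sequentially. \<forall>i. l2n ?M (\<lambda>x. partial i (\<phi> m) x - wpartial \<Omega> i (u k) x) < 1 / Suc k"
    proof (rule eventually_all_finite)
      fix i
      have "(\<lambda>m. l2n ?M (\<lambda>x. partial i (\<phi> m) x - wpartial \<Omega> i (u k) x)) \<longlonglongrightarrow> 0"
        using \<phi>(3)[of i] L2_tendsto_iff[of ?M "\<lambda>m. partial i (\<phi> m)" "wpartial \<Omega> i (u k)"] s\<phi>(2) L2_wpartial(1)[OF H1] by simp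
      then show "\<forall>\<^sub>F m in sequentially. l2n ?M (\<lambda>x. partial i (\<phi> m) x - wpartial \<Omega> i (u k) x) < 1 / Suc k"
        by (rule order_tendstoD) simp
    qed
    moreover have "\<forall>\<^sub>F m in sequentially. (\<integral>\<^sup>+x. ennreal ((norm (\<phi> m x - 0))\<^sup>2) \<partial>?S) < ennreal (1 / Suc k)"
      using \<phi>(4) unfolding L2_tendsto_def by (rule order_tendstoD) simp
    ultimately have "\<forall>\<^sub>F m in sequentially. smooth (\<phi> m) \<and> l2n ?M (\<lambda>x. \<phi> m x - u k x) < 1 / Suc k \<and>
      (\<forall>i. l2n ?M (\<lambda>x. partial i (\<phi> m) x - wpartial \<Omega> i (u k) x) < 1 / Suc k) \<and>
      (\<integral>\<^sup>+x. ennreal ((norm (\<phi> m x - 0))\<^sup>2) \<partial>?S) < ennreal (1 / Suc k)"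
      by eventually_elim (simp add: \<phi>(1))
    then show ?thesis using eventually_happens'[OF sequentially_bot] by blast
  qed
  define q where "q k \<phi> \<longleftrightarrow> smooth \<phi> \<and> l2n ?M (\<lambda>x. \<phi> x - u k x) < 1 / Suc k \<and>
      (\<forall>i. l2n ?M (\<lambda>x. partial i \<phi> x - wpartial \<Omega> i (u k) x) < 1 / Suc k) \<and>
      (\<integral>\<^sup>+x. ennreal ((norm (\<phi> x - 0))\<^sup>2) \<partial>?S) < ennreal (1 / Suc k)" for k \<phi>
  have "\<forall>k. \<exists>\<phi>. q k \<phi>" unfolding q_def using ex by blast
  from choice[OF this] obtain \<phi> where "\<forall>k. q k (\<phi> k)" ..
  then have \<phi>: "smooth (\<phi> k)" "l2n ?M (\<lambda>x. \<phi> k x - u k x) < 1 / Suc k"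
      "l2n ?M (\<lambda>x. partial i (\<phi> k) x - wpartial \<Omega> i (u k) x) < 1 / Suc k"
      "(\<integral>\<^sup>+x. ennreal ((norm (\<phi> k x - 0))\<^sup>2) \<partial>?S) < ennreal (1 / Suc k)" for k i
    unfolding q_def by blast+
  note s\<phi> = L2_smooth[OF \<Omega> \<phi>(1)] L2_smooth[OF \<Omega> smooth_partial[OF \<phi>(1)]]
  have inv0: "(\<lambda>k. 1 / real (Suc k)) \<longlonglongrightarrow> 0" by (rule LIMSEQ_Suc[OF lim_const_over_n])
  have diag: "L2_tendsto ?M f F"
    if "\<And>k. L2 ?M (f k)" "\<And>k. L2 ?M (g k)" "L2 ?M F" "L2_tendsto ?M g F"
      "\<And>k. l2n ?M (\<lambda>x. f k x - g k x) < 1 / Suc k" for f g F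
    unfolding L2_tendsto_iff[OF that(1,3)]
  proof (rule tendsto_sandwich[OF _ _ tendsto_const])
    have "l2n ?M (\<lambda>x. f k x - F x) \<le> 1 / Suc k + l2n ?M (\<lambda>x. g k x - F x)" for k
      using l2n_triangle3[OF that(1)[of k] that(2)[of k] that(3)] that(5)[of k] by linarith
    then show "\<forall>\<^sub>F k in sequentially. l2n ?M (\<lambda>x. f k x - F x) \<le> 1 / Suc k + l2n ?M (\<lambda>x. g k x - F x)" by simp
    have "(\<lambda>k. l2n ?M (\<lambda>x. g k x - F x)) \<longlonglongrightarrow> 0" using that(2,3,4) L2_tendsto_iff[of ?M g F] by simp
    from tendsto_add[OF inv0 this]
    show "(\<lambda>k. 1 / Suc k + l2n ?M (\<lambda>x. g k x - F x)) \<longlonglongrightarrow> 0" by simp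
  qed (simp add: l2n_nonneg)
  have "L2_tendsto ?M \<phi> U" by (rule diag[OF s\<phi>(1) L U \<phi>(2)])
  moreover have "L2_tendsto ?M (\<lambda>k. partial i (\<phi> k)) (wpartial \<Omega> i U)" for i
  proof (rule L2_tendsto_cong_AE)
    show "L2_tendsto ?M (\<lambda>k. partial i (\<phi> k)) (D i)"
      by (rule diag[OF s\<phi>(2) L2_wpartial(1)[OF H1] D \<phi>(3)])
    show "AE x in ?M. D i x = wpartial \<Omega> i U x" using ae[of i] by eventually_elim simp
  qed simp
  moreover have "L2_tendsto ?S \<phi> (\<lambda>_. 0)"
    unfolding L2_tendsto_def
  proof (rule tendsto_sandwich[OF _ _ tendsto_const])
    show "\<forall>\<^sub>F k in sequentially. (\<integral>\<^sup>+x. ennreal ((norm (\<phi> k x - 0))\<^sup>2) \<partial>?S) \<le> ennreal (1 / Suc k)"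
      using \<phi>(4) by (intro always_eventually allI less_imp_le)
    show "(\<lambda>k. ennreal (1 / Suc k)) \<longlonglongrightarrow> 0" using tendsto_ennrealI[OF inv0] by simp
  qed simp
  moreover have "H1 \<Omega> U" unfolding H1_def using U(1) D(1) wp by blast
  ultimately show "has_trace \<Omega> U (\<lambda>_. 0)"
    unfolding has_trace_def using \<phi>(1) by (intro conjI L2_zero exI[of _ \<phi>]) auto
qed

lemma H0_curlD:
  assumes \<Omega>: "open \<Omega>" "bounded \<Omega>" and v: "H0_curl \<Omega> v" and \<phi>: "H1_vec \<Omega> \<phi>"
  shows "(LINT x|lebesgue_on \<Omega>. v x \<bullet> wcurl \<Omega> \<phi> x) = (LINT x|lebesgue_on \<Omega>. wcurl \<Omega> v x \<bullet> \<phi> x)"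
proof -
  have vc: "H_curl \<Omega> v" using v by (simp add: H0_curl_def)
  have \<phi>c: "H_curl \<Omega> \<phi>" by (rule H1_vec_imp_H_curl[OF \<Omega> \<phi>])
  have L: "L2 (lebesgue_on \<Omega>) v" "L2 (lebesgue_on \<Omega>) \<phi>" using vc \<phi>c by (auto simp: H_curl_def)
  have "(LINT x|lebesgue_on \<Omega>. v x \<bullet> wcurl \<Omega> \<phi> x - wcurl \<Omega> v x \<bullet> \<phi> x) = 0"
    using v \<phi> by (simp add: H0_curl_def tangential_trace_def)
  then show ?thesis
    using L2_inner_integrable[OF L(1) L2_wcurl(1)[OF \<phi>c]] L2_inner_integrable[OF L2_wcurl(1)[OF vc] L(2)] by simp
qed

text \<open>The zero tangential trace is Green's formula against every \<open>H1\<close> field, an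
  identity between integrals of products of square-integrable functions; in this form it passes to
  linear combinations and to limits.\<close>

lemma H0_curlI:
  assumes \<Omega>: "open \<Omega>" "bounded \<Omega>" and L: "L2 (lebesgue_on \<Omega>) v" "L2 (lebesgue_on \<Omega>) w"
    and w: "has_weak_curl \<Omega> v w"
    and green: "\<And>\<phi>. H1_vec \<Omega> \<phi> \<Longrightarrow>
      (LINT x|lebesgue_on \<Omega>. v x \<bullet> wcurl \<Omega> \<phi> x) = (LINT x|lebesgue_on \<Omega>. w x \<bullet> \<phi> x)"
  shows "H0_curl \<Omega> v" "AE x in lebesgue_on \<Omega>. wcurl \<Omega> v x = w x"
proof -
  show ae: "AE x in lebesgue_on \<Omega>. wcurl \<Omega> v x = w x" by (rule wcurl_AE_eq(1)[OF \<Omega> L(2) w])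
  have vc: "H_curl \<Omega> v" using L w by (auto simp: H_curl_def)
  have "tangential_trace \<Omega> v \<phi> = 0" if \<phi>: "H1_vec \<Omega> \<phi>" for \<phi>
  proof -
    have \<phi>c: "H_curl \<Omega> \<phi>" by (rule H1_vec_imp_H_curl[OF \<Omega> \<phi>])
    have L\<phi>: "L2 (lebesgue_on \<Omega>) \<phi>" using \<phi>c by (auto simp: H_curl_def)
    have "(LINT x|lebesgue_on \<Omega>. wcurl \<Omega> v x \<bullet> \<phi> x) = (LINT x|lebesgue_on \<Omega>. w x \<bullet> \<phi> x)"
      using L2_inner_integrable[OF L2_wcurl(1)[OF vc] L\<phi>] L2_inner_integrable[OF L(2) L\<phi>] ae
      by (intro integral_cong_AE) auto
    then show ?thesis
      using L2_inner_integrable[OF L(1) L2_wcurl(1)[OF \<phi>c]] L2_inner_integrable[OF L2_wcurl(1)[OF vc] L\<phi>] green[OF \<phi>]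
      by (simp add: tangential_trace_def)
  qed
  then show "H0_curl \<Omega> v" using vc by (simp add: H0_curl_def)
qed

lemma H0_curl_L2: "H0_curl \<Omega> v \<Longrightarrow> L2 (lebesgue_on \<Omega>) v"
  "H0_curl \<Omega> v \<Longrightarrow> L2 (lebesgue_on \<Omega>) (wcurl \<Omega> v)" "H0_curl \<Omega> v \<Longrightarrow> has_weak_curl \<Omega> v (wcurl \<Omega> v)"
  using L2_wcurl[of \<Omega> v] by (auto simp: H0_curl_def H_curl_def)

lemma H0_curl_lin:
  assumes \<Omega>: "open \<Omega>" "bounded \<Omega>" and v: "H0_curl \<Omega> v" and w: "H0_curl \<Omega> w"
  shows "H0_curl \<Omega> (\<lambda>x. v x + c *\<^sub>R w x)"
    "AE x in lebesgue_on \<Omega>. wcurl \<Omega> (\<lambda>x. v x + c *\<^sub>R w x) x = wcurl \<Omega> v x + c *\<^sub>R wcurl \<Omega> w x"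
proof -
  note V = H0_curl_L2[OF v] and W = H0_curl_L2[OF w]
  have *: "(LINT x|lebesgue_on \<Omega>. (v x + c *\<^sub>R w x) \<bullet> wcurl \<Omega> \<phi> x)
      = (LINT x|lebesgue_on \<Omega>. (wcurl \<Omega> v x + c *\<^sub>R wcurl \<Omega> w x) \<bullet> \<phi> x)" if \<phi>: "H1_vec \<Omega> \<phi>" for \<phi>
  proof -
    have \<phi>c: "H_curl \<Omega> \<phi>" by (rule H1_vec_imp_H_curl[OF \<Omega> \<phi>])
    have L\<phi>: "L2 (lebesgue_on \<Omega>) \<phi>" using \<phi>c by (auto simp: H_curl_def)
    note i = L2_inner_integrable[OF _ L\<phi>] L2_inner_integrable[OF _ L2_wcurl(1)[OF \<phi>c]]
    show ?thesis
      using i(1)[OF V(2)] i(1)[OF W(2)] i(2)[OF V(1)] i(2)[OF W(1)] H0_curlD[OF \<Omega> v \<phi>] H0_curlD[OF \<Omega> w \<phi>]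
      by (simp add: inner_add_left)
  qed
  note I = H0_curlI[OF \<Omega> L2_add[OF V(1) L2_scaleR[OF W(1)]] L2_add[OF V(2) L2_scaleR[OF W(2)]]
      has_weak_curl_lin[OF \<Omega> V(1,2) W(1,2) V(3) W(3)] *]
  show "H0_curl \<Omega> (\<lambda>x. v x + c *\<^sub>R w x)"
    "AE x in lebesgue_on \<Omega>. wcurl \<Omega> (\<lambda>x. v x + c *\<^sub>R w x) x = wcurl \<Omega> v x + c *\<^sub>R wcurl \<Omega> w x"
    by (rule I, assumption)+
qed

lemma H0_curl_zero:
  assumes \<Omega>: "open \<Omega>" "bounded \<Omega>"
  shows "H0_curl \<Omega> (\<lambda>_. 0)" "AE x in lebesgue_on \<Omega>. wcurl \<Omega> (\<lambda>_. 0) x = 0"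
  using H0_curlI[OF \<Omega> L2_zero L2_zero] by (auto simp: has_weak_curl_def)

lemma H0_curl_closed:
  assumes \<Omega>: "open \<Omega>" "bounded \<Omega>" and v: "\<And>k. H0_curl \<Omega> (v k)"
    and V: "L2 (lebesgue_on \<Omega>) V" "L2_tendsto (lebesgue_on \<Omega>) v V"
    and W: "L2 (lebesgue_on \<Omega>) W" "L2_tendsto (lebesgue_on \<Omega>) (\<lambda>k. wcurl \<Omega> (v k)) W"
  shows "H0_curl \<Omega> V" "AE x in lebesgue_on \<Omega>. wcurl \<Omega> V x = W x"
proof -
  note L = H0_curl_L2[OF v]
  have *: "(LINT x|lebesgue_on \<Omega>. V x \<bullet> wcurl \<Omega> \<phi> x) = (LINT x|lebesgue_on \<Omega>. W x \<bullet> \<phi> x)" if \<phi>: "H1_vec \<Omega> \<phi>" for \<phi>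
  proof -
    have \<phi>c: "H_curl \<Omega> \<phi>" by (rule H1_vec_imp_H_curl[OF \<Omega> \<phi>])
    have L\<phi>: "L2 (lebesgue_on \<Omega>) \<phi>" using \<phi>c by (auto simp: H_curl_def)
    have "(\<lambda>k. LINT x|lebesgue_on \<Omega>. v k x \<bullet> wcurl \<Omega> \<phi> x) \<longlonglongrightarrow> (LINT x|lebesgue_on \<Omega>. V x \<bullet> wcurl \<Omega> \<phi> x)"
      by (intro L2_tendsto_bilinear[OF bounded_bilinear_inner] L V L2_wcurl(1)[OF \<phi>c] L2_tendsto_const)
    moreover have "(\<lambda>k. LINT x|lebesgue_on \<Omega>. wcurl \<Omega> (v k) x \<bullet> \<phi> x) \<longlonglongrightarrow> (LINT x|lebesgue_on \<Omega>. W x \<bullet> \<phi> x)"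
      by (intro L2_tendsto_bilinear[OF bounded_bilinear_inner] L W L\<phi> L2_tendsto_const)
    ultimately show ?thesis
      unfolding H0_curlD[OF \<Omega> v \<phi>] using LIMSEQ_unique by blast
  qed
  note I = H0_curlI[OF \<Omega> V(1) W(1) has_weak_curl_closed[OF \<Omega> L(1) V L(2) W L(3)] *]
  show "H0_curl \<Omega> V" "AE x in lebesgue_on \<Omega>. wcurl \<Omega> V x = W x" by (rule I, assumption)+
qed

section \<open>Korn's inequality for incompatible fields\<close>

lemma norm_sq_matrix: "(norm X)\<^sup>2 = (\<Sum>i\<in>UNIV. (norm (X $ i))\<^sup>2)" for X :: "real^3^3"
  by (simp add: power2_norm_eq_inner inner_vec_def)

lemma bounded_linear_msym: "bounded_linear msym"
  unfolding msym_def[abs_def] linear_conv_bounded_linear[symmetric]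
  by (rule linearI) (simp_all add: transpose_def vec_eq_iff algebra_simps)

lemma bounded_linear_mskew: "bounded_linear mskew"
  unfolding mskew_def[abs_def] linear_conv_bounded_linear[symmetric]
  by (rule linearI) (simp_all add: transpose_def vec_eq_iff algebra_simps)

lemma bounded_linear_trace: "bounded_linear (trace :: real^3^3 \<Rightarrow> real)"
  unfolding trace_def[abs_def] linear_conv_bounded_linear[symmetric]
  by (rule linearI) (simp_all add: sum.distrib sum_distrib_left)

lemma norm_transpose: "norm (transpose X) = norm X" for X :: "real^3^3"
  by (rule power2_eq_imp_eq)
     (simp_all add: power2_norm_eq_inner inner_vec_def transpose_def sum.swap[of _ UNIV UNIV] sum_3)

lemma norm_msym_le: "norm (msym X) \<le> norm X"
proof -
  have "norm (msym X) = (1/2) * norm (transpose X + X)" by (simp add: msym_def)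
  also have "\<dots> \<le> (1/2) * (norm (transpose X) + norm X)"
    by (intro mult_left_mono norm_triangle_ineq) auto
  finally show ?thesis by (simp add: norm_transpose)
qed

lemma norm_msym_rank_one:
  fixes a e :: "real^3"
  shows "(norm (msym (\<chi> i. a $ i *\<^sub>R e)))\<^sup>2 = ((norm a)\<^sup>2 * (norm e)\<^sup>2 + (a \<bullet> e)\<^sup>2) / 2"
  unfolding power2_norm_eq_inner
  by (simp add: inner_vec_def msym_def transpose_def sum_3 power2_eq_square field_simps)

text \<open>The algebraic core. Splitting the rows of \<open>X\<close> along \<open>e = K / \<bar>K\<bar>\<close> gives \<open>X = a \<otimes> e + Y\<close>; the part
  \<open>Y\<close> is seen by the cross products with \<open>K\<close>, and a rank-one matrix \<open>a \<otimes> e\<close> is controlled by its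
  symmetric part.\<close>

lemma matrix_le_sym_and_cross:
  fixes X :: "real^3^3" and K :: "real^3"
  assumes \<kappa>: "0 < \<kappa>" "\<kappa> \<le> norm K"
  shows "(norm X)\<^sup>2 \<le> 4 * (norm (msym X))\<^sup>2 + 5 / \<kappa>\<^sup>2 * (\<Sum>i\<in>UNIV. (norm (cross3 K (X $ i)))\<^sup>2)"
proof -
  define e where "e = (1 / norm K) *\<^sub>R K"
  have K0: "0 < norm K" using \<kappa> by linarith
  have e: "norm e = 1" using K0 by (simp add: e_def)
  have Ke: "K = norm K *\<^sub>R e" using K0 by (simp add: e_def)
  define a where "a = (\<chi> i. X $ i \<bullet> e)"
  define Y where "Y = (\<chi> i. X $ i - a $ i *\<^sub>R e)"
  define T where "T = (\<chi> i. a $ i *\<^sub>R e)"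
  have XTY: "X = T + Y" by (simp add: T_def Y_def vec_eq_iff)
  have ee: "e \<bullet> e = 1" using e by (simp add: power2_norm_eq_inner[symmetric])
  have row: "(norm (X $ i))\<^sup>2 = (a $ i)\<^sup>2 + (norm (Y $ i))\<^sup>2" for i
    unfolding power2_norm_eq_inner
    by (simp add: Y_def a_def inner_diff_left inner_diff_right ee inner_commute[of e "X $ i"] power2_eq_square)
  have cross: "(norm K)\<^sup>2 * (norm (Y $ i))\<^sup>2 = (norm (cross3 K (X $ i)))\<^sup>2" for i
  proof -
    have "K \<bullet> X $ i = norm K * a $ i" by (subst Ke) (simp add: a_def inner_commute)
    then show ?thesis using row[of i] unfolding norm_cross by (simp add: power_mult_distrib algebra_simps)
  qed
  have na: "(norm a)\<^sup>2 = (\<Sum>i\<in>UNIV. (a $ i)\<^sup>2)"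
    unfolding power2_norm_eq_inner by (simp add: inner_vec_def power2_eq_square)
  have split: "(norm X)\<^sup>2 = (norm a)\<^sup>2 + (norm Y)\<^sup>2"
    unfolding norm_sq_matrix na row by (simp add: sum.distrib)
  have "\<kappa>\<^sup>2 * (norm Y)\<^sup>2 \<le> (norm K)\<^sup>2 * (norm Y)\<^sup>2" using \<kappa> by (intro mult_right_mono power_mono) auto
  also have "\<dots> = (\<Sum>i\<in>UNIV. (norm (cross3 K (X $ i)))\<^sup>2)"
    unfolding norm_sq_matrix sum_distrib_left cross ..
  finally have Y: "(norm Y)\<^sup>2 \<le> (\<Sum>i\<in>UNIV. (norm (cross3 K (X $ i)))\<^sup>2) / \<kappa>\<^sup>2"
    using \<kappa> by (simp add: field_simps)
  have "(norm a)\<^sup>2 \<le> 2 * (norm (msym T))\<^sup>2"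
    unfolding T_def norm_msym_rank_one e by simp
  also have "norm (msym T) \<le> norm (msym X) + norm Y"
  proof -
    have "msym T = msym X - msym Y"
      unfolding XTY using linear_add[OF bounded_linear.linear[OF bounded_linear_msym], of T Y] by simp
    then have "norm (msym T) \<le> norm (msym X) + norm (msym Y)" by (simp add: norm_triangle_ineq4)
    then show ?thesis using norm_msym_le[of Y] by linarith
  qed
  then have "2 * (norm (msym T))\<^sup>2 \<le> 2 * (norm (msym X) + norm Y)\<^sup>2"
    by (intro mult_left_mono power_mono) auto
  also have "\<dots> \<le> 4 * (norm (msym X))\<^sup>2 + 4 * (norm Y)\<^sup>2"
    using sum_squares_bound[of "norm (msym X)" "norm Y"] by (simp add: power2_sum)
  finally have "(norm X)\<^sup>2 \<le> 4 * (norm (msym X))\<^sup>2 + 5 * (norm Y)\<^sup>2" unfolding split by simp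
  also have "\<dots> \<le> 4 * (norm (msym X))\<^sup>2 + 5 * ((\<Sum>i\<in>UNIV. (norm (cross3 K (X $ i)))\<^sup>2) / \<kappa>\<^sup>2)"
    using Y by simp
  finally show ?thesis by simp
qed

lemma coeff_bounded_linear:
  fixes f :: "real^3 \<Rightarrow> 'b::euclidean_space" and h :: "'b \<Rightarrow> 'c::euclidean_space"
  assumes "\<Omega> \<in> sets lebesgue" "bounded \<Omega>" "L2 (lebesgue_on \<Omega>) f" and h: "bounded_linear h"
  shows "cos_mode R \<Omega> (\<lambda>x. h (f x)) k = h (cos_mode R \<Omega> f k)"
    and "sin_mode R \<Omega> (\<lambda>x. h (f x)) k = h (sin_mode R \<Omega> f k)"
  unfolding cos_mode_def sin_mode_def
  using trig_coeff_integrable[OF assms(1-3), of "wave R k"]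
  by (simp_all flip: integral_bounded_linear[OF h] add: linear_scale[OF bounded_linear.linear[OF h]])

lemma norm_wave_ge:
  fixes k :: "int^'n::finite"
  assumes "k \<noteq> 0" "0 < R" shows "pi / R \<le> norm (wave R k)"
proof -
  obtain i where "k $ i \<noteq> 0" using assms(1) by (auto simp: vec_eq_iff)
  then have "1 \<le> \<bar>real_of_int (k $ i)\<bar>" by (simp flip: of_int_abs)
  then have "pi / R * 1 \<le> pi / R * \<bar>real_of_int (k $ i)\<bar>" using assms(2) by (intro mult_left_mono) auto
  also have "\<dots> = \<bar>wave R k $ i\<bar>" using assms(2) by (simp add: wave_def abs_mult)
  also have "\<dots> \<le> norm (wave R k)" by (rule component_le_norm_cart)
  finally show ?thesis by simp
qed

text \<open>Fields \<open>X\<close> whose Fourier coefficients satisfy the relation between a field and its curl are controlled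
  by their symmetric part and their curl, row by row.\<close>

text \<open>The matrix inequality at each non-zero frequency is summed over the frequencies. Here
  \<open>C\<close> stands for the row-wise curl of \<open>X\<close>; the hypothesis concerns its
  Fourier modes only, so that \<open>C = 0\<close> is a possible choice for a gradient field
  \<open>X\<close>.\<close>

lemma Korn_of_modes:
  fixes X C :: "real^3 \<Rightarrow> real^3^3"
  assumes \<Omega>: "\<Omega> \<in> sets lebesgue" "\<Omega> \<subseteq> cball 0 r" and r: "0 < r" and R: "R = 2 * r"
    and X: "L2 (lebesgue_on \<Omega>) X" and C: "L2 (lebesgue_on \<Omega>) C"
    and modes: "\<And>k i. (norm (cross3 (wave R k) (cos_mode R \<Omega> X k $ i)))\<^sup>2
        + (norm (cross3 (wave R k) (sin_mode R \<Omega> X k $ i)))\<^sup>2 \<le> mode_sq R \<Omega> (\<lambda>x. C x $ i) k"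
  shows "(l2n (lebesgue_on \<Omega>) X)\<^sup>2
     \<le> 2 * (4 + 5 * R\<^sup>2 / pi\<^sup>2) * ((l2n (lebesgue_on \<Omega>) (\<lambda>x. msym (X x)))\<^sup>2 + (l2n (lebesgue_on \<Omega>) C)\<^sup>2)"
proof -
  let ?M = "lebesgue_on \<Omega>" and ?A = "4 + 5 * R\<^sup>2 / pi\<^sup>2"
  have R0: "0 < R" using r R by simp
  have bdd: "bounded \<Omega>" using \<Omega>(2) bounded_subset by blast
  have S: "L2 ?M (\<lambda>x. msym (X x))" by (rule L2_bounded_linear[OF bounded_linear_msym X])
  note coeff = coeff_bounded_linear[OF \<Omega>(1) bdd]
  have G: "L2 ?M (\<lambda>x. (msym (X x), C x))" by (rule L2_Pair[OF S C])
  have "(l2n ?M X)\<^sup>2 \<le> 2 * ?A * (l2n ?M (\<lambda>x. (msym (X x), C x)))\<^sup>2"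
  proof (rule l2n_le_of_modes[OF \<Omega> r R X G])
    fix k :: "int^3" assume k: "k \<noteq> 0"
    define c s where "c = cos_mode R \<Omega> X k" and "s = sin_mode R \<Omega> X k"
    let ?K = "wave R k"
    have \<kappa>: "0 < pi / R" "pi / R \<le> norm ?K" using norm_wave_ge[OF k R0] R0 by auto
    have "mode_sq R \<Omega> X k \<le> 4 * ((norm (msym c))\<^sup>2 + (norm (msym s))\<^sup>2)
        + 5 / (pi / R)\<^sup>2 * (\<Sum>i\<in>UNIV. (norm (cross3 ?K (c $ i)))\<^sup>2 + (norm (cross3 ?K (s $ i)))\<^sup>2)"
      using matrix_le_sym_and_cross[OF \<kappa>, of c] matrix_le_sym_and_cross[OF \<kappa>, of s]
      by (simp add: mode_sq_def c_def[symmetric] s_def[symmetric] sum.distrib distrib_left)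
    also have "(\<Sum>i\<in>UNIV. (norm (cross3 ?K (c $ i)))\<^sup>2 + (norm (cross3 ?K (s $ i)))\<^sup>2)
        \<le> (\<Sum>i\<in>UNIV. mode_sq R \<Omega> (\<lambda>x. C x $ i) k)"
      unfolding c_def s_def by (intro sum_mono modes)
    also have "(\<Sum>i\<in>UNIV. mode_sq R \<Omega> (\<lambda>x. C x $ i) k) = mode_sq R \<Omega> C k"
      using coeff[OF C bounded_linear_vec_nth] by (simp add: mode_sq_def norm_sq_matrix sum.distrib)
    also have "(norm (msym c))\<^sup>2 + (norm (msym s))\<^sup>2 = mode_sq R \<Omega> (\<lambda>x. msym (X x)) k"
      using coeff[OF X bounded_linear_msym] by (simp add: mode_sq_def c_def s_def)
    finally have *: "mode_sq R \<Omega> X k \<le> 4 * mode_sq R \<Omega> (\<lambda>x. msym (X x)) k + 5 / (pi / R)\<^sup>2 * mode_sq R \<Omega> C k"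
      by (simp add: divide_right_mono mult_left_mono)
    have pair: "mode_sq R \<Omega> (\<lambda>x. (msym (X x), C x)) k = mode_sq R \<Omega> (\<lambda>x. msym (X x)) k + mode_sq R \<Omega> C k"
    proof -
      have np: "(norm z)\<^sup>2 = (norm (fst z))\<^sup>2 + (norm (snd z))\<^sup>2" for z :: "(real^3^3) \<times> (real^3^3)"
        by (simp add: norm_prod_def)
      show ?thesis
        using coeff[OF G bounded_linear_fst, of R k] coeff[OF G bounded_linear_snd, of R k]
        unfolding mode_sq_def np[of "cos_mode _ _ _ _"] np[of "sin_mode _ _ _ _"] by simp
    qed
    have "4 * mode_sq R \<Omega> (\<lambda>x. msym (X x)) k + 5 / (pi / R)\<^sup>2 * mode_sq R \<Omega> C k
        \<le> ?A * mode_sq R \<Omega> (\<lambda>x. msym (X x)) k + ?A * mode_sq R \<Omega> C k"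
      using R0 by (intro add_mono mult_right_mono mode_sq_nonneg) (auto simp: power_divide)
    then show "mode_sq R \<Omega> X k \<le> ?A * mode_sq R \<Omega> (\<lambda>x. (msym (X x), C x)) k"
      using * by (simp add: pair distrib_left)
  qed simp
  also have "(l2n ?M (\<lambda>x. (msym (X x), C x)))\<^sup>2 = (l2n ?M (\<lambda>x. msym (X x)))\<^sup>2 + (l2n ?M C)\<^sup>2"
    using L2_sq_integrable[OF S] L2_sq_integrable[OF C] by (simp add: l2n_power2 norm_prod_def)
  finally show ?thesis .
qed

lemma vec_eq_of_inner: "(\<And>c. x \<bullet> c = y \<bullet> c) \<Longrightarrow> x = y" for x y :: "real^3"
  by (rule vector_eq_ldot[THEN iffD1]) (simp add: inner_commute)

lemma curl_ridge:
  fixes K c :: "real^3"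
  assumes h: "\<And>t. (h has_real_derivative h' t) (at t)"
  shows "curl (\<lambda>x. h (K \<bullet> x) *\<^sub>R c) x = h' (K \<bullet> x) *\<^sub>R cross3 K c"
proof -
  have dh: "partial i (\<lambda>x. h (K \<bullet> x) * d) x = K $ i * h' (K \<bullet> x) * d" for i d
  proof -
    have "((\<lambda>t. h t * d) has_real_derivative h' t * d) (at t)" for t
      using h by (auto intro!: derivative_eq_intros)
    from partial_ridge(2)[OF this, of i K 0 x] show ?thesis by simp
  qed
  show ?thesis
    by (simp add: curl_def cross3_def vec_eq_iff forall_3 dh) (simp add: algebra_simps)
qed

text \<open>Green's formula against the fields \<open>h (K \<bullet> x) *\<^sub>R c\<close>, with
  \<open>h\<close> the sine or cosine, whose curl is \<open>h' (K \<bullet> x) *\<^sub>R cross3 K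
  c\<close>. The zero tangential trace is what removes the boundary term, as the waves do not
  vanish at the boundary.\<close>

lemma H0_curl_modes:
  assumes \<Omega>: "open \<Omega>" "bounded \<Omega>" and v: "H0_curl \<Omega> v"
  shows "cos_mode R \<Omega> (wcurl \<Omega> v) k = cross3 (wave R k) (sin_mode R \<Omega> v k)"
    and "sin_mode R \<Omega> (wcurl \<Omega> v) k = - cross3 (wave R k) (cos_mode R \<Omega> v k)"
proof -
  let ?M = "lebesgue_on \<Omega>" and ?K = "wave R k"
  have meas: "\<Omega> \<in> sets lebesgue" using \<Omega>(1) by simp
  note V = H0_curl_L2[OF v]
  note iv = trig_coeff_integrable[OF meas \<Omega>(2) V(1), of ?K] and iw = trig_coeff_integrable[OF meas \<Omega>(2) V(2), of ?K]
  have green: "(LINT x|?M. v x \<bullet> (h' (?K \<bullet> x) *\<^sub>R cross3 ?K c)) = (LINT x|?M. wcurl \<Omega> v x \<bullet> (h (?K \<bullet> x) *\<^sub>R c))"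
    if h: "\<And>t. (h has_real_derivative h' t) (at t)" "smooth (\<lambda>x. h (?K \<bullet> x))" for h h' c
  proof -
    let ?\<phi> = "\<lambda>x. h (?K \<bullet> x) *\<^sub>R c"
    have sm: "smooth (\<lambda>x. ?\<phi> x $ i)" for i using smooth_mult[OF h(2) smooth_const] by simp
    note \<phi> = smooth_field_wcurl[OF \<Omega> sm]
    have "(LINT x|?M. v x \<bullet> curl ?\<phi> x) = (LINT x|?M. v x \<bullet> wcurl \<Omega> ?\<phi> x)"
      using \<phi>(2) L2_measurable[OF V(1)] L2_measurable[OF L2_wcurl(1)[OF H1_vec_imp_H_curl[OF \<Omega> \<phi>(1)]]]
        L2_measurable[OF L2_smooth_field[OF \<Omega> smooth_curl[OF sm]]]
      by (intro integral_cong_AE) auto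
    also have "\<dots> = (LINT x|?M. wcurl \<Omega> v x \<bullet> ?\<phi> x)" by (rule H0_curlD[OF \<Omega> v \<phi>(1)])
    finally show ?thesis unfolding curl_ridge[OF h(1)] .
  qed
  show "cos_mode R \<Omega> (wcurl \<Omega> v) k = cross3 ?K (sin_mode R \<Omega> v k)"
  proof (rule vec_eq_of_inner)
    fix c
    have "cos_mode R \<Omega> (wcurl \<Omega> v) k \<bullet> c = (LINT x|?M. wcurl \<Omega> v x \<bullet> (cos (?K \<bullet> x) *\<^sub>R c))"
      unfolding cos_mode_def using iw(1) by (simp flip: Bochner_Integration.integral_inner_left)
    also have "\<dots> = (LINT x|?M. v x \<bullet> (- sin (?K \<bullet> x) *\<^sub>R cross3 ?K c))"
      by (rule green[symmetric]) (auto intro!: derivative_eq_intros smooth_trig)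
    also have "\<dots> = - (sin_mode R \<Omega> v k \<bullet> cross3 ?K c)"
      unfolding sin_mode_def using iv(2) by (simp flip: Bochner_Integration.integral_inner_left)
    also have "\<dots> = cross3 ?K (sin_mode R \<Omega> v k) \<bullet> c"
      by (simp add: cross3_simps)
    finally show "cos_mode R \<Omega> (wcurl \<Omega> v) k \<bullet> c = cross3 ?K (sin_mode R \<Omega> v k) \<bullet> c" .
  qed
  show "sin_mode R \<Omega> (wcurl \<Omega> v) k = - cross3 ?K (cos_mode R \<Omega> v k)"
  proof (rule vec_eq_of_inner)
    fix c
    have "sin_mode R \<Omega> (wcurl \<Omega> v) k \<bullet> c = (LINT x|?M. wcurl \<Omega> v x \<bullet> (sin (?K \<bullet> x) *\<^sub>R c))"
      unfolding sin_mode_def using iw(2) by (simp flip: Bochner_Integration.integral_inner_left)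
    also have "\<dots> = (LINT x|?M. v x \<bullet> (cos (?K \<bullet> x) *\<^sub>R cross3 ?K c))"
      by (rule green[symmetric]) (auto intro!: derivative_eq_intros smooth_trig)
    also have "\<dots> = cos_mode R \<Omega> v k \<bullet> cross3 ?K c"
      unfolding cos_mode_def using iv(1) by (simp flip: Bochner_Integration.integral_inner_left)
    also have "\<dots> = (- cross3 ?K (cos_mode R \<Omega> v k)) \<bullet> c"
      by (simp add: cross3_simps)
    finally show "sin_mode R \<Omega> (wcurl \<Omega> v) k \<bullet> c = (- cross3 ?K (cos_mode R \<Omega> v k)) \<bullet> c" .
  qed
qed

text \<open>The zero trace admits waves as test functions although they do not vanish at the
  boundary.\<close>

lemma zero_trace_modes:
  fixes \<Omega> :: "(real^3) set"
  assumes \<Omega>: "open \<Omega>" "bounded \<Omega>" "C11_boundary \<Omega>" and u: "has_trace \<Omega> u (\<lambda>_. 0)"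
  shows "cos_mode R \<Omega> (wpartial \<Omega> i u) k = wave R k $ i * sin_mode R \<Omega> u k"
    and "sin_mode R \<Omega> (wpartial \<Omega> i u) k = - (wave R k $ i * cos_mode R \<Omega> u k)"
proof -
  have scale: "(LINT x|lebesgue_on \<Omega>. u x * (wave R k $ i * f x)) = wave R k $ i * (LINT x|lebesgue_on \<Omega>. u x * f x)" for f
    by (subst mult.left_commute) simp
  show "cos_mode R \<Omega> (wpartial \<Omega> i u) k = wave R k $ i * sin_mode R \<Omega> u k"
    using zero_trace_by_parts[OF \<Omega> u smooth_trig(1)[of "wave R k"], of i]
    by (simp add: cos_mode_def sin_mode_def partial_cos scale mult.commute[of _ "u _"] mult.commute[of _ "wpartial \<Omega> i u _"])
  show "sin_mode R \<Omega> (wpartial \<Omega> i u) k = - (wave R k $ i * cos_mode R \<Omega> u k)"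
    using zero_trace_by_parts[OF \<Omega> u smooth_trig(2)[of "wave R k"], of i]
    by (simp add: cos_mode_def sin_mode_def partial_sin scale mult.commute[of _ "u _"] mult.commute[of _ "wpartial \<Omega> i u _"])
qed

section \<open>The relaxed micromorphic model\<close>

text \<open>A state collects the values of \<open>u\<close>, its gradient, \<open>P\<close> and
  its Curl. The graph norms of the function spaces become the norm of square-integrable states,
  and the energy becomes a bilinear form on a finite-dimensional space.\<close>

type_synonym state = "(real^3) \<times> (real^3^3) \<times> (real^3^3) \<times> (real^3^3)"

definition lift :: "(real^3) set \<Rightarrow> (real^3 \<Rightarrow> real^3) \<Rightarrow> (real^3 \<Rightarrow> real^3^3) \<Rightarrow> real^3 \<Rightarrow> state" where
  "lift \<Omega> u P x = (u x, wgrad \<Omega> u x, P x, wCurl \<Omega> P x)"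

text \<open>Equality almost everywhere is what makes this a linear space: \<open>wgrad\<close> and
  \<open>wCurl\<close> choose representatives, which depend linearly on the fields only up to null
  sets.\<close>

definition admissible :: "(real^3) set \<Rightarrow> (real^3 \<Rightarrow> state) set" where
  "admissible \<Omega> = {f. L2 (lebesgue_on \<Omega>) f \<and>
     (\<exists>u P. H1_0 \<Omega> u \<and> H0_Curl \<Omega> P \<and> (AE x in lebesgue_on \<Omega>. f x = lift \<Omega> u P x))}"

lemma H1_0_iff: "H1_0 \<Omega> u \<longleftrightarrow> (\<forall>i. has_trace \<Omega> (\<lambda>x. u x $ i) (\<lambda>_. 0))"
  unfolding H1_0_def H1_vec_def has_trace_vec_def by (auto simp: has_trace_def)

lemma H1_0_L2: "H1_0 \<Omega> u \<Longrightarrow> L2 (lebesgue_on \<Omega>) u" "H1_0 \<Omega> u \<Longrightarrow> L2 (lebesgue_on \<Omega>) (wgrad \<Omega> u)"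
proof -
  assume u: "H1_0 \<Omega> u"
  then have H1: "H1 \<Omega> (\<lambda>x. u x $ i)" for i by (simp add: H1_0_def H1_vec_def)
  then show "L2 (lebesgue_on \<Omega>) u" by (intro L2_vecI) (simp add: H1_def)
  show "L2 (lebesgue_on \<Omega>) (wgrad \<Omega> u)"
    by (intro L2_vecI) (simp add: wgrad_def L2_wpartial[OF H1])
qed

lemma H0_Curl_L2: "H0_Curl \<Omega> P \<Longrightarrow> L2 (lebesgue_on \<Omega>) P" "H0_Curl \<Omega> P \<Longrightarrow> L2 (lebesgue_on \<Omega>) (wCurl \<Omega> P)"
proof -
  assume P: "H0_Curl \<Omega> P"
  then have row: "H0_curl \<Omega> (\<lambda>x. P x $ i)" for i by (simp add: H0_Curl_def)
  show "L2 (lebesgue_on \<Omega>) P" by (intro L2_vecI H0_curl_L2(1) row)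
  show "L2 (lebesgue_on \<Omega>) (wCurl \<Omega> P)"
    by (intro L2_vecI[where f="wCurl \<Omega> P"]) (simp add: wCurl_def H0_curl_L2(2)[OF row])
qed

lemma L2_lift: "H1_0 \<Omega> u \<Longrightarrow> H0_Curl \<Omega> P \<Longrightarrow> L2 (lebesgue_on \<Omega>) (lift \<Omega> u P)"
  unfolding lift_def[abs_def] by (intro L2_Pair H1_0_L2 H0_Curl_L2)

lemma lift_admissible: "H1_0 \<Omega> u \<Longrightarrow> H0_Curl \<Omega> P \<Longrightarrow> lift \<Omega> u P \<in> admissible \<Omega>"
  unfolding admissible_def using L2_lift by blast

lemma lift_lin:
  assumes \<Omega>: "open \<Omega>" "bounded \<Omega>"
    and u: "H1_0 \<Omega> u" "H1_0 \<Omega> v" and P: "H0_Curl \<Omega> P" "H0_Curl \<Omega> Q"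
  shows "H1_0 \<Omega> (\<lambda>x. u x + c *\<^sub>R v x)" "H0_Curl \<Omega> (\<lambda>x. P x + c *\<^sub>R Q x)"
    "AE x in lebesgue_on \<Omega>. lift \<Omega> (\<lambda>x. u x + c *\<^sub>R v x) (\<lambda>x. P x + c *\<^sub>R Q x) x = lift \<Omega> u P x + c *\<^sub>R lift \<Omega> v Q x"
proof -
  have tr: "has_trace \<Omega> (\<lambda>x. u x $ i) (\<lambda>_. 0)" "has_trace \<Omega> (\<lambda>x. v x $ i) (\<lambda>_. 0)" for i
    using u by (auto simp: H1_0_iff)
  have row: "H0_curl \<Omega> (\<lambda>x. P x $ i)" "H0_curl \<Omega> (\<lambda>x. Q x $ i)" for i
    using P by (auto simp: H0_Curl_def)
  show "H1_0 \<Omega> (\<lambda>x. u x + c *\<^sub>R v x)"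
    unfolding H1_0_iff using zero_trace_lin(1)[OF \<Omega> tr] by simp
  show "H0_Curl \<Omega> (\<lambda>x. P x + c *\<^sub>R Q x)"
    unfolding H0_Curl_def using H0_curl_lin(1)[OF \<Omega> row] by simp
  have "AE x in lebesgue_on \<Omega>. \<forall>i j. wpartial \<Omega> j (\<lambda>x. u x $ i + c * v x $ i) x
      = wpartial \<Omega> j (\<lambda>x. u x $ i) x + c * wpartial \<Omega> j (\<lambda>x. v x $ i) x"
    unfolding AE_all_countable by (intro allI zero_trace_lin(2)[OF \<Omega> tr])
  moreover have "AE x in lebesgue_on \<Omega>. \<forall>i. wcurl \<Omega> (\<lambda>x. P x $ i + c *\<^sub>R Q x $ i) x
      = wcurl \<Omega> (\<lambda>x. P x $ i) x + c *\<^sub>R wcurl \<Omega> (\<lambda>x. Q x $ i) x"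
    unfolding AE_all_countable by (intro allI H0_curl_lin(2)[OF \<Omega> row])
  ultimately show "AE x in lebesgue_on \<Omega>. lift \<Omega> (\<lambda>x. u x + c *\<^sub>R v x) (\<lambda>x. P x + c *\<^sub>R Q x) x = lift \<Omega> u P x + c *\<^sub>R lift \<Omega> v Q x"
    by eventually_elim (simp add: lift_def wgrad_def wCurl_def vec_eq_iff)
qed

lemma admissible_lin:
  assumes \<Omega>: "open \<Omega>" "bounded \<Omega>" and f: "f \<in> admissible \<Omega>" and g: "g \<in> admissible \<Omega>"
  shows "(\<lambda>x. f x + c *\<^sub>R g x) \<in> admissible \<Omega>"
proof -
  obtain u P where u: "H1_0 \<Omega> u" "H0_Curl \<Omega> P" "AE x in lebesgue_on \<Omega>. f x = lift \<Omega> u P x"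
    using f by (auto simp: admissible_def)
  obtain v Q where v: "H1_0 \<Omega> v" "H0_Curl \<Omega> Q" "AE x in lebesgue_on \<Omega>. g x = lift \<Omega> v Q x"
    using g by (auto simp: admissible_def)
  note lin = lift_lin[OF \<Omega> u(1) v(1) u(2) v(2), of c]
  have "AE x in lebesgue_on \<Omega>. f x + c *\<^sub>R g x = lift \<Omega> (\<lambda>x. u x + c *\<^sub>R v x) (\<lambda>x. P x + c *\<^sub>R Q x) x"
    using u(3) v(3) lin(3) by eventually_elim simp
  moreover have "L2 (lebesgue_on \<Omega>) (\<lambda>x. f x + c *\<^sub>R g x)"
    using f g by (auto simp: admissible_def intro: L2_add L2_scaleR)
  ultimately show ?thesis using lin(1,2) unfolding admissible_def by blast
qed

lemma zero_admissible:
  assumes \<Omega>: "open \<Omega>" "bounded \<Omega>"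
  shows "(\<lambda>_. 0) \<in> admissible \<Omega>"
proof -
  have "H1_0 \<Omega> (\<lambda>_. 0)" "H0_Curl \<Omega> (\<lambda>_. 0)"
    using zero_trace_zero[OF \<Omega>] H0_curl_zero[OF \<Omega>] by (auto simp: H1_0_iff H0_Curl_def)
  from admissible_lin[OF \<Omega> lift_admissible[OF this] lift_admissible[OF this], of "-1"]
  show ?thesis by simp
qed

text \<open>Convergence of states is convergence of the fields together with their derivatives, so
  the limit is again a state because zero traces and weak derivatives are stable under such
  limits.\<close>

lemma admissible_closed:
  assumes \<Omega>: "open \<Omega>" "bounded \<Omega>" and f: "\<And>k. f k \<in> admissible \<Omega>"
    and F: "L2 (lebesgue_on \<Omega>) F" "L2_tendsto (lebesgue_on \<Omega>) f F"
  shows "F \<in> admissible \<Omega>"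
proof -
  let ?M = "lebesgue_on \<Omega>"
  have "\<forall>k. \<exists>uP. H1_0 \<Omega> (fst uP) \<and> H0_Curl \<Omega> (snd uP) \<and> (AE x in ?M. f k x = lift \<Omega> (fst uP) (snd uP) x)"
    using f by (auto simp: admissible_def)
  from choice[OF this] obtain uP where "\<forall>k. H1_0 \<Omega> (fst (uP k)) \<and> H0_Curl \<Omega> (snd (uP k))
      \<and> (AE x in ?M. f k x = lift \<Omega> (fst (uP k)) (snd (uP k)) x)" ..
  then obtain u P where uP: "\<And>k. H1_0 \<Omega> (u k)" "\<And>k. H0_Curl \<Omega> (P k)" "\<And>k. AE x in ?M. f k x = lift \<Omega> (u k) (P k) x"
    using that[of "\<lambda>k. fst (uP k)" "\<lambda>k. snd (uP k)"] by blast
  note L = L2_lift[OF uP(1,2)]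
  have lim: "L2_tendsto ?M (\<lambda>k. lift \<Omega> (u k) (P k)) F"
    by (rule L2_tendsto_cong_AE[OF F(2) uP(3)]) simp
  have part: "L2 ?M (\<lambda>x. h (F x))" "L2_tendsto ?M (\<lambda>k x. h (lift \<Omega> (u k) (P k) x)) (\<lambda>x. h (F x))"
    if "bounded_linear h" for h :: "state \<Rightarrow> 'b::euclidean_space"
    using L2_bounded_linear[OF that F(1)] L2_tendsto_bounded_linear[OF that L F(1) lim] by auto
  define U where "U x = fst (F x)" for x
  define D where "D x = fst (snd (F x))" for x
  define T where "T x = fst (snd (snd (F x)))" for x
  define C where "C x = snd (snd (snd (F x)))" for x
  have bl: "bounded_linear (\<lambda>s::state. fst s $ i)" "bounded_linear (\<lambda>s::state. fst (snd s) $ i $ j)"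
    "bounded_linear (\<lambda>s::state. fst (snd (snd s)) $ i)" "bounded_linear (\<lambda>s::state. snd (snd (snd s)) $ i)" for i j
    by (intro bounded_linear_compose[OF bounded_linear_vec_nth] bounded_linear_fst bounded_linear_snd
        bounded_linear_compose[OF bounded_linear_fst] bounded_linear_compose[OF bounded_linear_snd])+
  have tr: "has_trace \<Omega> (\<lambda>x. u k x $ i) (\<lambda>_. 0)" for i k using uP(1) by (auto simp: H1_0_iff)
  have row: "H0_curl \<Omega> (\<lambda>x. P k x $ i)" for i k using uP(2) by (auto simp: H0_Curl_def)
  have Ulim: "L2 ?M (\<lambda>x. U x $ i)" "L2_tendsto ?M (\<lambda>k x. u k x $ i) (\<lambda>x. U x $ i)"
    "L2 ?M (\<lambda>x. D x $ i $ j)" "L2_tendsto ?M (\<lambda>k. wpartial \<Omega> j (\<lambda>x. u k x $ i)) (\<lambda>x. D x $ i $ j)" for i j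
    using part[OF bl(1)[of i]] part[OF bl(2)[of i j]] by (simp_all add: U_def D_def lift_def wgrad_def)
  have U: "has_trace \<Omega> (\<lambda>x. U x $ i) (\<lambda>_. 0)" "AE x in ?M. wpartial \<Omega> j (\<lambda>x. U x $ i) x = D x $ i $ j" for i j
    using zero_trace_closed[OF \<Omega> tr Ulim(1,2), where D="\<lambda>j x. D x $ i $ j"] Ulim(3,4) by auto
  have Tlim: "L2 ?M (\<lambda>x. T x $ i)" "L2_tendsto ?M (\<lambda>k x. P k x $ i) (\<lambda>x. T x $ i)"
    "L2 ?M (\<lambda>x. C x $ i)" "L2_tendsto ?M (\<lambda>k. wcurl \<Omega> (\<lambda>x. P k x $ i)) (\<lambda>x. C x $ i)" for i
    using part[OF bl(3)[of i]] part[OF bl(4)[of i]] by (simp_all add: T_def C_def lift_def wCurl_def)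
  note T = H0_curl_closed[OF \<Omega> row Tlim]
  have "AE x in ?M. \<forall>i j. wpartial \<Omega> j (\<lambda>x. U x $ i) x = D x $ i $ j"
    unfolding AE_all_countable by (intro allI U)
  moreover have "AE x in ?M. \<forall>i. wcurl \<Omega> (\<lambda>x. T x $ i) x = C x $ i"
    unfolding AE_all_countable by (intro allI T)
  ultimately have "AE x in ?M. F x = lift \<Omega> U T x"
    by eventually_elim (simp add: lift_def wgrad_def wCurl_def vec_eq_iff prod_eq_iff U_def D_def T_def C_def)
  moreover have "H1_0 \<Omega> U" "H0_Curl \<Omega> T" using U(1) T(1) by (auto simp: H1_0_iff H0_Curl_def)
  ultimately show ?thesis using F(1) unfolding admissible_def by blast
qed

subsection \<open>The energy\<close>

definition energy :: "real \<Rightarrow> real \<Rightarrow> real \<Rightarrow> real \<Rightarrow> real \<Rightarrow> real \<Rightarrow> real \<Rightarrow> state \<Rightarrow> state \<Rightarrow> real" where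
  "energy mu_e lam_e mu_c mu_micro lam_micro mu_macro L_c = (\<lambda>(u, D, P, C) (u', D', P', C').
       2 * mu_e * (msym (D - P) \<bullet> msym (D' - P')) + 2 * mu_c * (mskew (D - P) \<bullet> mskew (D' - P'))
     + lam_e * trace (D - P) * trace (D' - P') + 2 * mu_micro * (msym P \<bullet> msym P')
     + lam_micro * trace P * trace P' + mu_macro * L_c\<^sup>2 * (C \<bullet> C'))"

lemma matrix_parts_linear:
  "msym (X + Y) = msym X + msym Y" "msym (c *\<^sub>R X) = c *\<^sub>R msym X" "msym (X - Y) = msym X - msym Y"
  "mskew (X + Y) = mskew X + mskew Y" "mskew (c *\<^sub>R X) = c *\<^sub>R mskew X" "mskew (X - Y) = mskew X - mskew Y"
  "trace (c *\<^sub>R X) = c * trace X" for X Y :: "real^3^3"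
  using bounded_linear.linear[OF bounded_linear_msym] bounded_linear.linear[OF bounded_linear_mskew]
    bounded_linear.linear[OF bounded_linear_trace]
  by (simp_all add: linear_add linear_diff linear_scale)

lemma bounded_bilinear_energy: "bounded_bilinear (energy mu_e lam_e mu_c mu_micro lam_micro mu_macro L_c)"
  unfolding bilinear_conv_bounded_bilinear[symmetric] bilinear_def
  by (auto intro!: linearI simp: energy_def split_beta matrix_parts_linear trace_add trace_sub
      inner_add_left inner_add_right inner_diff_left inner_diff_right algebra_simps)

lemma energy_sym: "energy mu_e lam_e mu_c mu_micro lam_micro mu_macro L_c s t
    = energy mu_e lam_e mu_c mu_micro lam_micro mu_macro L_c t s"
  by (simp add: energy_def split_beta inner_commute)

lemma trace_sq_le: "(trace X)\<^sup>2 \<le> 3 * (norm (msym X))\<^sup>2" for X :: "real^3^3"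
proof -
  have "(X $ 1 $ 1 + X $ 2 $ 2 + X $ 3 $ 3)\<^sup>2 \<le> 3 * ((X $ 1 $ 1)\<^sup>2 + (X $ 2 $ 2)\<^sup>2 + (X $ 3 $ 3)\<^sup>2)"
    using sum_squares_bound[of "X $ 1 $ 1" "X $ 2 $ 2"] sum_squares_bound[of "X $ 1 $ 1" "X $ 3 $ 3"]
      sum_squares_bound[of "X $ 2 $ 2" "X $ 3 $ 3"] by (simp add: power2_eq_square algebra_simps)
  also have "(X $ 1 $ 1)\<^sup>2 + (X $ 2 $ 2)\<^sup>2 + (X $ 3 $ 3)\<^sup>2 \<le> (norm (msym X))\<^sup>2"
  proof -
    have *: "(X $ i $ i)\<^sup>2 \<le> (norm (msym X $ i))\<^sup>2" for i
      using power_mono[OF component_le_norm_cart[of "msym X $ i" i], of 2] by (simp add: msym_def transpose_def)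
    show ?thesis unfolding norm_sq_matrix sum_3 by (intro add_mono *)
  qed
  finally show ?thesis by (simp add: trace_def sum_3)
qed

text \<open>A negative \<open>lam\<close> is outweighed by the first term, because the square of
  the trace is at most three times the squared norm of the symmetric part.\<close>

lemma Lame_energy_ge:
  fixes X :: "real^3^3"
  assumes "0 < mu" "0 < 2 * mu + 3 * lam"
  shows "min (2 * mu) (2 * mu + 3 * lam) * (norm (msym X))\<^sup>2 \<le> 2 * mu * (norm (msym X))\<^sup>2 + lam * (trace X)\<^sup>2"
proof (cases "0 \<le> lam")
  case True
  then have "0 \<le> lam * (trace X)\<^sup>2" by simp
  moreover have "min (2 * mu) (2 * mu + 3 * lam) * (norm (msym X))\<^sup>2 \<le> 2 * mu * (norm (msym X))\<^sup>2"
    by (intro mult_right_mono) auto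
  ultimately show ?thesis by linarith
next
  case False
  then have "lam * (3 * (norm (msym X))\<^sup>2) \<le> lam * (trace X)\<^sup>2"
    using trace_sq_le[of X] by (intro mult_left_mono_neg) auto
  moreover have "min (2 * mu) (2 * mu + 3 * lam) * (norm (msym X))\<^sup>2 \<le> (2 * mu + 3 * lam) * (norm (msym X))\<^sup>2"
    by (intro mult_right_mono) auto
  ultimately show ?thesis by (simp add: algebra_simps)
qed

text \<open>The two Lame energies bound the symmetric parts; the skew-symmetric part contributes a
  non-negative term.\<close>

lemma energy_ge:
  assumes "mu_e > 0" "2 * mu_e + 3 * lam_e > 0" "mu_c \<ge> 0" "mu_micro > 0" "2 * mu_micro + 3 * lam_micro > 0"
    "mu_macro > 0" "L_c > 0"
  shows "\<exists>c>0. \<forall>u D P C. c * ((norm (msym (D - P)))\<^sup>2 + (norm (msym P))\<^sup>2 + (norm C)\<^sup>2)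
    \<le> energy mu_e lam_e mu_c mu_micro lam_micro mu_macro L_c (u, D, P, C) (u, D, P, C)"
proof -
  define c1 c2 c3 where "c1 = min (2 * mu_e) (2 * mu_e + 3 * lam_e)"
    and "c2 = min (2 * mu_micro) (2 * mu_micro + 3 * lam_micro)" and "c3 = mu_macro * L_c\<^sup>2"
  have pos: "0 < c1" "0 < c2" "0 < c3" using assms by (auto simp: c1_def c2_def c3_def)
  define c where "c = min c1 (min c2 c3)"
  have "c * ((norm (msym (D - P)))\<^sup>2 + (norm (msym P))\<^sup>2 + (norm C)\<^sup>2)
    \<le> energy mu_e lam_e mu_c mu_micro lam_micro mu_macro L_c (u, D, P, C) (u, D, P, C)" for u D P C
  proof -
    have "c * (norm (msym (D - P)))\<^sup>2 \<le> c1 * (norm (msym (D - P)))\<^sup>2" "c * (norm (msym P))\<^sup>2 \<le> c2 * (norm (msym P))\<^sup>2"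
      "c * (norm C)\<^sup>2 \<le> c3 * (norm C)\<^sup>2"
      by (intro mult_right_mono; simp add: c_def)+
    moreover have "0 \<le> 2 * mu_c * (norm (mskew (D - P)))\<^sup>2" using assms by simp
    moreover note Lame_energy_ge[OF assms(1,2), of "D - P"] Lame_energy_ge[OF assms(4,5), of P]
    moreover have "energy mu_e lam_e mu_c mu_micro lam_micro mu_macro L_c (u, D, P, C) (u, D, P, C)
      = (2 * mu_e * (norm (msym (D - P)))\<^sup>2 + lam_e * (trace (D - P))\<^sup>2) + 2 * mu_c * (norm (mskew (D - P)))\<^sup>2
        + (2 * mu_micro * (norm (msym P))\<^sup>2 + lam_micro * (trace P)\<^sup>2) + c3 * (norm C)\<^sup>2"
      unfolding power2_norm_eq_inner by (simp add: energy_def c3_def power2_eq_square)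
    ultimately show ?thesis unfolding c1_def c2_def by (simp add: distrib_left)
  qed
  then show ?thesis using pos by (intro exI[of _ c]) (auto simp: c_def)
qed

text \<open>The strains \<open>sym (grad u - P)\<close> and \<open>sym P\<close> control
  \<open>sym (grad u)\<close>, hence the gradient, which is curl-free; \<open>sym P\<close> and
  \<open>Curl P\<close> control \<open>P\<close>; and \<open>u\<close> is controlled by its
  gradient.\<close>

lemma lift_coercive:
  assumes \<Omega>: "open \<Omega>" "bounded \<Omega>" "C11_boundary \<Omega>"
  shows "\<exists>B>0. \<forall>u P. H1_0 \<Omega> u \<longrightarrow> H0_Curl \<Omega> P \<longrightarrow> (l2n (lebesgue_on \<Omega>) (lift \<Omega> u P))\<^sup>2
    \<le> B * ((l2n (lebesgue_on \<Omega>) (\<lambda>x. msym (wgrad \<Omega> u x - P x)))\<^sup>2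
        + (l2n (lebesgue_on \<Omega>) (\<lambda>x. msym (P x)))\<^sup>2 + (l2n (lebesgue_on \<Omega>) (wCurl \<Omega> P))\<^sup>2)"
proof -
  let ?M = "lebesgue_on \<Omega>"
  have meas: "\<Omega> \<in> sets lebesgue" using \<Omega>(1) by simp
  obtain r0 where r0: "\<Omega> \<subseteq> cball 0 r0" using \<Omega>(2) by (auto simp: bounded_iff subset_iff)
  define r where "r = max r0 1"
  define R where "R = 2 * r"
  have r: "\<Omega> \<subseteq> cball 0 r" "0 < r" and R: "0 < R" using r0 by (auto simp: r_def R_def)
  define A where "A = 2 * (4 + 5 * R\<^sup>2 / pi\<^sup>2)"
  define E where "E = 2 * (R / pi)\<^sup>2"
  have Rr: "R = 2 * r" by (simp add: R_def)
  have A: "0 < A" unfolding A_def by (intro mult_pos_pos add_pos_nonneg) auto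
  have E: "0 \<le> E" unfolding E_def by simp
  note Korn = Korn_of_modes[OF meas r Rr, folded A_def]
  define B where "B = (E + 1) * A * 2 + A + 1"
  have B: "0 < B" unfolding B_def using A E by (intro add_nonneg_pos add_nonneg_nonneg mult_nonneg_nonneg) auto
  have main: "(l2n ?M (lift \<Omega> u P))\<^sup>2 \<le> B * ((l2n ?M (\<lambda>x. msym (wgrad \<Omega> u x - P x)))\<^sup>2
        + (l2n ?M (\<lambda>x. msym (P x)))\<^sup>2 + (l2n ?M (wCurl \<Omega> P))\<^sup>2)"
    if u: "H1_0 \<Omega> u" and P: "H0_Curl \<Omega> P" for u P
  proof -
    note Lu = H1_0_L2[OF u] and LP = H0_Curl_L2[OF P]
    have tr: "has_trace \<Omega> (\<lambda>x. u x $ i) (\<lambda>_. 0)" for i using u by (auto simp: H1_0_iff)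
    have row: "H0_curl \<Omega> (\<lambda>x. P x $ i)" for i using P by (auto simp: H0_Curl_def)
    note coeff = coeff_bounded_linear[OF meas \<Omega>(2)]
    have grad_modes: "cos_mode R \<Omega> (wgrad \<Omega> u) k $ i = (sin_mode R \<Omega> u k $ i) *\<^sub>R wave R k"
      "sin_mode R \<Omega> (wgrad \<Omega> u) k $ i = - (cos_mode R \<Omega> u k $ i) *\<^sub>R wave R k" for k i
    proof -
      have bl: "bounded_linear (\<lambda>X::real^3^3. X $ i $ j)" for j
        by (rule bounded_linear_compose[OF bounded_linear_vec_nth bounded_linear_vec_nth])
      show "cos_mode R \<Omega> (wgrad \<Omega> u) k $ i = (sin_mode R \<Omega> u k $ i) *\<^sub>R wave R k"
        "sin_mode R \<Omega> (wgrad \<Omega> u) k $ i = - (cos_mode R \<Omega> u k $ i) *\<^sub>R wave R k"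
        using coeff[OF Lu(2) bl, of R _ k] coeff[OF Lu(1) bounded_linear_vec_nth[of i], of R k]
          zero_trace_modes[OF \<Omega> tr[of i], of R _ k]
        by (simp_all add: vec_eq_iff wgrad_def mult.commute)
    qed
    have poincare: "(l2n ?M u)\<^sup>2 \<le> E * (l2n ?M (wgrad \<Omega> u))\<^sup>2"
    proof -
      have "(l2n ?M u)\<^sup>2 \<le> 2 * (R / pi)\<^sup>2 * (l2n ?M (wgrad \<Omega> u))\<^sup>2"
      proof (rule l2n_le_of_modes[OF meas r Rr Lu])
        fix k :: "int^3" assume k: "k \<noteq> 0"
        have "mode_sq R \<Omega> (wgrad \<Omega> u) k = (norm (wave R k))\<^sup>2 * mode_sq R \<Omega> u k"
        proof -
          have "(norm (cos_mode R \<Omega> (wgrad \<Omega> u) k))\<^sup>2 = (norm (wave R k))\<^sup>2 * (norm (sin_mode R \<Omega> u k))\<^sup>2"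
            "(norm (sin_mode R \<Omega> (wgrad \<Omega> u) k))\<^sup>2 = (norm (wave R k))\<^sup>2 * (norm (cos_mode R \<Omega> u k))\<^sup>2"
            unfolding norm_sq_matrix grad_modes
            by (simp_all add: power_mult_distrib sum_distrib_left[symmetric] mult.commute
                power2_norm_eq_inner[of "sin_mode _ _ _ _"] power2_norm_eq_inner[of "cos_mode _ _ _ _"] inner_vec_def power2_eq_square[of "_ $ _"])
          then show ?thesis by (simp add: mode_sq_def distrib_left)
        qed
        moreover have "1 \<le> (R / pi)\<^sup>2 * (norm (wave R k))\<^sup>2"
        proof -
          have "1 \<le> R / pi * norm (wave R k)" using norm_wave_ge[OF k R] R by (simp add: field_simps)
          from power_mono[OF this, of 2] show ?thesis by (simp add: power_mult_distrib power_divide)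
        qed
        ultimately show "mode_sq R \<Omega> u k \<le> (R / pi)\<^sup>2 * mode_sq R \<Omega> (wgrad \<Omega> u) k"
          using mult_right_mono[OF _ mode_sq_nonneg[of R \<Omega> u k], of 1 "(R / pi)\<^sup>2 * (norm (wave R k))\<^sup>2"]
          by (simp add: mult.assoc)
      qed simp
      then show ?thesis by (simp add: E_def)
    qed
    \<comment> \<open>The rows of the Fourier modes of a gradient are parallel to the frequency:
      Korn's inequality applies with zero curl.\<close>
    have grad: "(l2n ?M (wgrad \<Omega> u))\<^sup>2 \<le> A * (l2n ?M (\<lambda>x. msym (wgrad \<Omega> u x)))\<^sup>2"
      using Korn[OF Lu(2) L2_zero] by (simp add: grad_modes mode_sq_def cross_mult_right l2n_def[of _ "\<lambda>_. 0"])
    have dist: "(l2n ?M P)\<^sup>2 \<le> A * ((l2n ?M (\<lambda>x. msym (P x)))\<^sup>2 + (l2n ?M (wCurl \<Omega> P))\<^sup>2)"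
    proof (rule Korn[OF LP])
      fix k i
      have "(\<lambda>x. wCurl \<Omega> P x $ i) = wcurl \<Omega> (\<lambda>x. P x $ i)" by (simp add: wCurl_def fun_eq_iff)
      then show "(norm (cross3 (wave R k) (cos_mode R \<Omega> P k $ i)))\<^sup>2
        + (norm (cross3 (wave R k) (sin_mode R \<Omega> P k $ i)))\<^sup>2 \<le> mode_sq R \<Omega> (\<lambda>x. wCurl \<Omega> P x $ i) k"
        using H0_curl_modes[OF \<Omega>(1,2) row[of i], of R k] coeff[OF LP(1) bounded_linear_vec_nth[of i], of R k]
        by (simp add: mode_sq_def)
    qed
    define a where "a = (l2n ?M (\<lambda>x. msym (wgrad \<Omega> u x - P x)))\<^sup>2"
    define p where "p = (l2n ?M (\<lambda>x. msym (P x)))\<^sup>2"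
    define c where "c = (l2n ?M (wCurl \<Omega> P))\<^sup>2"
    have nonneg: "0 \<le> a" "0 \<le> p" "0 \<le> c" by (auto simp: a_def p_def c_def)
    have sym: "(l2n ?M (\<lambda>x. msym (wgrad \<Omega> u x)))\<^sup>2 \<le> 2 * a + 2 * p"
    proof -
      have "l2n ?M (\<lambda>x. msym (wgrad \<Omega> u x - P x) + msym (P x)) \<le> l2n ?M (\<lambda>x. msym (wgrad \<Omega> u x - P x)) + l2n ?M (\<lambda>x. msym (P x))"
        by (intro l2n_triangle L2_bounded_linear[OF bounded_linear_msym] L2_diff Lu LP)
      then have "(l2n ?M (\<lambda>x. msym (wgrad \<Omega> u x)))\<^sup>2 \<le> (l2n ?M (\<lambda>x. msym (wgrad \<Omega> u x - P x)) + l2n ?M (\<lambda>x. msym (P x)))\<^sup>2"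
        by (intro power_mono l2n_nonneg) (simp add: matrix_parts_linear)
      also have "\<dots> \<le> 2 * a + 2 * p"
        using sum_squares_bound[of "l2n ?M (\<lambda>x. msym (wgrad \<Omega> u x - P x))" "l2n ?M (\<lambda>x. msym (P x))"]
        by (simp add: power2_sum a_def p_def)
      finally show ?thesis .
    qed
    have D: "(l2n ?M (wgrad \<Omega> u))\<^sup>2 \<le> A * (2 * a + 2 * p)"
      using grad mult_left_mono[OF sym, of A] A by linarith
    have "(l2n ?M (lift \<Omega> u P))\<^sup>2 = (l2n ?M u)\<^sup>2 + (l2n ?M (wgrad \<Omega> u))\<^sup>2 + (l2n ?M P)\<^sup>2 + c"
      using L2_sq_integrable[OF Lu(1)] L2_sq_integrable[OF Lu(2)] L2_sq_integrable[OF LP(1)] L2_sq_integrable[OF LP(2)]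
      by (simp add: c_def l2n_power2 lift_def norm_prod_def)
    also have "\<dots> \<le> (E + 1) * (l2n ?M (wgrad \<Omega> u))\<^sup>2 + A * (p + c) + c"
      using poincare dist by (simp add: p_def c_def distrib_right)
    also have "\<dots> \<le> (E + 1) * (A * (2 * a + 2 * p)) + A * (p + c) + c"
      using D E by (intro add_right_mono mult_left_mono) auto
    also have "\<dots> \<le> B * (a + p + c)"
    proof -
      have "0 \<le> (E + 1) * A * 2 * c" "0 \<le> A * a" using A E nonneg by (auto intro!: mult_nonneg_nonneg)
      then show ?thesis using nonneg by (simp add: B_def algebra_simps)
    qed
    finally show ?thesis by (simp add: a_def p_def c_def)
  qed
  then show ?thesis using B by blast
qed

lemma energy_coercive:
  assumes \<Omega>: "open \<Omega>" "bounded \<Omega>" "C11_boundary \<Omega>"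
    and coeffs: "mu_e > 0" "2 * mu_e + 3 * lam_e > 0" "mu_c \<ge> 0" "mu_micro > 0" "2 * mu_micro + 3 * lam_micro > 0"
      "mu_macro > 0" "L_c > 0"
  shows "\<exists>B>0. \<forall>f\<in>admissible \<Omega>. (l2n (lebesgue_on \<Omega>) f)\<^sup>2
    \<le> B * (LINT x|lebesgue_on \<Omega>. energy mu_e lam_e mu_c mu_micro lam_micro mu_macro L_c (f x) (f x))"
proof -
  let ?M = "lebesgue_on \<Omega>" and ?E = "energy mu_e lam_e mu_c mu_micro lam_micro mu_macro L_c"
  obtain c where c: "0 < c" and ge: "\<And>u D P C. c * ((norm (msym (D - P)))\<^sup>2 + (norm (msym P))\<^sup>2 + (norm C)\<^sup>2) \<le> ?E (u, D, P, C) (u, D, P, C)"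
    using energy_ge[OF coeffs] by blast
  obtain B where B: "0 < B" and le: "\<And>u P. H1_0 \<Omega> u \<Longrightarrow> H0_Curl \<Omega> P \<Longrightarrow> (l2n ?M (lift \<Omega> u P))\<^sup>2
    \<le> B * ((l2n ?M (\<lambda>x. msym (wgrad \<Omega> u x - P x)))\<^sup>2 + (l2n ?M (\<lambda>x. msym (P x)))\<^sup>2 + (l2n ?M (wCurl \<Omega> P))\<^sup>2)"
    using lift_coercive[OF \<Omega>] by blast
  have "(l2n ?M f)\<^sup>2 \<le> B / c * (LINT x|?M. ?E (f x) (f x))" if f: "f \<in> admissible \<Omega>" for f
  proof -
    obtain u P where u: "H1_0 \<Omega> u" and P: "H0_Curl \<Omega> P" and ae: "AE x in ?M. f x = lift \<Omega> u P x" and Lf: "L2 ?M f"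
      using f by (auto simp: admissible_def)
    note L = L2_lift[OF u P]
    note Ef = L2_bilinear_integrable[OF bounded_bilinear_energy Lf Lf, of mu_e lam_e mu_c mu_micro lam_micro mu_macro L_c]
    note El = L2_bilinear_integrable[OF bounded_bilinear_energy L L, of mu_e lam_e mu_c mu_micro lam_micro mu_macro L_c]
    have L2s: "L2 ?M (\<lambda>x. msym (wgrad \<Omega> u x - P x))" "L2 ?M (\<lambda>x. msym (P x))" "L2 ?M (wCurl \<Omega> P)"
      by (intro L2_bounded_linear[OF bounded_linear_msym] L2_diff H1_0_L2(2)[OF u] H0_Curl_L2[OF P])+
    note sq = L2s[THEN L2_sq_integrable]
    have "(l2n ?M f)\<^sup>2 = (l2n ?M (lift \<Omega> u P))\<^sup>2"
      unfolding l2n_power2 using L2_sq_integrable[OF Lf] L2_sq_integrable[OF L] ae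
      by (intro integral_cong_AE) auto
    also have "\<dots> \<le> B * ((l2n ?M (\<lambda>x. msym (wgrad \<Omega> u x - P x)))\<^sup>2 + (l2n ?M (\<lambda>x. msym (P x)))\<^sup>2 + (l2n ?M (wCurl \<Omega> P))\<^sup>2)"
      by (rule le[OF u P])
    also have "\<dots> = B / c * (LINT x|?M. c * ((norm (msym (wgrad \<Omega> u x - P x)))\<^sup>2 + (norm (msym (P x)))\<^sup>2 + (norm (wCurl \<Omega> P x))\<^sup>2))"
      using sq c by (simp add: l2n_power2)
    also have "\<dots> \<le> B / c * (LINT x|?M. ?E (lift \<Omega> u P x) (lift \<Omega> u P x))"
      using sq El B c unfolding lift_def by (intro mult_left_mono integral_mono ge) auto
    also have "(LINT x|?M. ?E (lift \<Omega> u P x) (lift \<Omega> u P x)) = (LINT x|?M. ?E (f x) (f x))"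
      using Ef El ae by (intro integral_cong_AE) auto
    finally show ?thesis .
  qed
  then show ?thesis using B c by (intro exI[of _ "B / c"]) auto
qed

subsection \<open>Loads\<close>

lemma H1_lin:
  fixes f g :: "real^'n::finite \<Rightarrow> real"
  assumes \<Omega>: "open \<Omega>" "bounded \<Omega>" and f: "H1 \<Omega> f" and g: "H1 \<Omega> g"
  shows "H1 \<Omega> (\<lambda>x. f x + c * g x)"
proof -
  have L: "L2 (lebesgue_on \<Omega>) f" "L2 (lebesgue_on \<Omega>) g" using f g by (auto simp: H1_def)
  have "\<exists>w. L2 (lebesgue_on \<Omega>) w \<and> has_weak_partial \<Omega> i (\<lambda>x. f x + c * g x) w" for i
    using has_weak_partial_lin[OF \<Omega> L(1) L2_wpartial(1)[OF f] L(2) L2_wpartial(1)[OF g] L2_wpartial(2)[OF f] L2_wpartial(2)[OF g], of i c]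
      L2_add[OF L2_wpartial(1)[OF f] L2_cmult[OF L2_wpartial(1)[OF g]], of i c i] by blast
  then show ?thesis using L by (simp add: H1_def L2_add L2_cmult)
qed

text \<open>The sum of the weak partial derivatives is a weak divergence, so \<open>wdiv\<close>
  chooses among square-integrable functions.\<close>

lemma L2_wdiv:
  assumes \<Omega>: "open \<Omega>" "bounded \<Omega>" and v: "H1_vec \<Omega> v"
  shows "L2 (lebesgue_on \<Omega>) (wdiv \<Omega> v)"
proof -
  let ?g = "\<lambda>x. \<Sum>j\<in>UNIV. wpartial \<Omega> j (\<lambda>y. v y $ j) x"
  have H1: "H1 \<Omega> (\<lambda>y. v y $ j)" for j using v by (simp add: H1_vec_def)
  then have L: "L2 (lebesgue_on \<Omega>) (\<lambda>y. v y $ j)" for j by (simp add: H1_def)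
  have "L2 (lebesgue_on \<Omega>) ?g"
    unfolding sum_3 by (intro L2_add L2_wpartial(1)[OF H1])
  moreover have "has_weak_div \<Omega> v ?g"
    unfolding has_weak_div_def
  proof (intro allI impI)
    fix \<phi> assume \<phi>: "test_fun \<Omega> \<phi>"
    note s = L2_smooth[OF \<Omega> test_fun_smooth[OF \<phi>]] L2_smooth[OF \<Omega> smooth_partial[OF test_fun_smooth[OF \<phi>]]]
    have parts: "(LINT x|lebesgue_on \<Omega>. v x $ j * partial j \<phi> x) = - (LINT x|lebesgue_on \<Omega>. wpartial \<Omega> j (\<lambda>y. v y $ j) x * \<phi> x)" for j
      using L2_wpartial(2)[OF H1[of j], of j] \<phi> by (simp add: has_weak_partial_def)
    have "(LINT x|lebesgue_on \<Omega>. v x \<bullet> (\<chi> i. partial i \<phi> x)) = (\<Sum>j\<in>UNIV. LINT x|lebesgue_on \<Omega>. v x $ j * partial j \<phi> x)"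
      by (simp add: inner_vec_def L2_mult_integrable[OF L s(2)])
    also have "\<dots> = - (LINT x|lebesgue_on \<Omega>. ?g x * \<phi> x)"
      by (simp add: parts sum_negf sum_distrib_right L2_mult_integrable[OF L2_wpartial(1)[OF H1] s(1)])
    finally show "(LINT x|lebesgue_on \<Omega>. v x \<bullet> (\<chi> i. partial i \<phi> x)) = - (LINT x|lebesgue_on \<Omega>. ?g x * \<phi> x)" .
  qed
  ultimately have "\<exists>g. L2 (lebesgue_on \<Omega>) g \<and> has_weak_div \<Omega> v g" by blast
  from someI_ex[OF this] show ?thesis by (simp add: wdiv_def)
qed

lemma bounded_linear_force_stress: "bounded_linear (force_stress mu_e mu_c lam_e)"
  and bounded_linear_micro_stress: "bounded_linear (micro_stress mu_micro lam_micro)"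
  unfolding linear_conv_bounded_linear[symmetric] force_stress_def[abs_def] micro_stress_def[abs_def]
  by (auto intro!: linearI simp: matrix_parts_linear trace_add algebra_simps)

lemma force_stress_H1:
  assumes \<Omega>: "open \<Omega>" "bounded \<Omega>" and X: "\<And>i j. H1 \<Omega> (\<lambda>x. X x $ i $ j)"
  shows "H1_vec \<Omega> (\<lambda>x. force_stress mu_e mu_c lam_e (X x) $ i)"
  unfolding H1_vec_def
proof
  fix j
  have H1_cmult: "H1 \<Omega> (\<lambda>x. c * f x)" if "H1 \<Omega> f" for c :: real and f
    using H1_lin[OF \<Omega> that that, of "c - 1"] by (simp add: algebra_simps)
  note lin = H1_lin[OF \<Omega>, of _ _ 1, unfolded mult_1]
  have "H1 \<Omega> (\<lambda>x. ((mu_e + mu_c) * X x $ i $ j + (mu_e - mu_c) * X x $ j $ i)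
      + (lam_e * (mat 1 :: real^3^3) $ i $ j) * ((X x $ 1 $ 1 + X x $ 2 $ 2) + X x $ 3 $ 3))"
    by (intro lin H1_cmult X)
  also have "(\<lambda>x. ((mu_e + mu_c) * X x $ i $ j + (mu_e - mu_c) * X x $ j $ i)
      + (lam_e * (mat 1 :: real^3^3) $ i $ j) * ((X x $ 1 $ 1 + X x $ 2 $ 2) + X x $ 3 $ 3))
      = (\<lambda>x. force_stress mu_e mu_c lam_e (X x) $ i $ j)"
    by (simp add: fun_eq_iff force_stress_def msym_def mskew_def transpose_def trace_def sum_3 algebra_simps)
  finally show "H1 \<Omega> (\<lambda>x. force_stress mu_e mu_c lam_e (X x) $ i $ j)" .
qed

text \<open>The entries of \<open>grad gt\<close> and of \<open>Gt\<close> lie in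
  \<open>H1\<close>, and so do those of the force stress, a linear combination of them; its
  divergence is then square-integrable.\<close>

lemma modified_loads_L2:
  assumes \<Omega>: "open \<Omega>" "bounded \<Omega>" and F: "L2 (lebesgue_on \<Omega>) F" and M: "L2 (lebesgue_on \<Omega>) M"
    and gt: "H2_vec \<Omega> gt" and Gt: "\<And>i. H1_vec \<Omega> (\<lambda>x. Gt x $ i)"
  shows "L2 (lebesgue_on \<Omega>) (\<lambda>x. F x + wDiv \<Omega> (\<lambda>y. force_stress mu_e mu_c lam_e (wgrad \<Omega> gt y - Gt y)) x)"
    and "L2 (lebesgue_on \<Omega>) (\<lambda>x. M x + force_stress mu_e mu_c lam_e (wgrad \<Omega> gt x - Gt x) - micro_stress mu_micro lam_micro (Gt x))"
proof -
  let ?X = "\<lambda>x. wgrad \<Omega> gt x - Gt x"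
  have G: "H1 \<Omega> (\<lambda>x. Gt x $ i $ j)" for i j using Gt by (simp add: H1_vec_def)
  have X: "H1 \<Omega> (\<lambda>x. ?X x $ i $ j)" for i j
  proof -
    have "H1 \<Omega> (wpartial \<Omega> j (\<lambda>y. gt y $ i))" using gt by (simp add: H2_vec_def H2_def)
    from H1_lin[OF \<Omega> this G[of i j], of "-1"] show ?thesis by (simp add: wgrad_def)
  qed
  have L: "L2 (lebesgue_on \<Omega>) ?X" "L2 (lebesgue_on \<Omega>) Gt"
    using X G by (auto intro!: L2_vecI simp: H1_def)
  show "L2 (lebesgue_on \<Omega>) (\<lambda>x. M x + force_stress mu_e mu_c lam_e (?X x) - micro_stress mu_micro lam_micro (Gt x))"
    by (rule L2_diff[OF L2_add[OF M L2_bounded_linear[OF bounded_linear_force_stress L(1)]]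
          L2_bounded_linear[OF bounded_linear_micro_stress L(2)]])
  have "L2 (lebesgue_on \<Omega>) (wDiv \<Omega> (\<lambda>y. force_stress mu_e mu_c lam_e (?X y)))"
    by (intro L2_vecI[where f="wDiv _ _"]) (simp add: wDiv_def L2_wdiv[OF \<Omega> force_stress_H1[OF \<Omega> X]])
  with F show "L2 (lebesgue_on \<Omega>) (\<lambda>x. F x + wDiv \<Omega> (\<lambda>y. force_stress mu_e mu_c lam_e (?X y)) x)"
    by (rule L2_add)
qed

subsection \<open>Existence and uniqueness\<close>

lemma weak_solution_hom_iff:
  "weak_solution_hom \<Omega> mu_e lam_e mu_c mu_micro lam_micro mu_macro L_c F M u P \<longleftrightarrow>
     H1_0 \<Omega> u \<and> H0_Curl \<Omega> P \<and> (\<forall>v Q. H1_0 \<Omega> v \<and> H0_Curl \<Omega> Q \<longrightarrow>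
       (LINT x|lebesgue_on \<Omega>. energy mu_e lam_e mu_c mu_micro lam_micro mu_macro L_c (lift \<Omega> u P x) (lift \<Omega> v Q x))
       = (LINT x|lebesgue_on \<Omega>. F x \<bullet> v x + M x \<bullet> Q x))"
  by (simp add: weak_solution_hom_def energy_def lift_def)

text \<open>The loads act on states as the function \<open>(F, 0, M, 0)\<close>, whose Riesz
  representative with respect to the energy is the state of a solution.\<close>

lemma weak_solution_hom_exists:
  assumes \<Omega>: "open \<Omega>" "bounded \<Omega>" "C11_boundary \<Omega>"
    and coeffs: "mu_e > 0" "2 * mu_e + 3 * lam_e > 0" "mu_c \<ge> 0" "mu_micro > 0" "2 * mu_micro + 3 * lam_micro > 0"
      "mu_macro > 0" "L_c > 0"
    and F: "L2 (lebesgue_on \<Omega>) F" and M: "L2 (lebesgue_on \<Omega>) M"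
  shows "\<exists>u P. weak_solution_hom \<Omega> mu_e lam_e mu_c mu_micro lam_micro mu_macro L_c F M u P"
proof -
  let ?M = "lebesgue_on \<Omega>" and ?E = "energy mu_e lam_e mu_c mu_micro lam_micro mu_macro L_c"
  obtain B where B: "0 < B" "\<And>f. f \<in> admissible \<Omega> \<Longrightarrow> (l2n ?M f)\<^sup>2 \<le> B * (LINT x|?M. ?E (f x) (f x))"
    using energy_coercive[OF \<Omega> coeffs] by blast
  have h: "L2 ?M (\<lambda>x. (F x, 0, M x, 0) :: state)"
    by (intro L2_Pair F M L2_zero)
  have Lf: "L2 ?M f" if "f \<in> admissible \<Omega>" for f using that by (simp add: admissible_def)
  have "\<exists>f\<in>admissible \<Omega>. \<forall>g\<in>admissible \<Omega>. (LINT x|?M. ?E (f x) (g x)) = (LINT x|?M. (F x, 0, M x, 0) \<bullet> g x)"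
    by (rule Riesz_on_L2_subspace[OF Lf zero_admissible[OF \<Omega>(1,2)] admissible_lin[OF \<Omega>(1,2)]
          admissible_closed[OF \<Omega>(1,2)] bounded_bilinear_energy energy_sym B(2,1) h])
  then obtain f where f: "f \<in> admissible \<Omega>"
    and eq: "\<And>g. g \<in> admissible \<Omega> \<Longrightarrow> (LINT x|?M. ?E (f x) (g x)) = (LINT x|?M. (F x, 0, M x, 0) \<bullet> g x)"
    by blast
  obtain u P where u: "H1_0 \<Omega> u" and P: "H0_Curl \<Omega> P" and ae: "AE x in ?M. f x = lift \<Omega> u P x"
    using f by (auto simp: admissible_def)
  have "(LINT x|?M. ?E (lift \<Omega> u P x) (lift \<Omega> v Q x)) = (LINT x|?M. F x \<bullet> v x + M x \<bullet> Q x)"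
    if v: "H1_0 \<Omega> v" "H0_Curl \<Omega> Q" for v Q
  proof -
    have "(LINT x|?M. ?E (lift \<Omega> u P x) (lift \<Omega> v Q x)) = (LINT x|?M. ?E (f x) (lift \<Omega> v Q x))"
      using ae L2_bilinear_integrable[OF bounded_bilinear_energy L2_lift[OF u P] L2_lift[OF v]]
        L2_bilinear_integrable[OF bounded_bilinear_energy Lf[OF f] L2_lift[OF v]]
      by (intro integral_cong_AE) auto
    also have "\<dots> = (LINT x|?M. F x \<bullet> v x + M x \<bullet> Q x)"
      unfolding eq[OF lift_admissible[OF v]] by (simp add: lift_def)
    finally show ?thesis .
  qed
  then show ?thesis unfolding weak_solution_hom_iff using u P by blast
qed

text \<open>The difference of two solutions is admissible and may be tested against itself; its energy vanishes.\<close>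

lemma weak_solution_hom_unique:
  assumes \<Omega>: "open \<Omega>" "bounded \<Omega>" "C11_boundary \<Omega>"
    and coeffs: "mu_e > 0" "2 * mu_e + 3 * lam_e > 0" "mu_c \<ge> 0" "mu_micro > 0" "2 * mu_micro + 3 * lam_micro > 0"
      "mu_macro > 0" "L_c > 0"
    and sol: "weak_solution_hom \<Omega> mu_e lam_e mu_c mu_micro lam_micro mu_macro L_c F M u P"
      "weak_solution_hom \<Omega> mu_e lam_e mu_c mu_micro lam_micro mu_macro L_c F M v Q"
  shows "AE x in lebesgue_on \<Omega>. u x = v x \<and> P x = Q x"
proof -
  let ?M = "lebesgue_on \<Omega>" and ?E = "energy mu_e lam_e mu_c mu_micro lam_micro mu_macro L_c"
  obtain B where B: "0 < B" "\<And>f. f \<in> admissible \<Omega> \<Longrightarrow> (l2n ?M f)\<^sup>2 \<le> B * (LINT x|?M. ?E (f x) (f x))"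
    using energy_coercive[OF \<Omega> coeffs] by blast
  have u: "H1_0 \<Omega> u" "H0_Curl \<Omega> P" and v: "H1_0 \<Omega> v" "H0_Curl \<Omega> Q"
    using sol by (auto simp: weak_solution_hom_iff)
  let ?f = "lift \<Omega> u P" and ?g = "lift \<Omega> v Q"
  define w where "w x = ?f x + (-1) *\<^sub>R ?g x" for x
  have w: "w \<in> admissible \<Omega>"
    unfolding w_def[abs_def] by (intro admissible_lin \<Omega> lift_admissible u v)
  note L = L2_lift[OF u] L2_lift[OF v]
  interpret E: bounded_bilinear ?E by (rule bounded_bilinear_energy)
  have test: "(LINT x|?M. ?E (?f x) (lift \<Omega> z Z x)) = (LINT x|?M. ?E (?g x) (lift \<Omega> z Z x))"
    if "H1_0 \<Omega> z" "H0_Curl \<Omega> Z" for z Z using sol that by (simp add: weak_solution_hom_iff)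
  have int: "integrable ?M (\<lambda>x. ?E (a x) (b x))" if "L2 ?M a" "L2 ?M b" for a b :: "real^3 \<Rightarrow> state"
    by (rule L2_bilinear_integrable[OF bounded_bilinear_energy that])
  have "(LINT x|?M. ?E (w x) (w x)) = (LINT x|?M. (?E (?f x) (?f x) - ?E (?g x) (?f x)) - (?E (?f x) (?g x) - ?E (?g x) (?g x)))"
    by (intro Bochner_Integration.integral_cong) (simp_all add: w_def E.diff_left E.diff_right)
  also have "\<dots> = 0"
    using test[OF u] test[OF v] by (simp add: int L)
  finally have "(l2n ?M w)\<^sup>2 \<le> 0" using B(2)[OF w] by simp
  then have "(LINT x|?M. (norm (w x))\<^sup>2) = 0" unfolding l2n_power2 by (simp add: antisym)
  moreover have "integrable ?M (\<lambda>x. (norm (w x))\<^sup>2)" using w by (simp add: admissible_def L2_def)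
  ultimately have "AE x in ?M. (norm (w x))\<^sup>2 = 0"
    using integral_nonneg_eq_0_iff_AE[of ?M "\<lambda>x. (norm (w x))\<^sup>2"] by simp
  then show ?thesis
    by eventually_elim (simp add: w_def lift_def zero_prod_def)
qed

theorem theorem5p2:
  fixes \<Omega> :: "(real^3) set"
    and n :: "real^3 \<Rightarrow> real^3"
    and mu_e lam_e mu_c mu_micro lam_micro mu_macro L_c :: real
    and F :: "real^3 \<Rightarrow> real^3" and M :: "real^3 \<Rightarrow> real^3^3"
    and g :: "real^3 \<Rightarrow> real^3" and G :: "3 \<Rightarrow> real^3 \<Rightarrow> real^3"
    and gt :: "real^3 \<Rightarrow> real^3" and Gt :: "real^3 \<Rightarrow> real^3^3"
  assumes "open \<Omega>" and "connected \<Omega>" and "bounded \<Omega>"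
    and "C11_boundary \<Omega>" and "unit_normal_field \<Omega> n"
    and "mu_e > 0" and "2 * mu_e + 3 * lam_e > 0" and "mu_c \<ge> 0"
    and "mu_micro > 0" and "2 * mu_micro + 3 * lam_micro > 0"
    and "mu_macro > 0" and "L_c > 0"
    and "L2 (lebesgue_on \<Omega>) F" and "L2 (lebesgue_on \<Omega>) M"
    and "H_three_halves_bd \<Omega> g" and "\<And>i. chi_tilde \<Omega> n (G i)"
    and "displacement_extension \<Omega> g gt" and "distortion_extension \<Omega> G Gt"
  shows "\<exists>u P.
      weak_solution \<Omega> mu_e lam_e mu_c mu_micro lam_micro mu_macro L_c F M gt Gt u P \<and>
      (\<forall>u' P'.
         weak_solution \<Omega> mu_e lam_e mu_c mu_micro lam_micro mu_macro L_c F M gt Gt u' P' \<longrightarrow>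
         (AE x in lebesgue_on \<Omega>. u' x = u x \<and> P' x = P x))"
proof -
  define F' where "F' x = F x + wDiv \<Omega> (\<lambda>y. force_stress mu_e mu_c lam_e (wgrad \<Omega> gt y - Gt y)) x" for x
  define M' where "M' x = M x + force_stress mu_e mu_c lam_e (wgrad \<Omega> gt x - Gt x) - micro_stress mu_micro lam_micro (Gt x)" for x
  note \<Omega> = \<open>open \<Omega>\<close> \<open>bounded \<Omega>\<close> \<open>C11_boundary \<Omega>\<close>
  note coeffs = \<open>mu_e > 0\<close> \<open>2 * mu_e + 3 * lam_e > 0\<close> \<open>mu_c \<ge> 0\<close> \<open>mu_micro > 0\<close>
    \<open>2 * mu_micro + 3 * lam_micro > 0\<close> \<open>mu_macro > 0\<close> \<open>L_c > 0\<close>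
  have ext: "H2_vec \<Omega> gt" "H1_vec \<Omega> (\<lambda>x. Gt x $ i)" for i
    using \<open>displacement_extension \<Omega> g gt\<close> \<open>distortion_extension \<Omega> G Gt\<close>
    by (auto simp: displacement_extension_def distortion_extension_def)
  have loads: "L2 (lebesgue_on \<Omega>) F'" "L2 (lebesgue_on \<Omega>) M'"
    unfolding F'_def[abs_def] M'_def[abs_def]
    using modified_loads_L2[OF \<Omega>(1,2) \<open>L2 (lebesgue_on \<Omega>) F\<close> \<open>L2 (lebesgue_on \<Omega>) M\<close> ext] by auto
  have weak: "weak_solution \<Omega> mu_e lam_e mu_c mu_micro lam_micro mu_macro L_c F M gt Gt u P \<longleftrightarrow>
    (\<exists>ut Pt. (AE x in lebesgue_on \<Omega>. u x = ut x + gt x \<and> P x = Pt x + Gt x)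
      \<and> weak_solution_hom \<Omega> mu_e lam_e mu_c mu_micro lam_micro mu_macro L_c F' M' ut Pt)" for u P
    by (simp add: weak_solution_def F'_def[abs_def] M'_def[abs_def])
  obtain ut Pt where sol: "weak_solution_hom \<Omega> mu_e lam_e mu_c mu_micro lam_micro mu_macro L_c F' M' ut Pt"
    using weak_solution_hom_exists[OF \<Omega> coeffs loads] by blast
  show ?thesis
  proof (intro exI[of _ "\<lambda>x. ut x + gt x"] exI[of _ "\<lambda>x. Pt x + Gt x"] conjI allI impI)
    show "weak_solution \<Omega> mu_e lam_e mu_c mu_micro lam_micro mu_macro L_c F M gt Gt (\<lambda>x. ut x + gt x) (\<lambda>x. Pt x + Gt x)"
      unfolding weak using sol by auto
    fix u' P'
    assume "weak_solution \<Omega> mu_e lam_e mu_c mu_micro lam_micro mu_macro L_c F M gt Gt u' P'"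
    then obtain vt Qt where v: "AE x in lebesgue_on \<Omega>. u' x = vt x + gt x \<and> P' x = Qt x + Gt x"
      and "weak_solution_hom \<Omega> mu_e lam_e mu_c mu_micro lam_micro mu_macro L_c F' M' vt Qt"
      unfolding weak by blast
    from weak_solution_hom_unique[OF \<Omega> coeffs this(2) sol] v
    show "AE x in lebesgue_on \<Omega>. u' x = ut x + gt x \<and> P' x = Pt x + Gt x"
      by eventually_elim simp
  qed
qed

end
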